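(* Let $D,k\in\mathbb{N}$, let $v_1,\dots,v_k\in\mathbb{Z}^D$ be nonzero vectors, and let $P_1,\dots,P_k\in\mathbb{Z}[y]$ be linearly independent polynomials with zero constant terms; set $d=\max_{1\le i\le k}\deg P_i$. Let $\theta:\mathbb{F}_p\to\mathbb{C}$ be $1$-bounded and strongly $(d+1)$-uniform. Then there exist $p_0=p_0(\{v_i\},\{P_i\},\theta)\in\mathbb{N}$ and $c=c(\{P_i\},\theta)>0$ such that for every prime $p>p_0$, \[ \mathbb{E}_{\underline{x}\in\mathbb{F}_p^D}\left|\mathbb{E}_{y\in\mathbb{F}_p}\theta(y)\prod_{i=1}^k f_i(\underline{x}+P_i(y)v_i)-\mathbb{E}_{y\in\mathbb{F}_p}\theta(y)\cdot\prod_{i=1}^k\mathbb{E}_{n_i\in\mathbb{F}_p}f_i(\underline{x}+n_iv_i)\right|^2=O_{\{P_i\},\theta}\left(p^{-c}\right) \] for all $1$-bounded functions $f_0,\dots,f_k:\mathbb{F}_p^D\to\mathbb{C}$.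
   Context: $p$ denotes a prime; polynomials with integer coefficients and vectors in $\mathbb{Z}^D$ are reduced modulo $p$. $\mathbb{E}_{x\in X}f(x)=\frac1{|X|}\sum_{x\in X}f(x)$; a function is $1$-bounded if its absolute value is at most $1$ everywhere; $e_p(x)=e^{2\pi i x/p}$. For $\theta:\mathbb{F}_p\to\mathbb{C}$, $\|\theta\|_{u^s(\mathbb{F}_p)}:=\sup_{P\in\mathbb{Z}[y],\ \deg P\le s-1}\left|\mathbb{E}_{y\in\mathbb{F}_p}\theta(y)e_p(-P(y))\right|$, and $\mathbb{E}\theta=\mathbb{E}_{y\in\mathbb{F}_p}\theta(y)$. The function $\theta$ (understood as given for each prime $p$) is called strongly $s$-uniform if there exist $C=C(\theta,s),c=c(\theta,s)>0$ independent of $p$ with $\|\theta-\mathbb{E}\theta\|_{u^s(\mathbb{F}_p)}\le Cp^{-c}$. The notation $A=O_{X}(B)$ means $|A|\le C(X)B$ with $C(X)$ depending only on $X$. *)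

theory Defs
  imports Complex_Main "HOL-Library.FuncSet" "HOL-Computational_Algebra.Polynomial"
    "HOL-Computational_Algebra.Primes"
begin

text \<open>
  The prime varies inside the statements, so the prime field is modelled by the explicit carrier
  of representatives \<open>0, \<dots>, p - 1\<close>, and its \<open>D\<close>-th power by the extensional functions on
  \<open>{..<D}\<close> with values in that carrier.  A function on either set is a total HOL function of which
  only the values on the carrier matter; integer points are brought back into the carrier by
  \<open>red_vec\<close>.
\<close>

definition Fp :: "nat \<Rightarrow> int set" where
  "Fp p = {0..<int p}"

definition Fp_vec :: "nat \<Rightarrow> nat \<Rightarrow> (nat \<Rightarrow> int) set" where
  "Fp_vec p D = {..<D} \<rightarrow>\<^sub>E Fp p"

definition red_vec :: "nat \<Rightarrow> nat \<Rightarrow> (nat \<Rightarrow> int) \<Rightarrow> (nat \<Rightarrow> int)" where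
  "red_vec p D x = (\<lambda>j\<in>{..<D}. x j mod int p)"

definition avg :: "'a set \<Rightarrow> ('a \<Rightarrow> 'b::field) \<Rightarrow> 'b" where
  "avg X f = (\<Sum>x\<in>X. f x) / of_nat (card X)"

definition one_bounded_on :: "'a set \<Rightarrow> ('a \<Rightarrow> complex) \<Rightarrow> bool" where
  "one_bounded_on X f \<longleftrightarrow> (\<forall>x\<in>X. cmod (f x) \<le> 1)"

definition e_p :: "nat \<Rightarrow> int \<Rightarrow> complex" where
  "e_p p x = exp (2 * complex_of_real pi * \<i> * of_int x / of_nat p)"

definition u_norm :: "nat \<Rightarrow> nat \<Rightarrow> (int \<Rightarrow> complex) \<Rightarrow> real" where
  "u_norm s p \<theta> =
     (SUP P\<in>{P :: int poly. degree P \<le> s - 1}.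
        cmod (avg (Fp p) (\<lambda>y. \<theta> y * e_p p (- poly P y))))"

text \<open>
  Here \<open>\<theta>\<close> is a family of functions, one for each prime; the constants are uniform over the family.
\<close>

definition strongly_uniform :: "nat \<Rightarrow> (nat \<Rightarrow> int \<Rightarrow> complex) \<Rightarrow> bool" where
  "strongly_uniform s \<theta> \<longleftrightarrow>
     (\<exists>C>0. \<exists>c>0. \<forall>p. prime p \<longrightarrow>
        u_norm s p (\<lambda>y. \<theta> p y - avg (Fp p) (\<theta> p)) \<le> C * real p powr (- c))"

text \<open>
  Independence of an indexed family (so repetitions are excluded); for integer polynomials,
  integer and rational coefficients give the same notion.
\<close>

definition lin_indep_polys :: "'i set \<Rightarrow> ('i \<Rightarrow> int poly) \<Rightarrow> bool" where
  "lin_indep_polys I P \<longleftrightarrow>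
     (\<forall>a :: 'i \<Rightarrow> int. (\<Sum>i\<in>I. smult (a i) (P i)) = 0 \<longrightarrow> (\<forall>i\<in>I. a i = 0))"

end

theory Submission
  imports Defs "HOL-Analysis.Complex_Transcendental" "HOL-Library.Function_Algebras" "HOL-Number_Theory.Cong"
begin

text \<open>
  Call \<open>f\<close> an eigenfunction in direction \<open>w\<close> if it is a linear phase \<open>e_p (\<phi>(x) n)\<close> along every
  line \<open>x + n w\<close>. The estimate is proved for families in which the \<open>f i\<close> with \<open>i \<in> E\<close> are eigenfunctions,
  by downward induction on \<open>E\<close>. If all of them are, everything reduces to exponential sums, which are small by
  Weyl's inequality and the independence of the polynomials modulo \<open>p\<close>.

  For the induction step, van der Corput differencing bounds the average by a box norm of some \<open>f j\<close>
  (of top degree) along many directions taken from a set \<open>G\<close>. Replacing \<open>f i\<close> and \<open>f j\<close> by dual functions, one trades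
  each such direction \<open>u\<close> for \<open>w i\<close> and then for \<open>w j\<close>: a function invariant in direction \<open>u\<close> does not
  notice when \<open>w j\<close> is replaced by \<open>w j - c u\<close>, which can be put into the kernel of a linear form
  \<open>u \<mapsto> \<Sum> s^i u_i\<close>, so that an induction on the number of such forms vanishing on the directions applies.
  The resulting box norm along \<open>w j\<close> alone is lowered to degree two by comparing the dual function with its
  derivatives, and a large degree two norm produces an eigenfunction, i.e. the case of \<open>insert j E\<close>.

  The weight \<open>\<theta>\<close> is introduced at the end: one Cauchy--Schwarz step removes it and leaves control by the
  degree two norm. All losses are polynomial, in the form \<open>K \<beta> < \<delta>^K\<close> implies \<open>\<delta>^K \<le> K \<delta>'\<close> with a constant \<open>K\<close>
  depending on the polynomials only.
\<close>

text \<open>They are harmless: along its own curve such a function is a polynomial phase in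
  \<open>y\<close> with coefficients depending on \<open>x\<close>, and differencing in
  \<open>y\<close> without translating \<open>x\<close> removes it.

  The obstacle is that differencing never produces the direction \<open>w j\<close> itself, only
  leading vectors of differences of curves, and those may depend on the shifts. Nothing can be
  assumed about these vectors either: the directions may be dependent, coincide or vanish modulo
  \<open>p\<close>. Two devices help. Every estimate can be pulled back to a fixed dimension
  \<open>Dk\<close> (\<open>Xat_lift\<close>), so the constants never see the given vectors. And the
  forms are of Vandermonde type: a nonzero vector is killed by fewer than \<open>Dk\<close> of them,
  so a form separating finitely many vectors always exists.

  \<open>\<beta>\<close> is one error parameter dominating both \<open>1 / p\<close>, the price of
  an exceptional shift, and all exponential sums. The mean square is reached by using the conjugate
  of the difference to be estimated as the free function \<open>f0\<close>.\<close>

lemma avg_cong: "(\<And>x. x \<in> X \<Longrightarrow> f x = g x) \<Longrightarrow> avg X f = avg X g"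
  by (simp add: avg_def)

lemma avg_add: "avg X (\<lambda>x. f x + g x) = avg X f + avg X g"
  by (simp add: avg_def sum.distrib add_divide_distrib)

lemma avg_diff: "avg X (\<lambda>x. f x - g x) = avg X f - (avg X g :: 'a :: field)"
  by (simp add: avg_def sum_subtractf diff_divide_distrib)

lemma avg_cmult: "avg X (\<lambda>x. c * f x) = c * avg X f"
  by (simp add: avg_def sum_distrib_left[symmetric])

lemma avg_cmult_right: "avg X (\<lambda>x. f x * c) = avg X f * c"
  by (simp add: avg_def sum_distrib_right[symmetric])

lemma avg_const: "finite X \<Longrightarrow> X \<noteq> {} \<Longrightarrow> avg X (\<lambda>x. c) = (c :: 'a :: field_char_0)"
  by (simp add: avg_def)

lemma avg_swap: "avg X (\<lambda>x. avg Y (f x)) = avg Y (\<lambda>y. avg X (\<lambda>x. f x y))"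
proof -
  have "(\<Sum>x\<in>X. sum (f x) Y / of_nat (card Y)) = (\<Sum>x\<in>X. sum (f x) Y) / of_nat (card Y)"
    by (rule sum_divide_distrib[symmetric])
  moreover have "(\<Sum>y\<in>Y. (\<Sum>x\<in>X. f x y) / of_nat (card X)) = (\<Sum>y\<in>Y. \<Sum>x\<in>X. f x y) / of_nat (card X)"
    by (rule sum_divide_distrib[symmetric])
  moreover have "(\<Sum>x\<in>X. sum (f x) Y) = (\<Sum>y\<in>Y. \<Sum>x\<in>X. f x y)"
    by (rule sum.swap)
  ultimately show ?thesis by (simp add: avg_def divide_divide_eq_left mult.commute)
qed

lemma avg_Times: "avg (X \<times> Y) f = avg X (\<lambda>x. avg Y (\<lambda>y. f (x, y)))"
  by (simp add: avg_def sum.cartesian_product sum_divide_distrib[symmetric] card_cartesian_product mult.commute)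

lemma avg_of_real: "avg X (\<lambda>x. complex_of_real (f x)) = complex_of_real (avg X f)"
  unfolding avg_def by simp

lemma avg_Re: "Re (avg X f) = avg X (\<lambda>x. Re (f x))"
  by (simp add: avg_def Re_divide_of_nat)

lemma avg_cnj: "cnj (avg X f) = avg X (\<lambda>x. cnj (f x))"
  by (simp add: avg_def)

lemma norm_avg_le: "cmod (avg X f) \<le> avg X (\<lambda>x. cmod (f x))"
  by (simp add: avg_def norm_divide divide_right_mono norm_sum)

lemma avg_mono: "(\<And>x. x \<in> X \<Longrightarrow> f x \<le> g x) \<Longrightarrow> avg X f \<le> avg X (g :: _ \<Rightarrow> real)"
  by (simp add: avg_def divide_right_mono sum_mono)

lemma avg_nonneg: "(\<And>x. x \<in> X \<Longrightarrow> 0 \<le> f x) \<Longrightarrow> 0 \<le> avg X (f :: _ \<Rightarrow> real)"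
  by (simp add: avg_def sum_nonneg)

lemma avg_le_const:
  fixes f :: "'a \<Rightarrow> real"
  assumes "finite X" "X \<noteq> {}" "\<And>x. x \<in> X \<Longrightarrow> f x \<le> c"
  shows "avg X f \<le> c"
  using avg_mono[of X f "\<lambda>_. c"] assms by (simp add: avg_const)

lemma norm_avg_le_const:
  assumes "finite X" "X \<noteq> {}" "\<And>x. x \<in> X \<Longrightarrow> cmod (f x) \<le> c"
  shows "cmod (avg X f) \<le> c"
  using norm_avg_le[of X f] avg_le_const[OF assms(1,2), of "\<lambda>x. cmod (f x)" c] assms(3) by fastforce

lemma avg_reindex:
  assumes "bij_betw h X Y"
  shows "avg X (\<lambda>x. f (h x)) = avg Y f"
  using assms by (simp add: avg_def sum.reindex_bij_betw bij_betw_same_card)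

lemma avg_square_nonneg: "0 \<le> avg X (\<lambda>x. (f x :: real)\<^sup>2)"
  by (rule avg_nonneg) simp

lemma avg_CS: 
  fixes a b :: "'a \<Rightarrow> real"
  shows "(avg X (\<lambda>x. a x * b x))\<^sup>2 \<le> avg X (\<lambda>x. (a x)\<^sup>2) * avg X (\<lambda>x. (b x)\<^sup>2)"
proof -
  have "(\<Sum>x\<in>X. a x * b x)\<^sup>2 \<le> (\<Sum>x\<in>X. (a x)\<^sup>2) * (\<Sum>x\<in>X. (b x)\<^sup>2)"
    by (rule Cauchy_Schwarz_ineq_sum)
  then show ?thesis
    by (simp add: avg_def power_divide power2_eq_square divide_right_mono)
qed

lemma avg_CS_complex:
  "(cmod (avg X (\<lambda>x. a x * b x)))\<^sup>2 \<le> avg X (\<lambda>x. (cmod (a x))\<^sup>2) * avg X (\<lambda>x. (cmod (b x))\<^sup>2)"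
proof -
  have "(cmod (avg X (\<lambda>x. a x * b x)))\<^sup>2 \<le> (avg X (\<lambda>x. cmod (a x) * cmod (b x)))\<^sup>2"
    using norm_avg_le[of X "\<lambda>x. a x * b x"] unfolding norm_mult by (intro power_mono) simp_all
  also have "\<dots> \<le> avg X (\<lambda>x. (cmod (a x))\<^sup>2) * avg X (\<lambda>x. (cmod (b x))\<^sup>2)"
    by (rule avg_CS)
  finally show ?thesis .
qed

lemma avg_CS_bounded:
  assumes "finite X" "X \<noteq> {}" "\<And>x. x \<in> X \<Longrightarrow> cmod (a x) \<le> 1"
  shows "(cmod (avg X (\<lambda>x. a x * b x)))\<^sup>2 \<le> avg X (\<lambda>x. (cmod (b x))\<^sup>2)"
proof -
  have "avg X (\<lambda>x. (cmod (a x))\<^sup>2) \<le> 1"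
    by (rule avg_le_const) (use assms in \<open>auto simp: power_le_one\<close>)
  then have "avg X (\<lambda>x. (cmod (a x))\<^sup>2) * avg X (\<lambda>x. (cmod (b x))\<^sup>2) \<le> 1 * avg X (\<lambda>x. (cmod (b x))\<^sup>2)"
    by (rule mult_right_mono) (rule avg_square_nonneg)
  then show ?thesis using avg_CS_complex[of X a b] by simp
qed

text \<open>Convexity: the graph of the power lies above its tangent at \<open>m\<close>. With
  \<open>m\<close> the mean of \<open>r\<close>, averaging kills the linear term, which gives
  Jensen's inequality in \<open>avg_power_le\<close>.\<close>

lemma power_tangent_le:
  fixes r m :: real
  assumes "0 \<le> r" "0 \<le> m"
  shows "m ^ n + of_nat n * m ^ (n - 1) * (r - m) \<le> r ^ n"
proof (induction n)
  case (Suc n)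
  have "m ^ Suc n + of_nat (Suc n) * m ^ n * (r - m) = r * m ^ n + of_nat n * (m ^ n * (r - m))"
    by (simp add: algebra_simps)
  also have "\<dots> \<le> r * (m ^ n + of_nat n * m ^ (n - 1) * (r - m))"
  proof (cases n)
    case (Suc q)
    have "m * (m ^ q * (r - m)) \<le> r * (m ^ q * (r - m))"
    proof -
      have "0 \<le> m ^ q * (r - m)\<^sup>2" using assms by simp
      then show ?thesis by (simp add: algebra_simps power2_eq_square)
    qed
    then have "of_nat n * (m * (m ^ q * (r - m))) \<le> of_nat n * (r * (m ^ q * (r - m)))"
      by (rule mult_left_mono) simp
    then show ?thesis using Suc by (simp add: algebra_simps)
  qed simp
  also have "\<dots> \<le> r * r ^ n" using Suc assms by (intro mult_left_mono) auto
  finally show ?case by simp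
qed simp

lemma avg_power_le:
  fixes r :: "'a \<Rightarrow> real"
  assumes "finite X" "X \<noteq> {}" "\<And>x. x \<in> X \<Longrightarrow> 0 \<le> r x"
  shows "(avg X r) ^ n \<le> avg X (\<lambda>x. r x ^ n)"
proof -
  let ?m = "avg X r"
  have m: "0 \<le> ?m" using assms by (intro avg_nonneg) auto
  have "?m ^ n = avg X (\<lambda>x. ?m ^ n + of_nat n * ?m ^ (n - 1) * (r x - ?m))"
    using assms by (simp add: avg_add avg_cmult avg_diff avg_const)
  also have "\<dots> \<le> avg X (\<lambda>x. r x ^ n)"
    by (rule avg_mono, rule power_tangent_le) (use assms m in auto)
  finally show ?thesis .
qed

lemma avg_square_expand:
  "complex_of_real ((cmod (avg X f))\<^sup>2) = avg X (\<lambda>x. avg X (\<lambda>y. f x * cnj (f y)))"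
proof -
  have "avg X (\<lambda>x. avg X (\<lambda>y. f x * cnj (f y))) = avg X (\<lambda>x. f x * avg X (\<lambda>y. cnj (f y)))"
    by (simp add: avg_cmult)
  also have "\<dots> = avg X f * avg X (\<lambda>y. cnj (f y))" by (rule avg_cmult_right)
  also have "\<dots> = complex_of_real ((cmod (avg X f))\<^sup>2)" by (simp only: complex_norm_square avg_cnj)
  finally show ?thesis by simp
qed

lemma exists_ge_avg:
  fixes r :: "'a \<Rightarrow> real"
  assumes "finite X" "X \<noteq> {}" 
  shows "\<exists>x\<in>X. avg X r \<le> r x"
proof (rule ccontr)
  assume "\<not> ?thesis"
  then have "\<And>x. x \<in> X \<Longrightarrow> r x < avg X r" by force
  then have "sum r X < sum (\<lambda>_. avg X r) X" using assms by (intro sum_strict_mono) auto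
  then show False using assms by (simp add: avg_def)
qed

subsection \<open>Additive characters\<close>

lemma e_p_add: "e_p p (x + y) = e_p p x * e_p p y"
  by (simp add: e_p_def exp_add[symmetric] algebra_simps add_divide_distrib)

lemma e_p_0 [simp]: "e_p p 0 = 1"
  by (simp add: e_p_def)

lemma norm_e_p [simp]: "cmod (e_p p x) = 1"
proof -
  have "e_p p x = exp (\<i> * of_real (2 * pi * of_int x / of_nat p))"
    by (simp add: e_p_def algebra_simps)
  then show ?thesis by (simp only: norm_exp_i_times)
qed

lemma e_p_nonzero [simp]: "e_p p x \<noteq> 0"
  by (simp add: e_p_def)

lemma e_p_minus: "e_p p (- x) = cnj (e_p p x)"
proof -
  have "e_p p (- x) * e_p p x = 1" by (simp add: e_p_add[symmetric])
  moreover have "cnj (e_p p x) * e_p p x = 1"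
    using complex_norm_square[of "e_p p x"] by (simp add: mult.commute)
  ultimately show ?thesis using e_p_nonzero[of p x] by (metis mult_right_cancel)
qed

lemma e_p_diff: "e_p p (x - y) = e_p p x * cnj (e_p p y)"
  using e_p_add[of p x "- y"] by (simp add: e_p_minus)

lemma e_p_multiple: "p > 0 \<Longrightarrow> e_p p (int p * n) = 1"
proof -
  assume "p > 0"
  then have "e_p p (int p * n) = exp (2 * of_int n * complex_of_real pi * \<i>)"
    by (simp add: e_p_def field_simps)
  then show ?thesis using exp_integer_2pi[of "of_int n"] by simp
qed

lemma e_p_cong: "p > 0 \<Longrightarrow> [x = y] (mod int p) \<Longrightarrow> e_p p x = e_p p y"
proof -
  assume "p > 0" "[x = y] (mod int p)"
  then obtain n where "y = x + int p * n" by (auto simp: cong_iff_lin)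
  then show ?thesis using \<open>p > 0\<close> by (simp add: e_p_add e_p_multiple)
qed

lemma e_p_dvd: "p > 0 \<Longrightarrow> int p dvd x \<Longrightarrow> e_p p x = 1"
  using e_p_cong[of p x 0] by (simp add: cong_0_iff)

lemma e_p_eq_1_iff:
  assumes "p > 0"
  shows "e_p p x = 1 \<longleftrightarrow> int p dvd x"
proof
  assume "e_p p x = 1"
  then obtain n :: int where n: "Im (2 * complex_of_real pi * \<i> * of_int x / of_nat p) = of_int (2 * n) * pi"
    unfolding e_p_def exp_eq_1 by blast
  have "Im (2 * complex_of_real pi * \<i> * of_int x / of_nat p) = 2 * pi * of_int x / of_nat p"
    by (simp add: Im_divide_of_nat)
  with n have "2 * pi * of_int x / of_nat p = of_int (2 * n) * pi" by simp
  then have "real_of_int x = of_int n * of_nat p" using assms by (simp add: field_simps)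
  then have "x = n * int p" by (metis of_int_eq_iff of_int_mult of_int_of_nat_eq)
  then show "int p dvd x" by simp
qed (use e_p_dvd assms in auto)

section \<open>Periodic functions of an integer as functions on the prime field\<close>

lemma finite_Fp [simp]: "finite (Fp p)" by (simp add: Fp_def)
lemma Fp_nonempty: "p > 0 \<Longrightarrow> Fp p \<noteq> {}" by (auto simp: Fp_def intro!: exI[of _ 0])
lemma card_Fp [simp]: "card (Fp p) = p" by (simp add: Fp_def)

text \<open>Shifts and dilations leave the carrier \<open>Fp p\<close>. Functions of a residue are
  therefore total periodic functions of an integer, and no reduction has to be written;
  \<open>per\<close> does the same for vectors.\<close>

definition yper :: "nat \<Rightarrow> (int \<Rightarrow> 'a) \<Rightarrow> bool" where
  "yper p F \<longleftrightarrow> (\<forall>x y. [x = y] (mod int p) \<longrightarrow> F x = F y)"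

lemma yperD: "yper p F \<Longrightarrow> [x = y] (mod int p) \<Longrightarrow> F x = F y"
  unfolding yper_def by blast

lemma bij_Fp_shift: "p > 0 \<Longrightarrow> bij_betw (\<lambda>y. (y + h) mod int p) (Fp p) (Fp p)"
  by (rule bij_betw_byWitness[where f' = "\<lambda>y. (y - h) mod int p"]) (auto simp: Fp_def mod_simps)

lemma bij_Fp_mult:
  assumes "prime p" "\<not> int p dvd c"
  shows "bij_betw (\<lambda>y. (c * y) mod int p) (Fp p) (Fp p)"
proof -
  have "coprime c (int p)" using assms
    by (metis coprime_commute prime_imp_coprime prime_nat_int_transfer)
  then obtain b where b: "[c * b = 1] (mod int p)" using cong_solve_coprime_int by blast
  have p: "int p > 0" using assms(1) prime_gt_0_nat by auto
  have 1: "(b * (c * y mod int p)) mod int p = y mod int p" "(c * (b * y mod int p)) mod int p = y mod int p" for y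
  proof -
    have "[(c * b) * y = 1 * y] (mod int p)" using b by (rule cong_scalar_right)
    then show "(b * (c * y mod int p)) mod int p = y mod int p" "(c * (b * y mod int p)) mod int p = y mod int p"
      by (simp_all add: cong_def mod_simps ac_simps)
  qed
  show ?thesis
    by (rule bij_betw_byWitness[where f' = "\<lambda>y. (b * y) mod int p"])
      (use p in \<open>auto simp: Fp_def 1\<close>)
qed

lemma EY_shift:
  assumes "p > 0" "yper p F"
  shows "avg (Fp p) (\<lambda>y. F (y + h)) = avg (Fp p) F"
proof -
  have "avg (Fp p) (\<lambda>y. F (y + h)) = avg (Fp p) (\<lambda>y. F ((y + h) mod int p))"
    by (intro avg_cong yperD[OF assms(2)]) (simp add: cong_def)
  also have "\<dots> = avg (Fp p) F" by (rule avg_reindex[OF bij_Fp_shift[OF assms(1)]])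
  finally show ?thesis .
qed

lemma EY_mult:
  assumes "prime p" "\<not> int p dvd c" "yper p F"
  shows "avg (Fp p) (\<lambda>y. F (c * y)) = avg (Fp p) F"
proof -
  have "avg (Fp p) (\<lambda>y. F (c * y)) = avg (Fp p) (\<lambda>y. F ((c * y) mod int p))"
    by (intro avg_cong yperD[OF assms(3)]) (simp add: cong_def)
  also have "\<dots> = avg (Fp p) F" by (rule avg_reindex[OF bij_Fp_mult[OF assms(1,2)]])
  finally show ?thesis .
qed

lemma EY_e_p:
  assumes "p > 0"
  shows "avg (Fp p) (\<lambda>n. e_p p (\<xi> * n)) = (if int p dvd \<xi> then 1 else 0)"
proof (cases "int p dvd \<xi>")
  case True
  then show ?thesis using assms by (simp add: e_p_dvd avg_const Fp_nonempty)
next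
  case False
  let ?S = "avg (Fp p) (\<lambda>n. e_p p (\<xi> * n))"
  have "yper p (\<lambda>n. e_p p (\<xi> * n))"
    using assms by (auto simp: yper_def intro!: e_p_cong cong_scalar_left)
  \<comment> \<open>Shifting by one multiplies the mean by \<open>e_p p \<xi>\<close>, which is not
    1, so the mean is zero.\<close>
  from EY_shift[OF assms this, of 1] have "e_p p \<xi> * ?S = ?S"
    by (simp add: distrib_left e_p_add avg_cmult[symmetric] mult.commute)
  then have "(e_p p \<xi> - 1) * ?S = 0" by (simp add: algebra_simps)
  then show ?thesis using False e_p_eq_1_iff[OF assms] by simp
qed

section \<open>Vectors modulo p and periodic functions of them\<close>

type_synonym vec = "nat \<Rightarrow> int"

abbreviation EY :: "nat \<Rightarrow> (int \<Rightarrow> 'a::field) \<Rightarrow> 'a" where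
  "EY p \<equiv> avg (Fp p)"

abbreviation EV :: "nat \<Rightarrow> nat \<Rightarrow> (vec \<Rightarrow> 'a::field) \<Rightarrow> 'a" where
  "EV p D \<equiv> avg (Fp_vec p D)"

definition sm :: "int \<Rightarrow> vec \<Rightarrow> vec" where
  "sm n w = (\<lambda>j. n * w j)"

lemma sm_add_left: "sm (a + b) w = sm a w + sm b w" by (rule ext) (simp add: sm_def algebra_simps)
lemma sm_diff_left: "sm (a - b) w = sm a w - sm b w" by (rule ext) (simp add: sm_def algebra_simps)
lemma sm_minus_left: "sm (- a) w = - sm a w" by (rule ext) (simp add: sm_def)
lemma sm_diff_right: "sm a (v - w) = sm a v - sm a w" by (rule ext) (simp add: sm_def algebra_simps)
lemma sm_sm: "sm a (sm b w) = sm (a * b) w" by (rule ext) (simp add: sm_def)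
lemma sm_0 [simp]: "sm 0 w = 0" by (rule ext) (simp add: sm_def)
lemma sm_1 [simp]: "sm 1 w = w" by (rule ext) (simp add: sm_def)

definition cg :: "nat \<Rightarrow> nat \<Rightarrow> vec \<Rightarrow> vec \<Rightarrow> bool" where
  "cg p D x y \<longleftrightarrow> (\<forall>j<D. [x j = y j] (mod int p))"

lemma cg_refl [simp]: "cg p D x x" by (simp add: cg_def)
lemma cg_sym: "cg p D x y \<Longrightarrow> cg p D y x" by (simp add: cg_def cong_sym)
lemma cg_trans: "cg p D x y \<Longrightarrow> cg p D y z \<Longrightarrow> cg p D x z" unfolding cg_def using cong_trans by blast
lemma cg_add: "cg p D x y \<Longrightarrow> cg p D x' y' \<Longrightarrow> cg p D (x + x') (y + y')"
  by (simp add: cg_def cong_add)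
lemma cg_diff: "cg p D x y \<Longrightarrow> cg p D x' y' \<Longrightarrow> cg p D (x - x') (y - y')"
  by (simp add: cg_def cong_diff)
lemma cg_sm: "[a = b] (mod int p) \<Longrightarrow> cg p D v w \<Longrightarrow> cg p D (sm a v) (sm b w)"
  by (simp add: cg_def sm_def cong_mult)

definition per :: "nat \<Rightarrow> nat \<Rightarrow> (vec \<Rightarrow> 'a) \<Rightarrow> bool" where
  "per p D f \<longleftrightarrow> (\<forall>x y. cg p D x y \<longrightarrow> f x = f y)"

lemma perD: "per p D f \<Longrightarrow> cg p D x y \<Longrightarrow> f x = f y" unfolding per_def by blast

definition B1 :: "nat \<Rightarrow> nat \<Rightarrow> (vec \<Rightarrow> complex) \<Rightarrow> bool" where
  "B1 p D f \<longleftrightarrow> per p D f \<and> (\<forall>x. cmod (f x) \<le> 1)"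

lemma B1_per: "B1 p D f \<Longrightarrow> per p D f" by (simp add: B1_def)
lemma B1_norm: "B1 p D f \<Longrightarrow> cmod (f x) \<le> 1" by (simp add: B1_def)

lemma finite_Fp_vec [simp]: "finite (Fp_vec p D)"
  unfolding Fp_vec_def by (intro finite_PiE) auto

lemma Fp_vec_nonempty: "p > 0 \<Longrightarrow> Fp_vec p D \<noteq> {}"
  unfolding Fp_vec_def using Fp_nonempty[of p] by (auto simp: PiE_eq_empty_iff)

lemma cg_red_vec: "cg p D (red_vec p D x) x"
  by (simp add: cg_def red_vec_def cong_def)

lemma red_vec_in: "p > 0 \<Longrightarrow> red_vec p D x \<in> Fp_vec p D"
  by (auto simp: red_vec_def Fp_vec_def Fp_def)

lemma cg_Fp_vec_eq:
  assumes "x \<in> Fp_vec p D" "y \<in> Fp_vec p D" "cg p D x y"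
  shows "x = y"
proof
  fix j
  show "x j = y j"
  proof (cases "j < D")
    case True
    then have "0 \<le> x j" "x j < int p" "0 \<le> y j" "y j < int p" "[x j = y j] (mod int p)"
      using assms by (auto simp: Fp_vec_def Fp_def cg_def PiE_iff)
    then show ?thesis by (metis cong_less_imp_eq_int)
  next
    case False
    then show ?thesis using assms(1,2) by (simp add: Fp_vec_def PiE_def extensional_def)
  qed
qed

lemma bij_Fp_vec_shift:
  assumes "p > 0"
  shows "bij_betw (\<lambda>x. red_vec p D (x + v)) (Fp_vec p D) (Fp_vec p D)"
proof (rule bij_betw_byWitness[where f' = "\<lambda>x. red_vec p D (x - v)"])
  have 1: "cg p D (red_vec p D (x + v) - v) x" "cg p D (red_vec p D (x - v) + v) x" for x
    using cg_diff[OF cg_red_vec[of p D "x + v"] cg_refl[of p D v]]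
      cg_add[OF cg_red_vec[of p D "x - v"] cg_refl[of p D v]] by simp_all
  show "\<forall>x\<in>Fp_vec p D. red_vec p D (red_vec p D (x + v) - v) = x"
    "\<forall>x\<in>Fp_vec p D. red_vec p D (red_vec p D (x - v) + v) = x"
    using 1 assms by (auto intro!: cg_Fp_vec_eq red_vec_in intro: cg_trans[OF cg_red_vec])
qed (use assms red_vec_in in auto)

lemma EV_shift:
  assumes "p > 0" "per p D f"
  shows "EV p D (\<lambda>x. f (x + v)) = EV p D f"
proof -
  have "EV p D (\<lambda>x. f (x + v)) = EV p D (\<lambda>x. f (red_vec p D (x + v)))"
    by (intro avg_cong perD[OF assms(2)]) (rule cg_sym[OF cg_red_vec])
  also have "\<dots> = EV p D f" by (rule avg_reindex[OF bij_Fp_vec_shift[OF assms(1)]])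
  finally show ?thesis .
qed

lemma B1_mult: "B1 p D f \<Longrightarrow> B1 p D g \<Longrightarrow> B1 p D (\<lambda>x. f x * g x)"
  unfolding B1_def per_def by (auto simp: norm_mult mult_le_one)

lemma B1_cnj: "B1 p D f \<Longrightarrow> B1 p D (\<lambda>x. cnj (f x))"
  unfolding B1_def per_def by auto

lemma B1_const: "cmod c \<le> 1 \<Longrightarrow> B1 p D (\<lambda>x. c)"
  unfolding B1_def per_def by auto

lemma per_shift: "per p D f \<Longrightarrow> per p D (\<lambda>x. f (x + v))"
  unfolding per_def by (blast intro: cg_add cg_refl)

lemma B1_shift: "B1 p D f \<Longrightarrow> B1 p D (\<lambda>x. f (x + v))"
  by (simp add: B1_def per_shift)

lemma B1_prod: "(\<And>i. i \<in> I \<Longrightarrow> B1 p D (f i)) \<Longrightarrow> B1 p D (\<lambda>x. \<Prod>i\<in>I. f i x)"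
proof (induction I rule: infinite_finite_induct)
  case (insert i I)
  then show ?case using B1_mult[of p D "f i" "\<lambda>x. \<Prod>i\<in>I. f i x"] by simp
qed (auto intro: B1_const)

lemma B1_avg:
  assumes "finite T" "T \<noteq> {}" "\<And>t. t \<in> T \<Longrightarrow> B1 p D (g t)"
  shows "B1 p D (\<lambda>x. avg T (\<lambda>t. g t x))"
  unfolding B1_def
proof
  show "per p D (\<lambda>x. avg T (\<lambda>t. g t x))"
    unfolding per_def by (intro allI impI avg_cong perD[OF B1_per[OF assms(3)]])
  show "\<forall>x. cmod (avg T (\<lambda>t. g t x)) \<le> 1"
    by (intro allI norm_avg_le_const assms B1_norm[OF assms(3)])
qed

subsection \<open>Box averages\<close>

text \<open>The product of \<open>A\<close> over the vertices of the cube with opposite corners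
  \<open>hs\<close> and \<open>ks\<close>, conjugated where an odd number of coordinates comes from
  \<open>ks\<close>. The recursion runs over \<open>hs\<close> alone and reads \<open>ks\<close>
  through \<open>hd\<close> and \<open>tl\<close>, so the algebraic rules need no length
  condition.\<close>

fun dl :: "(int list \<Rightarrow> complex) \<Rightarrow> int list \<Rightarrow> int list \<Rightarrow> complex" where
  "dl A [] ks = A []"
| "dl A (h # hs) ks = dl (\<lambda>l. A (h # l)) hs (tl ks) * cnj (dl (\<lambda>l. A (hd ks # l)) hs (tl ks))"

text \<open>The cube product with the vertex \<open>hs\<close> left out, see
  \<open>dl_eq_lowp\<close>.\<close>

fun lowp :: "(int list \<Rightarrow> complex) \<Rightarrow> int list \<Rightarrow> int list \<Rightarrow> complex" where
  "lowp A ks [] = 1"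
| "lowp A ks (h # hs) = lowp (\<lambda>l. A (h # l)) (tl ks) hs * cnj (dl (\<lambda>l. A (hd ks # l)) hs (tl ks))"

text \<open>\<open>low r\<close> describes products of \<open>r\<close> bounded functions, the \<open>i\<close>-th of which ignores the \<open>i\<close>-th variable.\<close>

fun low :: "nat \<Rightarrow> (int list \<Rightarrow> complex) \<Rightarrow> bool" where
  "low 0 b \<longleftrightarrow> b [] = 1"
| "low (Suc r) b \<longleftrightarrow> (\<exists>B b'. (\<forall>hs. cmod (B hs) \<le> 1) \<and> (\<forall>h. low r (b' h)) \<and>
     (\<forall>h hs. b (h # hs) = B hs * b' h hs))"

lemma dl_mult: "dl (\<lambda>l. A l * B l) hs ks = dl A hs ks * dl B hs ks"
  by (induction hs arbitrary: A B ks) (simp_all add: ac_simps)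

lemma dl_mult_fun: "dl (\<lambda>l. A l * B l) hs = (\<lambda>ks. dl A hs ks * dl B hs ks)"
  by (rule ext) (rule dl_mult)

lemma dl_cnj: "dl (\<lambda>l. cnj (A l)) hs ks = cnj (dl A hs ks)"
  by (induction hs arbitrary: A ks) simp_all

lemma norm_dl_le: "(\<And>l. cmod (A l) \<le> 1) \<Longrightarrow> cmod (dl A hs ks) \<le> 1"
  by (induction hs arbitrary: A ks) (simp_all add: norm_mult mult_le_one)

lemma dl_eq_lowp: "dl A hs ks = A hs * lowp A ks hs"
  by (induction hs arbitrary: A ks) simp_all

lemma norm_lowp_le: "(\<And>l. cmod (A l) \<le> 1) \<Longrightarrow> cmod (lowp A ks hs) \<le> 1"
  by (induction hs arbitrary: A ks) (simp_all add: norm_mult mult_le_one norm_dl_le)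

lemma norm_dl_le_hd: "(\<And>l. cmod (A l) \<le> 1) \<Longrightarrow> cmod (dl A hs ks) \<le> cmod (A hs)"
  unfolding dl_eq_lowp norm_mult using norm_lowp_le[of A ks hs]
  by (simp add: mult_left_le)

text \<open>Each remaining vertex takes some coordinate from \<open>ks\<close>. Grouped by the first
  such coordinate, the vertices form factors that each ignore that variable of
  \<open>hs\<close>.\<close>

lemma low_lowp: "(\<And>l. cmod (A l) \<le> 1) \<Longrightarrow> low r (lowp A ks)"
proof (induction r arbitrary: A ks)
  case (Suc r)
  show ?case
    unfolding low.simps
    by (rule exI[of _ "\<lambda>hs. cnj (dl (\<lambda>l. A (hd ks # l)) hs (tl ks))"],
        rule exI[of _ "\<lambda>h. lowp (\<lambda>l. A (h # l)) (tl ks)"])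
      (use Suc in \<open>auto simp: norm_dl_le mult.commute\<close>)
qed simp

lemma low_mult: "low r a \<Longrightarrow> low r b \<Longrightarrow> low r (\<lambda>hs. a hs * b hs)"
proof (induction r arbitrary: a b)
  case (Suc r)
  from Suc.prems obtain A a' B b' where
    *: "\<forall>hs. cmod (A hs) \<le> 1" "\<forall>h. low r (a' h)" "\<forall>h hs. a (h # hs) = A hs * a' h hs"
       "\<forall>hs. cmod (B hs) \<le> 1" "\<forall>h. low r (b' h)" "\<forall>h hs. b (h # hs) = B hs * b' h hs"
    by auto
  show ?case
    unfolding low.simps
    by (rule exI[of _ "\<lambda>hs. A hs * B hs"], rule exI[of _ "\<lambda>h hs. a' h hs * b' h hs"])
      (use * Suc.IH in \<open>auto simp: norm_mult mult_le_one\<close>)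
qed simp

lemma low_cnj: "low r a \<Longrightarrow> low r (\<lambda>hs. cnj (a hs))"
proof (induction r arbitrary: a)
  case (Suc r)
  from Suc.prems obtain A a' where
    *: "\<forall>hs. cmod (A hs) \<le> 1" "\<forall>h. low r (a' h)" "\<forall>h hs. a (h # hs) = A hs * a' h hs"
    by auto
  show ?case
    unfolding low.simps
    by (rule exI[of _ "\<lambda>hs. cnj (A hs)"], rule exI[of _ "\<lambda>h hs. cnj (a' h hs)"])
      (use * Suc.IH in auto)
qed simp

definition LS :: "nat \<Rightarrow> nat \<Rightarrow> int list set" where
  "LS p r = {hs. set hs \<subseteq> Fp p \<and> length hs = r}"

lemma finite_LS [simp]: "finite (LS p r)"
  unfolding LS_def by (rule finite_lists_length_eq) simp

lemma LS_nonempty: "p > 0 \<Longrightarrow> LS p r \<noteq> {}"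
proof -
  assume "p > 0"
  then have "replicate r 0 \<in> LS p r" by (auto simp: LS_def Fp_def)
  then show ?thesis by blast
qed

lemma avg_LS_0: "avg (LS p 0) F = F []"
proof -
  have "LS p 0 = {[]}" by (auto simp: LS_def)
  then show ?thesis by (simp add: avg_def)
qed

lemma avg_LS_Suc: "avg (LS p (Suc r)) F = EY p (\<lambda>h. avg (LS p r) (\<lambda>hs. F (h # hs)))"
proof -
  have "bij_betw (\<lambda>(h, hs). h # hs) (Fp p \<times> LS p r) (LS p (Suc r))"
    by (rule bij_betw_byWitness[where f' = "\<lambda>l. (hd l, tl l)"]) (auto simp: LS_def length_Suc_conv)
  from avg_reindex[OF this, of F, symmetric] show ?thesis by (simp add: avg_Times)
qed

text \<open>\<open>B\<close> does not see \<open>h\<close>, so the Cauchy--Schwarz inequality in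
  \<open>hs\<close> removes it at the price of doubling \<open>h\<close>.\<close>

lemma box_CS_step:
  assumes "p > 0" "\<And>hs. cmod (B hs) \<le> 1"
  shows "(cmod (EY p (\<lambda>h. avg (LS p r) (\<lambda>hs. B hs * c h hs))))\<^sup>2
    \<le> Re (EY p (\<lambda>h. EY p (\<lambda>k. avg (LS p r) (\<lambda>hs. c h hs * cnj (c k hs)))))"
proof -
  have "EY p (\<lambda>h. avg (LS p r) (\<lambda>hs. B hs * c h hs)) = avg (LS p r) (\<lambda>hs. B hs * EY p (\<lambda>h. c h hs))"
    by (subst avg_swap) (simp add: avg_cmult)
  then have "(cmod (EY p (\<lambda>h. avg (LS p r) (\<lambda>hs. B hs * c h hs))))\<^sup>2
      \<le> avg (LS p r) (\<lambda>hs. (cmod (EY p (\<lambda>h. c h hs)))\<^sup>2)"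
    using avg_CS_bounded[OF finite_LS LS_nonempty[OF assms(1)], where a = B] assms(2) by simp
  also have "\<dots> = Re (avg (LS p r) (\<lambda>hs. complex_of_real ((cmod (EY p (\<lambda>h. c h hs)))\<^sup>2)))"
    by (simp add: avg_of_real del: of_real_power)
  also have "\<dots> = Re (avg (LS p r) (\<lambda>hs. EY p (\<lambda>h. EY p (\<lambda>k. c h hs * cnj (c k hs)))))"
    by (simp only: avg_square_expand)
  also have "avg (LS p r) (\<lambda>hs. EY p (\<lambda>h. EY p (\<lambda>k. c h hs * cnj (c k hs))))
      = EY p (\<lambda>h. EY p (\<lambda>k. avg (LS p r) (\<lambda>hs. c h hs * cnj (c k hs))))"
    by (subst avg_swap) (subst (2) avg_swap, rule refl)
  finally show ?thesis .
qed

text \<open>The Gowers--Cauchy--Schwarz inequality: each variable is doubled in turn, which removes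
  the factor ignoring it, and Jensen's inequality carries the remaining powers inside. It starts
  with one variable, because with none the right side would be \<open>Re (A [])\<close> without an
  absolute value.\<close>

lemma box_CS:
  assumes "p > 0" "low (Suc r) b"
  shows "cmod (avg (LS p (Suc r)) (\<lambda>hs. A hs * b hs)) ^ (2 ^ Suc r)
    \<le> Re (avg (LS p (Suc r)) (\<lambda>hs. avg (LS p (Suc r)) (\<lambda>ks. dl A hs ks)))"
  using assms(2)
proof (induction r arbitrary: A b)
  case 0
  then obtain B b' where *: "\<forall>hs. cmod (B hs) \<le> 1" "\<forall>h. b' h [] = 1" "\<forall>h hs. b (h # hs) = B hs * b' h hs"
    by auto
  have "(cmod (EY p (\<lambda>h. avg (LS p 0) (\<lambda>hs. B hs * A (h # hs)))))\<^sup>2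
    \<le> Re (EY p (\<lambda>h. EY p (\<lambda>k. avg (LS p 0) (\<lambda>hs. A (h # hs) * cnj (A (k # hs))))))"
    by (rule box_CS_step) (use assms * in auto)
  then show ?case using * by (simp add: avg_LS_Suc avg_LS_0 mult.commute)
next
  case (Suc r)
  from Suc.prems obtain B b' where *: "\<forall>hs. cmod (B hs) \<le> 1" "\<forall>h. low (Suc r) (b' h)"
      "\<forall>h hs. b (h # hs) = B hs * b' h hs"
    by (subst (asm) low.simps(2)) blast
  let ?r = "Suc r"
  let ?n = "2 ^ ?r :: nat"
  let ?in = "\<lambda>h k. avg (LS p ?r) (\<lambda>hs. (A (h # hs) * cnj (A (k # hs))) * (b' h hs * cnj (b' k hs)))"
  let ?out = "\<lambda>h k. Re (avg (LS p ?r) (\<lambda>hs. avg (LS p ?r) (\<lambda>ks. dl (\<lambda>l. A (h # l) * cnj (A (k # l))) hs ks)))"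
  have "(cmod (EY p (\<lambda>h. avg (LS p ?r) (\<lambda>hs. B hs * (A (h # hs) * b' h hs)))))\<^sup>2
    \<le> Re (EY p (\<lambda>h. EY p (\<lambda>k. avg (LS p ?r) (\<lambda>hs. (A (h # hs) * b' h hs) * cnj (A (k # hs) * b' k hs)))))"
    by (rule box_CS_step) (use assms * in auto)
  also have "\<dots> = Re (avg (Fp p \<times> Fp p) (\<lambda>z. ?in (fst z) (snd z)))"
    by (simp add: avg_Times ac_simps)
  also have "\<dots> \<le> cmod (avg (Fp p \<times> Fp p) (\<lambda>z. ?in (fst z) (snd z)))" by (rule complex_Re_le_cmod)
  also have "\<dots> \<le> avg (Fp p \<times> Fp p) (\<lambda>z. cmod (?in (fst z) (snd z)))" by (rule norm_avg_le)
  finally have 1: "(cmod (avg (LS p (Suc ?r)) (\<lambda>hs. A hs * b hs)))\<^sup>2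
      \<le> avg (Fp p \<times> Fp p) (\<lambda>z. cmod (?in (fst z) (snd z)))"
    using * by (simp add: avg_LS_Suc[of p "Suc r"] ac_simps)
  have ne: "Fp p \<times> Fp p \<noteq> {}" using Fp_nonempty[OF assms(1)] by auto
  have "cmod (avg (LS p (Suc ?r)) (\<lambda>hs. A hs * b hs)) ^ (2 ^ Suc ?r)
      = ((cmod (avg (LS p (Suc ?r)) (\<lambda>hs. A hs * b hs)))\<^sup>2) ^ ?n"
    by (simp add: power_mult[symmetric])
  also have "\<dots> \<le> (avg (Fp p \<times> Fp p) (\<lambda>z. cmod (?in (fst z) (snd z)))) ^ ?n"
    by (rule power_mono[OF 1]) simp
  also have "\<dots> \<le> avg (Fp p \<times> Fp p) (\<lambda>z. cmod (?in (fst z) (snd z)) ^ ?n)"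
    by (rule avg_power_le) (use ne in auto)
  also have "\<dots> \<le> avg (Fp p \<times> Fp p) (\<lambda>z. ?out (fst z) (snd z))"
    by (rule avg_mono, rule Suc.IH) (use * in \<open>auto intro!: low_mult low_cnj simp del: low.simps\<close>)
  also have "\<dots> = Re (EY p (\<lambda>h. EY p (\<lambda>k. avg (LS p ?r) (\<lambda>hs. avg (LS p ?r) (\<lambda>ks. dl (\<lambda>l. A (h # l) * cnj (A (k # l))) hs ks)))))"
    by (simp add: avg_Times avg_Re)
  also have "EY p (\<lambda>h. EY p (\<lambda>k. avg (LS p ?r) (\<lambda>hs. avg (LS p ?r) (\<lambda>ks. dl (\<lambda>l. A (h # l) * cnj (A (k # l))) hs ks))))
     = EY p (\<lambda>h. avg (LS p ?r) (\<lambda>hs. EY p (\<lambda>k. avg (LS p ?r) (\<lambda>ks. dl A (h # hs) (k # ks)))))"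
    by (subst avg_swap[of "Fp p" "LS p ?r"]) (simp add: dl_mult_fun dl_cnj)
  also have "\<dots> = avg (LS p (Suc ?r)) (\<lambda>hs. avg (LS p (Suc ?r)) (\<lambda>ks. dl A hs ks))"
    by (simp only: avg_LS_Suc[of p "Suc r"])
  finally show ?case .
qed

section \<open>Box norms along a list of directions\<close>

fun dot :: "int list \<Rightarrow> vec list \<Rightarrow> vec" where
  "dot [] us = 0"
| "dot (h # hs) us = sm h (hd us) + dot hs (tl us)"

definition dm :: "vec \<Rightarrow> int \<Rightarrow> int \<Rightarrow> (vec \<Rightarrow> complex) \<Rightarrow> vec \<Rightarrow> complex" where
  "dm u h k f x = f (x + sm h u) * cnj (f (x + sm k u))"

definition dml :: "vec list \<Rightarrow> int list \<Rightarrow> int list \<Rightarrow> (vec \<Rightarrow> complex) \<Rightarrow> vec \<Rightarrow> complex" where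
  "dml us hs ks f x = dl (\<lambda>l. f (x + dot l us)) hs ks"

text \<open>The Gowers box norm along the directions \<open>us\<close>, raised to the power
  \<open>2 ^ length us\<close>, with all roots avoided. For the empty list it is the real part of a
  mean and may be negative.\<close>

definition bx :: "nat \<Rightarrow> nat \<Rightarrow> vec list \<Rightarrow> (vec \<Rightarrow> complex) \<Rightarrow> real" where
  "bx p D us f = avg (LS p (length us)) (\<lambda>hs. avg (LS p (length us)) (\<lambda>ks. Re (EV p D (dml us hs ks f))))"

lemma B1_dm: "B1 p D f \<Longrightarrow> B1 p D (dm u h k f)"
  unfolding dm_def by (intro B1_mult B1_cnj B1_shift)

lemma B1_dl: "(\<And>l. B1 p D (A l)) \<Longrightarrow> B1 p D (\<lambda>x. dl (\<lambda>l. A l x) hs ks)"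
  by (induction hs arbitrary: A ks) (auto intro!: B1_mult B1_cnj)

lemma B1_dml: "B1 p D f \<Longrightarrow> B1 p D (dml us hs ks f)"
  unfolding dml_def by (intro B1_dl B1_shift)

lemma dml_mult: "dml us hs ks (\<lambda>x. f x * g x) x = dml us hs ks f x * dml us hs ks g x"
  by (simp add: dml_def dl_mult)

lemma dml_prod: "dml us hs ks (\<lambda>x. \<Prod>i\<in>I. f i x) x = (\<Prod>i\<in>I. dml us hs ks (f i) x)"
proof (induction I rule: infinite_finite_induct)
  have 1: "dl (\<lambda>l. 1) hs ks = 1" by (induction hs arbitrary: ks) auto
  case empty then show ?case by (simp add: dml_def 1)
next
  have 1: "dl (\<lambda>l. 1) hs ks = 1" by (induction hs arbitrary: ks) auto
  case infinite then show ?case by (simp add: dml_def 1)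
next
  case (insert i I)
  then show ?case using dml_mult[of us hs ks "f i" "\<lambda>x. \<Prod>i\<in>I. f i x" x] by simp
qed

lemma dml_cnj: "dml us hs ks (\<lambda>x. cnj (f x)) x = cnj (dml us hs ks f x)"
  by (simp add: dml_def dl_cnj)

lemma dml_shift: "dml us hs ks (\<lambda>x. f (x + v)) x = dml us hs ks f (x + v)"
  by (simp add: dml_def ac_simps)

lemma dml_Cons: "dml (u # us) (h # hs) (k # ks) f = dml us hs ks (dm u h k f)"
  by (rule ext) (simp add: dml_def dm_def[abs_def] dl_mult dl_cnj ac_simps)

lemma dml_dm: "dml us hs ks (dm u h k f) = dm u h k (dml us hs ks f)"
  by (rule ext) (simp add: dml_def dm_def[abs_def] dl_mult dl_cnj ac_simps)

lemma bx_Nil: "bx p D [] f = Re (EV p D f)"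
  by (simp add: bx_def avg_LS_0 dml_def[abs_def])

lemma bx_Cons: "bx p D (u # us) f = EY p (\<lambda>h. EY p (\<lambda>k. bx p D us (dm u h k f)))"
proof -
  let ?L = "LS p (length us)"
  have "bx p D (u # us) f = EY p (\<lambda>h. avg ?L (\<lambda>hs. EY p (\<lambda>k. avg ?L (\<lambda>ks. Re (EV p D (dml us hs ks (dm u h k f)))))))"
    by (simp add: bx_def avg_LS_Suc dml_Cons)
  also have "\<dots> = EY p (\<lambda>h. EY p (\<lambda>k. avg ?L (\<lambda>hs. avg ?L (\<lambda>ks. Re (EV p D (dml us hs ks (dm u h k f)))))))"
    by (subst avg_swap[of ?L]) (rule refl)
  finally show ?thesis by (simp add: bx_def)
qed

lemma bx_swap: "bx p D (u # v # us) f = bx p D (v # u # us) f"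
proof -
  have comm: "dm v h' k' (dm u h k f) = dm u h k (dm v h' k' f)" for h k h' k'
    by (rule ext) (simp add: dm_def ac_simps)
  have "bx p D (u # v # us) f = avg (Fp p \<times> Fp p) (\<lambda>(h,k). avg (Fp p \<times> Fp p) (\<lambda>(h',k'). bx p D us (dm v h' k' (dm u h k f))))"
    by (simp add: bx_Cons avg_Times)
  also have "\<dots> = avg (Fp p \<times> Fp p) (\<lambda>(h',k'). avg (Fp p \<times> Fp p) (\<lambda>(h,k). bx p D us (dm v h' k' (dm u h k f))))"
    unfolding case_prod_beta by (rule avg_swap)
  also have "\<dots> = bx p D (v # u # us) f"
    by (simp add: bx_Cons avg_Times comm)
  finally show ?thesis .
qed

lemma bx_move: "bx p D (us @ v # vs) f = bx p D (v # us @ vs) f"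
proof (induction us arbitrary: f)
  case (Cons u us)
  have "bx p D (u # us @ v # vs) f = bx p D (u # v # us @ vs) f"
    by (subst (1 2) bx_Cons) (simp add: Cons)
  then show ?case by (simp add: bx_swap)
qed simp

lemma bx_eq_avg_norm:
  assumes "p > 0" "per p D f"
  shows "bx p D [v] f = EV p D (\<lambda>x. (cmod (EY p (\<lambda>n. f (x + sm n v))))\<^sup>2)"
proof -
  have "EV p D (\<lambda>x. (cmod (EY p (\<lambda>n. f (x + sm n v))))\<^sup>2)
     = Re (EV p D (\<lambda>x. complex_of_real ((cmod (EY p (\<lambda>n. f (x + sm n v))))\<^sup>2)))"
    by (simp add: avg_of_real del: of_real_power)
  also have "\<dots> = Re (EV p D (\<lambda>x. EY p (\<lambda>h. EY p (\<lambda>k. dm v h k f x))))"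
    by (simp only: avg_square_expand dm_def)
  also have "EV p D (\<lambda>x. EY p (\<lambda>h. EY p (\<lambda>k. dm v h k f x))) = EY p (\<lambda>h. EY p (\<lambda>k. EV p D (dm v h k f)))"
    by (subst avg_swap) (subst (2) avg_swap, rule refl)
  finally show ?thesis unfolding bx_Cons bx_Nil by (simp only: avg_Re)
qed

text \<open>With \<open>v\<close> averaged innermost the box norm is a mean of nonnegative
  quantities, each a mean square of line averages. Facts about one direction thereby extend to
  longer lists.\<close>

lemma bx_Cons_inner:
  "bx p D (v # us) f = avg (LS p (length us)) (\<lambda>hs. avg (LS p (length us)) (\<lambda>ks. bx p D [v] (dml us hs ks f)))"
proof -
  let ?L = "LS p (length us)"
  have "bx p D (v # us) f = avg (Fp p \<times> Fp p) (\<lambda>(h,k). avg (?L \<times> ?L) (\<lambda>(hs,ks). Re (EV p D (dml us hs ks (dm v h k f)))))"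
    by (simp add: bx_Cons bx_def[of _ _ us] avg_Times)
  also have "\<dots> = avg (?L \<times> ?L) (\<lambda>(hs,ks). avg (Fp p \<times> Fp p) (\<lambda>(h,k). Re (EV p D (dml us hs ks (dm v h k f)))))"
    unfolding case_prod_beta by (rule avg_swap)
  also have "\<dots> = avg ?L (\<lambda>hs. avg ?L (\<lambda>ks. bx p D [v] (dml us hs ks f)))"
    by (simp add: avg_Times dml_dm bx_Cons bx_Nil)
  finally show ?thesis .
qed

lemma bx1_nonneg: "p > 0 \<Longrightarrow> per p D f \<Longrightarrow> 0 \<le> bx p D [v] f"
  by (simp add: bx_eq_avg_norm avg_square_nonneg)

lemma bx_nonneg:
  assumes "p > 0" "B1 p D f" "us \<noteq> []"
  shows "0 \<le> bx p D us f"
proof -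
  obtain v vs where "us = v # vs" using assms(3) by (cases us) auto
  then show ?thesis
    by (simp only:, subst bx_Cons_inner) (intro avg_nonneg bx1_nonneg B1_per B1_dml assms)
qed

lemma bx_le_1:
  assumes "p > 0" "B1 p D f"
  shows "bx p D us f \<le> 1"
  unfolding bx_def
proof (intro avg_le_const finite_LS LS_nonempty assms)
  fix hs ks
  have "cmod (EV p D (dml us hs ks f)) \<le> 1"
    by (intro norm_avg_le_const finite_Fp_vec Fp_vec_nonempty assms B1_norm[OF B1_dml[OF assms(2)]])
  then show "Re (EV p D (dml us hs ks f)) \<le> 1" using complex_Re_le_cmod order_trans by blast
qed

lemma square_mean_le_bx1:
  assumes "p > 0" "B1 p D f"
  shows "(cmod (EV p D f))\<^sup>2 \<le> bx p D [v] f"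
proof -
  have "EV p D f = EY p (\<lambda>n. EV p D (\<lambda>x. f (x + sm n v)))"
    using assms by (simp add: EV_shift B1_per avg_const Fp_nonempty)
  also have "\<dots> = EV p D (\<lambda>x. EY p (\<lambda>n. f (x + sm n v)))" by (rule avg_swap)
  finally have "(cmod (EV p D f))\<^sup>2 = (cmod (EV p D (\<lambda>x. 1 * EY p (\<lambda>n. f (x + sm n v)))))\<^sup>2" by simp
  also have "\<dots> \<le> bx p D [v] f"
    unfolding bx_eq_avg_norm[OF assms(1) B1_per[OF assms(2)]]
    by (rule avg_CS_bounded) (use Fp_vec_nonempty[OF assms(1)] in auto)
  finally show ?thesis .
qed

text \<open>Monotonicity of box norms in the number of directions: Cauchy--Schwarz over
  \<open>hs\<close> and \<open>ks\<close>, then \<open>square_mean_le_bx1\<close> for each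
  derivative. The added direction is arbitrary.\<close>

lemma bx_pad:
  assumes "p > 0" "B1 p D f"
  shows "(bx p D us f)\<^sup>2 \<le> bx p D (v # us) f"
proof -
  let ?L = "LS p (length us)"
  let ?Z = "?L \<times> ?L"
  have ne: "?Z \<noteq> {}" using LS_nonempty[OF assms(1)] by auto
  have "(bx p D us f)\<^sup>2 = (cmod (avg ?Z (\<lambda>z. 1 * complex_of_real (Re (EV p D (dml us (fst z) (snd z) f))))))\<^sup>2"
    by (simp add: bx_def avg_Times avg_of_real)
  also have "\<dots> \<le> avg ?Z (\<lambda>z. (cmod (complex_of_real (Re (EV p D (dml us (fst z) (snd z) f)))))\<^sup>2)"
    by (rule avg_CS_bounded) (use ne in auto)
  also have "\<dots> \<le> avg ?Z (\<lambda>z. bx p D [v] (dml us (fst z) (snd z) f))"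
  proof (rule avg_mono)
    fix z
    have "(cmod (complex_of_real (Re (EV p D (dml us (fst z) (snd z) f)))))\<^sup>2 \<le> (cmod (EV p D (dml us (fst z) (snd z) f)))\<^sup>2"
      by (rule power_mono) (auto simp: abs_Re_le_cmod)
    also have "\<dots> \<le> bx p D [v] (dml us (fst z) (snd z) f)"
      by (intro square_mean_le_bx1 B1_dml assms)
    finally show "(cmod (complex_of_real (Re (EV p D (dml us (fst z) (snd z) f)))))\<^sup>2 \<le> bx p D [v] (dml us (fst z) (snd z) f)" .
  qed
  also have "\<dots> = bx p D (v # us) f" by (subst bx_Cons_inner[of _ _ v us]) (simp add: avg_Times)
  finally show ?thesis .
qed

lemma bx_cnj: "bx p D us (\<lambda>x. cnj (f x)) = bx p D us f"
proof -
  have "dml us hs ks (\<lambda>x. cnj (f x)) = (\<lambda>x. cnj (dml us hs ks f x))" for hs ks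
    by (rule ext) (rule dml_cnj)
  then show ?thesis by (simp add: bx_def avg_cnj[symmetric])
qed

lemma bx_shift:
  assumes "p > 0" "B1 p D f"
  shows "bx p D us (\<lambda>x. f (x + v)) = bx p D us f"
proof -
  have "dml us hs ks (\<lambda>x. f (x + v)) = (\<lambda>x. dml us hs ks f (x + v))" for hs ks
    by (rule ext) (rule dml_shift)
  then show ?thesis using assms by (simp add: bx_def EV_shift B1_per B1_dml)
qed

text \<open>Only averages over whole lines enter, and a multiplier invertible modulo
  \<open>p\<close> merely permutes the points of a line.\<close>

lemma bx_scale:
  assumes "prime p" "\<not> int p dvd c" "B1 p D f"
  shows "bx p D (sm c v # us) f = bx p D (v # us) f"
proof -
  have p: "p > 0" using assms(1) prime_gt_0_nat by auto
  have "bx p D [sm c v] g = bx p D [v] g" if "B1 p D g" for g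
  proof -
    have "yper p (\<lambda>n. g (x + sm n v))" for x
      unfolding yper_def using B1_per[OF that] by (auto intro!: perD[of p D g] cg_add cg_sm)
    from EY_mult[OF assms(1,2) this] show ?thesis
      by (simp add: bx_eq_avg_norm[OF p B1_per[OF that]] sm_sm mult.commute)
  qed
  then show ?thesis
    by (subst bx_Cons_inner[of _ _ "sm c v"], subst bx_Cons_inner[of _ _ v]) (simp add: B1_dml assms)
qed

lemma norm_avg_power_le:
  assumes "finite Z" "Z \<noteq> {}" "\<And>z. z \<in> Z \<Longrightarrow> cmod (a z) \<le> 1"
  shows "cmod (avg Z (\<lambda>z. a z * Q z)) ^ n \<le> avg Z (\<lambda>z. cmod (Q z) ^ n)"
proof -
  have "cmod (avg Z (\<lambda>z. a z * Q z)) \<le> avg Z (\<lambda>z. cmod (a z * Q z))" by (rule norm_avg_le)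
  also have "\<dots> \<le> avg Z (\<lambda>z. cmod (Q z))"
    by (rule avg_mono) (use assms(3) in \<open>auto simp: norm_mult intro!: mult_left_le_one_le\<close>)
  finally have "cmod (avg Z (\<lambda>z. a z * Q z)) ^ n \<le> (avg Z (\<lambda>z. cmod (Q z))) ^ n"
    by (rule power_mono) simp
  also have "\<dots> \<le> avg Z (\<lambda>z. cmod (Q z) ^ n)" by (rule avg_power_le) (use assms in auto)
  finally show ?thesis .
qed

text \<open>
  A large average of multiplicative derivatives of \<open>F = avg T (a * g)\<close> against test functions
  yields a large average of derivatives of the individual \<open>g t\<close>: all vertices but one are removed by the
  Cauchy--Schwarz inequality, so that the same \<open>t\<close> occurs at all vertices afterwards.
\<close>

lemma dual_difference_interchange:
  fixes us :: "vec list" and p D :: nat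
  defines "L \<equiv> LS p (length us)"
  assumes p: "p > 0" and T: "finite T" "T \<noteq> {}" and a: "\<And>t. t \<in> T \<Longrightarrow> cmod (a t) \<le> 1"
    and g: "\<And>t x. t \<in> T \<Longrightarrow> cmod (g t x) \<le> 1" and us: "us \<noteq> []"
    and chi: "\<And>hs ks x. cmod (ch hs ks x) \<le> 1"
    and F: "\<And>x. F x = avg T (\<lambda>t. a t * g t x)"
  shows "cmod (avg L (\<lambda>hs. avg L (\<lambda>ks. EV p D (\<lambda>x. dml us hs ks F x * ch hs ks x)))) ^ (2 ^ length us)
    \<le> avg L (\<lambda>ks'. avg L (\<lambda>hs. avg L (\<lambda>ks.
        cmod (avg T (\<lambda>t. EV p D (\<lambda>x. dml us hs ks (g t) x * dl (\<lambda>l. ch l ks' x) hs ks))))))"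
proof -
  obtain r where r: "length us = Suc r" using us by (cases us) auto
  let ?n = "2 ^ length us :: nat"
  have L: "finite L" "L \<noteq> {}" using LS_nonempty[OF p] by (auto simp: L_def)
  let ?Z = "L \<times> Fp_vec p D \<times> T"
  have Z: "finite ?Z" "?Z \<noteq> {}" using L T Fp_vec_nonempty[OF p] by auto
  have F1: "cmod (F x) \<le> 1" for x
    unfolding F using T by (rule norm_avg_le_const) (use a g in \<open>auto simp: norm_mult mult_le_one\<close>)
  \<comment> \<open>The vertex \<open>hs\<close> of the cube is expanded as an average over
    \<open>t\<close>; the copies of \<open>F\<close> at all other vertices are collected in
    \<open>b\<close>, which is of lower order in \<open>hs\<close> and is removed by
    \<open>box_CS\<close>.\<close>
  define b where "b ks x = lowp (\<lambda>l. F (x + dot l us)) ks" for ks x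
  have b: "low (Suc r) (b ks x)" for ks x unfolding b_def by (rule low_lowp) (rule F1)
  define A where "A ks x t = (\<lambda>hs. g t (x + dot hs us) * ch hs ks x)" for ks x t
  define Q where "Q z = (case z of (ks, x, t) \<Rightarrow> avg L (\<lambda>hs. A ks x t hs * b ks x hs))" for z
  have "avg L (\<lambda>hs. avg L (\<lambda>ks. EV p D (\<lambda>x. dml us hs ks F x * ch hs ks x)))
      = avg L (\<lambda>ks. EV p D (\<lambda>x. avg L (\<lambda>hs. dml us hs ks F x * ch hs ks x)))"
    by (subst avg_swap) (subst (2) avg_swap, rule refl)
  also have "\<dots> = avg ?Z (\<lambda>z. a (snd (snd z)) * Q z)"
  proof -
    have "avg L (\<lambda>hs. dml us hs ks F x * ch hs ks x) = avg T (\<lambda>t. a t * Q (ks, x, t))" for ks x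
    proof -
      have "avg L (\<lambda>hs. dml us hs ks F x * ch hs ks x)
          = avg L (\<lambda>hs. F (x + dot hs us) * (b ks x hs * ch hs ks x))"
        by (simp add: dml_def dl_eq_lowp b_def mult.assoc)
      also have "\<dots> = avg L (\<lambda>hs. avg T (\<lambda>t. a t * (A ks x t hs * b ks x hs)))"
        unfolding F avg_cmult_right[symmetric] by (simp add: A_def ac_simps)
      also have "\<dots> = avg T (\<lambda>t. a t * Q (ks, x, t))"
        by (subst avg_swap) (simp add: avg_cmult Q_def)
      finally show ?thesis .
    qed
    then show ?thesis by (simp add: avg_Times)
  qed
  finally have "cmod (avg L (\<lambda>hs. avg L (\<lambda>ks. EV p D (\<lambda>x. dml us hs ks F x * ch hs ks x)))) ^ ?n
      = cmod (avg ?Z (\<lambda>z. a (snd (snd z)) * Q z)) ^ ?n" by simp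
  also have "\<dots> \<le> avg ?Z (\<lambda>z. cmod (Q z) ^ ?n)"
    by (rule norm_avg_power_le[OF Z]) (use a in auto)
  also have "\<dots> \<le> avg ?Z (\<lambda>(ks', x, t). Re (avg L (\<lambda>hs. avg L (\<lambda>ks. dl (A ks' x t) hs ks))))"
  proof (rule avg_mono, clarsimp simp: Q_def)
    fix ks' x t
    show "cmod (avg L (\<lambda>hs. A ks' x t hs * b ks' x hs)) ^ 2 ^ length us
       \<le> Re (avg L (\<lambda>hs. avg L (dl (A ks' x t) hs)))"
      unfolding L_def r using box_CS[OF p b] .
  qed
  also have "\<dots> = Re (avg L (\<lambda>ks'. EV p D (\<lambda>x. avg T (\<lambda>t. avg L (\<lambda>hs. avg L (\<lambda>ks. dl (A ks' x t) hs ks))))))"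
    by (simp add: avg_Times avg_Re)
  also have "avg L (\<lambda>ks'. EV p D (\<lambda>x. avg T (\<lambda>t. avg L (\<lambda>hs. avg L (\<lambda>ks. dl (A ks' x t) hs ks)))))
     = avg L (\<lambda>ks'. avg (Fp_vec p D \<times> T) (\<lambda>z. avg (L \<times> L) (\<lambda>y. dl (A ks' (fst z) (snd z)) (fst y) (snd y))))"
    by (simp add: avg_Times)
  also have "\<dots> = avg L (\<lambda>ks'. avg (L \<times> L) (\<lambda>y. avg (Fp_vec p D \<times> T) (\<lambda>z. dl (A ks' (fst z) (snd z)) (fst y) (snd y))))"
    by (subst avg_swap) (rule refl)
  also have "\<dots> = avg L (\<lambda>ks'. avg L (\<lambda>hs. avg L (\<lambda>ks. avg T (\<lambda>t. EV p D (\<lambda>x. dl (A ks' x t) hs ks)))))"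
    by (simp add: avg_Times) (subst (4) avg_swap, rule refl)
  finally have *: "cmod (avg L (\<lambda>hs. avg L (\<lambda>ks. EV p D (\<lambda>x. dml us hs ks F x * ch hs ks x)))) ^ ?n
     \<le> Re (avg L (\<lambda>ks'. avg L (\<lambda>hs. avg L (\<lambda>ks. avg T (\<lambda>t. EV p D (\<lambda>x. dl (A ks' x t) hs ks))))))" .
  also have "\<dots> \<le> avg L (\<lambda>ks'. avg L (\<lambda>hs. avg L (\<lambda>ks. cmod (avg T (\<lambda>t. EV p D (\<lambda>x. dl (A ks' x t) hs ks))))))"
    unfolding avg_Re[of L] by (intro avg_mono complex_Re_le_cmod)
  finally show ?thesis by (simp add: A_def dl_mult dml_def)
qed

subsection \<open>Fourier coefficients along a line\<close>

definition fh :: "nat \<Rightarrow> vec \<Rightarrow> (vec \<Rightarrow> complex) \<Rightarrow> vec \<Rightarrow> int \<Rightarrow> complex" where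
  "fh p w g x \<xi> = EY p (\<lambda>n. g (x + sm n w) * e_p p (- (\<xi> * n)))"

text \<open>A dominant frequency on the line through \<open>x\<close>. Only absolute values of
  coefficients are compared, and these agree at all points of the line, so \<open>SOME\<close> makes
  the same choice along it (\<open>frq_shift\<close>).\<close>

definition frq :: "nat \<Rightarrow> vec \<Rightarrow> (vec \<Rightarrow> complex) \<Rightarrow> vec \<Rightarrow> int" where
  "frq p w g x = (SOME \<xi>. \<xi> \<in> Fp p \<and> (\<forall>\<eta>\<in>Fp p. cmod (fh p w g x \<eta>) \<le> cmod (fh p w g x \<xi>)))"

lemma yper_e_p: "p > 0 \<Longrightarrow> yper p (\<lambda>n. e_p p (c * n))"
  unfolding yper_def by (blast intro: e_p_cong cong_scalar_left)

lemma yper_line: "per p D g \<Longrightarrow> yper p (\<lambda>n. g (x + sm n w))"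
  unfolding yper_def by (intro allI impI, erule perD) (intro cg_add cg_refl cg_sm)

lemma yper_mult: "yper p a \<Longrightarrow> yper p b \<Longrightarrow> yper p (\<lambda>n. a n * b n)"
  unfolding yper_def by metis

lemma yper_cnj: "yper p a \<Longrightarrow> yper p (\<lambda>n. cnj (a n))"
  unfolding yper_def by metis

text \<open>The source of eigenfunctions: moving the base point along the line multiplies a Fourier
  coefficient by a linear phase.\<close>

lemma fh_shift:
  assumes "p > 0" "per p D g"
  shows "fh p w g (x + sm m w) \<xi> = fh p w g x \<xi> * e_p p (\<xi> * m)"
proof -
  let ?F = "\<lambda>n. g (x + sm n w) * e_p p (- (\<xi> * n))"
  have "yper p ?F"
    using yper_mult[OF yper_line[OF assms(2)] yper_e_p[OF assms(1), of "- \<xi>"]] by simp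
  from EY_shift[OF assms(1) this, of m]
  have "fh p w g x \<xi> = EY p (\<lambda>n. ?F (n + m))" by (simp add: fh_def)
  also have "\<dots> = EY p (\<lambda>n. g (x + sm m w + sm n w) * e_p p (- (\<xi> * n)) * e_p p (- (\<xi> * m)))"
  proof (rule avg_cong)
    fix n
    have "- (\<xi> * (n + m)) = - (\<xi> * n) + - (\<xi> * m)" by (simp add: algebra_simps)
    then show "?F (n + m) = g (x + sm m w + sm n w) * e_p p (- (\<xi> * n)) * e_p p (- (\<xi> * m))"
      by (simp only: e_p_add sm_add_left ac_simps)
  qed
  also have "\<dots> = fh p w g (x + sm m w) \<xi> * e_p p (- (\<xi> * m))" by (simp add: fh_def avg_cmult_right)
  finally have 1: "fh p w g x \<xi> * e_p p (\<xi> * m) = fh p w g (x + sm m w) \<xi> * (e_p p (- (\<xi> * m)) * e_p p (\<xi> * m))"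
    by (simp only: mult.assoc)
  have 2: "e_p p (- (\<xi> * m)) * e_p p (\<xi> * m) = 1" by (simp only: e_p_add[symmetric]) simp
  show ?thesis by (simp only: 1 2 mult_1_right)
qed

lemma fh_cg: "per p D g \<Longrightarrow> cg p D x y \<Longrightarrow> fh p w g x = fh p w g y"
  unfolding fh_def by (intro ext avg_cong arg_cong2[of _ _ _ _ "(*)"] refl) (erule perD, intro cg_add cg_refl)

lemma frq_cg: "per p D g \<Longrightarrow> cg p D x y \<Longrightarrow> frq p w g x = frq p w g y"
  unfolding frq_def by (simp only: fh_cg[of p D g x y w])

lemma frq_shift: "p > 0 \<Longrightarrow> per p D g \<Longrightarrow> frq p w g (x + sm m w) = frq p w g x"
  unfolding frq_def by (simp add: fh_shift norm_mult)

lemma norm_fh_le: "p > 0 \<Longrightarrow> B1 p D g \<Longrightarrow> cmod (fh p w g x \<xi>) \<le> 1"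
  unfolding fh_def by (rule norm_avg_le_const) (auto simp: norm_mult Fp_nonempty B1_norm)

lemma frq_max:
  assumes "p > 0" "\<eta> \<in> Fp p"
  shows "cmod (fh p w g x \<eta>) \<le> cmod (fh p w g x (frq p w g x))"
proof -
  let ?P = "\<lambda>\<xi>. \<xi> \<in> Fp p \<and> (\<forall>\<eta>\<in>Fp p. cmod (fh p w g x \<eta>) \<le> cmod (fh p w g x \<xi>))"
  have "\<exists>\<xi>. ?P \<xi>"
    using ex_is_arg_min_if_finite[OF finite_Fp Fp_nonempty[OF assms(1)], of "\<lambda>\<xi>. - cmod (fh p w g x \<xi>)"]
    by (auto simp: is_arg_min_linorder)
  then have "?P (frq p w g x)" unfolding frq_def by (rule someI_ex)
  then show ?thesis using assms(2) by blast
qed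

lemma Fp_dvd_diff: "n \<in> Fp p \<Longrightarrow> m \<in> Fp p \<Longrightarrow> int p dvd (n - m) \<longleftrightarrow> n = m"
proof
  assume *: "n \<in> Fp p" "m \<in> Fp p" "int p dvd (n - m)"
  then have "[n = m] (mod int p)" by (simp add: cong_iff_dvd_diff)
  then show "n = m" using * cong_less_imp_eq_int[of n "int p" m] by (auto simp: Fp_def)
qed simp

lemma parseval:
  assumes "p > 0"
  shows "(\<Sum>\<xi>\<in>Fp p. (cmod (EY p (\<lambda>n. a n * e_p p (- (\<xi> * n)))))\<^sup>2) = EY p (\<lambda>n. (cmod (a n))\<^sup>2)"
proof -
  have "complex_of_real (EY p (\<lambda>\<xi>. (cmod (EY p (\<lambda>n. a n * e_p p (- (\<xi> * n)))))\<^sup>2))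
      = EY p (\<lambda>\<xi>. EY p (\<lambda>n. EY p (\<lambda>m. (a n * e_p p (- (\<xi> * n))) * cnj (a m * e_p p (- (\<xi> * m))))))"
    by (simp only: avg_of_real[symmetric] avg_square_expand)
  also have "\<dots> = EY p (\<lambda>\<xi>. EY p (\<lambda>n. EY p (\<lambda>m. a n * cnj (a m) * e_p p ((m - n) * \<xi>))))"
  proof -
    have "(a n * e_p p (- (\<xi> * n))) * cnj (a m * e_p p (- (\<xi> * m))) = a n * cnj (a m) * e_p p ((m - n) * \<xi>)" for \<xi> n m
    proof -
      have "e_p p ((m - n) * \<xi>) = e_p p (- (\<xi> * n)) * cnj (e_p p (- (\<xi> * m)))"
        unfolding e_p_diff[symmetric] by (simp add: algebra_simps)
      then show ?thesis by (simp add: ac_simps)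
    qed
    then show ?thesis by (simp only:)
  qed
  also have "\<dots> = EY p (\<lambda>n. EY p (\<lambda>m. EY p (\<lambda>\<xi>. a n * cnj (a m) * e_p p ((m - n) * \<xi>))))"
    by (subst avg_swap) (subst (2) avg_swap, rule refl)
  also have "\<dots> = EY p (\<lambda>n. EY p (\<lambda>m. if m = n then a n * cnj (a n) else 0))"
  proof (intro avg_cong)
    fix n m assume "n \<in> Fp p" "m \<in> Fp p"
    then have "int p dvd (m - n) \<longleftrightarrow> m = n" by (rule Fp_dvd_diff[rotated])
    then show "EY p (\<lambda>\<xi>. a n * cnj (a m) * e_p p ((m - n) * \<xi>)) = (if m = n then a n * cnj (a n) else 0)"
      by (simp add: avg_cmult EY_e_p[OF assms])
  qed
  also have "\<dots> = EY p (\<lambda>n. complex_of_real ((cmod (a n))\<^sup>2) / of_nat p)"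
    by (rule avg_cong) (simp only: avg_def sum.delta[OF finite_Fp] if_True card_Fp complex_norm_square)
  also have "\<dots> = complex_of_real (EY p (\<lambda>n. (cmod (a n))\<^sup>2) / of_nat p)"
    by (simp add: avg_def sum_divide_distrib[symmetric])
  finally have "EY p (\<lambda>\<xi>. (cmod (EY p (\<lambda>n. a n * e_p p (- (\<xi> * n)))))\<^sup>2) = EY p (\<lambda>n. (cmod (a n))\<^sup>2) / of_nat p"
    by (simp only: of_real_eq_iff)
  then show ?thesis using assms by (simp add: avg_def field_simps)
qed

text \<open>The inverse theorem for the second Gowers norm. The Fourier coefficients of the
  autocorrelation \<open>c\<close> are the squared moduli of those of \<open>a\<close>; hence the
  left side is the sum of their fourth powers, and two of the four factors are bounded by
  \<open>M\<close> while Parseval's identity sums the rest.\<close>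

lemma U2_le_max_coeff:
  assumes p: "p > 0" and a: "yper p a" "\<And>n. cmod (a n) \<le> 1"
    and M: "\<And>\<xi>. \<xi> \<in> Fp p \<Longrightarrow> cmod (EY p (\<lambda>n. a n * e_p p (- (\<xi> * n)))) \<le> M"
  shows "EY p (\<lambda>h. EY p (\<lambda>k. (cmod (EY p (\<lambda>n. a (n + h) * cnj (a (n + k)))))\<^sup>2)) \<le> M\<^sup>2"
proof -
  define c where "c m = EY p (\<lambda>n. a (n + m) * cnj (a n))" for m
  have per_c: "yper p c"
    unfolding c_def yper_def
    by (intro allI impI avg_cong arg_cong2[of _ _ _ _ "(*)"] refl yperD[OF a(1)] cong_add cong_refl)
  have "EY p (\<lambda>n. a (n + h) * cnj (a (n + k))) = c (h - k)" for h k
  proof -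
    have "yper p (\<lambda>n. a (n + (h - k)) * cnj (a n))"
      by (intro yper_mult yper_cnj a(1), unfold yper_def)
        (intro allI impI yperD[OF a(1)] cong_add cong_refl)
    from EY_shift[OF p this, of k] show ?thesis by (simp add: c_def algebra_simps)
  qed
  then have "EY p (\<lambda>h. EY p (\<lambda>k. (cmod (EY p (\<lambda>n. a (n + h) * cnj (a (n + k)))))\<^sup>2))
     = EY p (\<lambda>k. EY p (\<lambda>h. (cmod (c (h - k)))\<^sup>2))"
    by (subst avg_swap) simp
  also have "\<dots> = EY p (\<lambda>k. EY p (\<lambda>h. (cmod (c h))\<^sup>2))"
  proof (rule avg_cong)
    fix k
    have "yper p (\<lambda>h. (cmod (c h))\<^sup>2)" unfolding yper_def by (intro allI impI) (simp only: yperD[OF per_c])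
    from EY_shift[OF p this, of "- k"] show "EY p (\<lambda>h. (cmod (c (h - k)))\<^sup>2) = EY p (\<lambda>h. (cmod (c h))\<^sup>2)" by simp
  qed
  also have "\<dots> = EY p (\<lambda>h. (cmod (c h))\<^sup>2)" using p by (simp add: avg_const Fp_nonempty)
  also have "\<dots> = (\<Sum>\<xi>\<in>Fp p. (cmod (EY p (\<lambda>n. c n * e_p p (- (\<xi> * n)))))\<^sup>2)" by (rule parseval[OF p, symmetric])
  also have "\<dots> \<le> (\<Sum>\<xi>\<in>Fp p. M\<^sup>2 * (cmod (EY p (\<lambda>n. a n * e_p p (- (\<xi> * n)))))\<^sup>2)"
  proof (rule sum_mono)
    fix \<xi> assume xi: "\<xi> \<in> Fp p"
    let ?A = "EY p (\<lambda>n. a n * e_p p (- (\<xi> * n)))"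
    have "EY p (\<lambda>m. c m * e_p p (- (\<xi> * m))) = EY p (\<lambda>m. EY p (\<lambda>n. a (n + m) * cnj (a n) * e_p p (- (\<xi> * m))))"
      by (simp add: c_def avg_cmult_right)
    also have "\<dots> = EY p (\<lambda>n. EY p (\<lambda>m. cnj (a n * e_p p (- (\<xi> * n))) * (a (m + n) * e_p p (- (\<xi> * (m + n))))))"
    proof (subst avg_swap, intro avg_cong)
      fix n m
      have "e_p p (- (\<xi> * m)) = cnj (e_p p (- (\<xi> * n))) * e_p p (- (\<xi> * (m + n)))"
        unfolding e_p_minus[symmetric] e_p_add[symmetric] by (simp add: algebra_simps)
      then show "a (n + m) * cnj (a n) * e_p p (- (\<xi> * m))
          = cnj (a n * e_p p (- (\<xi> * n))) * (a (m + n) * e_p p (- (\<xi> * (m + n))))"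
        by (simp add: ac_simps)
    qed
    also have "\<dots> = EY p (\<lambda>n. cnj (a n * e_p p (- (\<xi> * n))) * ?A)"
    proof (intro avg_cong)
      fix n
      have "yper p (\<lambda>m. a m * e_p p (- (\<xi> * m)))"
        using yper_mult[OF a(1) yper_e_p[OF p, of "- \<xi>"]] by simp
      from EY_shift[OF p this, of n]
      show "EY p (\<lambda>m. cnj (a n * e_p p (- (\<xi> * n))) * (a (m + n) * e_p p (- (\<xi> * (m + n))))) = cnj (a n * e_p p (- (\<xi> * n))) * ?A"
        by (simp only: avg_cmult)
    qed
    also have "\<dots> = cnj ?A * ?A" by (simp only: avg_cmult_right avg_cnj)
    finally have "cmod (EY p (\<lambda>m. c m * e_p p (- (\<xi> * m)))) = cmod ?A * cmod ?A"
      by (simp only: norm_mult complex_mod_cnj)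
    moreover have "cmod ?A * cmod ?A \<le> M * cmod ?A" using M[OF xi] by (rule mult_right_mono) simp
    ultimately have "(cmod (EY p (\<lambda>m. c m * e_p p (- (\<xi> * m)))))\<^sup>2 \<le> (M * cmod ?A)\<^sup>2"
      by (intro power_mono) auto
    then show "(cmod (EY p (\<lambda>n. c n * e_p p (- (\<xi> * n)))))\<^sup>2 \<le> M\<^sup>2 * (cmod ?A)\<^sup>2"
      by (simp add: power_mult_distrib)
  qed
  also have "\<dots> = M\<^sup>2 * EY p (\<lambda>n. (cmod (a n))\<^sup>2)" by (simp only: sum_distrib_left[symmetric] parseval[OF p])
  also have "\<dots> \<le> M\<^sup>2 * 1"
  proof (rule mult_left_mono)
    show "EY p (\<lambda>n. (cmod (a n))\<^sup>2) \<le> 1"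
      by (rule avg_le_const) (use a(2) Fp_nonempty[OF p] in \<open>auto simp: power_le_one\<close>)
  qed simp
  finally show ?thesis by simp
qed

text \<open>A repeated direction stays on one line, so \<open>U2_le_max_coeff\<close> applies to
  each line separately, with a frequency depending on the line.\<close>

lemma bx2_le_fh:
  assumes p: "p > 0" and g: "B1 p D g"
  shows "bx p D [w, w] g \<le> EV p D (\<lambda>x. (cmod (fh p w g x (frq p w g x)))\<^sup>2)"
proof -
  have "bx p D [w, w] g = EY p (\<lambda>h. EY p (\<lambda>k. EV p D (\<lambda>x. (cmod (EY p (\<lambda>n. dm w h k g (x + sm n w))))\<^sup>2)))"
    by (subst bx_Cons) (simp only: bx_eq_avg_norm[OF p B1_per[OF B1_dm[OF g]]])
  also have "\<dots> = EV p D (\<lambda>x. EY p (\<lambda>h. EY p (\<lambda>k. (cmod (EY p (\<lambda>n. dm w h k g (x + sm n w))))\<^sup>2)))"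
    by (subst (2) avg_swap) (subst avg_swap, rule refl)
  also have "\<dots> \<le> EV p D (\<lambda>x. (cmod (fh p w g x (frq p w g x)))\<^sup>2)"
  proof (rule avg_mono)
    fix x
    have "EY p (\<lambda>h. EY p (\<lambda>k. (cmod (EY p (\<lambda>n. g (x + sm (n + h) w) * cnj (g (x + sm (n + k) w)))))\<^sup>2))
        \<le> (cmod (fh p w g x (frq p w g x)))\<^sup>2"
      by (rule U2_le_max_coeff[OF p yper_line[OF B1_per[OF g]]])
        (use B1_norm[OF g] frq_max[OF p, of _ w g x] in \<open>auto simp: fh_def[symmetric]\<close>)
    then show "EY p (\<lambda>h. EY p (\<lambda>k. (cmod (EY p (\<lambda>n. dm w h k g (x + sm n w))))\<^sup>2)) \<le> (cmod (fh p w g x (frq p w g x)))\<^sup>2"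
      by (simp only: dm_def sm_add_left add.assoc)
  qed
  finally show ?thesis .
qed

lemma EV_line:
  fixes f :: "vec \<Rightarrow> 'a::field_char_0"
  assumes "p > 0" "per p D f"
  shows "EV p D f = EV p D (\<lambda>x. EY p (\<lambda>n. f (x + sm n w)))"
proof -
  have "EV p D f = EY p (\<lambda>n. EV p D (\<lambda>x. f (x + sm n w)))"
    using assms by (simp add: EV_shift avg_const Fp_nonempty)
  then show ?thesis by (simp only: avg_swap[of "Fp p"])
qed

text \<open>Averaging over the line first turns \<open>g\<close> against the conjugate phase into
  its Fourier coefficient. \<open>\<iota>\<close> is constant on lines and serves as a cutoff to the
  points where the coefficient is large.\<close>

lemma EV_fh:
  assumes p: "p > 0" and g: "B1 p D g"
    and io: "per p D \<iota>" "\<And>x m. \<iota> (x + sm m w) = \<iota> x"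
  shows "EV p D (\<lambda>x. g x * (cnj (fh p w g x (frq p w g x)) * complex_of_real (\<iota> x)))
    = EV p D (\<lambda>x. complex_of_real ((cmod (fh p w g x (frq p w g x)))\<^sup>2 * \<iota> x))"
proof -
  let ?H = "\<lambda>x. g x * (cnj (fh p w g x (frq p w g x)) * complex_of_real (\<iota> x))"
  have gp: "per p D g" using g by (rule B1_per)
  have "per p D ?H"
    unfolding per_def
  proof (intro allI impI)
    fix x y assume c: "cg p D x y"
    show "?H x = ?H y"
      by (simp only: perD[OF gp c] perD[OF io(1) c] fh_cg[OF gp c] frq_cg[OF gp c])
  qed
  from EV_line[OF p this, of w]
  have "EV p D ?H = EV p D (\<lambda>x. EY p (\<lambda>n. ?H (x + sm n w)))" .
  also have "\<dots> = EV p D (\<lambda>x. complex_of_real ((cmod (fh p w g x (frq p w g x)))\<^sup>2 * \<iota> x))"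
  proof (rule avg_cong)
    fix x
    let ?\<phi> = "frq p w g x"
    have "?H (x + sm n w) = (g (x + sm n w) * e_p p (- (?\<phi> * n))) * (cnj (fh p w g x ?\<phi>) * complex_of_real (\<iota> x))" for n
      by (simp add: fh_shift[OF p gp] frq_shift[OF p gp] io e_p_minus ac_simps)
    then have "EY p (\<lambda>n. ?H (x + sm n w)) = fh p w g x ?\<phi> * (cnj (fh p w g x ?\<phi>) * complex_of_real (\<iota> x))"
      by (simp only: avg_cmult_right fh_def)
    also have "\<dots> = complex_of_real ((cmod (fh p w g x ?\<phi>))\<^sup>2 * \<iota> x)"
      by (simp only: complex_norm_square of_real_mult mult.assoc)
    finally show "EY p (\<lambda>n. ?H (x + sm n w)) = complex_of_real ((cmod (fh p w g x ?\<phi>))\<^sup>2 * \<iota> x)" .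
  qed
  finally show ?thesis .
qed

subsection \<open>Bookkeeping of polynomial losses\<close>

lemma power_antimono:
  fixes \<delta> :: real
  assumes "0 \<le> \<delta>" "\<delta> \<le> 1" "m \<le> n"
  shows "\<delta> ^ n \<le> \<delta> ^ m"
  using power_decreasing[OF assms(3,1,2)] .

text \<open>Exponent and factor of an estimate are the same natural number. This lemma and
  \<open>gain_mono\<close> allow it to be enlarged in the hypothesis and in the conclusion, so that
  finitely many constants can be merged.\<close>

lemma loss_mono:
  fixes \<delta> \<beta> :: real
  assumes "0 \<le> \<delta>" "\<delta> \<le> 1" "0 \<le> \<beta>" "K \<le> M" "real M * \<beta> < \<delta> ^ M"
  shows "real K * \<beta> < \<delta> ^ K"
proof -
  have "real K * \<beta> \<le> real M * \<beta>" using assms by (intro mult_right_mono) auto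
  also have "\<dots> < \<delta> ^ M" by fact
  also have "\<dots> \<le> \<delta> ^ K" using assms by (intro power_antimono)
  finally show ?thesis .
qed

lemma gain_mono:
  fixes \<delta> t :: real
  assumes "0 \<le> \<delta>" "\<delta> \<le> 1" "1 \<le> K" "K \<le> M" "\<delta> ^ K \<le> real K * t"
  shows "\<delta> ^ M \<le> real M * t"
proof -
  have "0 \<le> real K * t" using assms(5) zero_le_power[OF assms(1), of K] by linarith
  then have t: "0 \<le> t" using assms(3) by (simp add: zero_le_mult_iff)
  have "\<delta> ^ M \<le> \<delta> ^ K" using assms by (intro power_antimono)
  also have "\<dots> \<le> real K * t" by fact
  also have "\<dots> \<le> real M * t" using assms t by (intro mult_right_mono) auto
  finally show ?thesis .
qed

text \<open>Composition of two lossy steps. Raising the first gain to the power \<open>L\<close>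
  bounds \<open>\<delta> ^ (K * L)\<close> by \<open>K ^ L * \<delta>' ^ L\<close>, so
  \<open>M\<close> must dominate the exponent \<open>K * L\<close> and the factor
  \<open>L * K ^ L\<close>. The first claim says that \<open>\<delta>'\<close> is still large enough
  to start the second step.\<close>

lemma loss_chain:
  fixes \<delta> \<delta>' \<beta> :: real
  assumes "0 \<le> \<delta>" "\<delta> \<le> 1" "0 \<le> \<beta>" "1 \<le> K" "1 \<le> L" "K * L * K ^ L \<le> M"
    and M: "real M * \<beta> < \<delta> ^ M" and le: "\<delta> ^ K \<le> real K * \<delta>'"
  shows "real L * \<beta> < \<delta>' ^ L" and "\<delta>' ^ L \<le> real L * t \<Longrightarrow> \<delta> ^ M \<le> real M * t"
proof -
  have "K * L * 1 \<le> K * L * K ^ L" using assms by (intro mult_left_mono) auto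
  then have KL: "K * L \<le> M" using assms(6) by linarith
  have "1 * (L * K ^ L) \<le> K * (L * K ^ L)" using assms by (intro mult_right_mono) auto
  then have "L * K ^ L \<le> M" using assms(6) by (metis mult.assoc mult_1 order_trans)
  then have LK: "real L * real K ^ L \<le> real M" by (metis of_nat_le_iff of_nat_mult of_nat_power)
  have "\<delta> ^ M \<le> (\<delta> ^ K) ^ L" unfolding power_mult[symmetric] using assms KL by (intro power_antimono)
  also have "\<dots> \<le> (real K * \<delta>') ^ L" using le assms by (intro power_mono) auto
  finally have 1: "\<delta> ^ M \<le> real K ^ L * \<delta>' ^ L" by (simp add: power_mult_distrib)
  have K: "0 < real K ^ L" using assms by auto
  have "real K ^ L * (real L * \<beta>) \<le> real M * \<beta>"
    using mult_right_mono[OF LK assms(3)] by (simp add: ac_simps)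
  also have "\<dots> < real K ^ L * \<delta>' ^ L" using M 1 by linarith
  finally show "real L * \<beta> < \<delta>' ^ L" using K by (simp add: mult_less_cancel_left_pos)
  assume t: "\<delta>' ^ L \<le> real L * t"
  have "0 < real L * t"
    using t \<open>real L * \<beta> < \<delta>' ^ L\<close> assms(3) mult_nonneg_nonneg[of "real L" \<beta>] by linarith
  then have t0: "0 \<le> t" using assms(5) by (simp add: zero_less_mult_iff)
  have "\<delta> ^ M \<le> real K ^ L * (real L * t)" using 1 mult_left_mono[OF t, of "real K ^ L"] K by linarith
  also have "\<dots> \<le> real M * t" using mult_right_mono[OF LK t0] by (simp add: ac_simps)
  finally show "\<delta> ^ M \<le> real M * t" .
qed

text \<open>Bad shifts have proportion at most \<open>b / p\<close>, so they carry at most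
  \<open>b * \<beta>\<close> of the mean. The function set to zero on them still has positive mean,
  hence a point where it reaches its mean is not bad.\<close>

lemma exists_good_shift:
  fixes \<rho> :: "int \<Rightarrow> real"
  assumes p: "p > 0" and le: "\<delta> \<le> EY p \<rho>" and rho: "\<And>h. 0 \<le> \<rho> h" "\<And>h. \<rho> h \<le> 1"
    and bad: "card {h \<in> Fp p. bad h} \<le> b" and b: "real b * \<beta> < \<delta>" "1 / real p \<le> \<beta>"
  shows "\<exists>h\<in>Fp p. \<not> bad h \<and> \<delta> \<le> real b * \<beta> + \<rho> h"
proof -
  let ?\<rho> = "\<lambda>h. if bad h then 0 else \<rho> h"
  have "EY p \<rho> \<le> EY p (\<lambda>h. ?\<rho> h + (if bad h then 1 else 0))"
    by (rule avg_mono) (use rho in auto)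
  also have "\<dots> = EY p ?\<rho> + EY p (\<lambda>h. if bad h then 1 else 0)" by (rule avg_add)
  also have "EY p (\<lambda>h. if bad h then 1 else (0::real)) = real (card {h \<in> Fp p. bad h}) / real p"
    by (simp add: avg_def sum.If_cases Int_def)
  also have "\<dots> \<le> real b * (1 / real p)" using bad p by (simp add: divide_right_mono)
  also have "\<dots> \<le> real b * \<beta>" using b(2) by (rule mult_left_mono) simp
  finally have *: "\<delta> \<le> EY p ?\<rho> + real b * \<beta>" using le by linarith
  obtain h where h: "h \<in> Fp p" "EY p ?\<rho> \<le> ?\<rho> h"
    using exists_ge_avg[OF finite_Fp Fp_nonempty[OF p], of ?\<rho>] by blast
  show ?thesis
  proof (intro bexI[OF _ h(1)] conjI)
    show "\<not> bad h" using h(2) * b(1) by (auto split: if_splits)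
    then show "\<delta> \<le> real b * \<beta> + \<rho> h" using h(2) * by simp
  qed
qed

subsection \<open>Leading terms of polynomial curves\<close>

lemma poly_cong: "[x = y] (mod m) \<Longrightarrow> [poly R x = poly R y] (mod (m::int))"
  by (induction R) (auto intro: cong_add cong_mult)

text \<open>Phrased with a degree bound and the coefficient at that place rather than with a leading
  coefficient, since the latter may vanish or be divisible by \<open>p\<close>. For
  \<open>R = a + y S\<close> the difference is \<open>y S' + h (S + S')\<close>, which drives the
  induction.\<close>

lemma poly_shift_diff:
  fixes R :: "int poly"
  assumes "degree R \<le> Suc e"
  shows "\<exists>R'. (\<forall>y. poly R' y = poly R (y + h) - poly R y) \<and> degree R' \<le> e \<and>
    coeff R' e = int (Suc e) * h * coeff R (Suc e)"
  using assms
proof (induction e arbitrary: R)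
  case 0
  obtain a S where R: "R = pCons a S" by (cases R)
  then have "degree S = 0" using 0 by (auto split: if_splits)
  then obtain s where S: "S = [:s:]" by (rule degree_eq_zeroE)
  show ?case by (rule exI[of _ "[:h * s:]"]) (auto simp: R S algebra_simps)
next
  case (Suc e)
  obtain a S where R: "R = pCons a S" by (cases R)
  then have "degree S \<le> Suc e" using Suc.prems by (auto split: if_splits)
  from Suc.IH[OF this] obtain S' where S': "\<And>y. poly S' y = poly S (y + h) - poly S y" "degree S' \<le> e"
    "coeff S' e = int (Suc e) * h * coeff S (Suc e)" by blast
  have c0: "coeff S' (Suc e) = 0" using S'(2) by (simp add: coeff_eq_0)
  show ?case
  proof (intro exI[of _ "pCons 0 S' + smult h (S + S')"] conjI allI)
    fix y
    have "poly S (y + h) = poly S y + poly S' y" using S'(1)[of y] by simp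
    then show "poly (pCons 0 S' + smult h (S + S')) y = poly R (y + h) - poly R y"
      by (simp add: R algebra_simps)
    have "degree (pCons 0 S') \<le> Suc e" using S'(2) by (auto simp: degree_pCons_le intro: order_trans[OF degree_pCons_le])
    moreover have "degree (smult h (S + S')) \<le> Suc e"
      using \<open>degree S \<le> Suc e\<close> S'(2) by (intro order_trans[OF degree_smult_le] degree_add_le) auto
    ultimately show "degree (pCons 0 S' + smult h (S + S')) \<le> Suc e" by (rule degree_add_le)
    show "coeff (pCons 0 S' + smult h (S + S')) (Suc e) = int (Suc (Suc e)) * h * coeff R (Suc (Suc e))"
      by (simp add: R S'(3) c0 algebra_simps)
  qed
qed

text \<open>Modulo \<open>p\<close> and in the first \<open>D\<close> coordinates, \<open>q\<close>
  is a polynomial curve of degree at most \<open>e\<close> with vector coefficient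
  \<open>\<kappa>\<close> at \<open>y ^ e\<close>. The coefficient may be zero, and the congruence
  leaves it free up to multiples of \<open>p\<close>.\<close>

definition LT :: "nat \<Rightarrow> nat \<Rightarrow> nat \<Rightarrow> vec \<Rightarrow> (int \<Rightarrow> vec) \<Rightarrow> bool" where
  "LT p D e \<kappa> q \<longleftrightarrow> (\<exists>R :: nat \<Rightarrow> int poly. \<forall>j<D. (\<forall>y. [q y j = poly (R j) y] (mod int p)) \<and>
     degree (R j) \<le> e \<and> coeff (R j) e = \<kappa> j)"

lemma LT_I:
  assumes "\<And>j y. j < D \<Longrightarrow> [q y j = poly (R j) y] (mod int p)" "\<And>j. j < D \<Longrightarrow> degree (R j) \<le> e"
    "\<And>j. j < D \<Longrightarrow> coeff (R j) e = \<kappa> j"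
  shows "LT p D e \<kappa> q"
  unfolding LT_def using assms by blast

lemma LT_E:
  assumes "LT p D e \<kappa> q"
  obtains R where "\<And>j y. j < D \<Longrightarrow> [q y j = poly (R j) y] (mod int p)" "\<And>j. j < D \<Longrightarrow> degree (R j) \<le> e"
    "\<And>j. j < D \<Longrightarrow> coeff (R j) e = \<kappa> j"
  using assms unfolding LT_def by blast

lemma LT_add:
  assumes "LT p D e \<kappa> q" "LT p D e \<kappa>' q'"
  shows "LT p D e (\<kappa> + \<kappa>') (\<lambda>y. q y + q' y)"
proof -
  obtain R where R: "\<And>j y. j < D \<Longrightarrow> [q y j = poly (R j) y] (mod int p)" "\<And>j. j < D \<Longrightarrow> degree (R j) \<le> e"
    "\<And>j. j < D \<Longrightarrow> coeff (R j) e = \<kappa> j" using LT_E[OF assms(1)] by blast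
  obtain R' where R': "\<And>j y. j < D \<Longrightarrow> [q' y j = poly (R' j) y] (mod int p)" "\<And>j. j < D \<Longrightarrow> degree (R' j) \<le> e"
    "\<And>j. j < D \<Longrightarrow> coeff (R' j) e = \<kappa>' j" using LT_E[OF assms(2)] by blast
  show ?thesis
    by (rule LT_I[where R = "\<lambda>j. R j + R' j"]) (use R R' in \<open>auto intro: cong_add degree_add_le\<close>)
qed

lemma LT_sm:
  assumes "LT p D e \<kappa> q"
  shows "LT p D e (sm c \<kappa>) (\<lambda>y. sm c (q y))"
proof -
  obtain R where R: "\<And>j y. j < D \<Longrightarrow> [q y j = poly (R j) y] (mod int p)" "\<And>j. j < D \<Longrightarrow> degree (R j) \<le> e"
    "\<And>j. j < D \<Longrightarrow> coeff (R j) e = \<kappa> j" using LT_E[OF assms(1)] by blast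
  show ?thesis
    by (rule LT_I[where R = "\<lambda>j. smult c (R j)"])
      (use R in \<open>auto simp: sm_def intro!: cong_mult intro: order_trans[OF degree_smult_le]\<close>)
qed

lemma LT_diff:
  assumes "LT p D e \<kappa> q" "LT p D e \<kappa>' q'"
  shows "LT p D e (\<kappa> - \<kappa>') (\<lambda>y. q y - q' y)"
proof -
  have "LT p D e (\<kappa> + sm (- 1) \<kappa>') (\<lambda>y. q y + sm (- 1) (q' y))" by (intro LT_add LT_sm assms)
  then show ?thesis by (simp add: sm_minus_left)
qed

lemma LT_mono:
  assumes "LT p D e \<kappa> q" "e < e'"
  shows "LT p D e' 0 q"
proof -
  obtain R where R: "\<And>j y. j < D \<Longrightarrow> [q y j = poly (R j) y] (mod int p)" "\<And>j. j < D \<Longrightarrow> degree (R j) \<le> e"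
    "\<And>j. j < D \<Longrightarrow> coeff (R j) e = \<kappa> j" using LT_E[OF assms(1)] by blast
  show ?thesis
  proof (rule LT_I[where R = R])
    fix j assume j: "j < D"
    show "degree (R j) \<le> e'" using R(2)[OF j] assms(2) by linarith
    show "coeff (R j) e' = 0 j" using R(2)[OF j] assms(2) by (simp add: coeff_eq_0)
  qed (use R(1) in auto)
qed

lemma LT_drop:
  assumes "LT p D (Suc e) 0 q"
  shows "\<exists>\<kappa>. LT p D e \<kappa> q"
proof -
  obtain R where R: "\<And>j y. j < D \<Longrightarrow> [q y j = poly (R j) y] (mod int p)" "\<And>j. j < D \<Longrightarrow> degree (R j) \<le> Suc e"
    "\<And>j. j < D \<Longrightarrow> coeff (R j) (Suc e) = 0" using LT_E[OF assms(1)] by (metis zero_fun_apply)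
  have "degree (R j) \<le> e" if "j < D" for j
  proof (rule degree_le, intro allI impI)
    fix i assume "e < i"
    then show "coeff (R j) i = 0" using R(2,3)[OF that] by (cases "i = Suc e") (auto intro: coeff_eq_0)
  qed
  then have "LT p D e (\<lambda>j. coeff (R j) e) q" by (intro LT_I[where R = R]) (use R in auto)
  then show ?thesis by blast
qed

lemma LT_cg:
  assumes "LT p D e \<kappa> q" "\<And>y. cg p D (q' y) (q y)"
  shows "LT p D e \<kappa> q'"
  using assms unfolding LT_def cg_def by (meson cong_trans)

lemma LT_shift_diff:
  assumes "LT p D (Suc e) \<kappa> q"
  shows "LT p D e (sm (int (Suc e) * h) \<kappa>) (\<lambda>y. q (y + h) - q y)"
proof -
  obtain R where R: "\<And>j y. j < D \<Longrightarrow> [q y j = poly (R j) y] (mod int p)" "\<And>j. j < D \<Longrightarrow> degree (R j) \<le> Suc e"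
    "\<And>j. j < D \<Longrightarrow> coeff (R j) (Suc e) = \<kappa> j" using LT_E[OF assms(1)] by blast
  have "\<forall>j. \<exists>R'. j < D \<longrightarrow> (\<forall>y. poly R' y = poly (R j) (y + h) - poly (R j) y) \<and> degree R' \<le> e \<and>
      coeff R' e = int (Suc e) * h * coeff (R j) (Suc e)"
    using poly_shift_diff R(2) by blast
  then obtain R' where R': "\<forall>j. j < D \<longrightarrow> (\<forall>y. poly (R' j) y = poly (R j) (y + h) - poly (R j) y) \<and> degree (R' j) \<le> e \<and>
      coeff (R' j) e = int (Suc e) * h * coeff (R j) (Suc e)" by (rule choice[THEN exE])
  show ?thesis
    by (rule LT_I[where R = R']) (use R R' in \<open>auto simp: sm_def intro!: cong_diff\<close>)
qed

lemma LT_0_const: "LT p D 0 \<kappa> q \<Longrightarrow> cg p D (q y) (q y')"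
proof -
  assume *: "LT p D 0 \<kappa> q"
  obtain R where R: "\<And>j y. j < D \<Longrightarrow> [q y j = poly (R j) y] (mod int p)" "\<And>j. j < D \<Longrightarrow> degree (R j) \<le> 0"
    "\<And>j. j < D \<Longrightarrow> coeff (R j) 0 = \<kappa> j"
    using LT_E[OF *] by blast
  have "[q y j = q y' j] (mod int p)" if "j < D" for j
  proof -
    have "degree (R j) = 0" using R(2)[OF that] by simp
    then obtain c where "R j = [:c:]" by (rule degree_eq_zeroE)
    then have "poly (R j) y = poly (R j) y'" by simp
    then show ?thesis using R(1)[OF that, of y] R(1)[OF that, of y'] by (simp add: cong_def)
  qed
  then show ?thesis by (simp add: cg_def)
qed

lemma LT_shift:
  assumes "LT p D e \<kappa> q"
  shows "LT p D e \<kappa> (\<lambda>y. q (y + h))"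
proof (cases e)
  case 0
  then show ?thesis using LT_cg[OF assms, of "\<lambda>y. q (y + h)"] LT_0_const[of p D \<kappa> q] assms by simp
next
  case (Suc e')
  have "LT p D e (\<kappa> + 0) (\<lambda>y. q y + (q (y + h) - q y))"
    by (rule LT_add[OF assms]) (rule LT_mono[OF LT_shift_diff[OF assms[unfolded Suc]]], simp add: Suc)
  then show ?thesis by simp
qed

subsection \<open>Averages along polynomial curves\<close>

type_synonym elt = "(vec \<Rightarrow> complex) \<times> (int \<Rightarrow> vec)"

definition qp :: "nat \<Rightarrow> nat \<Rightarrow> (int \<Rightarrow> vec) \<Rightarrow> bool" where
  "qp p D q \<longleftrightarrow> (\<forall>y y'. [y = y'] (mod int p) \<longrightarrow> cg p D (q y) (q y'))"

lemma LT_qp: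
  assumes "LT p D e \<kappa> q"
  shows "qp p D q"
proof -
  obtain R where R: "\<And>j y. j < D \<Longrightarrow> [q y j = poly (R j) y] (mod int p)" "\<And>j. j < D \<Longrightarrow> degree (R j) \<le> e"
    "\<And>j. j < D \<Longrightarrow> coeff (R j) e = \<kappa> j" using LT_E[OF assms] by blast
  show ?thesis
    unfolding qp_def cg_def
  proof (intro allI impI)
    fix y y' j assume "[y = y'] (mod int p)" "j < D"
    then show "[q y j = q y' j] (mod int p)"
      by (intro cong_trans[OF cong_trans[OF R(1) poly_cong] cong_sym[OF R(1)]])
  qed
qed

definition adm :: "nat \<Rightarrow> nat \<Rightarrow> elt \<Rightarrow> bool" where
  "adm p D z \<longleftrightarrow> B1 p D (fst z) \<and> qp p D (snd z)"

lemma adm_eq: "adm p D z \<Longrightarrow> cg p D x x' \<Longrightarrow> cg p D u u' \<Longrightarrow> fst z (x + u) = fst z (x' + u')"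
  unfolding adm_def B1_def by (blast intro: perD cg_add)

lemma adm_norm: "adm p D z \<Longrightarrow> cmod (fst z x) \<le> 1"
  by (simp add: adm_def B1_def)

lemma adm_qp: "adm p D z \<Longrightarrow> qp p D (snd z)"
  by (simp add: adm_def)

lemma qpD: "qp p D q \<Longrightarrow> [y = y'] (mod int p) \<Longrightarrow> cg p D (q y) (q y')"
  unfolding qp_def by blast

definition LamL :: "nat \<Rightarrow> nat \<Rightarrow> elt list \<Rightarrow> complex" where
  "LamL p D L = EV p D (\<lambda>x. EY p (\<lambda>y. \<Prod>z\<leftarrow>L. fst z (x + snd z y)))"

definition sub :: "(int \<Rightarrow> vec) \<Rightarrow> elt \<Rightarrow> elt" where
  "sub a z = (fst z, \<lambda>y. snd z y - a y)"

text \<open>The second copy of an element after squaring: conjugated, evaluated at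
  \<open>y + h\<close>, and moved by the pivot curve \<open>a\<close> at that same time.
  \<open>sub\<close> is the first copy.\<close>

definition subs :: "(int \<Rightarrow> vec) \<Rightarrow> int \<Rightarrow> elt \<Rightarrow> elt" where
  "subs a h z = (\<lambda>x. cnj (fst z x), \<lambda>y. snd z (y + h) - a (y + h))"

lemma qp_diff: "qp p D q \<Longrightarrow> qp p D a \<Longrightarrow> qp p D (\<lambda>y. q y - a y)"
  unfolding qp_def by (simp add: cg_diff)

lemma qp_shift: "qp p D q \<Longrightarrow> qp p D (\<lambda>y. q (y + h))"
  unfolding qp_def by (simp add: cong_add)

lemma adm_sub: "adm p D z \<Longrightarrow> qp p D a \<Longrightarrow> adm p D (sub a z)"
  unfolding adm_def sub_def by (simp add: qp_diff)

lemma adm_subs: "adm p D z \<Longrightarrow> qp p D a \<Longrightarrow> adm p D (subs a h z)"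
  unfolding adm_def subs_def using qp_shift[OF qp_diff, of p D "snd z" a h] by (simp add: B1_cnj)

lemma prod_list_norm_le: "(\<And>z. z \<in> set L \<Longrightarrow> cmod (f z) \<le> 1) \<Longrightarrow> cmod (\<Prod>z\<leftarrow>L. f z) \<le> 1"
  by (induction L) (auto simp: norm_mult intro!: mult_le_one)

lemma prod_list_cong: "(\<And>z. z \<in> set L \<Longrightarrow> f z = g z) \<Longrightarrow> (\<Prod>z\<leftarrow>L. f z) = (\<Prod>z\<leftarrow>L. g z)"
  by (simp cong: map_cong)

lemma prod_list_cnj: "cnj (\<Prod>z\<leftarrow>L. f z) = (\<Prod>z\<leftarrow>L. cnj (f z))"
  by (induction L) auto

lemma norm_LamL_le: "p > 0 \<Longrightarrow> (\<And>z. z \<in> set L \<Longrightarrow> adm p D z) \<Longrightarrow> cmod (LamL p D L) \<le> 1"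
  unfolding LamL_def
  by (intro norm_avg_le_const finite_Fp_vec finite_Fp Fp_nonempty Fp_vec_nonempty prod_list_norm_le)
    (auto intro: adm_norm)

lemma per_prod_list:
  "(\<And>z. z \<in> set L \<Longrightarrow> adm p D z) \<Longrightarrow> per p D (\<lambda>x. \<Prod>z\<leftarrow>L. fst z (x + snd z y))"
  unfolding per_def by (intro allI impI prod_list_cong adm_eq[of p D]) auto

lemma LamL_mset: "mset L = mset L' \<Longrightarrow> LamL p D L = LamL p D L'"
  unfolding LamL_def prod_mset_prod_list[symmetric] mset_map by simp

text \<open>For fixed \<open>y\<close> the mean over \<open>x\<close> is translation invariant, so a
  common curve can be subtracted from all elements.\<close>

lemma LamL_sub:
  assumes "p > 0" "\<And>z. z \<in> set L \<Longrightarrow> adm p D z"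
  shows "LamL p D (map (sub a) L) = LamL p D L"
proof -
  have "LamL p D L = EY p (\<lambda>y. EV p D (\<lambda>x. \<Prod>z\<leftarrow>L. fst z (x + snd z y)))"
    unfolding LamL_def by (rule avg_swap)
  also have "\<dots> = EY p (\<lambda>y. EV p D (\<lambda>x. \<Prod>z\<leftarrow>L. fst z (x + - a y + snd z y)))"
    by (intro avg_cong EV_shift[OF assms(1) per_prod_list, symmetric] assms)
  also have "\<dots> = LamL p D (map (sub a) L)"
    unfolding LamL_def by (subst avg_swap) (simp add: sub_def comp_def add_diff_eq diff_add_eq)
  finally show ?thesis ..
qed

text \<open>After subtraction of \<open>a\<close> the elements of \<open>K\<close> no longer depend
  on \<open>y\<close>. They form a bounded factor \<open>k x\<close> that Cauchy--Schwarz removes,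
  while the remaining elements are doubled with a shift \<open>h\<close>.\<close>

lemma van_der_Corput:
  assumes p: "p > 0" and adm: "\<And>z. z \<in> set (K @ R) \<Longrightarrow> adm p D z" and a: "qp p D a"
    and K: "\<And>z y. z \<in> set K \<Longrightarrow> cg p D (snd z y - a y) (snd z 0 - a 0)"
  shows "(cmod (LamL p D (K @ R)))\<^sup>2 \<le> EY p (\<lambda>h. cmod (LamL p D (map (sub a) R @ map (subs a h) R)))"
proof -
  define k where "k x = (\<Prod>z\<leftarrow>K. fst z (x + (snd z 0 - a 0)))" for x
  define r where "r x y = (\<Prod>z\<leftarrow>R. fst z (x + (snd z y - a y)))" for x y
  have "LamL p D (K @ R) = LamL p D (map (sub a) (K @ R))" by (rule LamL_sub[OF p adm, symmetric])
  also have "\<dots> = EV p D (\<lambda>x. EY p (\<lambda>y. (\<Prod>z\<leftarrow>K. fst z (x + (snd z y - a y))) * r x y))"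
    by (simp add: LamL_def sub_def comp_def r_def)
  also have "\<dots> = EV p D (\<lambda>x. EY p (\<lambda>y. k x * r x y))"
    unfolding k_def
    by (intro avg_cong arg_cong2[of _ _ _ _ "(*)"] refl prod_list_cong adm_eq[of p D] cg_refl K)
      (use adm in auto)
  also have "\<dots> = EV p D (\<lambda>x. k x * EY p (r x))" by (simp add: avg_cmult)
  finally have "(cmod (LamL p D (K @ R)))\<^sup>2 \<le> EV p D (\<lambda>x. (cmod (EY p (r x)))\<^sup>2)"
  proof (simp only:, intro avg_CS_bounded finite_Fp_vec Fp_vec_nonempty[OF p])
    show "cmod (k x) \<le> 1" for x
      unfolding k_def by (intro prod_list_norm_le adm_norm[of p D] adm) auto
  qed
  also have "\<dots> = Re (EV p D (\<lambda>x. complex_of_real ((cmod (EY p (r x)))\<^sup>2)))"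
    by (simp add: avg_of_real del: of_real_power)
  also have "\<dots> = Re (EV p D (\<lambda>x. EY p (\<lambda>y. EY p (\<lambda>y'. r x y * cnj (r x y')))))"
    by (simp only: avg_square_expand)
  also have "\<dots> = Re (EV p D (\<lambda>x. EY p (\<lambda>y. EY p (\<lambda>h. r x y * cnj (r x (y + h))))))"
  proof -
    have "yper p (\<lambda>y. r x y)" for x
      unfolding yper_def r_def
      by (intro allI impI prod_list_cong adm_eq[of p D] cg_refl cg_diff qpD[OF a] qpD[OF adm_qp] adm) auto
    then have "yper p (\<lambda>y'. r x y * cnj (r x y'))" for x y
      using yper_mult[OF _ yper_cnj, of p "\<lambda>_. r x y" "r x"] by (simp add: yper_def)
    from EY_shift[OF p this] have "EY p (\<lambda>h. r x y * cnj (r x (h + y))) = EY p (\<lambda>y'. r x y * cnj (r x y'))" for x y .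
    then have "EY p (\<lambda>h. r x y * cnj (r x (y + h))) = EY p (\<lambda>y'. r x y * cnj (r x y'))" for x y
      by (simp only: add.commute[of y])
    then show ?thesis by (simp only:)
  qed
  also have "EV p D (\<lambda>x. EY p (\<lambda>y. EY p (\<lambda>h. r x y * cnj (r x (y + h)))))
      = EY p (\<lambda>h. EV p D (\<lambda>x. EY p (\<lambda>y. r x y * cnj (r x (y + h)))))"
    by (subst avg_swap[of "Fp p"]) (rule avg_swap)
  also have "\<dots> = EY p (\<lambda>h. LamL p D (map (sub a) R @ map (subs a h) R))"
    by (simp add: LamL_def sub_def subs_def comp_def r_def prod_list_cnj)
  also have "Re \<dots> \<le> EY p (\<lambda>h. cmod (LamL p D (map (sub a) R @ map (subs a h) R)))"
    using complex_Re_le_cmod norm_avg_le order_trans by blast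
  finally show ?thesis .
qed

text \<open>By translation invariance only the difference of the two parameters of a direction
  matters. This one-parameter form is the one in which van der Corput differencing produces box
  norms.\<close>

lemma bx_Cons_diff:
  assumes p: "p > 0" and f: "B1 p D f"
  shows "bx p D (u # us) f = EY p (\<lambda>h. bx p D us (\<lambda>x. f x * cnj (f (x + sm h u))))"
proof -
  let ?b = "\<lambda>h. bx p D us (\<lambda>x. f x * cnj (f (x + sm h u)))"
  have B: "B1 p D (\<lambda>x. f x * cnj (f (x + sm h u)))" for h by (intro B1_mult B1_cnj B1_shift f)
  have "bx p D us (dm u h k f) = ?b (k - h)" for h k
    using bx_shift[OF p B[of "k - h"], of us "sm h u"]
    by (simp add: dm_def[abs_def] add.assoc sm_add_left[symmetric])
  then have "bx p D (u # us) f = EY p (\<lambda>h. EY p (\<lambda>k. ?b (k - h)))" by (simp add: bx_Cons)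
  also have "\<dots> = EY p (\<lambda>h. EY p ?b)"
  proof (rule avg_cong)
    fix h
    have "yper p ?b"
      unfolding yper_def
      by (intro allI impI arg_cong[where f = "bx p D us"] ext arg_cong2[of _ _ _ _ "(*)"] refl arg_cong[where f = cnj]
          perD[OF B1_per[OF f]] cg_add cg_refl cg_sm)
    from EY_shift[OF p this, of "- h"] show "EY p (\<lambda>k. ?b (k - h)) = EY p ?b" by simp
  qed
  also have "\<dots> = EY p ?b" using p by (simp add: avg_const Fp_nonempty)
  finally show ?thesis .
qed

subsection \<open>Eliminating curves of lower complexity\<close>

text \<open>Closedness under the leading coefficients created by differencing: scalar multiples, and
  differences up to one exceptional shift \<open>h\<close>.\<close>

definition gd :: "nat \<Rightarrow> vec set \<Rightarrow> bool" where
  "gd p G \<longleftrightarrow> (\<forall>\<nu>\<in>G. \<forall>c. \<not> int p dvd c \<longrightarrow> sm c \<nu> \<in> G) \<and>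
     (\<forall>\<nu>\<in>G. \<forall>\<mu>\<in>G. \<forall>c. \<not> int p dvd c \<longrightarrow> card {h \<in> Fp p. \<nu> - sm (h * c) \<mu> \<notin> G} \<le> 1)"

text \<open>The curve of \<open>z\<close> is genuinely apart from the tracked curve
  \<open>q0\<close>: their difference is nonconstant of controlled degree, with leading vector in
  \<open>G\<close>. These vectors become the directions of the final box norm.\<close>

definition rc :: "nat \<Rightarrow> nat \<Rightarrow> nat \<Rightarrow> vec set \<Rightarrow> (int \<Rightarrow> vec) \<Rightarrow> elt \<Rightarrow> bool" where
  "rc p D d G q0 z \<longleftrightarrow> (\<exists>e \<nu>. 1 \<le> e \<and> e \<le> d \<and> \<nu> \<in> G \<and> LT p D e \<nu> (\<lambda>y. q0 y - snd z y))"

text \<open>An element with a label recording the degree and leading vector of its own curve.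
  Relative to \<open>q0\<close> it has full degree \<open>d\<close>; the label is the quantity that
  the elimination decreases.\<close>

definition nel :: "nat \<Rightarrow> nat \<Rightarrow> nat \<Rightarrow> vec set \<Rightarrow> (int \<Rightarrow> vec) \<Rightarrow> elt \<times> nat \<times> vec \<Rightarrow> bool" where
  "nel p D d G q0 x \<longleftrightarrow> fst (snd x) \<le> d \<and> LT p D (fst (snd x)) (snd (snd x)) (snd (fst x)) \<and>
     (\<exists>\<nu>\<in>G. LT p D d \<nu> (\<lambda>y. q0 y - snd (fst x) y))"

lemma Fp_nonzero_not_dvd: "h \<in> Fp p \<Longrightarrow> h \<noteq> 0 \<Longrightarrow> \<not> int p dvd h"
  using zdvd_not_zless[of h "int p"] by (auto simp: Fp_def)

lemma prime_not_dvd_small: "prime p \<Longrightarrow> 0 < d \<Longrightarrow> d < p \<Longrightarrow> \<not> int p dvd int d"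
  using nat_dvd_not_less by (simp add: int_dvd_int_iff)

lemma prime_not_dvd_mult: "prime p \<Longrightarrow> \<not> int p dvd a \<Longrightarrow> \<not> int p dvd b \<Longrightarrow> \<not> int p dvd a * b"
  by (metis prime_dvd_mult_iff prime_nat_int_transfer)

lemma card_le_1_subset: "{h \<in> Fp p. bad h} \<subseteq> {0} \<Longrightarrow> card {h \<in> Fp p. bad h} \<le> 1"
  using card_mono[of "{0::int}" "{h \<in> Fp p. bad h}"] by simp

text \<open>Relative to the new tracked curve, the shifted copy is at
  \<open>r (y + h) - (s (y + h) - s y)\<close>, where \<open>r\<close> is its old distance and
  \<open>s\<close> that of the pivot. If \<open>e = d\<close> the first term dominates, if
  \<open>e < d - 1\<close> the derivative of \<open>s\<close> does, with vector
  \<open>- d h \<nu>a\<close>; if \<open>e = d - 1\<close> the two vectors combine and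
  \<open>gd\<close> allows one exceptional \<open>h\<close>.\<close>

lemma rc_step:
  assumes p: "prime p" and d: "2 \<le> d" "d < p" and G: "gd p G" and la: "\<nu>a \<in> G"
    and ra: "LT p D d \<nu>a (\<lambda>y. q0 y - a y)" and z: "rc p D m G q0 z" and m: "d - 1 \<le> m" "m \<le> d"
  shows "card {h \<in> Fp p. \<not> rc p D m G (\<lambda>y. q0 y - a y) (subs a h z)} \<le> 1"
proof -
  obtain e l where el: "1 \<le> e" "e \<le> m" "l \<in> G" "LT p D e l (\<lambda>y. q0 y - snd z y)"
    using z unfolding rc_def by blast
  define r where "r y = q0 y - snd z y" for y
  define s where "s y = q0 y - a y" for y
  have r: "LT p D e l r" using el(4) by (simp add: r_def[abs_def])
  have s: "LT p D d \<nu>a s" using ra by (simp add: s_def[abs_def])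
  obtain d' where d': "d = Suc d'" "1 \<le> d'" using d by (cases d) auto
  have s': "LT p D d' (sm (int d * h) \<nu>a) (\<lambda>y. s (y + h) - s y)" for h
    using LT_shift_diff s d' by simp
  have eq: "(\<lambda>y. (q0 y - a y) - snd (subs a h z) y) = (\<lambda>y. r (y + h) - (s (y + h) - s y))" for h
    by (rule ext) (simp add: subs_def r_def s_def)
  consider "e = d" | "e < d'" | "e = d'" using el(2) m d' by linarith
  then show ?thesis
  proof cases
    case 1
    have "LT p D d (l - 0) (\<lambda>y. r (y + h) - (s (y + h) - s y))" for h
      using LT_diff[OF LT_shift[OF r[unfolded 1]] LT_mono[OF s']] d' by simp
    then have "rc p D m G (\<lambda>y. q0 y - a y) (subs a h z)" for h
      unfolding rc_def eq using el 1 by (intro exI[of _ d] exI[of _ l]) auto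
    then show ?thesis by simp
  next
    case 2
    have *: "LT p D d' (sm (- (int d * h)) \<nu>a) (\<lambda>y. r (y + h) - (s (y + h) - s y))" for h
      using LT_diff[OF LT_mono[OF LT_shift[OF r] 2] s'] by (simp add: sm_minus_left)
    have "rc p D m G (\<lambda>y. q0 y - a y) (subs a h z)" if h: "h \<in> Fp p" "h \<noteq> 0" for h
    proof -
      have "\<not> int p dvd - (int d * h)"
        using prime_not_dvd_mult[OF p prime_not_dvd_small[OF p _ d(2)] Fp_nonzero_not_dvd[OF h]] d by simp
      then have "sm (- (int d * h)) \<nu>a \<in> G" using G la unfolding gd_def by blast
      then show ?thesis
        unfolding rc_def eq using * m d' by (intro exI[of _ d'] exI[of _ "sm (- (int d * h)) \<nu>a"]) auto
    qed
    then show ?thesis by (intro card_le_1_subset) auto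
  next
    case 3
    have *: "LT p D d' (l - sm (h * int d) \<nu>a) (\<lambda>y. r (y + h) - (s (y + h) - s y))" for h
      using LT_diff[OF LT_shift[OF r[unfolded 3]] s', of h h] by (simp add: mult.commute)
    have "{h \<in> Fp p. \<not> rc p D m G (\<lambda>y. q0 y - a y) (subs a h z)} \<subseteq> {h \<in> Fp p. l - sm (h * int d) \<nu>a \<notin> G}"
      unfolding rc_def eq using * m d' by (auto intro!: exI[of _ d'])
    moreover have "card {h \<in> Fp p. l - sm (h * int d) \<nu>a \<notin> G} \<le> 1"
      using G la el(3) prime_not_dvd_small[OF p _ d(2)] d unfolding gd_def by auto
    moreover have "finite {h \<in> Fp p. l - sm (h * int d) \<nu>a \<notin> G}" by simp
    ultimately show ?thesis by (meson card_mono order_trans)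
  qed
qed

text \<open>The tracked function reappears as a shifted copy. Its distance from the new tracked
  curve is minus the derivative of \<open>q0 - a\<close>, whose leading vector is a nonzero multiple
  of \<open>\<nu>a\<close> unless \<open>h = 0\<close>.\<close>

lemma rc_tracked:
  assumes p: "prime p" and d: "2 \<le> d" "d < p" and G: "gd p G" and la: "\<nu>a \<in> G"
    and ra: "LT p D d \<nu>a (\<lambda>y. q0 y - a y)" and m: "d - 1 \<le> m"
  shows "card {h \<in> Fp p. \<not> rc p D m G (\<lambda>y. q0 y - a y) (subs a h (g0, q0))} \<le> 1"
proof -
  define s where "s y = q0 y - a y" for y
  have s: "LT p D d \<nu>a s" using ra by (simp add: s_def[abs_def])
  obtain d' where d': "d = Suc d'" "1 \<le> d'" using d by (cases d) auto
  have s': "LT p D d' (sm (int d * h) \<nu>a) (\<lambda>y. s (y + h) - s y)" for h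
    using LT_shift_diff s d' by simp
  have eq: "(\<lambda>y. (q0 y - a y) - snd (subs a h (g0, q0)) y) = (\<lambda>y. sm (- 1) (s (y + h) - s y))" for h
    by (rule ext) (simp add: subs_def s_def sm_minus_left)
  have *: "LT p D d' (sm (- (int d * h)) \<nu>a) (\<lambda>y. sm (- 1) (s (y + h) - s y))" for h
    using LT_sm[OF s', of "- 1" h] by (simp add: sm_sm)
  have "rc p D m G (\<lambda>y. q0 y - a y) (subs a h (g0, q0))" if h: "h \<in> Fp p" "h \<noteq> 0" for h
  proof -
    have "\<not> int p dvd - (int d * h)"
      using prime_not_dvd_mult[OF p prime_not_dvd_small[OF p _ d(2)] Fp_nonzero_not_dvd[OF h]] d by simp
    then have "sm (- (int d * h)) \<nu>a \<in> G" using G la unfolding gd_def by blast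
    then show ?thesis
      unfolding rc_def eq using * m d' by (intro exI[of _ d'] exI[of _ "sm (- (int d * h)) \<nu>a"]) auto
  qed
  then show ?thesis by (intro card_le_1_subset) auto
qed

lemma card_bad_list:
  assumes "\<And>z. z \<in> set L \<Longrightarrow> card {h \<in> Fp p. bad z h} \<le> 1"
  shows "card {h \<in> Fp p. \<exists>z\<in>set L. bad z h} \<le> length L"
  using assms
proof (induction L)
  case (Cons z L)
  have "{h \<in> Fp p. \<exists>z'\<in>set (z # L). bad z' h} = {h \<in> Fp p. bad z h} \<union> {h \<in> Fp p. \<exists>z\<in>set L. bad z h}" by auto
  then have "card {h \<in> Fp p. \<exists>z'\<in>set (z # L). bad z' h} \<le> card {h \<in> Fp p. bad z h} + card {h \<in> Fp p. \<exists>z\<in>set L. bad z h}"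
    by (simp only: card_Un_le)
  also have "\<dots> \<le> 1 + length L" using Cons.prems Cons.IH by (intro add_mono) simp_all
  finally show ?case by simp
qed simp

text \<open>A state of the elimination: curves in \<open>NL\<close> are at full degree
  \<open>d\<close> from the tracked one and must disappear, those in \<open>TL\<close> are at degree
  at most \<open>d - 1\<close>. Once \<open>NL\<close> is empty, the complexity has dropped to
  \<open>d - 1\<close>.\<close>

definition ST :: "nat \<Rightarrow> nat \<Rightarrow> nat \<Rightarrow> vec set \<Rightarrow> (vec \<Rightarrow> complex) \<Rightarrow> (int \<Rightarrow> vec) \<Rightarrow> (elt \<times> nat \<times> vec) list \<Rightarrow> elt list \<Rightarrow> bool" where
  "ST p D d G g0 q0 NL TL \<longleftrightarrow> adm p D (g0, q0) \<and> (\<forall>x\<in>set NL. adm p D (fst x) \<and> nel p D d G q0 x) \<and>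
     (\<forall>z\<in>set TL. adm p D z \<and> rc p D (d - 1) G q0 z)"

definition cx :: "nat \<Rightarrow> nat \<Rightarrow> vec set \<Rightarrow> real \<Rightarrow> bool" where
  "cx p d G \<beta> \<longleftrightarrow> prime p \<and> 2 \<le> d \<and> d < p \<and> gd p G \<and> 1 / real p \<le> \<beta>"

definition NT :: "nat \<Rightarrow> nat \<Rightarrow> (vec \<Rightarrow> complex) \<Rightarrow> (int \<Rightarrow> vec) \<Rightarrow> (elt \<times> nat \<times> vec) list \<Rightarrow> elt list \<Rightarrow> real" where
  "NT p D g0 q0 NL TL = cmod (LamL p D ((g0, q0) # map fst NL @ TL))"

lemma NT_nonneg: "0 \<le> NT p D g0 q0 NL TL"
  by (simp add: NT_def)

lemma NT_le_1: "p > 0 \<Longrightarrow> ST p D d G g0 q0 NL TL \<Longrightarrow> NT p D g0 q0 NL TL \<le> 1"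
  unfolding NT_def ST_def by (rule norm_LamL_le) auto

lemma cx_pos: "cx p d G \<beta> \<Longrightarrow> p > 0 \<and> 0 \<le> \<beta>"
  unfolding cx_def using prime_gt_0_nat[of p] by (auto intro: order_trans[OF _ , rotated])

text \<open>One differencing with a pivot of least level \<open>ea\<close>. Labels above
  \<open>ea\<close> survive; at level \<open>ea\<close> every leading vector loses
  \<open>\<kappa>a\<close>, and elements that had exactly this vector fall below. So the number of
  distinct vectors at level \<open>ea\<close> decreases. The error \<open>n + 1\<close> counts the
  tracked curve and the at most \<open>n\<close> curves in \<open>TL\<close>, each with one bad
  shift.\<close>

lemma elim_step:
  assumes cx: "cx p d G \<beta>" and ST: "ST p D d G g0 q0 NL TL" and len: "length NL + length TL \<le> n"
    and x0: "x0 \<in> set NL" "snd x0 = (ea, \<kappa>a)" and lev: "\<And>x. x \<in> set NL \<Longrightarrow> ea \<le> fst (snd x)"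
    and big: "real (n + 1) * \<beta> < (NT p D g0 q0 NL TL)\<^sup>2"
  shows "\<exists>q0' NL' TL'. ST p D d G g0 q0' NL' TL' \<and> length NL' + length TL' \<le> 2 * n + 1 \<and>
    (\<forall>x\<in>set NL'. (ea < fst (snd x) \<and> snd x \<in> snd ` set NL) \<or>
       (0 < ea \<and> fst (snd x) = ea \<and> (\<exists>x1\<in>set NL. fst (snd x1) = ea \<and> snd (snd x1) \<noteq> \<kappa>a \<and> snd (snd x) = snd (snd x1) - \<kappa>a)) \<or>
       fst (snd x) < ea) \<and>
    (NT p D g0 q0 NL TL)\<^sup>2 \<le> real (n + 1) * \<beta> + NT p D g0 q0' NL' TL'"
proof -
  have p: "prime p" "p > 0" and d: "2 \<le> d" "d < p" and G: "gd p G" and beta: "1 / real p \<le> \<beta>"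
    using cx cx_pos[OF cx] by (auto simp: cx_def)
  define a where "a = snd (fst x0)"
  \<comment> \<open>At level 0 all curves are constant and can be removed together. At positive
    level only exact copies of the pivot curve become constant after the subtraction.\<close>
  define kill where "kill x \<longleftrightarrow> (if ea = 0 then fst (snd x) = 0 else snd (fst x) = a)" for x :: "elt \<times> nat \<times> vec"
  define Kl where "Kl = filter kill NL"
  define Rl where "Rl = filter (\<lambda>x. \<not> kill x) NL"
  have x0N: "adm p D (fst x0)" "nel p D d G q0 x0" using ST x0 unfolding ST_def by auto
  have a_LT: "LT p D ea \<kappa>a a" and a_qp: "qp p D a" using x0N x0(2) by (auto simp: nel_def a_def adm_def)
  obtain \<nu>a where la: "\<nu>a \<in> G" "LT p D d \<nu>a (\<lambda>y. q0 y - a y)" using x0N(2) by (auto simp: nel_def a_def)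
  have NLx: "adm p D (fst x)" "nel p D d G q0 x" if "x \<in> set NL" for x using ST that unfolding ST_def by auto
  have TLz: "adm p D z" "rc p D (d - 1) G q0 z" if "z \<in> set TL" for z using ST that unfolding ST_def by auto
  have adm0: "adm p D (g0, q0)" using ST unfolding ST_def by auto
  let ?R = "(g0, q0) # map fst Rl @ TL"
  \<comment> \<open>The new labels. In the last case the leading terms cancel and
    \<open>LT_drop\<close> supplies some vector one degree lower; there \<open>ea\<close> is
    positive, as otherwise the element would have been killed.\<close>
  define lb where "lb x = (if ea < fst (snd x) then snd x else if snd (snd x) \<noteq> \<kappa>a then (ea, snd (snd x) - \<kappa>a)
      else (ea - 1, SOME \<kappa>. LT p D (ea - 1) \<kappa> (\<lambda>y. snd (fst x) y - a y)))" for x :: "elt \<times> nat \<times> vec"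
  have lb: "LT p D (fst (lb x)) (snd (lb x)) (\<lambda>y. snd (fst x) y - a y)" "fst (lb x) \<le> d" if x: "x \<in> set Rl" for x
  proof -
    have xN: "x \<in> set NL" "\<not> kill x" using x by (auto simp: Rl_def)
    have xL: "LT p D (fst (snd x)) (snd (snd x)) (snd (fst x))" "fst (snd x) \<le> d" using NLx(2)[OF xN(1)] by (auto simp: nel_def)
    have "LT p D (fst (lb x)) (snd (lb x)) (\<lambda>y. snd (fst x) y - a y) \<and> fst (lb x) \<le> d"
    proof (cases "ea < fst (snd x)")
      case True
      then show ?thesis using LT_diff[OF xL(1) LT_mono[OF a_LT True]] xL(2) by (simp add: lb_def)
    next
      case False
      then have e: "fst (snd x) = ea" using lev[OF xN(1)] by simp
      have D1: "LT p D ea (snd (snd x) - \<kappa>a) (\<lambda>y. snd (fst x) y - a y)" using LT_diff[OF _ a_LT] xL(1) e by simp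
      show ?thesis
      proof (cases "snd (snd x) = \<kappa>a")
        case True
        have "ea \<noteq> 0" using xN(2) e unfolding kill_def by metis
        then obtain e' where e': "ea = Suc e'" by (cases ea) auto
        have "\<exists>\<kappa>. LT p D e' \<kappa> (\<lambda>y. snd (fst x) y - a y)" using LT_drop D1 True e' by simp
        then have "LT p D e' (SOME \<kappa>. LT p D e' \<kappa> (\<lambda>y. snd (fst x) y - a y)) (\<lambda>y. snd (fst x) y - a y)" by (rule someI_ex)
        then show ?thesis using False True e' e xL(2) by (simp add: lb_def)
      next
        case F2: False
        then show ?thesis using False D1 e xL(2) by (simp add: lb_def)
      qed
    qed
    then show "LT p D (fst (lb x)) (snd (lb x)) (\<lambda>y. snd (fst x) y - a y)" "fst (lb x) \<le> d" by auto
  qed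
  have "mset ((g0, q0) # map fst NL @ TL) = mset (map fst Kl @ ?R)"
  proof -
    have "mset NL = mset Kl + mset Rl" unfolding Kl_def Rl_def mset_filter by (rule multiset_partition)
    then have "mset (map fst NL) = mset (map fst Kl) + mset (map fst Rl)" by simp
    then show ?thesis by simp
  qed
  then have NTeq: "NT p D g0 q0 NL TL = cmod (LamL p D (map fst Kl @ ?R))" unfolding NT_def by (rule arg_cong[where f = cmod, OF LamL_mset])
  have admR: "adm p D z" if "z \<in> set ?R" for z
  proof -
    have "z = (g0, q0) \<or> (\<exists>x\<in>set NL. z = fst x) \<or> z \<in> set TL" using that by (auto simp: Rl_def)
    then show ?thesis using adm0 NLx(1) TLz(1) by blast
  qed
  define q0' where "q0' y = q0 y - a y" for y
  define NL' where "NL' h = map (\<lambda>x. (sub a (fst x), lb x)) Rl @ map (\<lambda>x. (subs a h (fst x), lb x)) Rl" for h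
  define TL' where "TL' h = map (sub a) TL @ subs a h (g0, q0) # map (subs a h) TL" for h
  have new: "cmod (LamL p D (map (sub a) ?R @ map (subs a h) ?R)) = NT p D g0 q0' (NL' h) (TL' h)" for h
    unfolding NT_def
    by (intro arg_cong[where f = cmod] LamL_mset) (simp add: NL'_def TL'_def comp_def sub_def q0'_def[abs_def])
  have vdc: "(NT p D g0 q0 NL TL)\<^sup>2 \<le> EY p (\<lambda>h. NT p D g0 q0' (NL' h) (TL' h))"
    unfolding NTeq new[symmetric]
  proof (rule van_der_Corput[OF p(2) _ a_qp])
    show "adm p D z" if "z \<in> set (map fst Kl @ ?R)" for z
    proof -
      have "z \<in> set ?R \<or> (\<exists>x\<in>set NL. z = fst x)" using that unfolding set_append set_map Kl_def by auto
      then show ?thesis using admR NLx(1) by blast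
    qed
    show "cg p D (snd z y - a y) (snd z 0 - a 0)" if "z \<in> set (map fst Kl)" for z y
    proof -
      have "z \<in> fst ` set Kl" using that by simp
      then obtain x where "x \<in> set Kl" and x3: "z = fst x" by (rule imageE)
      then have x: "x \<in> set NL" "kill x" "z = fst x" unfolding Kl_def set_filter by simp_all
      show ?thesis
      proof (cases "ea = 0")
        case True
        then have "LT p D 0 (snd (snd x)) (snd z)" using x NLx(2)[OF x(1)] by (auto simp: kill_def nel_def)
        from LT_0_const[OF LT_diff[OF this a_LT[unfolded True]]] show ?thesis .
      next
        case False
        then have "snd z = a" using x by (simp add: kill_def)
        then show ?thesis by simp
      qed
    qed
  qed
  \<comment> \<open>Only shifted copies of the tracked curve and of \<open>TL\<close> can fail:
    unshifted copies keep their distance because the same curve was subtracted from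
    \<open>q0\<close>.\<close>
  let ?bad = "\<lambda>h. \<exists>z\<in>set ((g0, q0) # TL). \<not> rc p D (d - 1) G q0' (subs a h z)"
  have "card {h \<in> Fp p. ?bad h} \<le> length ((g0, q0) # TL)"
  proof (rule card_bad_list)
    fix z assume "z \<in> set ((g0, q0) # TL)"
    then consider "z = (g0, q0)" | "z \<in> set TL" by (metis set_ConsD)
    then show "card {h \<in> Fp p. \<not> rc p D (d - 1) G q0' (subs a h z)} \<le> 1"
    proof cases
      case 1
      then show ?thesis using rc_tracked[OF p(1) d G la order_refl, of g0] by (simp only: q0'_def[abs_def])
    next
      case 2
      show ?thesis using rc_step[OF p(1) d G la TLz(2)[OF 2] order_refl] by (simp add: q0'_def[abs_def])
    qed
  qed
  then have bad: "card {h \<in> Fp p. ?bad h} \<le> n + 1" using len by simp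
  have ST': "ST p D d G g0 q0' (NL' h) (TL' h)" if h: "\<not> ?bad h" for h
    unfolding ST_def
  proof (intro conjI ballI)
    show "adm p D (g0, q0')" using adm_sub[OF adm0 a_qp] by (simp add: sub_def q0'_def[abs_def])
    fix x assume "x \<in> set (NL' h)"
    then obtain x1 where x1: "x1 \<in> set Rl" "x = (sub a (fst x1), lb x1) \<or> x = (subs a h (fst x1), lb x1)"
      by (auto simp: NL'_def)
    then have x1N: "x1 \<in> set NL" by (simp add: Rl_def)
    show "adm p D (fst x)" using x1(2) adm_sub[OF NLx(1)[OF x1N] a_qp] adm_subs[OF NLx(1)[OF x1N] a_qp] by auto
    obtain l where l: "l \<in> G" "LT p D d l (\<lambda>y. q0 y - snd (fst x1) y)" using NLx(2)[OF x1N] by (auto simp: nel_def)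
    obtain d' where d': "d = Suc d'" using d by (cases d) auto
    have "LT p D d l (\<lambda>y. q0' y - snd (sub a (fst x1)) y)" using l(2) by (simp add: sub_def q0'_def)
    \<comment> \<open>The shift changes the distance by a derivative of \<open>q0 - a\<close>, of
      degree below \<open>d\<close>, so the vector at degree \<open>d\<close> is unaffected.\<close>
    moreover have "LT p D d l (\<lambda>y. q0' y - snd (subs a h (fst x1)) y)"
    proof -
      have "LT p D d (l - 0) (\<lambda>y. (q0 (y + h) - snd (fst x1) (y + h)) - ((q0 (y + h) - a (y + h)) - (q0 y - a y)))"
        by (rule LT_diff[OF LT_shift[OF l(2)] LT_mono[OF LT_shift_diff[OF la(2)[unfolded d']]]]) (simp add: d')
      then show ?thesis by (simp add: subs_def q0'_def algebra_simps)
    qed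
    moreover have "LT p D (fst (lb x1)) (snd (lb x1)) (snd (sub a (fst x1)))"
      "LT p D (fst (lb x1)) (snd (lb x1)) (snd (subs a h (fst x1)))"
      using lb(1)[OF x1(1)] LT_shift[OF lb(1)[OF x1(1)], of h] by (simp_all add: sub_def subs_def)
    ultimately show "nel p D d G q0' x" unfolding nel_def using x1(2) lb(2)[OF x1(1)] l(1) by auto
  next
    fix z assume z: "z \<in> set (TL' h)"
    have z1: "(\<exists>z1\<in>set TL. z = sub a z1 \<or> z = subs a h z1) \<or> z = subs a h (g0, q0)"
      using z by (auto simp: TL'_def)
    then show "adm p D z"
      using adm_sub[OF TLz(1) a_qp] adm_subs[OF TLz(1) a_qp] adm_subs[OF adm0 a_qp] by blast
    have "rc p D (d - 1) G q0' (sub a z1)" if "z1 \<in> set TL" for z1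
      using TLz(2)[OF that] by (simp add: rc_def sub_def q0'_def)
    then show "rc p D (d - 1) G q0' z" using z1 h by (metis list.set_intros)
  qed
  obtain h where h: "h \<in> Fp p" "\<not> ?bad h"
      "(NT p D g0 q0 NL TL)\<^sup>2 \<le> real (n + 1) * \<beta> + min 1 (NT p D g0 q0' (NL' h) (TL' h))"
  proof -
    have "NT p D g0 q0' (NL' h) (TL' h) \<le> 1" for h
      unfolding new[symmetric]
    proof (rule norm_LamL_le[OF p(2)])
      fix z assume "z \<in> set (map (sub a) ?R @ map (subs a h) ?R)"
      then obtain z1 where "z1 \<in> set ?R" "z = sub a z1 \<or> z = subs a h z1"
        unfolding set_append set_map by blast
      then show "adm p D z" using adm_sub[OF admR a_qp] adm_subs[OF admR a_qp] by blast
    qed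
    then have "EY p (\<lambda>h. NT p D g0 q0' (NL' h) (TL' h)) = EY p (\<lambda>h. min 1 (NT p D g0 q0' (NL' h) (TL' h)))"
      by (simp add: min_absorb2)
    then have "(NT p D g0 q0 NL TL)\<^sup>2 \<le> EY p (\<lambda>h. min 1 (NT p D g0 q0' (NL' h) (TL' h)))" using vdc by simp
    from exists_good_shift[OF p(2) this _ _ bad big beta] that show ?thesis by (auto simp: NT_nonneg)
  qed
  show ?thesis
  proof (intro exI[of _ q0'] exI[of _ "NL' h"] exI[of _ "TL' h"] conjI)
    show "ST p D d G g0 q0' (NL' h) (TL' h)" by (rule ST'[OF h(2)])
    have "x0 \<in> set Kl" using x0 by (auto simp: Kl_def kill_def a_def)
    have "length Rl < length NL"
      unfolding Rl_def by (rule length_filter_less[OF x0(1)]) (use x0 in \<open>auto simp: kill_def a_def\<close>)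
    then show "length (NL' h) + length (TL' h) \<le> 2 * n + 1" using len by (simp add: NL'_def TL'_def)
    show "\<forall>x\<in>set (NL' h). (ea < fst (snd x) \<and> snd x \<in> snd ` set NL) \<or>
       (0 < ea \<and> fst (snd x) = ea \<and> (\<exists>x1\<in>set NL. fst (snd x1) = ea \<and> snd (snd x1) \<noteq> \<kappa>a \<and> snd (snd x) = snd (snd x1) - \<kappa>a)) \<or>
       fst (snd x) < ea"
    proof
      fix x assume "x \<in> set (NL' h)"
      then obtain x1 where x1: "x1 \<in> set Rl" "snd x = lb x1" by (auto simp: NL'_def)
      then have x1N: "x1 \<in> set NL" "\<not> kill x1" by (auto simp: Rl_def)
      have ea0: "fst (snd x1) = ea \<Longrightarrow> 0 < ea" using x1N(2) unfolding kill_def by (metis gr0I)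
      show "(ea < fst (snd x) \<and> snd x \<in> snd ` set NL) \<or>
       (0 < ea \<and> fst (snd x) = ea \<and> (\<exists>x1\<in>set NL. fst (snd x1) = ea \<and> snd (snd x1) \<noteq> \<kappa>a \<and> snd (snd x) = snd (snd x1) - \<kappa>a)) \<or>
       fst (snd x) < ea"
        using x1(2) x1N(1) lev[OF x1N(1)] ea0 by (auto simp: lb_def split: if_splits)
    qed
    show "(NT p D g0 q0 NL TL)\<^sup>2 \<le> real (n + 1) * \<beta> + NT p D g0 q0' (NL' h) (TL' h)" using h(3) by linarith
  qed
qed

lemma elim_step_loss:
  assumes cx: "cx p d G \<beta>" and ST: "ST p D d G g0 q0 NL TL" and len: "length NL + length TL \<le> n"
    and x0: "x0 \<in> set NL" "snd x0 = (ea, \<kappa>a)" and lev: "\<And>x. x \<in> set NL \<Longrightarrow> ea \<le> fst (snd x)"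
    and big: "real (2 * n + 4) * \<beta> < (NT p D g0 q0 NL TL) ^ (2 * n + 4)"
  shows "\<exists>q0' NL' TL'. ST p D d G g0 q0' NL' TL' \<and> length NL' + length TL' \<le> 2 * n + 1 \<and>
    (\<forall>x\<in>set NL'. (ea < fst (snd x) \<and> snd x \<in> snd ` set NL) \<or>
       (0 < ea \<and> fst (snd x) = ea \<and> (\<exists>x1\<in>set NL. fst (snd x1) = ea \<and> snd (snd x1) \<noteq> \<kappa>a \<and> snd (snd x) = snd (snd x1) - \<kappa>a)) \<or>
       fst (snd x) < ea) \<and>
    (NT p D g0 q0 NL TL) ^ (2 * n + 4) \<le> real (2 * n + 4) * NT p D g0 q0' NL' TL'"
proof -
  let ?\<delta> = "NT p D g0 q0 NL TL" and ?K = "2 * n + 4"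
  have p: "p > 0" "0 \<le> \<beta>" using cx_pos[OF cx] by auto
  have \<delta>: "0 \<le> ?\<delta>" "?\<delta> \<le> 1" using NT_nonneg NT_le_1[OF p(1) ST] by auto
  have sq: "?\<delta> ^ ?K \<le> ?\<delta>\<^sup>2" by (rule power_antimono[OF \<delta>]) simp
  then have b: "real ?K * \<beta> < ?\<delta>\<^sup>2" using big by linarith
  have nb: "0 \<le> real n * \<beta>" using p by simp
  have b': "2 * (real n * \<beta>) + 4 * \<beta> < ?\<delta>\<^sup>2" using b by (simp add: algebra_simps)
  define u where "u = real n * \<beta>"
  have e: "real (n + 1) * \<beta> = u + \<beta>" by (simp add: u_def algebra_simps)
  have "real (n + 1) * \<beta> < ?\<delta>\<^sup>2" unfolding e using b' nb p(2) unfolding u_def[symmetric] by linarith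
  from elim_step[OF cx ST len x0 lev this] obtain q0' NL' TL' where
    *: "ST p D d G g0 q0' NL' TL'" "length NL' + length TL' \<le> 2 * n + 1"
    "\<forall>x\<in>set NL'. (ea < fst (snd x) \<and> snd x \<in> snd ` set NL) \<or>
       (0 < ea \<and> fst (snd x) = ea \<and> (\<exists>x1\<in>set NL. fst (snd x1) = ea \<and> snd (snd x1) \<noteq> \<kappa>a \<and> snd (snd x) = snd (snd x1) - \<kappa>a)) \<or>
       fst (snd x) < ea"
    "?\<delta>\<^sup>2 \<le> real (n + 1) * \<beta> + NT p D g0 q0' NL' TL'" by blast
  have "2 * (real (n + 1) * \<beta>) \<le> ?\<delta>\<^sup>2" unfolding e distrib_left using b' nb p(2) unfolding u_def[symmetric] by linarith
  then have "?\<delta>\<^sup>2 \<le> 2 * NT p D g0 q0' NL' TL'" using *(4) by linarith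
  also have "\<dots> \<le> real ?K * NT p D g0 q0' NL' TL'" by (rule mult_right_mono) (auto simp: NT_nonneg)
  finally have "?\<delta> ^ ?K \<le> real ?K * NT p D g0 q0' NL' TL'" using sq by linarith
  with * show ?thesis by blast
qed

lemma power_self_bound:
  fixes \<delta> :: real
  assumes "0 \<le> \<delta>" "\<delta> \<le> 1" "1 \<le> K"
  shows "\<delta> ^ K \<le> real K * \<delta>"
proof -
  have "\<delta> ^ K \<le> \<delta> ^ 1" using assms by (intro power_antimono)
  also have "\<dots> \<le> real K * \<delta>" using mult_right_mono[of 1 "real K" \<delta>] assms by simp
  finally show ?thesis .
qed

text \<open>The least constant that \<open>loss_chain\<close> accepts for the composition of two
  steps.\<close>

definition cmp :: "nat \<Rightarrow> nat \<Rightarrow> nat" where "cmp K L = K * L * K ^ L"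

lemma cmp_ge: "1 \<le> K \<Longrightarrow> 1 \<le> L \<Longrightarrow> K \<le> cmp K L \<and> L \<le> cmp K L \<and> 1 \<le> cmp K L"
proof -
  assume *: "1 \<le> K" "1 \<le> L"
  then have "1 \<le> K ^ L" by simp
  then have "K * L * 1 \<le> cmp K L" unfolding cmp_def by (intro mult_left_mono) auto
  moreover have "K \<le> K * L" "L \<le> K * L" using * by auto
  ultimately show ?thesis using * by linarith
qed

text \<open>All labels up to level \<open>e\<close> are eliminated. \<open>C\<close> is an arbitrary
  set of labels allowed above \<open>e\<close>; carrying it along expresses that higher levels are
  never disturbed, which the recursion needs. The constants depend on \<open>n\<close>,
  \<open>e\<close> and \<open>d\<close> only.\<close>

lemma elim_levels:
  "\<exists>K n'. 1 \<le> K \<and> (\<forall>p D \<beta> G g0 q0 NL TL C. cx p d G \<beta> \<longrightarrow> ST p D d G g0 q0 NL TL \<longrightarrow>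
     length NL + length TL \<le> n \<longrightarrow> (\<forall>x\<in>set NL. e < fst (snd x) \<longrightarrow> snd x \<in> C) \<longrightarrow>
     real K * \<beta> < NT p D g0 q0 NL TL ^ K \<longrightarrow>
     (\<exists>q0' NL' TL'. ST p D d G g0 q0' NL' TL' \<and> length NL' + length TL' \<le> n' \<and>
        (\<forall>x\<in>set NL'. e < fst (snd x) \<and> snd x \<in> C) \<and>
        NT p D g0 q0 NL TL ^ K \<le> real K * NT p D g0 q0' NL' TL'))"
proof (induction e arbitrary: n)
  case 0
  show ?case
  proof (rule exI[of _ "2 * n + 4"], rule exI[of _ "2 * n + 1"], intro conjI allI impI)
    fix p D \<beta> G g0 q0 NL TL and C :: "(nat \<times> vec) set"
    assume *: "cx p d G \<beta>" "ST p D d G g0 q0 NL TL" "length NL + length TL \<le> n"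
      "\<forall>x\<in>set NL. 0 < fst (snd x) \<longrightarrow> snd x \<in> C" "real (2 * n + 4) * \<beta> < NT p D g0 q0 NL TL ^ (2 * n + 4)"
    show "\<exists>q0' NL' TL'. ST p D d G g0 q0' NL' TL' \<and> length NL' + length TL' \<le> 2 * n + 1 \<and>
        (\<forall>x\<in>set NL'. 0 < fst (snd x) \<and> snd x \<in> C) \<and>
        NT p D g0 q0 NL TL ^ (2 * n + 4) \<le> real (2 * n + 4) * NT p D g0 q0' NL' TL'"
    proof (cases "\<exists>x0\<in>set NL. fst (snd x0) = 0")
      case False
      show ?thesis
        by (intro exI[of _ q0] exI[of _ NL] exI[of _ TL] conjI power_self_bound NT_nonneg NT_le_1[of p D d G])
          (use * False cx_pos[OF *(1)] in auto)
    next
      case True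
      then obtain x0 where x0: "x0 \<in> set NL" "snd x0 = (0, snd (snd x0))" by (metis prod.collapse)
      from elim_step_loss[OF *(1-3) x0 _ *(5)] obtain q0' NL' TL' where
        s: "ST p D d G g0 q0' NL' TL'" "length NL' + length TL' \<le> 2 * n + 1"
        "\<forall>x\<in>set NL'. 0 < fst (snd x) \<and> snd x \<in> snd ` set NL"
        "NT p D g0 q0 NL TL ^ (2 * n + 4) \<le> real (2 * n + 4) * NT p D g0 q0' NL' TL'"
        by auto
      have "\<forall>x\<in>set NL'. 0 < fst (snd x) \<and> snd x \<in> C" using s(3) *(4) by force
      with s show ?thesis by blast
    qed
  qed simp
next
  case (Suc e)
  note IHe = Suc.IH
  \<comment> \<open>Induction on the number \<open>m\<close> of distinct leading vectors at level
    \<open>e + 1\<close>. A step at this level creates new elements below it, so the lower levels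
    are cleared again before each such step.\<close>
  have inner: "\<exists>K n'. 1 \<le> K \<and> (\<forall>p D \<beta> G g0 q0 NL TL C \<K>. cx p d G \<beta> \<longrightarrow> ST p D d G g0 q0 NL TL \<longrightarrow>
     length NL + length TL \<le> n \<longrightarrow> finite \<K> \<longrightarrow> card \<K> \<le> m \<longrightarrow>
     (\<forall>x\<in>set NL. (fst (snd x) = Suc e \<longrightarrow> snd (snd x) \<in> \<K>) \<and> (Suc e < fst (snd x) \<longrightarrow> snd x \<in> C)) \<longrightarrow>
     real K * \<beta> < NT p D g0 q0 NL TL ^ K \<longrightarrow>
     (\<exists>q0' NL' TL'. ST p D d G g0 q0' NL' TL' \<and> length NL' + length TL' \<le> n' \<and>
        (\<forall>x\<in>set NL'. Suc e < fst (snd x) \<and> snd x \<in> C) \<and>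
        NT p D g0 q0 NL TL ^ K \<le> real K * NT p D g0 q0' NL' TL'))" for m n
  proof (induction m arbitrary: n)
    case 0
    obtain K1 n1 where K1: "1 \<le> K1" and E1: "\<And>p D \<beta> G g0 q0 NL TL C. cx p d G \<beta> \<Longrightarrow> ST p D d G g0 q0 NL TL \<Longrightarrow>
     length NL + length TL \<le> n \<Longrightarrow> (\<forall>x\<in>set NL. e < fst (snd x) \<longrightarrow> snd x \<in> C) \<Longrightarrow>
     real K1 * \<beta> < NT p D g0 q0 NL TL ^ K1 \<Longrightarrow>
     (\<exists>q0' NL' TL'. ST p D d G g0 q0' NL' TL' \<and> length NL' + length TL' \<le> n1 \<and>
        (\<forall>x\<in>set NL'. e < fst (snd x) \<and> snd x \<in> C) \<and>
        NT p D g0 q0 NL TL ^ K1 \<le> real K1 * NT p D g0 q0' NL' TL')"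
      using Suc.IH[of n] by blast
    show ?case
    proof (rule exI[of _ K1], rule exI[of _ n1], intro conjI allI impI K1)
      fix p D \<beta> G g0 q0 NL TL and C :: "(nat \<times> vec) set" and \<K> :: "vec set"
      assume *: "cx p d G \<beta>" "ST p D d G g0 q0 NL TL" "length NL + length TL \<le> n" "finite \<K>" "card \<K> \<le> 0"
        "\<forall>x\<in>set NL. (fst (snd x) = Suc e \<longrightarrow> snd (snd x) \<in> \<K>) \<and> (Suc e < fst (snd x) \<longrightarrow> snd x \<in> C)"
        "real K1 * \<beta> < NT p D g0 q0 NL TL ^ K1"
      have "\<K> = {}" using *(4,5) by simp
      then have "\<forall>x\<in>set NL. e < fst (snd x) \<longrightarrow> snd x \<in> {y \<in> C. Suc e < fst y}"
        using *(6) by (metis (no_types, lifting) Suc_lessI empty_iff mem_Collect_eq)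
      from E1[OF *(1-3) this *(7)] show "\<exists>q0' NL' TL'. ST p D d G g0 q0' NL' TL' \<and> length NL' + length TL' \<le> n1 \<and>
        (\<forall>x\<in>set NL'. Suc e < fst (snd x) \<and> snd x \<in> C) \<and>
        NT p D g0 q0 NL TL ^ K1 \<le> real K1 * NT p D g0 q0' NL' TL'" by blast
    qed
  next
    case (Suc m)
    obtain K1 n1 where K1: "1 \<le> K1" and E1: "\<And>p D \<beta> G g0 q0 NL TL C. cx p d G \<beta> \<Longrightarrow> ST p D d G g0 q0 NL TL \<Longrightarrow>
     length NL + length TL \<le> n \<Longrightarrow> (\<forall>x\<in>set NL. e < fst (snd x) \<longrightarrow> snd x \<in> C) \<Longrightarrow>
     real K1 * \<beta> < NT p D g0 q0 NL TL ^ K1 \<Longrightarrow>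
     (\<exists>q0' NL' TL'. ST p D d G g0 q0' NL' TL' \<and> length NL' + length TL' \<le> n1 \<and>
        (\<forall>x\<in>set NL'. e < fst (snd x) \<and> snd x \<in> C) \<and>
        NT p D g0 q0 NL TL ^ K1 \<le> real K1 * NT p D g0 q0' NL' TL')"
      using IHe[of n] by blast
    obtain K3 n3 where K3: "1 \<le> K3" and E3: "\<And>p D \<beta> G g0 q0 NL TL C \<K>. cx p d G \<beta> \<Longrightarrow> ST p D d G g0 q0 NL TL \<Longrightarrow>
     length NL + length TL \<le> 2 * n1 + 1 \<Longrightarrow> finite \<K> \<Longrightarrow> card \<K> \<le> m \<Longrightarrow>
     (\<forall>x\<in>set NL. (fst (snd x) = Suc e \<longrightarrow> snd (snd x) \<in> \<K>) \<and> (Suc e < fst (snd x) \<longrightarrow> snd x \<in> C)) \<Longrightarrow>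
     real K3 * \<beta> < NT p D g0 q0 NL TL ^ K3 \<Longrightarrow>
     (\<exists>q0' NL' TL'. ST p D d G g0 q0' NL' TL' \<and> length NL' + length TL' \<le> n3 \<and>
        (\<forall>x\<in>set NL'. Suc e < fst (snd x) \<and> snd x \<in> C) \<and>
        NT p D g0 q0 NL TL ^ K3 \<le> real K3 * NT p D g0 q0' NL' TL')"
      using Suc.IH[of "2 * n1 + 1"] by blast
    define K2 where "K2 = 2 * n1 + 4"
    have K2: "1 \<le> K2" by (simp add: K2_def)
    define L where "L = cmp K2 K3"
    define M where "M = cmp K1 L"
    have L: "1 \<le> L" "K2 \<le> L" using cmp_ge[OF K2 K3] by (auto simp: L_def)
    have M: "1 \<le> M" "K1 \<le> M" using cmp_ge[OF K1 L(1)] by (auto simp: M_def)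
    show ?case
    proof (rule exI[of _ M], rule exI[of _ "n1 + n3"], intro conjI allI impI M(1))
      fix p D \<beta> G g0 q0 NL TL and C :: "(nat \<times> vec) set" and \<K> :: "vec set"
      assume *: "cx p d G \<beta>" "ST p D d G g0 q0 NL TL" "length NL + length TL \<le> n" "finite \<K>" "card \<K> \<le> Suc m"
        "\<forall>x\<in>set NL. (fst (snd x) = Suc e \<longrightarrow> snd (snd x) \<in> \<K>) \<and> (Suc e < fst (snd x) \<longrightarrow> snd x \<in> C)"
        "real M * \<beta> < NT p D g0 q0 NL TL ^ M"
      let ?\<delta> = "NT p D g0 q0 NL TL"
      have p: "p > 0" "0 \<le> \<beta>" using cx_pos[OF *(1)] by auto
      have \<delta>: "0 \<le> ?\<delta>" "?\<delta> \<le> 1" using NT_nonneg NT_le_1[OF p(1) *(2)] by auto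
      \<comment> \<open>The set protected while the levels up to \<open>e\<close> are cleared
        includes the labels of level \<open>e + 1\<close>.\<close>
      let ?C = "{y. (fst y = Suc e \<and> snd y \<in> \<K>) \<or> (Suc e < fst y \<and> y \<in> C)}"
      have "\<forall>x\<in>set NL. e < fst (snd x) \<longrightarrow> snd x \<in> ?C"
      proof (intro ballI impI)
        fix x assume x: "x \<in> set NL" "e < fst (snd x)"
        then show "snd x \<in> ?C" using bspec[OF *(6) x(1)] by (cases "fst (snd x) = Suc e") simp_all
      qed
      from E1[OF *(1-3) this loss_mono[OF \<delta> p(2) M(2) *(7)]] obtain q1 NL1 TL1 where
        s1: "ST p D d G g0 q1 NL1 TL1" "length NL1 + length TL1 \<le> n1" "\<forall>x\<in>set NL1. snd x \<in> ?C"
          "?\<delta> ^ K1 \<le> real K1 * NT p D g0 q1 NL1 TL1" by blast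
      let ?\<delta>1 = "NT p D g0 q1 NL1 TL1"
      have \<delta>1: "0 \<le> ?\<delta>1" "?\<delta>1 \<le> 1" using NT_nonneg NT_le_1[OF p(1) s1(1)] by auto
      show "\<exists>q0' NL' TL'. ST p D d G g0 q0' NL' TL' \<and> length NL' + length TL' \<le> n1 + n3 \<and>
        (\<forall>x\<in>set NL'. Suc e < fst (snd x) \<and> snd x \<in> C) \<and>
        ?\<delta> ^ M \<le> real M * NT p D g0 q0' NL' TL'"
      proof (cases "\<exists>x0\<in>set NL1. fst (snd x0) = Suc e")
        case False
        then have "\<forall>x\<in>set NL1. Suc e < fst (snd x) \<and> snd x \<in> C" using s1(3) by auto
        moreover have "?\<delta> ^ M \<le> real M * ?\<delta>1" by (rule gain_mono[OF \<delta> K1 M(2) s1(4)])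
        ultimately show ?thesis using s1(1,2) by (intro exI[of _ q1] exI[of _ NL1] exI[of _ TL1]) auto
      next
        case True
        then obtain x0 where x00: "x0 \<in> set NL1" and f0: "fst (snd x0) = Suc e" by blast
        have x0: "x0 \<in> set NL1" "snd x0 = (Suc e, snd (snd x0))" using x00 f0 by (simp_all add: prod_eq_iff)
        let ?\<kappa> = "snd (snd x0)"
        note c1 = loss_chain[OF \<delta> p(2) K1 L(1) _ *(7) s1(4)]
        have Lb: "real L * \<beta> < ?\<delta>1 ^ L" by (rule c1(1)) (simp add: M_def cmp_def)
        have lev: "\<And>x. x \<in> set NL1 \<Longrightarrow> Suc e \<le> fst (snd x)" using s1(3) by auto
        have K2b: "real (2 * n1 + 4) * \<beta> < ?\<delta>1 ^ (2 * n1 + 4)"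
          using loss_mono[OF \<delta>1 p(2) L(2) Lb] unfolding K2_def .
        from elim_step_loss[OF *(1) s1(1,2) x0 lev K2b] obtain q2 NL2 TL2 where
          s2: "ST p D d G g0 q2 NL2 TL2" "length NL2 + length TL2 \<le> 2 * n1 + 1"
          "\<forall>x\<in>set NL2. (Suc e < fst (snd x) \<and> snd x \<in> snd ` set NL1) \<or>
            (0 < Suc e \<and> fst (snd x) = Suc e \<and> (\<exists>x1\<in>set NL1. fst (snd x1) = Suc e \<and> snd (snd x1) \<noteq> ?\<kappa> \<and> snd (snd x) = snd (snd x1) - ?\<kappa>)) \<or>
            fst (snd x) < Suc e"
          "?\<delta>1 ^ K2 \<le> real K2 * NT p D g0 q2 NL2 TL2" unfolding K2_def by blast
        let ?\<delta>2 = "NT p D g0 q2 NL2 TL2"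
        \<comment> \<open>Elements with the pivot's vector have left the level and the others are
          translated, so one vector fewer remains.\<close>
        let ?K' = "(\<lambda>\<kappa>. \<kappa> - ?\<kappa>) ` (\<K> - {?\<kappa>})"
        have kin: "?\<kappa> \<in> \<K>" using bspec[OF s1(3) x00] f0 by auto
        have "card ?K' \<le> card (\<K> - {?\<kappa>})" by (rule card_image_le) (use *(4) in simp)
        also have "\<dots> \<le> m" using *(4,5) kin by (simp add: card_Diff_singleton)
        finally have cK: "card ?K' \<le> m" .
        have lab: "\<forall>x\<in>set NL2. (fst (snd x) = Suc e \<longrightarrow> snd (snd x) \<in> ?K') \<and> (Suc e < fst (snd x) \<longrightarrow> snd x \<in> C)"
        proof (intro ballI conjI impI)
          fix x assume x: "x \<in> set NL2" "fst (snd x) = Suc e"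
          then obtain x1 where "x1 \<in> set NL1" "fst (snd x1) = Suc e" "snd (snd x1) \<noteq> ?\<kappa>" "snd (snd x) = snd (snd x1) - ?\<kappa>"
            using s2(3) by fastforce
          moreover from this have "snd (snd x1) \<in> \<K>" using s1(3) by auto
          ultimately show "snd (snd x) \<in> ?K'" by auto
        next
          fix x assume x: "x \<in> set NL2" "Suc e < fst (snd x)"
          then obtain x1 where "x1 \<in> set NL1" "snd x = snd x1" using s2(3) by fastforce
          then show "snd x \<in> C" using s1(3) x(2) by auto
        qed
        note c2 = loss_chain[OF \<delta>1 p(2) K2 K3 _ Lb s2(4)]
        have K3b: "real K3 * \<beta> < ?\<delta>2 ^ K3" by (rule c2(1)) (simp add: L_def cmp_def)
        from E3[OF *(1) s2(1,2) _ cK lab K3b] *(4) obtain q3 NL3 TL3 where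
          s3: "ST p D d G g0 q3 NL3 TL3" "length NL3 + length TL3 \<le> n3"
            "\<forall>x\<in>set NL3. Suc e < fst (snd x) \<and> snd x \<in> C" "?\<delta>2 ^ K3 \<le> real K3 * NT p D g0 q3 NL3 TL3"
          by auto
        have "?\<delta>1 ^ L \<le> real L * NT p D g0 q3 NL3 TL3" by (rule c2(2)[OF _ s3(4)]) (simp add: L_def cmp_def)
        then have "?\<delta> ^ M \<le> real M * NT p D g0 q3 NL3 TL3" by (rule c1(2)[rotated]) (simp add: M_def cmp_def)
        then show ?thesis using s3 by (intro exI[of _ q3] exI[of _ NL3] exI[of _ TL3]) auto
      qed
    qed
  qed
  obtain K n' where K: "1 \<le> K" and I: "\<And>p D \<beta> G g0 q0 NL TL C \<K>. cx p d G \<beta> \<Longrightarrow> ST p D d G g0 q0 NL TL \<Longrightarrow>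
     length NL + length TL \<le> n \<Longrightarrow> finite \<K> \<Longrightarrow> card \<K> \<le> n \<Longrightarrow>
     (\<forall>x\<in>set NL. (fst (snd x) = Suc e \<longrightarrow> snd (snd x) \<in> \<K>) \<and> (Suc e < fst (snd x) \<longrightarrow> snd x \<in> C)) \<Longrightarrow>
     real K * \<beta> < NT p D g0 q0 NL TL ^ K \<Longrightarrow>
     (\<exists>q0' NL' TL'. ST p D d G g0 q0' NL' TL' \<and> length NL' + length TL' \<le> n' \<and>
        (\<forall>x\<in>set NL'. Suc e < fst (snd x) \<and> snd x \<in> C) \<and>
        NT p D g0 q0 NL TL ^ K \<le> real K * NT p D g0 q0' NL' TL')"
    using inner[of n n] by blast
  show ?case
  proof (rule exI[of _ K], rule exI[of _ n'], intro conjI allI impI K)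
    fix p D \<beta> G g0 q0 NL TL and C :: "(nat \<times> vec) set"
    assume *: "cx p d G \<beta>" "ST p D d G g0 q0 NL TL" "length NL + length TL \<le> n"
      "\<forall>x\<in>set NL. Suc e < fst (snd x) \<longrightarrow> snd x \<in> C" "real K * \<beta> < NT p D g0 q0 NL TL ^ K"
    \<comment> \<open>A list of at most \<open>n\<close> elements has at most \<open>n\<close>
      leading vectors, which bounds the inner induction uniformly in the family.\<close>
    have "card ((\<lambda>x. snd (snd x)) ` set NL) \<le> n"
      using card_image_le[of "set NL" "\<lambda>x. snd (snd x)"] card_length[of NL] *(3) by simp
    from I[OF *(1-3) _ this _ *(5)] *(4) show "\<exists>q0' NL' TL'. ST p D d G g0 q0' NL' TL' \<and> length NL' + length TL' \<le> n' \<and>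
        (\<forall>x\<in>set NL'. Suc e < fst (snd x) \<and> snd x \<in> C) \<and>
        NT p D g0 q0 NL TL ^ K \<le> real K * NT p D g0 q0' NL' TL'" by simp
  qed
qed

subsection \<open>Box norm control along polynomial curves\<close>

lemma bx_Cons_diff_neg:
  assumes p: "prime p" and f: "B1 p D f"
  shows "bx p D (u # us) f = EY p (\<lambda>h. bx p D us (\<lambda>x. f x * cnj (f (x + sm (- h) u))))"
proof -
  have "\<not> int p dvd - 1" using p prime_gt_1_nat[OF p] by (simp add: zdvd1_eq)
  from bx_scale[OF p this f, of u us] bx_Cons_diff[OF prime_gt_0_nat[OF p] f, of "sm (- 1) u" us]
  show ?thesis by (simp add: sm_sm)
qed

lemma bx_pad_replicate:
  assumes p: "p > 0" and f: "B1 p D f" and us: "us \<noteq> []"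
  shows "bx p D us f ^ (2 ^ m) \<le> bx p D (replicate m u @ us) f"
proof (induction m)
  case (Suc m)
  have "bx p D us f ^ (2 ^ Suc m) = (bx p D us f ^ (2 ^ m))\<^sup>2" by (simp add: power_mult[symmetric] mult.commute)
  also have "\<dots> \<le> (bx p D (replicate m u @ us) f)\<^sup>2"
    by (rule power_mono[OF Suc]) (use bx_nonneg[OF p f us] in simp)
  also have "\<dots> \<le> bx p D (replicate (Suc m) u @ us) f" using bx_pad[OF p f] by simp
  finally show ?case .
qed simp

definition LinL :: "nat \<Rightarrow> nat \<Rightarrow> (vec \<Rightarrow> complex) \<Rightarrow> ((vec \<Rightarrow> complex) \<times> vec) list \<Rightarrow> complex" where
  "LinL p D g0 L = EV p D (\<lambda>x. EY p (\<lambda>y. g0 x * (\<Prod>z\<leftarrow>L. fst z (x + sm y (snd z)))))"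

lemma qp_linear: "qp p D (\<lambda>y. sm y \<kappa>)"
  unfolding qp_def by (intro allI impI cg_sm cg_refl)

lemma qp_zero: "qp p D (\<lambda>y. 0)"
  by (simp add: qp_def)

lemma prod_list_mult_distrib: "(\<Prod>z\<leftarrow>L. f z * g z) = (\<Prod>z\<leftarrow>L. f z) * (\<Prod>z\<leftarrow>L. (g z :: complex))"
  by (induction L) (simp_all add: ac_simps)

text \<open>Each differencing uses one linear curve as pivot and differentiates \<open>g0\<close> in
  its direction. The final direction \<open>u\<close> is only there to bound the mean that is left
  at the end by a nonnegative box norm.\<close>

lemma linear_box:
  assumes p: "prime p"
  shows "B1 p D g0 \<Longrightarrow> (\<And>z. z \<in> set L \<Longrightarrow> B1 p D (fst z)) \<Longrightarrow>
    cmod (LinL p D g0 L) ^ (2 ^ Suc (length L)) \<le> bx p D (map snd L @ [u]) g0"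
proof (induction "length L" arbitrary: L g0)
  case 0
  have p0: "p > 0" using p prime_gt_0_nat by blast
  have "LinL p D g0 L = EV p D g0" using 0 p0 by (simp add: LinL_def avg_const Fp_nonempty)
  then show ?case using square_mean_le_bx1[OF p0 0(2), of u] 0(1) by simp
next
  case (Suc n)
  have p0: "p > 0" using p prime_gt_0_nat by blast
  obtain z0 L' where L: "L = z0 # L'" using Suc.hyps(2) by (cases L) auto
  define \<kappa> where "\<kappa> = snd z0"
  have B': "B1 p D (fst z)" if "z \<in> set L'" for z using Suc.prems(2)[of z] that L by simp
  let ?a = "\<lambda>y. sm y \<kappa>"
  let ?K = "[(fst z0, \<lambda>y. sm y \<kappa>)]"
  let ?R = "(g0, \<lambda>y. 0) # map (\<lambda>z. (fst z, \<lambda>y. sm y (snd z))) L'"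
  define gh where "gh h x = g0 x * cnj (g0 (x + sm (- h) \<kappa>))" for h x
  define Lh where "Lh h = map (\<lambda>z. (\<lambda>x. fst z x * cnj (fst z (x + sm h (snd z - \<kappa>))), snd z)) L'" for h
  have adm: "adm p D z" if "z \<in> set (?K @ ?R)" for z
  proof -
    have "z = (fst z0, \<lambda>y. sm y \<kappa>) \<or> z = (g0, \<lambda>y. 0) \<or> (\<exists>z1\<in>set L'. z = (fst z1, \<lambda>y. sm y (snd z1)))"
      using that by auto
    then show ?thesis
      using Suc.prems(1) Suc.prems(2)[of z0] B' L by (auto simp: adm_def qp_linear qp_zero)
  qed
  have eqL: "LinL p D g0 L = LamL p D (?K @ ?R)"
    by (simp add: LinL_def LamL_def L comp_def \<kappa>_def mult.left_commute)
  have "(cmod (LinL p D g0 L))\<^sup>2 \<le> EY p (\<lambda>h. cmod (LamL p D (map (sub ?a) ?R @ map (subs ?a h) ?R)))"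
    unfolding eqL by (rule van_der_Corput[OF p0 adm qp_linear]) (auto simp: cg_def)
  also have "\<dots> = EY p (\<lambda>h. cmod (LinL p D (gh h) (Lh h)))"
  proof (intro avg_cong arg_cong[where f = cmod])
    fix h
    let ?M = "map (sub ?a) ?R @ map (subs ?a h) ?R"
    have aR: "adm p D z" if zM: "z \<in> set ?M" for z
    proof -
      obtain z1 where "z1 \<in> set ?R" "z = sub ?a z1 \<or> z = subs ?a h z1"
        using zM unfolding set_append set_map by blast
      then show ?thesis using adm_sub[OF adm qp_linear, of z1] adm_subs[OF adm qp_linear, of z1] by auto
    qed
    \<comment> \<open>Adding the pivot back makes \<open>g0\<close> stationary again. The two copies
      of every other function then move in parallel and merge into one, so the list is shorter by
      one and keeps its directions.\<close>
    have "LamL p D ?M = LamL p D (map (sub (\<lambda>y. - sm y \<kappa>)) ?M)" by (rule LamL_sub[OF p0 aR, symmetric])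
    also have "\<dots> = LinL p D (gh h) (Lh h)"
      by (simp add: LamL_def LinL_def comp_def sub_def subs_def gh_def Lh_def prod_list_mult_distrib
          sm_add_left sm_diff_right sm_minus_left algebra_simps)
    finally show "LamL p D ?M = LinL p D (gh h) (Lh h)" .
  qed
  finally have 1: "(cmod (LinL p D g0 L))\<^sup>2 \<le> EY p (\<lambda>h. cmod (LinL p D (gh h) (Lh h)))" .
  let ?n = "2 ^ Suc n :: nat"
  have "cmod (LinL p D g0 L) ^ (2 ^ Suc (length L)) = ((cmod (LinL p D g0 L))\<^sup>2) ^ ?n"
    using Suc.hyps(2) by (simp add: power_mult[symmetric])
  also have "\<dots> \<le> (EY p (\<lambda>h. cmod (LinL p D (gh h) (Lh h)))) ^ ?n" by (rule power_mono[OF 1]) simp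
  also have "\<dots> \<le> EY p (\<lambda>h. cmod (LinL p D (gh h) (Lh h)) ^ ?n)"
    by (rule avg_power_le) (use Fp_nonempty[OF p0] in auto)
  also have "\<dots> \<le> EY p (\<lambda>h. bx p D (map snd L' @ [u]) (gh h))"
  proof (rule avg_mono)
    fix h
    have len: "n = length (Lh h)" using Suc.hyps(2) L by (simp add: Lh_def)
    have "B1 p D (gh h)" unfolding gh_def using Suc.prems(1) by (intro B1_mult B1_cnj B1_shift)
    moreover have "B1 p D (fst z)" if zM: "z \<in> set (Lh h)" for z
    proof -
      obtain z1 where z1: "z1 \<in> set L'" "fst z = (\<lambda>x. fst z1 x * cnj (fst z1 (x + sm h (snd z1 - \<kappa>))))"
        using zM by (auto simp: Lh_def)
      show ?thesis unfolding z1(2) by (intro B1_mult B1_cnj B1_shift B'[OF z1(1)])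
    qed
    ultimately have "cmod (LinL p D (gh h) (Lh h)) ^ (2 ^ Suc (length (Lh h))) \<le> bx p D (map snd (Lh h) @ [u]) (gh h)"
      by (rule Suc.hyps(1)[OF len])
    moreover have "map snd (Lh h) = map snd L'" by (simp add: Lh_def comp_def)
    ultimately show "cmod (LinL p D (gh h) (Lh h)) ^ ?n \<le> bx p D (map snd L' @ [u]) (gh h)"
      using len by simp
  qed
  also have "\<dots> = bx p D (map snd L @ [u]) g0"
    using bx_Cons_diff_neg[OF p Suc.prems(1), of \<kappa> "map snd L' @ [u]"] by (simp add: L \<kappa>_def gh_def[abs_def])
  finally show ?case .
qed

lemma LT_1_linear:
  assumes "LT p D 1 \<nu> q"
  shows "\<exists>c. \<forall>y. cg p D (q y) (c + sm y \<nu>)"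
proof -
  obtain R where R: "\<And>j y. j < D \<Longrightarrow> [q y j = poly (R j) y] (mod int p)" "\<And>j. j < D \<Longrightarrow> degree (R j) \<le> 1"
    "\<And>j. j < D \<Longrightarrow> coeff (R j) 1 = \<nu> j" using LT_E[OF assms(1)] by blast
  have "[q y j = ((\<lambda>j. coeff (R j) 0) + sm y \<nu>) j] (mod int p)" if j: "j < D" for y j
  proof -
    obtain a S where RS: "R j = pCons a S" by (cases "R j")
    have "degree S = 0" using R(2)[OF j] RS by (auto split: if_splits)
    then obtain s where S: "S = [:s:]" by (rule degree_eq_zeroE)
    have "poly (R j) y = coeff (R j) 0 + y * \<nu> j" using R(3)[OF j] by (simp add: RS S)
    then show ?thesis using R(1)[OF j, of y] by (simp add: sm_def)
  qed
  then show ?thesis unfolding cg_def by blast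
qed

text \<open>Induction on the distance \<open>d\<close> from the tracked curve. The curves at full
  distance are labelled and eliminated completely, which leaves a family of distance
  \<open>d - 1\<close>; at distance one all curves are linear relative to the tracked one.\<close>

lemma polynomial_box_control:
  "1 \<le> d \<Longrightarrow> \<exists>K N. 1 \<le> K \<and> (\<forall>p D \<beta> G g0 q0 L u0. prime p \<longrightarrow> d < p \<longrightarrow> gd p G \<longrightarrow> 1 / real p \<le> \<beta> \<longrightarrow>
     u0 \<in> G \<longrightarrow> adm p D (g0, q0) \<longrightarrow> (\<forall>z\<in>set L. adm p D z \<and> rc p D d G q0 z) \<longrightarrow> length L \<le> n \<longrightarrow>
     real K * \<beta> < cmod (LamL p D ((g0, q0) # L)) ^ K \<longrightarrow>
     (\<exists>us. length us = Suc N \<and> set us \<subseteq> G \<and> cmod (LamL p D ((g0, q0) # L)) ^ K \<le> real K * bx p D us g0))"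
proof (induction d arbitrary: n rule: nat_induct_at_least)
  case base
  let ?K = "2 ^ Suc n :: nat"
  show ?case
  proof (rule exI[of _ ?K], rule exI[of _ n], intro conjI allI impI)
    fix p D \<beta> G g0 q0 L u0
    assume p: "prime p" and "1 < p" and G: "gd p G" and "1 / real p \<le> \<beta>" and u0: "u0 \<in> G"
      and adm0: "adm p D (g0, q0)" and L: "\<forall>z\<in>set L. adm p D z \<and> rc p D 1 G q0 z" and len: "length L \<le> n"
    have p0: "p > 0" using p prime_gt_0_nat by blast
    have "\<forall>z\<in>set L. \<exists>y. fst y \<in> G \<and> (\<forall>t. cg p D (snd z t - q0 t) (snd y + sm t (fst y)))"
    proof
      fix z assume "z \<in> set L"
      then obtain e \<nu> where "1 \<le> e" "e \<le> 1" "\<nu> \<in> G" "LT p D e \<nu> (\<lambda>y. q0 y - snd z y)" using L unfolding rc_def by blast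
      then have nu: "\<nu> \<in> G" "LT p D 1 (sm (- 1) \<nu>) (\<lambda>y. sm (- 1) (q0 y - snd z y))" using LT_sm[of p D 1 \<nu> _ "- 1"] by auto
      from LT_1_linear[OF this(2)] obtain c where c: "\<forall>t. cg p D (snd z t - q0 t) (c + sm t (sm (- 1) \<nu>))"
        by (auto simp: sm_minus_left)
      have "\<not> int p dvd - 1" using p prime_gt_1_nat[OF p] by (simp add: zdvd1_eq)
      then have "sm (- 1) \<nu> \<in> G" using G nu(1) unfolding gd_def by blast
      then show "\<exists>y. fst y \<in> G \<and> (\<forall>t. cg p D (snd z t - q0 t) (snd y + sm t (fst y)))"
        using c by (intro exI[of _ "(sm (- 1) \<nu>, c)"]) simp
    qed
    from bchoice[OF this] obtain k where k: "\<forall>z\<in>set L. fst (k z) \<in> G \<and> (\<forall>t. cg p D (snd z t - q0 t) (snd (k z) + sm t (fst (k z))))"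
      by blast
    define L' where "L' = map (\<lambda>z. (\<lambda>x. fst z (x + snd (k z)), fst (k z))) L"
    have admL: "adm p D z" if "z \<in> set ((g0, q0) # L)" for z
    proof -
      from that have "z = (g0, q0) \<or> z \<in> set L" by simp
      then show ?thesis using adm0 L by blast
    qed
    have "LamL p D ((g0, q0) # L) = LamL p D (map (sub q0) ((g0, q0) # L))" by (rule LamL_sub[OF p0 admL, symmetric])
    also have "\<dots> = LinL p D g0 L'"
      unfolding LamL_def LinL_def L'_def list.map map_map comp_def prod_list.Cons
    proof (intro avg_cong arg_cong2[of _ _ _ _ "(*)"])
      fix x y
      show "fst (sub q0 (g0, q0)) (x + snd (sub q0 (g0, q0)) y) = g0 x" by (simp add: sub_def)
      show "(\<Prod>z\<leftarrow>L. fst (sub q0 z) (x + snd (sub q0 z) y)) =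
        (\<Prod>z\<leftarrow>L. fst (\<lambda>x. fst z (x + snd (k z)), fst (k z)) (x + sm y (snd (\<lambda>x. fst z (x + snd (k z)), fst (k z)))))"
      proof (rule prod_list_cong)
        fix z assume z: "z \<in> set L"
        have "fst z (x + (snd z y - q0 y)) = fst z (x + (snd (k z) + sm y (fst (k z))))"
          by (rule adm_eq[of p D]) (use L k z in auto)
        then show "fst (sub q0 z) (x + snd (sub q0 z) y) = fst (\<lambda>x. fst z (x + snd (k z)), fst (k z)) (x + sm y (snd (\<lambda>x. fst z (x + snd (k z)), fst (k z))))"
          by (simp add: sub_def ac_simps)
      qed
    qed
    finally have eq: "LamL p D ((g0, q0) # L) = LinL p D g0 L'" .
    let ?\<delta> = "cmod (LamL p D ((g0, q0) # L))"
    let ?vs = "map snd L' @ [u0]"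
    \<comment> \<open>The number of directions must not depend on the family, so the list is padded
      to length \<open>n + 1\<close>; \<open>u0\<close> is any element of \<open>G\<close>.\<close>
    let ?us = "replicate (n - length L) u0 @ ?vs"
    have B0: "B1 p D g0" using adm0 by (simp add: adm_def)
    have BL: "B1 p D (fst z)" if "z \<in> set L'" for z
    proof -
      have "z \<in> (\<lambda>z. (\<lambda>x. fst z (x + snd (k z)), fst (k z))) ` set L" using that unfolding L'_def set_map .
      then obtain z1 where z1: "z1 \<in> set L" and "z = (\<lambda>x. fst z1 (x + snd (k z1)), fst (k z1))" by (rule imageE)
      then have z2: "fst z = (\<lambda>x. fst z1 (x + snd (k z1)))" by simp
      have "B1 p D (fst z1)" using bspec[OF L z1] by (simp add: adm_def)
      then show ?thesis unfolding z2 by (rule B1_shift)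
    qed
    have lL: "length L' = length L" by (simp add: L'_def)
    have "?\<delta> ^ ?K = (?\<delta> ^ (2 ^ Suc (length L'))) ^ (2 ^ (n - length L))"
      unfolding power_mult[symmetric] power_add[symmetric] using len lL by simp
    also have "\<dots> \<le> (bx p D ?vs g0) ^ (2 ^ (n - length L))"
      unfolding eq by (rule power_mono[OF linear_box[OF p B0 BL]]) simp_all
    also have "\<dots> \<le> bx p D ?us g0" by (rule bx_pad_replicate[OF p0 B0]) simp
    also have "\<dots> \<le> real ?K * bx p D ?us g0"
    proof -
      have "(1::real) \<le> 2 ^ Suc n" by (rule one_le_power) simp
      then have "1 \<le> real ?K" by simp
      from mult_right_mono[OF this] show ?thesis using bx_nonneg[OF p0 B0, of ?us] by simp
    qed
    finally have "?\<delta> ^ ?K \<le> real ?K * bx p D ?us g0" .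
    moreover have "set ?us \<subseteq> G" using u0 k by (auto simp: L'_def)
    moreover have "length ?us = Suc n" using len lL by simp
    ultimately show "\<exists>us. length us = Suc n \<and> set us \<subseteq> G \<and> ?\<delta> ^ ?K \<le> real ?K * bx p D us g0" by blast
  qed simp
next
  case (Suc d)
  obtain K1 n1 where K1: "1 \<le> K1" and E1: "\<And>p D \<beta> G g0 q0 NL TL C. cx p (Suc d) G \<beta> \<Longrightarrow> ST p D (Suc d) G g0 q0 NL TL \<Longrightarrow>
     length NL + length TL \<le> n \<Longrightarrow> (\<forall>x\<in>set NL. Suc d < fst (snd x) \<longrightarrow> snd x \<in> C) \<Longrightarrow>
     real K1 * \<beta> < NT p D g0 q0 NL TL ^ K1 \<Longrightarrow>
     (\<exists>q0' NL' TL'. ST p D (Suc d) G g0 q0' NL' TL' \<and> length NL' + length TL' \<le> n1 \<and>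
        (\<forall>x\<in>set NL'. Suc d < fst (snd x) \<and> snd x \<in> C) \<and>
        NT p D g0 q0 NL TL ^ K1 \<le> real K1 * NT p D g0 q0' NL' TL')"
    using elim_levels[of "Suc d" n "Suc d"] by blast
  obtain K2 N where K2: "1 \<le> K2" and E2: "\<And>p D \<beta> G g0 q0 L u0. prime p \<Longrightarrow> d < p \<Longrightarrow> gd p G \<Longrightarrow> 1 / real p \<le> \<beta> \<Longrightarrow>
     u0 \<in> G \<Longrightarrow> adm p D (g0, q0) \<Longrightarrow> (\<forall>z\<in>set L. adm p D z \<and> rc p D d G q0 z) \<Longrightarrow> length L \<le> n1 \<Longrightarrow>
     real K2 * \<beta> < cmod (LamL p D ((g0, q0) # L)) ^ K2 \<Longrightarrow>
     (\<exists>us. length us = Suc N \<and> set us \<subseteq> G \<and> cmod (LamL p D ((g0, q0) # L)) ^ K2 \<le> real K2 * bx p D us g0)"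
    using Suc.IH[of n1] by blast
  define M where "M = cmp K1 K2"
  have M: "1 \<le> M" "K1 \<le> M" using cmp_ge[OF K1 K2] by (auto simp: M_def)
  show ?case
  proof (rule exI[of _ M], rule exI[of _ N], intro conjI allI impI M(1))
    fix p D \<beta> G g0 q0 L u0
    assume p: "prime p" and dp: "Suc d < p" and G: "gd p G" and beta: "1 / real p \<le> \<beta>" and u0: "u0 \<in> G"
      and adm0: "adm p D (g0, q0)" and L: "\<forall>z\<in>set L. adm p D z \<and> rc p D (Suc d) G q0 z" and len: "length L \<le> n"
      and big: "real M * \<beta> < cmod (LamL p D ((g0, q0) # L)) ^ M"
    have p0: "p > 0" using p prime_gt_0_nat by blast
    have b0: "0 \<le> \<beta>" using beta order_trans[of 0 "1 / real p"] by simp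
    have cx: "cx p (Suc d) G \<beta>" using p dp G beta Suc.hyps by (simp add: cx_def)
    define A where "A z \<longleftrightarrow> (\<exists>\<nu>\<in>G. LT p D (Suc d) \<nu> (\<lambda>y. q0 y - snd z y))" for z :: elt
    \<comment> \<open>The labels are taken after subtracting \<open>q0\<close>, so they carry the
      negative of the vector that relates the curve to the tracked one.\<close>
    define \<kappa> where "\<kappa> z = sm (- 1) (SOME \<nu>. \<nu> \<in> G \<and> LT p D (Suc d) \<nu> (\<lambda>y. q0 y - snd z y))" for z :: elt
    define NL where "NL = map (\<lambda>z. (sub q0 z, (Suc d, \<kappa> z))) (filter A L)"
    define TL where "TL = map (sub q0) (filter (\<lambda>z. \<not> A z) L)"
    have q0p: "qp p D q0" using adm0 by (simp add: adm_def)
    have ST: "ST p D (Suc d) G g0 (\<lambda>y. 0) NL TL"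
      unfolding ST_def
    proof (intro conjI ballI)
      show "adm p D (g0, \<lambda>y. 0)" using adm0 by (simp add: adm_def qp_zero)
      fix x assume "x \<in> set NL"
      then obtain z where z: "z \<in> set L" "A z" "x = (sub q0 z, (Suc d, \<kappa> z))" by (auto simp: NL_def)
      show "adm p D (fst x)" using adm_sub[OF _ q0p, of z] L z by simp
      have "\<exists>\<nu>. \<nu> \<in> G \<and> LT p D (Suc d) \<nu> (\<lambda>y. q0 y - snd z y)" using z(2) unfolding A_def by blast
      from someI_ex[OF this] obtain \<nu> where nu: "\<nu> \<in> G" "LT p D (Suc d) \<nu> (\<lambda>y. q0 y - snd z y)" "\<kappa> z = sm (- 1) \<nu>"
        unfolding \<kappa>_def by blast
      have "LT p D (Suc d) (\<kappa> z) (\<lambda>y. sm (- 1) (q0 y - snd z y))" unfolding nu(3) by (rule LT_sm[OF nu(2)])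
      then have "LT p D (Suc d) (\<kappa> z) (\<lambda>y. snd z y - q0 y)" by (simp add: sm_minus_left)
      then show "nel p D (Suc d) G (\<lambda>y. 0) x"
        unfolding nel_def using nu(1,2) by (auto simp: z(3) sub_def)
    next
      fix x assume "x \<in> set TL"
      then obtain z where z: "z \<in> set L" "\<not> A z" "x = sub q0 z" by (auto simp: TL_def)
      show "adm p D x" using adm_sub[OF _ q0p, of z] L z by simp
      obtain e \<nu> where e: "1 \<le> e" "e \<le> Suc d" "\<nu> \<in> G" "LT p D e \<nu> (\<lambda>y. q0 y - snd z y)"
        using L z(1) unfolding rc_def by blast
      have "e \<noteq> Suc d" using z(2) e unfolding A_def by blast
      then show "rc p D (Suc d - 1) G (\<lambda>y. 0) x"
        unfolding rc_def using e by (intro exI[of _ e] exI[of _ \<nu>]) (auto simp: z(3) sub_def)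
    qed
    have admL: "adm p D z" if "z \<in> set ((g0, q0) # L)" for z
    proof -
      from that have "z = (g0, q0) \<or> z \<in> set L" by simp
      then show ?thesis using adm0 L by blast
    qed
    have "LamL p D ((g0, q0) # L) = LamL p D (map (sub q0) ((g0, q0) # L))" by (rule LamL_sub[OF p0 admL, symmetric])
    also have "\<dots> = LamL p D ((g0, \<lambda>y. 0) # map fst NL @ TL)"
    proof (rule LamL_mset)
      have "mset L = mset (filter A L) + mset (filter (\<lambda>z. \<not> A z) L)" unfolding mset_filter by (rule multiset_partition)
      from arg_cong[OF this, of "image_mset (sub q0)"]
      have "image_mset (sub q0) (mset L) = mset (map (sub q0) (filter A L)) + mset TL"
        unfolding TL_def mset_map image_mset_union .
      moreover have "map fst NL = map (sub q0) (filter A L)" by (simp add: NL_def comp_def)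
      moreover have "sub q0 (g0, q0) = (g0, \<lambda>y. 0)" by (simp add: sub_def)
      ultimately show "mset (map (sub q0) ((g0, q0) # L)) = mset ((g0, \<lambda>y. 0) # map fst NL @ TL)" by simp
    qed
    finally have eq: "cmod (LamL p D ((g0, q0) # L)) = NT p D g0 (\<lambda>y. 0) NL TL" by (simp add: NT_def)
    let ?\<delta> = "NT p D g0 (\<lambda>y. 0) NL TL"
    have \<delta>: "0 \<le> ?\<delta>" "?\<delta> \<le> 1" using NT_nonneg NT_le_1[OF p0 ST] by auto
    have big': "real M * \<beta> < ?\<delta> ^ M" using big eq by simp
    have "length NL + length TL \<le> n" using len sum_length_filter_compl[of A L] by (simp add: NL_def TL_def)
    \<comment> \<open>No label lies above level \<open>d + 1\<close>, so the protected set may be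
      empty and the elimination leaves no labelled element at all.\<close>
    moreover have "\<forall>x\<in>set NL. Suc d < fst (snd x) \<longrightarrow> snd x \<in> {}" by (auto simp: NL_def)
    ultimately obtain q1 NL1 TL1 where s: "ST p D (Suc d) G g0 q1 NL1 TL1" "length NL1 + length TL1 \<le> n1"
      "\<forall>x\<in>set NL1. Suc d < fst (snd x) \<and> snd x \<in> {}" "?\<delta> ^ K1 \<le> real K1 * NT p D g0 q1 NL1 TL1"
      using E1[OF cx ST _ _ loss_mono[OF \<delta> b0 M(2) big'], of "{}"] by blast
    have "NL1 = []" using s(3) by (cases NL1) auto
    then have s1: "adm p D (g0, q1)" "\<forall>z\<in>set TL1. adm p D z \<and> rc p D d G q1 z" "length TL1 \<le> n1"
      "?\<delta> ^ K1 \<le> real K1 * cmod (LamL p D ((g0, q1) # TL1))" using s by (auto simp: ST_def NT_def)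
    note c = loss_chain[OF \<delta> b0 K1 K2 _ big' s1(4)]
    have "real K2 * \<beta> < cmod (LamL p D ((g0, q1) # TL1)) ^ K2" by (rule c(1)) (simp add: M_def cmp_def)
    from E2[OF p _ G beta u0 s1(1-3) this] dp obtain us where us: "length us = Suc N" "set us \<subseteq> G"
      "cmod (LamL p D ((g0, q1) # TL1)) ^ K2 \<le> real K2 * bx p D us g0" by auto
    have "?\<delta> ^ M \<le> real M * bx p D us g0" by (rule c(2)[OF _ us(3)]) (simp add: M_def cmp_def)
    then show "\<exists>us. length us = Suc N \<and> set us \<subseteq> G \<and> cmod (LamL p D ((g0, q0) # L)) ^ M \<le> real M * bx p D us g0"
      using us(1,2) eq by auto
  qed
qed

section \<open>Averages twisted by polynomial phases that depend on x\<close>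

definition PHS :: "nat \<Rightarrow> nat \<Rightarrow> (vec \<Rightarrow> complex) \<Rightarrow> (vec \<Rightarrow> int poly) \<Rightarrow> elt list \<Rightarrow> real" where
  "PHS p D c Q L = cmod (EV p D (\<lambda>x. EY p (\<lambda>y. c x * (e_p p (poly (Q x) y) * (\<Prod>z\<leftarrow>L. fst z (x + snd z y))))))"

lemma PHS_le_1:
  assumes "p > 0" "\<And>x. cmod (c x) \<le> 1" "\<And>z. z \<in> set L \<Longrightarrow> adm p D z"
  shows "PHS p D c Q L \<le> 1"
proof -
  have "cmod (c x * (e_p p (poly (Q x) y) * (\<Prod>z\<leftarrow>L. fst z (x + snd z y)))) \<le> 1" for x y
    unfolding norm_mult norm_e_p mult_1
    by (intro mult_le_one assms(2) norm_ge_zero prod_list_norm_le adm_norm[OF assms(3)])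
  then show ?thesis
    unfolding PHS_def
    by (intro norm_avg_le_const finite_Fp_vec finite_Fp Fp_nonempty Fp_vec_nonempty assms(1))
qed

text \<open>\<open>Q x\<close> depends arbitrarily on \<open>x\<close>, so \<open>x\<close> must not
  be translated and no curve can be subtracted. Squaring in \<open>y\<close> alone still differences
  the phase and lowers its degree, at the price of doubling the whole list of curves; it also
  removes \<open>c\<close>.\<close>

lemma PHS_step:
  assumes p: "p > 0" and c: "\<And>x. cmod (c x) \<le> 1" and adm: "\<And>z. z \<in> set L \<Longrightarrow> adm p D z"
    and Q': "\<And>h x y. poly (Q' h x) y = poly (Q x) y - poly (Q x) (y + h)"
  shows "(PHS p D c Q L)\<^sup>2 \<le> EY p (\<lambda>h. PHS p D (\<lambda>x. 1) (Q' h) (L @ map (subs (\<lambda>y. 0) h) L))"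
proof -
  define r where "r x y = e_p p (poly (Q x) y) * (\<Prod>z\<leftarrow>L. fst z (x + snd z y))" for x y
  have "PHS p D c Q L = cmod (EV p D (\<lambda>x. c x * EY p (r x)))"
    by (simp add: PHS_def r_def[abs_def] avg_cmult)
  then have "(PHS p D c Q L)\<^sup>2 \<le> EV p D (\<lambda>x. (cmod (EY p (r x)))\<^sup>2)"
    by (simp only:) (intro avg_CS_bounded finite_Fp_vec Fp_vec_nonempty[OF p] c)
  also have "\<dots> = Re (EV p D (\<lambda>x. complex_of_real ((cmod (EY p (r x)))\<^sup>2)))"
    by (simp add: avg_of_real del: of_real_power)
  also have "\<dots> = Re (EV p D (\<lambda>x. EY p (\<lambda>y. EY p (\<lambda>y'. r x y * cnj (r x y')))))"
    by (simp only: avg_square_expand)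
  also have "\<dots> = Re (EV p D (\<lambda>x. EY p (\<lambda>y. EY p (\<lambda>h. r x y * cnj (r x (y + h))))))"
  proof -
    have "yper p (\<lambda>y. r x y)" for x
      unfolding yper_def r_def
      by (intro allI impI arg_cong2[of _ _ _ _ "(*)"] e_p_cong[OF p] poly_cong prod_list_cong adm_eq[of p D] cg_refl
          qpD[OF adm_qp] adm)
    then have "yper p (\<lambda>y'. r x y * cnj (r x y'))" for x y
      using yper_mult[OF _ yper_cnj, of p "\<lambda>_. r x y" "r x"] by (simp add: yper_def)
    from EY_shift[OF p this] have "EY p (\<lambda>h. r x y * cnj (r x (h + y))) = EY p (\<lambda>y'. r x y * cnj (r x y'))" for x y .
    then have "EY p (\<lambda>h. r x y * cnj (r x (y + h))) = EY p (\<lambda>y'. r x y * cnj (r x y'))" for x y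
      by (simp only: add.commute[of y])
    then show ?thesis by (simp only:)
  qed
  also have "EV p D (\<lambda>x. EY p (\<lambda>y. EY p (\<lambda>h. r x y * cnj (r x (y + h)))))
      = EY p (\<lambda>h. EV p D (\<lambda>x. EY p (\<lambda>y. r x y * cnj (r x (y + h)))))"
    by (subst avg_swap[of "Fp p"]) (rule avg_swap)
  also have "Re \<dots> \<le> EY p (\<lambda>h. cmod (EV p D (\<lambda>x. EY p (\<lambda>y. r x y * cnj (r x (y + h))))))"
    using complex_Re_le_cmod norm_avg_le order_trans by blast
  also have "\<dots> = EY p (\<lambda>h. PHS p D (\<lambda>x. 1) (Q' h) (L @ map (subs (\<lambda>y. 0) h) L))"
    unfolding PHS_def
  proof (intro avg_cong arg_cong[where f = cmod])
    fix h x y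
    show "r x y * cnj (r x (y + h)) = 1 * (e_p p (poly (Q' h x) y) * (\<Prod>z\<leftarrow>L @ map (subs (\<lambda>y. 0) h) L. fst z (x + snd z y)))"
      by (simp add: r_def Q' e_p_diff subs_def comp_def prod_list_cnj ac_simps)
  qed
  finally show ?thesis .
qed

lemma poly_diff_shift_ex:
  fixes Q :: "int poly"
  assumes "degree Q \<le> N"
  shows "\<exists>Q'. (\<forall>y. poly Q' y = poly Q y - poly Q (y + h)) \<and> degree Q' \<le> N - 1 \<and> (N = 0 \<longrightarrow> Q' = 0)"
proof (cases N)
  case 0
  then have "degree Q = 0" using assms by simp
  then obtain c where "Q = [:c:]" by (rule degree_eq_zeroE)
  then show ?thesis using 0 by (intro exI[of _ 0]) simp
next
  case (Suc n)
  obtain R where R: "\<forall>y. poly R y = poly Q (y + h) - poly Q y" "degree R \<le> n"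
    using poly_shift_diff[of Q n h] assms Suc by blast
  then show ?thesis using Suc by (intro exI[of _ "- R"]) simp
qed

text \<open>Each differencing lowers the degree of the phase and merges the two copies of
  \<open>f\<close> into a derivative in direction \<open>u\<close>. When the phase is constant in
  \<open>y\<close> it is absorbed into \<open>c\<close>, and the last Cauchy--Schwarz gives one more
  direction.\<close>

lemma PHS_linear_box:
  assumes p: "prime p"
  shows "(\<And>x. cmod (c x) \<le> 1) \<Longrightarrow> (\<And>x. degree (Q x) \<le> N) \<Longrightarrow> B1 p D f \<Longrightarrow>
    PHS p D c Q [(f, \<lambda>y. sm y u)] ^ (2 ^ Suc N) \<le> bx p D (replicate (Suc N) u) f"
proof (induction N arbitrary: c Q f)
  case 0
  have p0: "p > 0" using p prime_gt_0_nat by blast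
  have const: "poly (Q x) y = poly (Q x) 0" for x y
  proof -
    have "degree (Q x) = 0" using 0(2)[of x] by simp
    then obtain c where "Q x = [:c:]" by (rule degree_eq_zeroE)
    then show ?thesis by simp
  qed
  have "PHS p D c Q [(f, \<lambda>y. sm y u)] = cmod (EV p D (\<lambda>x. (c x * e_p p (poly (Q x) 0)) * EY p (\<lambda>y. f (x + sm y u))))"
    unfolding PHS_def by (subst const) (simp add: avg_cmult[symmetric] mult.assoc)
  then have "(PHS p D c Q [(f, \<lambda>y. sm y u)])\<^sup>2 \<le> EV p D (\<lambda>x. (cmod (EY p (\<lambda>y. f (x + sm y u))))\<^sup>2)"
    by (simp only:) (intro avg_CS_bounded finite_Fp_vec Fp_vec_nonempty[OF p0], simp add: norm_mult 0)
  moreover have "bx p D (replicate (Suc 0) u) f = EV p D (\<lambda>x. (cmod (EY p (\<lambda>y. f (x + sm y u))))\<^sup>2)"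
    by (simp only: replicate.simps bx_eq_avg_norm[OF p0 B1_per[OF 0(3)]])
  moreover have "(2::nat) ^ Suc 0 = 2" by simp
  ultimately show ?case by (simp only:)
next
  case (Suc N)
  have p0: "p > 0" using p prime_gt_0_nat by blast
  have "\<forall>h. \<forall>x. \<exists>Q'. (\<forall>y. poly Q' y = poly (Q x) y - poly (Q x) (y + h)) \<and> degree Q' \<le> N"
    using poly_diff_shift_ex[OF Suc.prems(2)] by (metis diff_Suc_1)
  then obtain Q' where Q': "\<And>h x y. poly (Q' h x) y = poly (Q x) y - poly (Q x) (y + h)" "\<And>h x. degree (Q' h x) \<le> N"
    by metis
  define fh' where "fh' h x = f x * cnj (f (x + sm h u))" for h x
  have adm: "adm p D z" if "z \<in> set [(f, \<lambda>y. sm y u)]" for z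
    using that Suc.prems(3) by (simp add: adm_def qp_linear)
  let ?P = "\<lambda>h. PHS p D (\<lambda>x. 1) (Q' h) [(fh' h, \<lambda>y. sm y u)]"
  have "(PHS p D c Q [(f, \<lambda>y. sm y u)])\<^sup>2 \<le> EY p (\<lambda>h. PHS p D (\<lambda>x. 1) (Q' h) ([(f, \<lambda>y. sm y u)] @ map (subs (\<lambda>y. 0) h) [(f, \<lambda>y. sm y u)]))"
    by (rule PHS_step[OF p0 Suc.prems(1) adm Q'(1)])
  also have "\<dots> = EY p ?P"
    by (rule avg_cong) (simp add: PHS_def subs_def fh'_def sm_add_left add.assoc)
  finally have 1: "(PHS p D c Q [(f, \<lambda>y. sm y u)])\<^sup>2 \<le> EY p ?P" .
  have "PHS p D c Q [(f, \<lambda>y. sm y u)] ^ (2 ^ Suc (Suc N)) = ((PHS p D c Q [(f, \<lambda>y. sm y u)])\<^sup>2) ^ (2 ^ Suc N)"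
    by (simp add: power_mult[symmetric])
  also have "\<dots> \<le> (EY p ?P) ^ (2 ^ Suc N)" by (rule power_mono[OF 1]) simp
  also have "\<dots> \<le> EY p (\<lambda>h. ?P h ^ (2 ^ Suc N))"
    by (rule avg_power_le) (use Fp_nonempty[OF p0] in \<open>auto simp: PHS_def\<close>)
  also have "\<dots> \<le> EY p (\<lambda>h. bx p D (replicate (Suc N) u) (fh' h))"
  proof (rule avg_mono)
    fix h
    have "B1 p D (fh' h)" unfolding fh'_def by (intro B1_mult B1_cnj B1_shift Suc.prems(3))
    then show "?P h ^ (2 ^ Suc N) \<le> bx p D (replicate (Suc N) u) (fh' h)"
      by (intro Suc.IH Q'(2)) simp_all
  qed
  also have "\<dots> = bx p D (replicate (Suc (Suc N)) u) f"
    unfolding fh'_def[abs_def] replicate_Suc[of "Suc N"] by (rule bx_Cons_diff[OF p0 Suc.prems(3), symmetric])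
  finally show ?case .
qed

text \<open>\<open>N + 1\<close> differencings make the phase vanish and turn \<open>c\<close> into
  1. The tracked element stays first in the list with its curve unchanged; only the number of other
  curves grows.\<close>

lemma phase_elimination:
  "\<exists>K n'. 1 \<le> K \<and> (\<forall>p D \<beta> G g0 q0 L c Q \<nu>. cx p d G \<beta> \<longrightarrow> adm p D (g0, q0) \<longrightarrow>
     (\<forall>z\<in>set L. adm p D z \<and> rc p D d G q0 z) \<longrightarrow> length L \<le> n \<longrightarrow> \<nu> \<in> G \<longrightarrow> LT p D d \<nu> q0 \<longrightarrow>
     (\<forall>x. cmod (c x) \<le> 1) \<longrightarrow> (\<forall>x. degree (Q x) \<le> N) \<longrightarrow>
     real K * \<beta> < PHS p D c Q ((g0, q0) # L) ^ K \<longrightarrow>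
     (\<exists>L'. (\<forall>z\<in>set L'. adm p D z \<and> rc p D d G q0 z) \<and> length L' \<le> n' \<and>
        PHS p D c Q ((g0, q0) # L) ^ K \<le> real K * cmod (LamL p D ((g0, q0) # L'))))"
proof (induction N arbitrary: n)
  have step: "\<exists>h L'. (\<forall>z\<in>set L'. adm p D z \<and> rc p D d G q0 z) \<and> length L' \<le> 2 * n + 1 \<and>
      PHS p D c Q ((g0, q0) # L) ^ (2 * n + 4) \<le> real (2 * n + 4) * PHS p D (\<lambda>x. 1) (Q' h) ((g0, q0) # L')"
    if cx: "cx p d G \<beta>" and adm0: "adm p D (g0, q0)" and L: "\<forall>z\<in>set L. adm p D z \<and> rc p D d G q0 z" and len: "length L \<le> n"
      and nu: "\<nu> \<in> G" "LT p D d \<nu> q0" and c: "\<forall>x. cmod (c x) \<le> 1"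
      and Q': "\<And>h x y. poly (Q' h x) y = poly (Q x) y - poly (Q x) (y + h)"
      and big: "real (2 * n + 4) * \<beta> < PHS p D c Q ((g0, q0) # L) ^ (2 * n + 4)"
    for p D \<beta> G g0 q0 L c Q \<nu> n and Q' :: "int \<Rightarrow> vec \<Rightarrow> int poly"
  proof -
    have p: "prime p" "p > 0" and d: "2 \<le> d" "d < p" and G: "gd p G" and beta: "1 / real p \<le> \<beta>" "0 \<le> \<beta>"
      using cx cx_pos[OF cx] by (auto simp: cx_def)
    let ?R = "(g0, q0) # L"
    let ?\<delta> = "PHS p D c Q ?R" and ?K = "2 * n + 4"
    have admR: "adm p D z" if "z \<in> set ?R" for z
    proof -
      from that have "z = (g0, q0) \<or> z \<in> set L" by simp
      then show ?thesis using adm0 L by blast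
    qed
    have \<delta>: "0 \<le> ?\<delta>" by (simp add: PHS_def)
    have \<delta>1: "?\<delta> \<le> 1" by (rule PHS_le_1[OF p(2) spec[OF c] admR])
    note \<delta> = \<delta> \<delta>1
    have sq: "?\<delta> ^ ?K \<le> ?\<delta>\<^sup>2" by (rule power_antimono[OF \<delta>]) simp
    then have b: "real ?K * \<beta> < ?\<delta>\<^sup>2" using big by linarith
    define u where "u = real n * \<beta>"
    have u0: "0 \<le> u" using beta by (simp add: u_def)
    have b': "2 * u + 4 * \<beta> < ?\<delta>\<^sup>2" using b by (simp add: algebra_simps u_def)
    have e: "real (n + 1) * \<beta> = u + \<beta>" by (simp add: u_def algebra_simps)
    have big2: "real (n + 1) * \<beta> < ?\<delta>\<^sup>2" unfolding e using b' u0 beta(2) by linarith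
    let ?P = "\<lambda>h. PHS p D (\<lambda>x. 1) (Q' h) (?R @ map (subs (\<lambda>y. 0) h) ?R)"
    have vdc: "?\<delta>\<^sup>2 \<le> EY p ?P" by (rule PHS_step[OF p(2) _ admR Q']) (use c in auto)
    let ?bad = "\<lambda>h. \<exists>z\<in>set ?R. \<not> rc p D d G q0 (subs (\<lambda>y. 0) h z)"
    \<comment> \<open>The step is a differencing with pivot 0, so the distance of the pivot from the
      tracked curve is \<open>q0\<close> itself.\<close>
    have nu': "LT p D d \<nu> (\<lambda>y. q0 y - 0)" using nu(2) by simp
    have "card {h \<in> Fp p. ?bad h} \<le> length ?R"
    proof (rule card_bad_list)
      fix z assume "z \<in> set ?R"
      then consider "z = (g0, q0)" | "z \<in> set L" by (metis set_ConsD)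
      then show "card {h \<in> Fp p. \<not> rc p D d G q0 (subs (\<lambda>y. 0) h z)} \<le> 1"
      proof cases
        case 1
        then show ?thesis using rc_tracked[OF p(1) d G nu(1) nu', of d g0] by (simp only: diff_0_right)
      next
        case 2
        then have "rc p D d G q0 z" using L by blast
        from rc_step[OF p(1) d G nu(1) nu' this] show ?thesis by simp
      qed
    qed
    then have bad: "card {h \<in> Fp p. ?bad h} \<le> n + 1" using len by simp
    have admL': "adm p D z" if z: "z \<in> set (L @ map (subs (\<lambda>y. 0) h) ?R)" for z h
    proof -
      have "z \<in> set L \<or> (\<exists>z1\<in>set ?R. z = subs (\<lambda>y. 0) h z1)" using z unfolding set_append set_map by blast
      then show ?thesis using admR adm_subs[OF admR qp_zero] by (metis list.set_intros(2))
    qed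
    have P1: "?P h \<le> 1" for h
    proof (rule PHS_le_1[OF p(2)])
      fix z assume "z \<in> set (?R @ map (subs (\<lambda>y. 0) h) ?R)"
      then have "z = (g0, q0) \<or> z \<in> set (L @ map (subs (\<lambda>y. 0) h) ?R)" by auto
      then show "adm p D z" using adm0 admL' by blast
    qed simp
    from exists_good_shift[OF p(2) vdc _ P1 bad big2 beta(1)] obtain h where
      h: "\<not> ?bad h" "?\<delta>\<^sup>2 \<le> real (n + 1) * \<beta> + ?P h" by (auto simp: PHS_def)
    have "2 * u + 2 * \<beta> \<le> ?\<delta>\<^sup>2" using b' u0 beta(2) by linarith
    then have "?\<delta>\<^sup>2 \<le> 2 * ?P h" using h(2) unfolding e by linarith
    also have "\<dots> \<le> real ?K * ?P h" by (rule mult_right_mono) (auto simp: PHS_def)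
    finally have fin: "?\<delta> ^ ?K \<le> real ?K * ?P h" using sq by linarith
    show ?thesis
    proof (intro exI[of _ h] exI[of _ "L @ map (subs (\<lambda>y. 0) h) ?R"] conjI ballI)
      fix z assume z: "z \<in> set (L @ map (subs (\<lambda>y. 0) h) ?R)"
      then show "adm p D z" by (rule admL')
      have "z \<in> set L \<or> (\<exists>z1\<in>set ?R. z = subs (\<lambda>y. 0) h z1)" using z unfolding set_append set_map by blast
      then show "rc p D d G q0 z" using L h(1) by blast
    next
      show "length (L @ map (subs (\<lambda>y. 0) h) ?R) \<le> 2 * n + 1" using len by simp
      show "?\<delta> ^ ?K \<le> real ?K * PHS p D (\<lambda>x. 1) (Q' h) ((g0, q0) # L @ map (subs (\<lambda>y. 0) h) ?R)" using fin by simp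
    qed
  qed
  {
    case 0
    show ?case
    proof (rule exI[of _ "2 * n + 4"], rule exI[of _ "2 * n + 1"], intro conjI allI impI)
      fix p D \<beta> G g0 q0 L c \<nu> and Q :: "vec \<Rightarrow> int poly"
      assume *: "cx p d G \<beta>" "adm p D (g0, q0)" "\<forall>z\<in>set L. adm p D z \<and> rc p D d G q0 z" "length L \<le> n" "\<nu> \<in> G" "LT p D d \<nu> q0"
        "\<forall>x. cmod (c x) \<le> 1" "\<forall>x. degree (Q x) \<le> 0"
        "real (2 * n + 4) * \<beta> < PHS p D c Q ((g0, q0) # L) ^ (2 * n + 4)"
      have "\<And>h x y. poly 0 y = poly (Q x) y - poly (Q x) (y + h)"
      proof -
        fix h x y
        have "degree (Q x) = 0" using *(8) by simp
        then obtain c where "Q x = [:c:]" by (rule degree_eq_zeroE)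
        then show "poly 0 y = poly (Q x) y - poly (Q x) (y + h)" by simp
      qed
      from step[OF *(1-7), of "\<lambda>h x. 0", OF this *(9)]
      show "\<exists>L'. (\<forall>z\<in>set L'. adm p D z \<and> rc p D d G q0 z) \<and> length L' \<le> 2 * n + 1 \<and>
        PHS p D c Q ((g0, q0) # L) ^ (2 * n + 4) \<le> real (2 * n + 4) * cmod (LamL p D ((g0, q0) # L'))"
        by (simp add: PHS_def LamL_def)
    qed simp
  next
    case (Suc N)
    obtain K2 n2 where K2: "1 \<le> K2" and E2: "\<And>p D \<beta> G g0 q0 L c Q \<nu>. cx p d G \<beta> \<Longrightarrow> adm p D (g0, q0) \<Longrightarrow>
     (\<forall>z\<in>set L. adm p D z \<and> rc p D d G q0 z) \<Longrightarrow> length L \<le> 2 * n + 1 \<Longrightarrow> \<nu> \<in> G \<Longrightarrow> LT p D d \<nu> q0 \<Longrightarrow>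
     (\<forall>x. cmod (c x) \<le> 1) \<Longrightarrow> (\<forall>x. degree (Q x) \<le> N) \<Longrightarrow>
     real K2 * \<beta> < PHS p D c Q ((g0, q0) # L) ^ K2 \<Longrightarrow>
     (\<exists>L'. (\<forall>z\<in>set L'. adm p D z \<and> rc p D d G q0 z) \<and> length L' \<le> n2 \<and>
        PHS p D c Q ((g0, q0) # L) ^ K2 \<le> real K2 * cmod (LamL p D ((g0, q0) # L')))"
      using Suc.IH[of "2 * n + 1"] by blast
    define K1 where "K1 = 2 * n + 4"
    have K1: "1 \<le> K1" by (simp add: K1_def)
    define M where "M = cmp K1 K2"
    have M: "1 \<le> M" "K1 \<le> M" using cmp_ge[OF K1 K2] by (auto simp: M_def)
    show ?case
    proof (rule exI[of _ M], rule exI[of _ n2], intro conjI allI impI M(1))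
      fix p D \<beta> G g0 q0 L c \<nu> and Q :: "vec \<Rightarrow> int poly"
      assume *: "cx p d G \<beta>" "adm p D (g0, q0)" "\<forall>z\<in>set L. adm p D z \<and> rc p D d G q0 z" "length L \<le> n" "\<nu> \<in> G" "LT p D d \<nu> q0"
        "\<forall>x. cmod (c x) \<le> 1" "\<forall>x. degree (Q x) \<le> Suc N"
        "real M * \<beta> < PHS p D c Q ((g0, q0) # L) ^ M"
      let ?\<delta> = "PHS p D c Q ((g0, q0) # L)"
      have p: "p > 0" "0 \<le> \<beta>" using cx_pos[OF *(1)] by auto
      have \<delta>: "0 \<le> ?\<delta>" "?\<delta> \<le> 1"
      proof -
        have "adm p D z" if "z \<in> set ((g0, q0) # L)" for z
        proof -
          from that have "z = (g0, q0) \<or> z \<in> set L" by simp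
          then show ?thesis using *(2,3) by blast
        qed
        then show "?\<delta> \<le> 1" by (rule PHS_le_1[OF p(1) spec[OF *(7)]])
        show "0 \<le> ?\<delta>" by (simp add: PHS_def)
      qed
      have "\<forall>h. \<forall>x. \<exists>Q'. (\<forall>y. poly Q' y = poly (Q x) y - poly (Q x) (y + h)) \<and> degree Q' \<le> N"
        using poly_diff_shift_ex *(8) by (metis diff_Suc_1)
      then obtain Q' where Q': "\<And>h x y. poly (Q' h x) y = poly (Q x) y - poly (Q x) (y + h)" "\<And>h x. degree (Q' h x) \<le> N"
        by metis
      have big1: "real (2 * n + 4) * \<beta> < ?\<delta> ^ (2 * n + 4)"
        using loss_mono[OF \<delta> p(2) M(2) *(9)] unfolding K1_def .
      obtain h L1 where s: "\<forall>z\<in>set L1. adm p D z \<and> rc p D d G q0 z" "length L1 \<le> 2 * n + 1"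
        "?\<delta> ^ K1 \<le> real K1 * PHS p D (\<lambda>x. 1) (Q' h) ((g0, q0) # L1)"
        using step[OF *(1-7) Q'(1) big1] unfolding K1_def by blast
      note c = loss_chain[OF \<delta> p(2) K1 K2 _ *(9) s(3)]
      have "real K2 * \<beta> < PHS p D (\<lambda>x. 1) (Q' h) ((g0, q0) # L1) ^ K2" by (rule c(1)) (simp add: M_def cmp_def)
      from E2[OF *(1,2) s(1,2) *(5,6) _ _ this] Q'(2) obtain L2 where
        s2: "\<forall>z\<in>set L2. adm p D z \<and> rc p D d G q0 z" "length L2 \<le> n2"
          "PHS p D (\<lambda>x. 1) (Q' h) ((g0, q0) # L1) ^ K2 \<le> real K2 * cmod (LamL p D ((g0, q0) # L2))"
        by (metis norm_one order_refl)
      have "?\<delta> ^ M \<le> real M * cmod (LamL p D ((g0, q0) # L2))" by (rule c(2)[OF _ s2(3)]) (simp add: M_def cmp_def)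
      then show "\<exists>L'. (\<forall>z\<in>set L'. adm p D z \<and> rc p D d G q0 z) \<and> length L' \<le> n2 \<and>
        ?\<delta> ^ M \<le> real M * cmod (LamL p D ((g0, q0) # L'))" using s2(1,2) by blast
    qed
  }
qed

subsection \<open>Families of functions along polynomial directions\<close>

definition Eig :: "nat \<Rightarrow> vec \<Rightarrow> (vec \<Rightarrow> complex) \<Rightarrow> bool" where
  "Eig p w f \<longleftrightarrow> (\<forall>x. \<exists>\<phi>. \<forall>n. f (x + sm n w) = f x * e_p p (\<phi> * n))"

lemma Eig_invariant: "(\<And>x n. f (x + sm n w) = f x) \<Longrightarrow> Eig p w f"
  unfolding Eig_def by (metis e_p_0 mult_1_right mult_zero_left)

lemma Eig_shift: "Eig p w f \<Longrightarrow> Eig p w (\<lambda>x. f (x + v))"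
  unfolding Eig_def
proof (intro allI)
  fix x assume *: "\<forall>x. \<exists>\<phi>. \<forall>n. f (x + sm n w) = f x * e_p p (\<phi> * n)"
  have "x + sm n w + v = (x + v) + sm n w" for n by (simp add: ac_simps)
  then show "\<exists>\<phi>. \<forall>n. f (x + sm n w + v) = f (x + v) * e_p p (\<phi> * n)" using *[rule_format, of "x + v"] by (simp only:)
qed

lemma Eig_cnj: assumes "Eig p w f" shows "Eig p w (\<lambda>x. cnj (f x))"
  unfolding Eig_def
proof
  fix x
  obtain \<phi> where "\<forall>n. f (x + sm n w) = f x * e_p p (\<phi> * n)" using assms unfolding Eig_def by blast
  then show "\<exists>\<phi>. \<forall>n. cnj (f (x + sm n w)) = cnj (f x) * e_p p (\<phi> * n)"
    by (intro exI[of _ "- \<phi>"]) (simp add: e_p_minus)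
qed

lemma Eig_mult: assumes "Eig p w f" "Eig p w g" shows "Eig p w (\<lambda>x. f x * g x)"
  unfolding Eig_def
proof
  fix x
  obtain \<phi> \<psi> where "\<forall>n. f (x + sm n w) = f x * e_p p (\<phi> * n)" "\<forall>n. g (x + sm n w) = g x * e_p p (\<psi> * n)"
    using assms unfolding Eig_def by blast
  then show "\<exists>\<phi>. \<forall>n. f (x + sm n w) * g (x + sm n w) = f x * g x * e_p p (\<phi> * n)"
    by (intro exI[of _ "\<phi> + \<psi>"]) (simp add: distrib_right e_p_add)
qed

lemma Eig_dl: "(\<And>l. Eig p w (A l)) \<Longrightarrow> Eig p w (\<lambda>x. dl (\<lambda>l. A l x) hs ks)"
  by (induction hs arbitrary: A ks) (auto intro!: Eig_mult Eig_cnj)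

lemma Eig_dml: "Eig p w f \<Longrightarrow> Eig p w (dml us hs ks f)"
  unfolding dml_def by (intro Eig_dl Eig_shift)

locale polys =
  fixes I :: "nat set" and P :: "nat \<Rightarrow> int poly"
  assumes finI: "finite I"
begin

definition Lam :: "nat \<Rightarrow> nat \<Rightarrow> (int \<Rightarrow> complex) \<Rightarrow> (nat \<Rightarrow> vec) \<Rightarrow> (vec \<Rightarrow> complex) \<Rightarrow> (nat \<Rightarrow> vec \<Rightarrow> complex) \<Rightarrow> complex" where
  "Lam p D \<theta> w f0 f = EV p D (\<lambda>x. EY p (\<lambda>y. \<theta> y * (f0 x * (\<Prod>i\<in>I. f i (x + sm (poly (P i) y) (w i))))))"

definition Mn :: "nat \<Rightarrow> nat \<Rightarrow> (int \<Rightarrow> complex) \<Rightarrow> (nat \<Rightarrow> vec) \<Rightarrow> (vec \<Rightarrow> complex) \<Rightarrow> (nat \<Rightarrow> vec \<Rightarrow> complex) \<Rightarrow> complex" where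
  "Mn p D \<theta> w f0 f = EY p \<theta> * EV p D (\<lambda>x. f0 x * (\<Prod>i\<in>I. EY p (\<lambda>n. f i (x + sm n (w i)))))"

definition gy :: "(nat \<Rightarrow> vec) \<Rightarrow> nat \<Rightarrow> (vec \<Rightarrow> complex) \<Rightarrow> (nat \<Rightarrow> vec \<Rightarrow> complex) \<Rightarrow> int \<Rightarrow> vec \<Rightarrow> complex" where
  "gy w j f0 f y x = f0 (x + - sm (poly (P j) y) (w j)) *
     (\<Prod>i\<in>I - {j}. f i (x + (- sm (poly (P j) y) (w j) + sm (poly (P i) y) (w i))))"

text \<open>The dual function at place \<open>j\<close>: by \<open>Lam_dual\<close> the average is
  its mean against \<open>f j\<close>.\<close>

definition Fd :: "nat \<Rightarrow> (int \<Rightarrow> complex) \<Rightarrow> (nat \<Rightarrow> vec) \<Rightarrow> nat \<Rightarrow> (vec \<Rightarrow> complex) \<Rightarrow> (nat \<Rightarrow> vec \<Rightarrow> complex) \<Rightarrow> vec \<Rightarrow> complex" where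
  "Fd p \<theta> w j f0 f x = EY p (\<lambda>y. \<theta> y * gy w j f0 f y x)"

definition fam :: "nat \<Rightarrow> nat \<Rightarrow> nat set \<Rightarrow> (nat \<Rightarrow> vec) \<Rightarrow> (vec \<Rightarrow> complex) \<Rightarrow> (nat \<Rightarrow> vec \<Rightarrow> complex) \<Rightarrow> bool" where
  "fam p D E w f0 f \<longleftrightarrow> B1 p D f0 \<and> (\<forall>i\<in>I. B1 p D (f i)) \<and> (\<forall>i\<in>E. Eig p (w i) (f i))"

text \<open>The only arithmetic input on the weight: its correlation with every nontrivial phase
  spanned by the polynomials is at most \<open>\<beta>\<close>. For the constant weight 1 this is a
  Weyl sum bound.\<close>

definition wt :: "nat \<Rightarrow> real \<Rightarrow> (int \<Rightarrow> complex) \<Rightarrow> bool" where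
  "wt p \<beta> \<theta> \<longleftrightarrow> (\<forall>y. cmod (\<theta> y) \<le> 1) \<and>
     (\<forall>\<phi>. (\<exists>i\<in>I. \<not> int p dvd \<phi> i) \<longrightarrow> cmod (EY p (\<lambda>y. \<theta> y * e_p p (\<Sum>i\<in>I. \<phi> i * poly (P i) y))) \<le> \<beta>)"

text \<open>The comparison with the main term when the places in \<open>E\<close> carry
  eigenfunctions. Division by two makes the base at most 1, so that \<open>K\<close> may be
  enlarged.\<close>

definition Xat :: "nat \<Rightarrow> nat set \<Rightarrow> nat \<Rightarrow> nat \<Rightarrow> real \<Rightarrow> (int \<Rightarrow> complex) \<Rightarrow> (nat \<Rightarrow> vec) \<Rightarrow> bool" where
  "Xat K E p D \<beta> \<theta> w \<longleftrightarrow> (\<forall>f0 f. fam p D E w f0 f \<longrightarrow>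
     (cmod (Lam p D \<theta> w f0 f - Mn p D \<theta> w f0 f) / 2) ^ K \<le> real K * \<beta>)"

lemma gy_upd: "gy w j f0 (f(j := g)) = gy w j f0 f"
  unfolding gy_def by (intro ext arg_cong2[of _ _ _ _ "(*)"] prod.cong) auto

lemma Fd_upd: "Fd p \<theta> w j f0 (f(j := g)) = Fd p \<theta> w j f0 f"
  unfolding Fd_def by (simp add: gy_upd)

lemma B1_gy:
  assumes "B1 p D f0" "\<And>i. i \<in> I - {j} \<Longrightarrow> B1 p D (f i)"
  shows "B1 p D (gy w j f0 f y)"
  unfolding gy_def by (intro B1_mult B1_prod B1_shift assms)

lemma B1_Fd:
  assumes "p > 0" "B1 p D f0" "\<And>i. i \<in> I - {j} \<Longrightarrow> B1 p D (f i)" "\<And>y. cmod (\<theta> y) \<le> 1"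
  shows "B1 p D (Fd p \<theta> w j f0 f)"
  unfolding Fd_def by (intro B1_avg B1_mult B1_gy B1_const assms finite_Fp Fp_nonempty)

lemma Lam_swap:
  assumes p: "p > 0" and j: "j \<in> I" and B: "B1 p D f0" "\<And>i. i \<in> I \<Longrightarrow> B1 p D (f i)"
  shows "Lam p D \<theta> w f0 f = EY p (\<lambda>y. \<theta> y * EV p D (\<lambda>x. gy w j f0 f y x * f j x))"
proof -
  have "Lam p D \<theta> w f0 f = EY p (\<lambda>y. EV p D (\<lambda>x. \<theta> y * (f0 x * (\<Prod>i\<in>I. f i (x + sm (poly (P i) y) (w i))))))"
    unfolding Lam_def by (rule avg_swap)
  also have "\<dots> = EY p (\<lambda>y. \<theta> y * EV p D (\<lambda>x. gy w j f0 f y x * f j x))"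
    unfolding avg_cmult
  proof (rule avg_cong)
    fix y
    let ?H = "\<lambda>x. f0 x * (\<Prod>i\<in>I. f i (x + sm (poly (P i) y) (w i)))"
    have "per p D ?H" by (rule B1_per) (intro B1_mult B1_prod B1_shift B)
    from EV_shift[OF p this, of "- sm (poly (P j) y) (w j)"]
    have "EV p D ?H = EV p D (\<lambda>x. ?H (x + - sm (poly (P j) y) (w j)))" by simp
    also have "\<dots> = EV p D (\<lambda>x. gy w j f0 f y x * f j x)"
    proof (rule avg_cong)
      fix x
      have "(\<Prod>i\<in>I. f i (x + - sm (poly (P j) y) (w j) + sm (poly (P i) y) (w i)))
          = f j x * (\<Prod>i\<in>I - {j}. f i (x + - sm (poly (P j) y) (w j) + sm (poly (P i) y) (w i)))"
        by (subst prod.remove[OF finI j]) simp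
      then show "?H (x + - sm (poly (P j) y) (w j)) = gy w j f0 f y x * f j x"
        unfolding gy_def by (simp only: add.assoc ac_simps)
    qed
    finally show "\<theta> y * EV p D ?H = \<theta> y * EV p D (\<lambda>x. gy w j f0 f y x * f j x)" by (simp only:)
  qed
  finally show ?thesis .
qed

lemma Lam_dual:
  assumes "p > 0" "j \<in> I" "B1 p D f0" "\<And>i. i \<in> I \<Longrightarrow> B1 p D (f i)"
  shows "Lam p D \<theta> w f0 f = EV p D (\<lambda>x. Fd p \<theta> w j f0 f x * f j x)"
proof -
  have "EV p D (\<lambda>x. Fd p \<theta> w j f0 f x * f j x) = EV p D (\<lambda>x. EY p (\<lambda>y. \<theta> y * (gy w j f0 f y x * f j x)))"
    unfolding Fd_def avg_cmult_right[symmetric] by (simp only: mult.assoc)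
  also have "\<dots> = EY p (\<lambda>y. EV p D (\<lambda>x. \<theta> y * (gy w j f0 f y x * f j x)))" by (rule avg_swap)
  finally show ?thesis using Lam_swap[where f = f and \<theta> = \<theta> and w = w, OF assms] unfolding avg_cmult by (simp only:)
qed

lemma norm_Lam_le:
  assumes "p > 0" "\<And>y. cmod (\<theta> y) \<le> 1" "B1 p D f0" "\<And>i. i \<in> I \<Longrightarrow> B1 p D (f i)"
  shows "cmod (Lam p D \<theta> w f0 f) \<le> 1"
proof -
  have "cmod (\<theta> y * (f0 x * (\<Prod>i\<in>I. f i (x + sm (poly (P i) y) (w i))))) \<le> 1" for x y
  proof -
    have "B1 p D (\<lambda>x. \<theta> y * (f0 x * (\<Prod>i\<in>I. f i (x + sm (poly (P i) y) (w i)))))"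
      by (intro B1_mult[OF B1_const[OF assms(2)]] B1_mult B1_prod B1_shift assms(3,4))
    from B1_norm[OF this] show ?thesis .
  qed
  then show ?thesis
    unfolding Lam_def by (intro norm_avg_le_const finite_Fp_vec finite_Fp Fp_nonempty Fp_vec_nonempty assms(1))
qed

lemma B1_line_mean: "p > 0 \<Longrightarrow> B1 p D f \<Longrightarrow> B1 p D (\<lambda>x. EY p (\<lambda>n. f (x + sm n w)))"
  by (intro B1_avg B1_shift finite_Fp Fp_nonempty)

lemma norm_Mn_le:
  assumes p: "p > 0" and th: "\<And>y. cmod (\<theta> y) \<le> 1" and B: "B1 p D f0" "\<And>i. i \<in> I \<Longrightarrow> B1 p D (f i)" and i: "i \<in> I"
  shows "cmod (Mn p D \<theta> w f0 f) \<le> EV p D (\<lambda>x. cmod (EY p (\<lambda>n. f i (x + sm n (w i)))))"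
proof -
  let ?m = "\<lambda>i x. EY p (\<lambda>n. f i (x + sm n (w i)))"
  have "cmod (EY p \<theta>) \<le> 1" by (intro norm_avg_le_const finite_Fp Fp_nonempty p th)
  then have "cmod (Mn p D \<theta> w f0 f) \<le> cmod (EV p D (\<lambda>x. f0 x * (\<Prod>i\<in>I. ?m i x)))"
    unfolding Mn_def norm_mult by (rule mult_left_le_one_le[rotated 2]) simp_all
  also have "\<dots> \<le> EV p D (\<lambda>x. cmod (f0 x * (\<Prod>i\<in>I. ?m i x)))" by (rule norm_avg_le)
  also have "\<dots> \<le> EV p D (\<lambda>x. cmod (?m i x))"
  proof (rule avg_mono)
    fix x
    have "B1 p D (\<lambda>x. f0 x * (\<Prod>i\<in>I - {i}. ?m i x))" by (intro B1_mult B1_prod B1_line_mean p B) auto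
    from B1_norm[OF this, of x] have "cmod (f0 x * (\<Prod>i\<in>I - {i}. ?m i x)) * cmod (?m i x) \<le> 1 * cmod (?m i x)"
      by (rule mult_right_mono) simp
    moreover have "f0 x * (\<Prod>i\<in>I. ?m i x) = (f0 x * (\<Prod>i\<in>I - {i}. ?m i x)) * ?m i x"
      by (subst prod.remove[OF finI i]) (simp only: ac_simps)
    ultimately show "cmod (f0 x * (\<Prod>i\<in>I. ?m i x)) \<le> cmod (?m i x)" by (simp only: norm_mult mult_1)
  qed
  finally show ?thesis .
qed

lemma control_loss:
  fixes a t u \<beta> :: real
  assumes "0 \<le> a" "a \<le> 1" "0 \<le> t" "0 \<le> u" "u \<le> 1" "0 \<le> \<beta>" "1 \<le> K" "a \<le> 2 * t + u" "t ^ K \<le> real K * \<beta>"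
  shows "a ^ (4 ^ K * K) \<le> real (4 ^ K * K) * (\<beta> + u)"
proof -
  have K4: "1 \<le> (4::nat) ^ K" "1 \<le> (2::real) ^ K" by simp_all
  have "a ^ (4 ^ K * K) \<le> a ^ K" using assms K4 by (intro power_antimono) simp_all
  also have "\<dots> \<le> (2 * max (2 * t) u) ^ K" using assms by (intro power_mono) auto
  also have "\<dots> = 2 ^ K * max (2 * t) u ^ K" by (rule power_mult_distrib)
  also have "\<dots> \<le> 2 ^ K * ((2 * t) ^ K + u ^ K)"
    using assms by (intro mult_left_mono) (auto simp: max_def)
  also have "\<dots> \<le> 2 ^ K * (2 ^ K * (real K * \<beta>) + u)"
  proof (intro mult_left_mono add_mono)
    show "(2 * t) ^ K \<le> 2 ^ K * (real K * \<beta>)" using assms by (simp add: power_mult_distrib)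
    show "u ^ K \<le> u" using power_antimono[of u 1 K] assms by simp
  qed simp
  also have "\<dots> \<le> 2 ^ K * (2 ^ K * (real K * \<beta>) + 2 ^ K * (real K * u))"
  proof (intro mult_left_mono add_left_mono)
    have "1 * (1 * u) \<le> 2 ^ K * (real K * u)" using assms K4 by (intro mult_mono) auto
    then show "u \<le> 2 ^ K * (real K * u)" by simp
  qed simp
  also have "\<dots> = real (4 ^ K * K) * (\<beta> + u)"
  proof -
    have "(4::real) ^ K = 2 ^ K * 2 ^ K" by (simp add: power_mult_distrib[symmetric])
    then show ?thesis by (simp add: algebra_simps)
  qed
  finally show ?thesis .
qed

text \<open>The main term is bounded by the line means at any single place, so the estimate turns
  into control by those means. The new constant comes from taking a \<open>K\<close>-th power of a
  sum of two terms.\<close>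

lemma Xat_control:
  assumes X: "Xat K E p D \<beta> \<theta> w" and p: "p > 0" and K: "1 \<le> K" and b: "0 \<le> \<beta>" and th: "\<And>y. cmod (\<theta> y) \<le> 1"
    and fam: "fam p D E w f0 f" and i: "i \<in> I"
  shows "cmod (Lam p D \<theta> w f0 f) ^ (4 ^ K * K) \<le> real (4 ^ K * K) * (\<beta> + EV p D (\<lambda>x. cmod (EY p (\<lambda>n. f i (x + sm n (w i))))))"
proof (rule control_loss[OF norm_ge_zero _ _ _ _ b K])
  have B: "B1 p D f0" "\<And>i. i \<in> I \<Longrightarrow> B1 p D (f i)" using fam unfolding fam_def by auto
  show "cmod (Lam p D \<theta> w f0 f) \<le> 1" by (rule norm_Lam_le[OF p th B])
  show "0 \<le> cmod (Lam p D \<theta> w f0 f - Mn p D \<theta> w f0 f) / 2" by simp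
  show "0 \<le> EV p D (\<lambda>x. cmod (EY p (\<lambda>n. f i (x + sm n (w i)))))" by (rule avg_nonneg) simp
  show "EV p D (\<lambda>x. cmod (EY p (\<lambda>n. f i (x + sm n (w i))))) \<le> 1"
    by (intro avg_le_const finite_Fp_vec Fp_vec_nonempty p B1_norm[OF B1_line_mean[OF p B(2)[OF i]]])
  have "cmod (Lam p D \<theta> w f0 f) \<le> cmod (Lam p D \<theta> w f0 f - Mn p D \<theta> w f0 f) + cmod (Mn p D \<theta> w f0 f)"
    using norm_triangle_ineq[of "Lam p D \<theta> w f0 f - Mn p D \<theta> w f0 f" "Mn p D \<theta> w f0 f"] by simp
  then show "cmod (Lam p D \<theta> w f0 f) \<le> 2 * (cmod (Lam p D \<theta> w f0 f - Mn p D \<theta> w f0 f) / 2) + EV p D (\<lambda>x. cmod (EY p (\<lambda>n. f i (x + sm n (w i)))))"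
    using norm_Mn_le[where f = f and \<theta> = \<theta> and w = w, OF p th B i] by simp
  show "(cmod (Lam p D \<theta> w f0 f - Mn p D \<theta> w f0 f) / 2) ^ K \<le> real K * \<beta>"
    using X fam unfolding Xat_def by blast
qed

text \<open>Once the same \<open>y\<close> occurs at all vertices, cube derivatives act on each
  \<open>f i\<close> separately and the average over \<open>y\<close> is again a \<open>Lam\<close>,
  with the differentiated test function at place \<open>j\<close>. The parameter set
  \<open>Z\<close> admits bounded combinations of translates of the dual function.\<close>

lemma family_interchange:
  fixes us :: "vec list" and p D :: nat and Z :: "'z set"
  defines "L \<equiv> LS p (length us)"
  assumes p: "p > 0" and j: "j \<in> I" and B: "B1 p D f0" "\<And>i. i \<in> I \<Longrightarrow> B1 p D (f i)"
    and Z: "finite Z" "Z \<noteq> {}" "\<And>z. z \<in> Z \<Longrightarrow> cmod (a z) \<le> 1"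
    and us: "us \<noteq> []" and ch: "\<And>hs ks. B1 p D (ch hs ks)"
    and F: "\<And>x. F x = avg Z (\<lambda>z. a z * Fd p (\<lambda>_. 1) w j f0 f (x + \<tau> z))"
  shows "cmod (avg L (\<lambda>hs. avg L (\<lambda>ks. EV p D (\<lambda>x. dml us hs ks F x * ch hs ks x)))) ^ (2 ^ length us)
    \<le> avg L (\<lambda>ks'. avg L (\<lambda>hs. avg L (\<lambda>ks. avg Z (\<lambda>z. cmod (Lam p D (\<lambda>_. 1) w (dml us hs ks f0)
        ((\<lambda>i. dml us hs ks (f i))(j := \<lambda>x. dl (\<lambda>l. ch l ks' (x + - \<tau> z)) hs ks)))))))"
proof -
  let ?T = "Fp p \<times> Z"
  let ?g = "\<lambda>t x. gy w j f0 f (fst t) (x + \<tau> (snd t))"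
  have Bg: "B1 p D (gy w j f0 f y)" for y by (rule B1_gy) (use B in auto)
  have "cmod (avg L (\<lambda>hs. avg L (\<lambda>ks. EV p D (\<lambda>x. dml us hs ks F x * ch hs ks x)))) ^ (2 ^ length us)
    \<le> avg L (\<lambda>ks'. avg L (\<lambda>hs. avg L (\<lambda>ks.
        cmod (avg ?T (\<lambda>t. EV p D (\<lambda>x. dml us hs ks (?g t) x * dl (\<lambda>l. ch l ks' x) hs ks))))))"
    unfolding L_def
  proof (rule dual_difference_interchange[OF p _ _ _ _ us, where a = "\<lambda>t. a (snd t)"])
    show "finite ?T" "?T \<noteq> {}" using Z Fp_nonempty[OF p] by auto
    show "cmod (a (snd t)) \<le> 1" if "t \<in> ?T" for t using that Z(3) by auto
    show "cmod (?g t x) \<le> 1" for t x using B1_norm[OF Bg] .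
    show "cmod (ch hs ks x) \<le> 1" for hs ks x using B1_norm[OF ch] .
    show "F x = avg ?T (\<lambda>t. a (snd t) * ?g t x)" for x
      unfolding F avg_Times Fd_def fst_conv snd_conv avg_cmult[symmetric] mult_1 by (rule avg_swap)
  qed
  also have "\<dots> \<le> avg L (\<lambda>ks'. avg L (\<lambda>hs. avg L (\<lambda>ks. avg Z (\<lambda>z. cmod (Lam p D (\<lambda>_. 1) w (dml us hs ks f0)
        ((\<lambda>i. dml us hs ks (f i))(j := \<lambda>x. dl (\<lambda>l. ch l ks' (x + - \<tau> z)) hs ks)))))))"
  proof (intro avg_mono)
    fix ks' hs ks
    let ?X = "\<lambda>x. dl (\<lambda>l. ch l ks' x) hs ks"
    let ?f = "\<lambda>z. (\<lambda>i. dml us hs ks (f i))(j := \<lambda>x. ?X (x + - \<tau> z))"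
    have BX: "B1 p D ?X" by (rule B1_dl) (rule ch)
    have "EY p (\<lambda>y. EV p D (\<lambda>x. dml us hs ks (?g (y, z)) x * ?X x)) = Lam p D (\<lambda>_. 1) w (dml us hs ks f0) (?f z)" for z
    proof -
      have "B1 p D (?f z i)" if "i \<in> I" for i
      proof (cases "i = j")
        case True
        then show ?thesis using B1_shift[OF BX, of "- \<tau> z"] by (simp only: fun_upd_same)
      qed (use B1_dml[OF B(2)[OF that]] in simp)
      from Lam_swap[where f = "?f z" and \<theta> = "\<lambda>_. 1" and w = w, OF p j B1_dml[OF B(1)] this]
      have "Lam p D (\<lambda>_. 1) w (dml us hs ks f0) (?f z) = EY p (\<lambda>y. EV p D (\<lambda>x. gy w j (dml us hs ks f0) (?f z) y x * ?X (x + - \<tau> z)))"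
        by (simp only: mult_1 fun_upd_same)
      also have "\<dots> = EY p (\<lambda>y. EV p D (\<lambda>x. dml us hs ks (?g (y, z)) x * ?X x))"
      proof (rule avg_cong)
        fix y
        \<comment> \<open>Derivatives are multiplicative and commute with translations, so they pass
          through the product defining \<open>gy\<close>.\<close>
        have gyd: "gy w j (dml us hs ks f0) (?f z) y x = dml us hs ks (gy w j f0 f y) x" for x
          unfolding gy_upd unfolding gy_def[abs_def] dml_mult dml_prod dml_shift ..
        have "per p D (\<lambda>x. dml us hs ks (gy w j f0 f y) x * ?X (x + - \<tau> z))"
          by (rule B1_per) (intro B1_mult B1_dml B1_shift Bg BX)
        from EV_shift[OF p this, of "\<tau> z"]
        have "EV p D (\<lambda>x. dml us hs ks (gy w j f0 f y) x * ?X (x + - \<tau> z))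
          = EV p D (\<lambda>x. dml us hs ks (gy w j f0 f y) (x + \<tau> z) * ?X (x + \<tau> z + - \<tau> z))" by (rule sym)
        also have "\<dots> = EV p D (\<lambda>x. dml us hs ks (?g (y, z)) x * ?X x)"
          unfolding fst_conv snd_conv dml_shift by (simp only: add.assoc right_minus add_0_right)
        finally show "EV p D (\<lambda>x. gy w j (dml us hs ks f0) (?f z) y x * ?X (x + - \<tau> z)) = EV p D (\<lambda>x. dml us hs ks (?g (y, z)) x * ?X x)"
          unfolding gyd .
      qed
      finally show ?thesis by (rule sym)
    qed
    then have "avg ?T (\<lambda>t. EV p D (\<lambda>x. dml us hs ks (?g t) x * ?X x)) = avg Z (\<lambda>z. Lam p D (\<lambda>_. 1) w (dml us hs ks f0) (?f z))"
      unfolding avg_Times by (subst avg_swap) (simp only:)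
    then show "cmod (avg ?T (\<lambda>t. EV p D (\<lambda>x. dml us hs ks (?g t) x * ?X x)))
       \<le> avg Z (\<lambda>z. cmod (Lam p D (\<lambda>_. 1) w (dml us hs ks f0) (?f z)))"
      by (simp only: norm_avg_le)
  qed
  finally show ?thesis .
qed

end

section \<open>Exchange of one direction, and families of eigenfunctions only\<close>

lemma sqrt_loss:
  fixes \<delta> \<beta> s \<eta> :: real
  assumes \<delta>: "0 \<le> \<delta>" "\<delta> \<le> 1" and b: "0 \<le> \<beta>" and K: "1 \<le> K" and s: "0 \<le> s" "s\<^sup>2 \<le> \<eta>"
    and le: "\<delta> ^ N \<le> real K * (\<beta> + s)" and M: "2 * N \<le> M" "4 * K\<^sup>2 \<le> M" and big: "real M * \<beta> < \<delta> ^ M"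
  shows "\<delta> ^ M \<le> real M * \<eta>"
proof -
  have K1: "K * 1 \<le> K * K" using K by (intro mult_left_mono) auto
  then have "2 * K \<le> M" using M(2) unfolding power2_eq_square by linarith
  then have "real (2 * K) * \<beta> \<le> real M * \<beta>" using b by (intro mult_right_mono) auto
  also have "\<dots> \<le> \<delta> ^ N" using big power_antimono[OF \<delta>, of N M] M(1) by linarith
  finally have "2 * (real K * \<beta>) \<le> \<delta> ^ N" by simp
  then have "\<delta> ^ N \<le> 2 * (real K * s)" using le unfolding distrib_left by linarith
  then have "(\<delta> ^ N)\<^sup>2 \<le> (2 * (real K * s))\<^sup>2" using \<delta> by (intro power_mono) auto
  then have 1: "\<delta> ^ (2 * N) \<le> real (4 * K\<^sup>2) * s\<^sup>2" by (simp add: power_mult_distrib power_mult[symmetric] mult.commute)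
  have eta: "0 \<le> \<eta>" using s(2) zero_le_power2[of s] by linarith
  have "\<delta> ^ M \<le> \<delta> ^ (2 * N)" using \<delta> M(1) by (intro power_antimono)
  also have "\<dots> \<le> real (4 * K\<^sup>2) * \<eta>" using 1 mult_left_mono[OF s(2), of "real (4 * K\<^sup>2)"] by linarith
  also have "\<dots> \<le> real M * \<eta>" using M(2) eta by (intro mult_right_mono) (simp_all only: of_nat_le_iff)
  finally show ?thesis .
qed

text \<open>The arithmetic of \<open>degree_lowering\<close>: \<open>N\<close> and \<open>C\<close>
  come from reaching the set of aligned frequencies, \<open>R\<close> from the final box
  Cauchy--Schwarz. The quantity \<open>Z\<close> is forced to be large because
  \<open>\<beta>\<close> alone cannot account for \<open>\<delta> ^ N\<close>.\<close>

lemma lower_loss: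
  fixes \<delta> \<beta> Z S \<eta> :: real
  assumes \<delta>: "0 \<le> \<delta>" "\<delta> \<le> 1" and b: "0 \<le> \<beta>" and C: "1 \<le> C" and R: "1 \<le> R" and Z: "0 \<le> Z" and S: "0 \<le> S"
    and 1: "\<delta> ^ N \<le> real C * (\<beta> + Z)" and 2: "\<delta> * Z \<le> 2 * S" and 3: "S ^ R \<le> \<eta>"
    and M: "M = (N + 1) * R * (4 * C) ^ R" and big: "real M * \<beta> < \<delta> ^ M"
  shows "\<delta> ^ M \<le> real M * \<eta>"
proof -
  have C1: "1 \<le> (4 * C) ^ R" using C by simp
  have "(N + 1) * R * 1 \<le> M" unfolding M using C1 by (intro mult_left_mono) auto
  then have M1: "(N + 1) * R \<le> M" by simp
  have "1 * (4 * C) ^ R \<le> M" unfolding M using R by (intro mult_right_mono) auto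
  then have M2: "(4 * C) ^ R \<le> M" by simp
  have "(4 * C) ^ 1 \<le> (4 * C) ^ R" using C R by (intro power_increasing) auto
  then have M3: "2 * C \<le> M" using M2 by simp
  have M4: "N \<le> M"
  proof -
    have "N * 1 \<le> (N + 1) * R" using R by (intro mult_mono) auto
    then show ?thesis using M1 by simp
  qed
  have "real (2 * C) * \<beta> \<le> real M * \<beta>" using b M3 by (intro mult_right_mono) auto
  also have "\<dots> \<le> \<delta> ^ N" using big power_antimono[OF \<delta> M4] by linarith
  finally have "2 * (real C * \<beta>) \<le> \<delta> ^ N" by simp
  then have "\<delta> ^ N \<le> 2 * (real C * Z)" using 1 unfolding distrib_left by linarith
  then have "\<delta> * \<delta> ^ N \<le> \<delta> * (2 * (real C * Z))" using \<delta>(1) by (rule mult_left_mono)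
  also have "\<dots> = 2 * real C * (\<delta> * Z)" by simp
  also have "\<dots> \<le> 2 * real C * (2 * S)" using 2 by (rule mult_left_mono) simp
  finally have "\<delta> ^ (N + 1) \<le> real (4 * C) * S" by simp
  then have "(\<delta> ^ (N + 1)) ^ R \<le> (real (4 * C) * S) ^ R" using \<delta> by (intro power_mono) auto
  then have 4: "\<delta> ^ ((N + 1) * R) \<le> real ((4 * C) ^ R) * S ^ R"
    unfolding power_mult of_nat_power power_mult_distrib[of "real (4 * C)" S R] .
  have eta: "0 \<le> \<eta>" using 3 zero_le_power[OF S, of R] by linarith
  have "\<delta> ^ M \<le> \<delta> ^ ((N + 1) * R)" using \<delta> M1 by (intro power_antimono)
  also have "\<dots> \<le> real ((4 * C) ^ R) * \<eta>" using 4 mult_left_mono[OF 3, of "real ((4 * C) ^ R)"] by linarith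
  also have "\<dots> \<le> real M * \<eta>" using M2 eta by (intro mult_right_mono) (simp_all only: of_nat_le_iff)
  finally show ?thesis .
qed

lemma line_mean_invariant:
  assumes "p > 0" "per p D g"
  shows "EY p (\<lambda>n. g (x + sm m v + sm n v)) = EY p (\<lambda>n. g (x + sm n v))"
proof -
  from EY_shift[OF assms(1) yper_line[OF assms(2), of x v], of m] show ?thesis
    by (simp only: sm_add_left add.commute[of "sm _ v" "sm m v"] add.assoc)
qed

lemma EV_mult_line_mean:
  assumes p: "p > 0" and g: "per p D g" and c: "per p D c" "\<And>x n. c (x + sm n v) = c x"
  shows "EV p D (\<lambda>x. g x * c x) = EV p D (\<lambda>x. EY p (\<lambda>n. g (x + sm n v)) * (c x :: complex))"
proof -
  have "per p D (\<lambda>x. g x * c x)" unfolding per_def using perD[OF g] perD[OF c(1)] by metis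
  from EV_line[OF p this, of v] show ?thesis by (simp only: c(2) avg_cmult_right)
qed

text \<open>The box norm along one direction is a correlation of \<open>g\<close> with its own
  conjugated line mean, a test function invariant in that direction.\<close>

lemma bx1_eq_EV:
  assumes p: "p > 0" and g: "B1 p D g"
  shows "complex_of_real (bx p D [v] g) = EV p D (\<lambda>x. g x * cnj (EY p (\<lambda>n. g (x + sm n v))))"
proof -
  have gp: "per p D g" using g by (rule B1_per)
  have "per p D (\<lambda>x. cnj (EY p (\<lambda>n. g (x + sm n v))))"
    by (rule B1_per) (intro B1_cnj B1_avg B1_shift g finite_Fp Fp_nonempty p)
  from EV_mult_line_mean[OF p gp this, of v] line_mean_invariant[OF p gp]
  have "EV p D (\<lambda>x. g x * cnj (EY p (\<lambda>n. g (x + sm n v)))) = EV p D (\<lambda>x. EY p (\<lambda>n. g (x + sm n v)) * cnj (EY p (\<lambda>n. g (x + sm n v))))"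
    by (simp only:)
  also have "\<dots> = EV p D (\<lambda>x. complex_of_real ((cmod (EY p (\<lambda>n. g (x + sm n v))))\<^sup>2))"
    by (simp only: complex_norm_square)
  also have "\<dots> = complex_of_real (bx p D [v] g)" by (simp only: avg_of_real bx_eq_avg_norm[OF p gp])
  finally show ?thesis by (rule sym)
qed

context polys
begin

text \<open>A direction \<open>v\<close> for the dual function at \<open>a\<close> is exchanged for
  \<open>w b\<close> at place \<open>b\<close>. The test function correlating with the derivatives
  is invariant in direction \<open>v\<close>, so \<open>ctl\<close> applies to the differentiated
  families, and line means of derivatives of \<open>f b\<close> along \<open>w b\<close> make up the
  new box norm.\<close>

lemma box_transfer:
  assumes p: "p > 0" and b: "0 \<le> \<beta>" and K: "1 \<le> K" and ab: "a \<in> I" "b \<in> I" "a \<noteq> b" and E: "E \<subseteq> I" "a \<notin> E"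
    and us: "us \<noteq> []" and fam: "fam p D E w f0 f"
    and ctl: "\<And>g0 g. fam p D E w g0 g \<Longrightarrow> (\<And>x n. g a (x + sm n v) = g a x) \<Longrightarrow>
       cmod (Lam p D (\<lambda>_. 1) w g0 g) ^ K \<le> real K * (\<beta> + EV p D (\<lambda>x. cmod (EY p (\<lambda>n. g b (x + sm n (w b))))))"
    and M: "M = 4 * K\<^sup>2 * 2 ^ length us"
    and big: "real M * \<beta> < bx p D (v # us) (Fd p (\<lambda>_. 1) w a f0 f) ^ M"
  shows "bx p D (v # us) (Fd p (\<lambda>_. 1) w a f0 f) ^ M \<le> real M * bx p D (w b # us) (f b)"
proof -
  let ?F = "Fd p (\<lambda>_. 1) w a f0 f"
  let ?\<delta> = "bx p D (v # us) ?F"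
  let ?L = "LS p (length us)"
  have B: "B1 p D f0" "\<And>i. i \<in> I \<Longrightarrow> B1 p D (f i)" using fam unfolding fam_def by auto
  have BF: "B1 p D ?F" by (rule B1_Fd[OF p]) (use B in auto)
  \<comment> \<open>Conjugated line means in direction \<open>v\<close>; invariance survives the
    cube product taken at place \<open>a\<close>.\<close>
  define ch where "ch hs ks x = cnj (EY p (\<lambda>n. dml us hs ks ?F (x + sm n v)))" for hs ks x
  have Bch: "B1 p D (ch hs ks)" for hs ks
    unfolding ch_def by (intro B1_cnj B1_line_mean[OF p] B1_dml BF)
  have inv: "ch hs ks (x + sm n v) = ch hs ks x" for hs ks x n
    unfolding ch_def by (simp only: line_mean_invariant[OF p B1_per[OF B1_dml[OF BF]]])
  have \<delta>: "0 \<le> ?\<delta>" "?\<delta> \<le> 1" using bx_nonneg[OF p BF, of "v # us"] bx_le_1[OF p BF] by auto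
  have "complex_of_real ?\<delta> = avg ?L (\<lambda>hs. avg ?L (\<lambda>ks. EV p D (\<lambda>x. dml us hs ks ?F x * ch hs ks x)))"
    by (subst bx_Cons_inner) (simp only: avg_of_real[symmetric] bx1_eq_EV[OF p B1_dml[OF BF]] ch_def)
  then have "?\<delta> = cmod (avg ?L (\<lambda>hs. avg ?L (\<lambda>ks. EV p D (\<lambda>x. dml us hs ks ?F x * ch hs ks x))))"
    using \<delta>(1) by (metis abs_of_nonneg norm_of_real)
  then have "?\<delta> ^ (2 ^ length us) \<le> avg ?L (\<lambda>ks'. avg ?L (\<lambda>hs. avg ?L (\<lambda>ks. avg {0::int} (\<lambda>z. cmod (Lam p D (\<lambda>_. 1) w (dml us hs ks f0)
        ((\<lambda>i. dml us hs ks (f i))(a := \<lambda>x. dl (\<lambda>l. ch l ks' (x + - 0)) hs ks)))))))"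
    using family_interchange[where Z = "{0::int}" and a = "\<lambda>_. 1" and \<tau> = "\<lambda>_. 0" and F = ?F and us = us and ch = ch and f = f and w = w,
        OF p ab(1) B _ _ _ us Bch] by (simp add: avg_def)
  also have "\<dots> = avg (?L \<times> ?L \<times> ?L) (\<lambda>(ks', hs, ks). cmod (Lam p D (\<lambda>_. 1) w (dml us hs ks f0)
        ((\<lambda>i. dml us hs ks (f i))(a := \<lambda>x. dl (\<lambda>l. ch l ks' x) hs ks))))"
    by (simp add: avg_Times avg_def[of "{0::int}"])
  finally have 1: "?\<delta> ^ (2 ^ length us) \<le> avg (?L \<times> ?L \<times> ?L) (\<lambda>(ks', hs, ks). cmod (Lam p D (\<lambda>_. 1) w (dml us hs ks f0)
        ((\<lambda>i. dml us hs ks (f i))(a := \<lambda>x. dl (\<lambda>l. ch l ks' x) hs ks))))" (is "_ \<le> avg ?T ?A") .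
  have T: "finite ?T" "?T \<noteq> {}" using LS_nonempty[OF p] by auto
  define U where "U t = (case t of (ks' :: int list, hs, ks) \<Rightarrow> EV p D (\<lambda>x. cmod (EY p (\<lambda>n. dml us hs ks (f b) (x + sm n (w b))))))" for t
  have U0: "0 \<le> U t" for t by (auto simp: U_def split: prod.splits intro: avg_nonneg)
  have "?\<delta> ^ (2 ^ length us * K) = (?\<delta> ^ (2 ^ length us)) ^ K" by (rule power_mult)
  also have "\<dots> \<le> (avg ?T ?A) ^ K" by (rule power_mono[OF 1]) (use \<delta> in simp)
  also have "\<dots> \<le> avg ?T (\<lambda>t. ?A t ^ K)" by (rule avg_power_le[OF T]) auto
  also have "\<dots> \<le> avg ?T (\<lambda>t. real K * (\<beta> + U t))"
  proof (rule avg_mono)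
    fix t :: "int list \<times> int list \<times> int list"
    obtain ks' hs ks where t: "t = (ks', hs, ks)" by (cases t)
    let ?g = "(\<lambda>i. dml us hs ks (f i))(a := \<lambda>x. dl (\<lambda>l. ch l ks' x) hs ks)"
    have "fam p D E w (dml us hs ks f0) ?g"
      unfolding fam_def
    proof (intro conjI ballI)
      show "B1 p D (dml us hs ks f0)" by (rule B1_dml[OF B(1)])
      show "B1 p D (?g i)" if "i \<in> I" for i
        using B1_dml[OF B(2)[OF that]] B1_dl[of p D "\<lambda>l. ch l ks'", OF Bch] by simp
      show "Eig p (w i) (?g i)" if "i \<in> E" for i
        using that E(2) fam Eig_dml by (auto simp: fam_def)
    qed
    from ctl[OF this] have "cmod (Lam p D (\<lambda>_. 1) w (dml us hs ks f0) ?g) ^ K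
        \<le> real K * (\<beta> + EV p D (\<lambda>x. cmod (EY p (\<lambda>n. ?g b (x + sm n (w b))))))"
      by (simp only: fun_upd_same inv)
    then show "?A t ^ K \<le> real K * (\<beta> + U t)" using ab(3) by (simp add: t U_def)
  qed
  also have "\<dots> = real K * (\<beta> + avg ?T U)" by (simp only: avg_cmult avg_add avg_const[OF T])
  finally have le: "?\<delta> ^ (2 ^ length us * K) \<le> real K * (\<beta> + avg ?T U)" .
  \<comment> \<open>The line means enter to the first power; squaring and Jensen's inequality turn
    them into box norms.\<close>
  have sq: "(avg ?T U)\<^sup>2 \<le> bx p D (w b # us) (f b)"
  proof -
    have "(avg ?T U)\<^sup>2 \<le> avg ?T (\<lambda>t. (U t)\<^sup>2)" by (rule avg_power_le[OF T U0])
    also have "\<dots> \<le> avg ?T (\<lambda>(ks', hs, ks). bx p D [w b] (dml us hs ks (f b)))"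
    proof (rule avg_mono)
      fix t :: "int list \<times> int list \<times> int list"
      obtain ks' hs ks where t: "t = (ks', hs, ks)" by (cases t)
      have "(U t)\<^sup>2 \<le> EV p D (\<lambda>x. (cmod (EY p (\<lambda>n. dml us hs ks (f b) (x + sm n (w b)))))\<^sup>2)"
        unfolding t U_def prod.case by (rule avg_power_le) (use Fp_vec_nonempty[OF p] in auto)
      also have "\<dots> = bx p D [w b] (dml us hs ks (f b))" by (rule bx_eq_avg_norm[OF p B1_per[OF B1_dml[OF B(2)[OF ab(2)]]], symmetric])
      finally show "(U t)\<^sup>2 \<le> (case t of (ks', hs, ks) \<Rightarrow> bx p D [w b] (dml us hs ks (f b)))" by (simp add: t)
    qed
    also have "\<dots> = bx p D (w b # us) (f b)"
      by (subst bx_Cons_inner) (simp add: avg_Times avg_const LS_nonempty[OF p])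
    finally show ?thesis .
  qed
  have n2: "1 \<le> (2::nat) ^ length us" by simp
  show ?thesis
  proof (rule sqrt_loss[OF \<delta> b K _ sq le _ _ big])
    show "0 \<le> avg ?T U" by (rule avg_nonneg) (rule U0)
    have "K * 1 \<le> K * K" using K by (intro mult_left_mono) auto
    then have "2 ^ length us * K \<le> 2 ^ length us * (K * K)" by simp
    then show "2 * (2 ^ length us * K) \<le> M" unfolding M power2_eq_square by simp
    show "4 * K\<^sup>2 \<le> M" unfolding M using mult_left_mono[OF n2, of "4 * K\<^sup>2"] by simp
  qed
qed

lemma e_p_sum: "e_p p (\<Sum>i\<in>A. g i) = (\<Prod>i\<in>A. e_p p (g i))"
  by (induction A rule: infinite_finite_induct) (auto simp: e_p_add)

text \<open>For each \<open>x\<close> the average over \<open>y\<close> is an exponential sum with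
  the frequencies of the line. If all of them are divisible by \<open>p\<close>, average and main
  term agree; otherwise a factor of the main term vanishes and \<open>wt\<close> bounds the
  sum.\<close>

lemma Xat_all_eigen:
  assumes p: "p > 0" and wt: "wt p \<beta> \<theta>" and b: "0 \<le> \<beta>"
  shows "Xat 1 I p D \<beta> \<theta> w"
  unfolding Xat_def
proof (intro allI impI)
  fix f0 f assume fam: "fam p D I w f0 f"
  have B: "B1 p D f0" "\<And>i. i \<in> I \<Longrightarrow> B1 p D (f i)" using fam unfolding fam_def by auto
  have "\<forall>i. \<forall>x. \<exists>\<phi>. i \<in> I \<longrightarrow> (\<forall>n. f i (x + sm n (w i)) = f i x * e_p p (\<phi> * n))"
    using fam unfolding fam_def Eig_def by blast
  then obtain \<phi> where \<phi>: "\<And>i x n. i \<in> I \<Longrightarrow> f i (x + sm n (w i)) = f i x * e_p p (\<phi> i x * n)" by metis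
  define S where "S x = EY p (\<lambda>y. \<theta> y * e_p p (\<Sum>i\<in>I. \<phi> i x * poly (P i) y))" for x
  define T where "T x = (\<Prod>i\<in>I. if int p dvd \<phi> i x then 1 else (0::complex))" for x
  define c where "c x = f0 x * (\<Prod>i\<in>I. f i x)" for x
  have "B1 p D c" unfolding c_def by (intro B1_mult B1_prod B)
  then have c1: "cmod (c x) \<le> 1" for x by (rule B1_norm)
  have L: "Lam p D \<theta> w f0 f = EV p D (\<lambda>x. c x * S x)"
    unfolding Lam_def S_def avg_cmult[symmetric]
  proof (intro avg_cong)
    fix x y
    have "(\<Prod>i\<in>I. f i (x + sm (poly (P i) y) (w i))) = (\<Prod>i\<in>I. f i x) * e_p p (\<Sum>i\<in>I. \<phi> i x * poly (P i) y)"
      unfolding e_p_sum prod.distrib[symmetric] by (rule prod.cong) (auto simp: \<phi>)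
    then show "\<theta> y * (f0 x * (\<Prod>i\<in>I. f i (x + sm (poly (P i) y) (w i)))) = c x * (\<theta> y * e_p p (\<Sum>i\<in>I. \<phi> i x * poly (P i) y))"
      by (simp add: c_def ac_simps)
  qed
  have R: "Mn p D \<theta> w f0 f = EV p D (\<lambda>x. c x * (EY p \<theta> * T x))"
    unfolding Mn_def avg_cmult[symmetric]
  proof (rule avg_cong)
    fix x
    have "(\<Prod>i\<in>I. EY p (\<lambda>n. f i (x + sm n (w i)))) = (\<Prod>i\<in>I. f i x) * T x"
      unfolding T_def prod.distrib[symmetric]
      by (rule prod.cong) (auto simp: \<phi> avg_cmult EY_e_p[OF p])
    then show "EY p \<theta> * (f0 x * (\<Prod>i\<in>I. EY p (\<lambda>n. f i (x + sm n (w i))))) = c x * (EY p \<theta> * T x)"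
      by (simp add: c_def ac_simps)
  qed
  have "cmod (S x - EY p \<theta> * T x) \<le> \<beta>" for x
  proof (cases "\<exists>i\<in>I. \<not> int p dvd \<phi> i x")
    case True
    then have "T x = 0" unfolding T_def by (auto simp: finI intro!: prod_zero)
    moreover have "cmod (S x) \<le> \<beta>" using wt[unfolded wt_def, THEN conjunct2, THEN spec[of _ "\<lambda>i. \<phi> i x"]] True unfolding S_def by blast
    ultimately show ?thesis by simp
  next
    case False
    then have "T x = 1" unfolding T_def by (intro prod.neutral) auto
    moreover have "e_p p (\<Sum>i\<in>I. \<phi> i x * poly (P i) y) = 1" for y
      by (rule e_p_dvd[OF p]) (use False in \<open>auto intro!: dvd_sum\<close>)
    ultimately show ?thesis using b by (simp add: S_def)
  qed
  then have "cmod (c x * (S x - EY p \<theta> * T x)) \<le> \<beta>" for x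
    unfolding norm_mult using c1[of x] mult_left_le_one_le[of "cmod (S x - EY p \<theta> * T x)" "cmod (c x)"] by (meson norm_ge_zero order_trans)
  then have "cmod (EV p D (\<lambda>x. c x * (S x - EY p \<theta> * T x))) \<le> \<beta>"
    by (intro norm_avg_le_const finite_Fp_vec Fp_vec_nonempty p)
  then have "cmod (Lam p D \<theta> w f0 f - Mn p D \<theta> w f0 f) \<le> \<beta>"
    unfolding L R avg_diff[symmetric] right_diff_distrib[symmetric] .
  then show "(cmod (Lam p D \<theta> w f0 f - Mn p D \<theta> w f0 f) / 2) ^ 1 \<le> real 1 * \<beta>" using b by simp
qed

end

section \<open>Lowering the degree of a box norm along a repeated direction\<close>

fun dls :: "(int list \<Rightarrow> int) \<Rightarrow> int list \<Rightarrow> int list \<Rightarrow> int" where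
  "dls A [] ks = A []"
| "dls A (h # hs) ks = dls (\<lambda>l. A (h # l)) hs (tl ks) - dls (\<lambda>l. A (hd ks # l)) hs (tl ks)"

lemma dl_e_p: "dl (\<lambda>l. e_p p (A l * n)) hs ks = e_p p (dls A hs ks * n)"
  by (induction hs arbitrary: A ks) (simp_all add: left_diff_distrib e_p_diff)

lemma norm_one_cnj: "cmod z = 1 \<Longrightarrow> z * u = 1 \<Longrightarrow> z = cnj u"
proof -
  assume *: "cmod z = 1" "z * u = 1"
  have "z * cnj z = 1" using complex_norm_square[of z] *(1) by simp
  then have "z * cnj z = z * u" using *(2) by simp
  moreover have "z \<noteq> 0" using *(2) by auto
  ultimately have "cnj z = u" by simp
  then show ?thesis by auto
qed

context polys
begin

text \<open>The part of the dual function with mean zero on lines in direction \<open>w j\<close>;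
  halving keeps it 1-bounded.\<close>

definition Gf :: "nat \<Rightarrow> (int \<Rightarrow> complex) \<Rightarrow> (nat \<Rightarrow> vec) \<Rightarrow> nat \<Rightarrow> (vec \<Rightarrow> complex) \<Rightarrow> (nat \<Rightarrow> vec \<Rightarrow> complex) \<Rightarrow> vec \<Rightarrow> complex" where
  "Gf p \<theta> w j f0 f x = (Fd p \<theta> w j f0 f x - EY p (\<lambda>n. Fd p \<theta> w j f0 f (x + sm n (w j)))) / 2"

text \<open>A signed average of translates of the dual function, the form required by
  \<open>family_interchange\<close>. The boolean selects the function itself or a translate along
  the line.\<close>

lemma Gf_avg:
  assumes "p > 0"
  shows "Gf p \<theta> w j f0 f x = avg (Fp p \<times> (UNIV :: bool set))
    (\<lambda>z. (if snd z then 1 else - 1) * Fd p \<theta> w j f0 f (x + (if snd z then 0 else sm (fst z) (w j))))"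
proof -
  have "avg (UNIV :: bool set) (\<lambda>s. (if s then 1 else - 1) * Fd p \<theta> w j f0 f (x + (if s then 0 else sm n (w j))))
     = (Fd p \<theta> w j f0 f x - Fd p \<theta> w j f0 f (x + sm n (w j))) * (1 / 2)" for n
    by (simp add: avg_def UNIV_bool)
  then show ?thesis
    unfolding Gf_def avg_Times fst_conv snd_conv by (simp only: avg_cmult_right avg_diff avg_const[OF finite_Fp Fp_nonempty[OF assms]]) simp
qed

lemma B1_Gf:
  assumes p: "p > 0" and B: "B1 p D f0" "\<And>i. i \<in> I - {j} \<Longrightarrow> B1 p D (f i)" "\<And>y. cmod (\<theta> y) \<le> 1"
  shows "B1 p D (Gf p \<theta> w j f0 f)"
proof -
  have BF: "B1 p D (Fd p \<theta> w j f0 f)" by (rule B1_Fd[OF p B])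
  have "B1 p D (\<lambda>x. avg (Fp p \<times> (UNIV :: bool set))
    (\<lambda>z. (if snd z then 1 else - 1) * Fd p \<theta> w j f0 f (x + (if snd z then 0 else sm (fst z) (w j)))))"
  proof (rule B1_avg)
    show "Fp p \<times> (UNIV :: bool set) \<noteq> {}" using Fp_nonempty[OF p] by auto
    show "B1 p D (\<lambda>x. (if snd z then 1 else - 1) * Fd p \<theta> w j f0 f (x + (if snd z then 0 else sm (fst z) (w j))))" for z
      by (rule B1_mult[OF B1_const B1_shift[OF BF]]) simp
  qed simp
  then show ?thesis by (simp only: Gf_avg[OF p, abs_def])
qed

lemma Gf_line_mean:
  assumes p: "p > 0" and B: "B1 p D f0" "\<And>i. i \<in> I - {j} \<Longrightarrow> B1 p D (f i)" "\<And>y. cmod (\<theta> y) \<le> 1"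
  shows "EY p (\<lambda>n. Gf p \<theta> w j f0 f (x + sm n (w j))) = 0"
proof -
  have BF: "B1 p D (Fd p \<theta> w j f0 f)" by (rule B1_Fd[OF p B])
  let ?m = "EY p (\<lambda>n. Fd p \<theta> w j f0 f (x + sm n (w j)))"
  have "Gf p \<theta> w j f0 f (x + sm m (w j)) = (Fd p \<theta> w j f0 f (x + sm m (w j)) - ?m) * (1 / 2)" for m
    unfolding Gf_def line_mean_invariant[OF p B1_per[OF BF]] by simp
  then show ?thesis by (simp only: avg_cmult_right avg_diff avg_const[OF finite_Fp Fp_nonempty[OF p]]) simp
qed

text \<open>A large norm with \<open>w j\<close> repeated makes the derivatives along
  \<open>us\<close> correlate with phases on lines. Interchanging puts the cube product of these
  phases at place \<open>j\<close>; it is an eigenfunction, so the hypothesis for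
  \<open>insert j E\<close> forces its frequency to vanish for many cubes. On such cubes the phase
  at one vertex is a product of phases of lower order, which Cauchy--Schwarz discards, and one copy
  of \<open>w j\<close> disappears.\<close>

lemma degree_lowering:
  assumes p: "p > 0" and b: "0 \<le> \<beta>" and K: "1 \<le> K" and j: "j \<in> I" "j \<notin> E" and us: "us \<noteq> []"
    and fam: "fam p D E w f0 f" and X: "Xat K (insert j E) p D \<beta> (\<lambda>_. 1) w"
    and M: "M = (2 ^ length us * (4 ^ K * K) + 1) * 2 ^ length us * (4 * (2 ^ (2 ^ length us * (4 ^ K * K)) * (4 ^ K * K))) ^ (2 ^ length us)"
    and big: "real M * \<beta> < bx p D (w j # w j # us) (Gf p (\<lambda>_. 1) w j f0 f) ^ M"
  shows "bx p D (w j # w j # us) (Gf p (\<lambda>_. 1) w j f0 f) ^ M \<le> real M * bx p D (w j # us) (Gf p (\<lambda>_. 1) w j f0 f)"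
proof -
  let ?G = "Gf p (\<lambda>_. 1) w j f0 f" and ?w = "w j" and ?r = "length us"
  let ?L = "LS p ?r"
  let ?\<delta> = "bx p D (?w # ?w # us) ?G"
  define K' where "K' = 4 ^ K * K"
  have K': "1 \<le> K'" using K by (simp add: K'_def)
  have B: "B1 p D f0" "\<And>i. i \<in> I \<Longrightarrow> B1 p D (f i)" using fam unfolding fam_def by auto
  have BG: "B1 p D ?G" by (rule B1_Gf[OF p]) (use B in auto)
  define g where "g hs ks = dml us hs ks ?G" for hs ks
  have Bg: "B1 p D (g hs ks)" for hs ks unfolding g_def by (rule B1_dml[OF BG])
  define \<phi> where "\<phi> hs ks x = frq p ?w (g hs ks) x" for hs ks x
  define H where "H hs ks x = fh p ?w (g hs ks) x (\<phi> hs ks x)" for hs ks x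
  \<comment> \<open>Points with squared coefficient below \<open>\<delta> / 2\<close> contribute at
    most \<open>\<delta> / 2\<close> to the mean square. At the others the lower bound is needed
    again when \<open>?\<delta> * Zb\<close> is compared with \<open>S\<close>.\<close>
  define \<iota> where "\<iota> hs ks x = (if ?\<delta> \<le> 2 * (cmod (H hs ks x))\<^sup>2 then 1 else (0::real))" for hs ks x
  define ch where "ch hs ks x = cnj (H hs ks x) * complex_of_real (\<iota> hs ks x)" for hs ks x
  have \<phi>sh: "\<phi> hs ks (x + sm m ?w) = \<phi> hs ks x" for hs ks x m
    unfolding \<phi>_def by (rule frq_shift[OF p B1_per[OF Bg]])
  have Hsh: "H hs ks (x + sm m ?w) = H hs ks x * e_p p (\<phi> hs ks x * m)" for hs ks x m
    unfolding H_def \<phi>sh by (rule fh_shift[OF p B1_per[OF Bg]])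
  have \<iota>sh: "\<iota> hs ks (x + sm m ?w) = \<iota> hs ks x" for hs ks x m
    unfolding \<iota>_def Hsh by (simp add: norm_mult)
  have chsh: "ch hs ks (x + sm m ?w) = ch hs ks x * e_p p (- \<phi> hs ks x * m)" for hs ks x m
    unfolding ch_def Hsh \<iota>sh by (simp add: e_p_minus)
  have Hcg: "H hs ks x = H hs ks y" if "cg p D x y" for hs ks x y
    unfolding H_def \<phi>_def fh_cg[OF B1_per[OF Bg] that] frq_cg[OF B1_per[OF Bg] that] ..
  have \<iota>per: "per p D (\<iota> hs ks)" for hs ks
    unfolding per_def \<iota>_def by (intro allI impI) (simp only: Hcg)
  have H1: "cmod (H hs ks x) \<le> 1" for hs ks x unfolding H_def by (rule norm_fh_le[OF p Bg])
  have ch1: "cmod (ch hs ks x) \<le> \<iota> hs ks x" for hs ks x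
    unfolding ch_def norm_mult using H1[of hs ks x] by (auto simp: \<iota>_def)
  have \<iota>01: "0 \<le> \<iota> hs ks x" "\<iota> hs ks x \<le> 1" for hs ks x by (auto simp: \<iota>_def)
  have Bch: "B1 p D (ch hs ks)" for hs ks
    unfolding B1_def
  proof
    show "per p D (ch hs ks)"
      unfolding per_def ch_def by (intro allI impI) (simp only: Hcg perD[OF \<iota>per])
    show "\<forall>x. cmod (ch hs ks x) \<le> 1" using ch1 \<iota>01(2) order_trans by blast
  qed
  have \<delta>: "0 \<le> ?\<delta>" "?\<delta> \<le> 1" using bx_nonneg[OF p BG, of "?w # ?w # us"] bx_le_1[OF p BG] by auto
  have "bx p D (?w # ?w # us) ?G = avg ?L (\<lambda>hs. avg ?L (\<lambda>ks. bx p D [?w, ?w] (g hs ks)))"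
  proof -
    have "bx p D (?w # ?w # us) ?G = EY p (\<lambda>h. EY p (\<lambda>k. avg ?L (\<lambda>hs. avg ?L (\<lambda>ks. bx p D [?w] (dm ?w h k (g hs ks))))))"
      unfolding bx_Cons[of p D ?w "?w # us"] bx_Cons_inner[of p D ?w us] g_def dml_dm ..
    also have "\<dots> = avg (Fp p \<times> Fp p) (\<lambda>(h, k). avg (?L \<times> ?L) (\<lambda>(hs, ks). bx p D [?w] (dm ?w h k (g hs ks))))"
      by (simp add: avg_Times)
    also have "\<dots> = avg (?L \<times> ?L) (\<lambda>(hs, ks). avg (Fp p \<times> Fp p) (\<lambda>(h, k). bx p D [?w] (dm ?w h k (g hs ks))))"
      unfolding case_prod_beta by (rule avg_swap)
    also have "\<dots> = avg ?L (\<lambda>hs. avg ?L (\<lambda>ks. bx p D [?w, ?w] (g hs ks)))"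
      unfolding bx_Cons[of p D ?w "[?w]"] by (simp add: avg_Times)
    finally show ?thesis .
  qed
  also have "\<dots> \<le> avg ?L (\<lambda>hs. avg ?L (\<lambda>ks. EV p D (\<lambda>x. (cmod (H hs ks x))\<^sup>2)))"
    unfolding H_def \<phi>_def by (intro avg_mono bx2_le_fh[OF p Bg])
  also have "\<dots> \<le> avg ?L (\<lambda>hs. avg ?L (\<lambda>ks. EV p D (\<lambda>x. (cmod (H hs ks x))\<^sup>2 * \<iota> hs ks x + ?\<delta> / 2)))"
    by (intro avg_mono) (use \<delta> in \<open>auto simp: \<iota>_def\<close>)
  also have "\<dots> = avg ?L (\<lambda>hs. avg ?L (\<lambda>ks. EV p D (\<lambda>x. (cmod (H hs ks x))\<^sup>2 * \<iota> hs ks x))) + ?\<delta> / 2"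
    by (simp only: avg_add avg_const[OF finite_Fp_vec Fp_vec_nonempty[OF p]] avg_const[OF finite_LS LS_nonempty[OF p]])
  finally have "?\<delta> / 2 \<le> avg ?L (\<lambda>hs. avg ?L (\<lambda>ks. EV p D (\<lambda>x. (cmod (H hs ks x))\<^sup>2 * \<iota> hs ks x)))" by simp
  also have "\<dots> = cmod (complex_of_real (avg ?L (\<lambda>hs. avg ?L (\<lambda>ks. EV p D (\<lambda>x. (cmod (H hs ks x))\<^sup>2 * \<iota> hs ks x)))))"
    by (subst norm_of_real, subst abs_of_nonneg) (auto intro!: avg_nonneg mult_nonneg_nonneg \<iota>01)
  also have "complex_of_real (avg ?L (\<lambda>hs. avg ?L (\<lambda>ks. EV p D (\<lambda>x. (cmod (H hs ks x))\<^sup>2 * \<iota> hs ks x))))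
     = avg ?L (\<lambda>hs. avg ?L (\<lambda>ks. EV p D (\<lambda>x. dml us hs ks ?G x * ch hs ks x)))"
  proof -
    have "EV p D (\<lambda>x. complex_of_real ((cmod (H hs ks x))\<^sup>2 * \<iota> hs ks x)) = EV p D (\<lambda>x. dml us hs ks ?G x * ch hs ks x)" for hs ks
      using EV_fh[OF p Bg \<iota>per \<iota>sh, of hs ks hs ks] unfolding ch_def H_def \<phi>_def g_def by (rule sym)
    then show ?thesis by (simp only: avg_of_real[symmetric])
  qed
  finally have "(?\<delta> / 2) ^ (2 ^ ?r) \<le> cmod (avg ?L (\<lambda>hs. avg ?L (\<lambda>ks. EV p D (\<lambda>x. dml us hs ks ?G x * ch hs ks x)))) ^ (2 ^ ?r)"
    by (rule power_mono) (use \<delta> in simp)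
  also have "\<dots> \<le> avg ?L (\<lambda>ks'. avg ?L (\<lambda>hs. avg ?L (\<lambda>ks. avg (Fp p \<times> (UNIV :: bool set)) (\<lambda>z. cmod (Lam p D (\<lambda>_. 1) w (dml us hs ks f0)
        ((\<lambda>i. dml us hs ks (f i))(j := \<lambda>x. dl (\<lambda>l. ch l ks' (x + - (if snd z then 0 else sm (fst z) ?w))) hs ks)))))))"
    by (rule family_interchange[where f = f and F = ?G, OF p j(1) B _ _ _ us Bch Gf_avg[OF p]]) (use Fp_nonempty[OF p] in auto)
  finally have 1: "(?\<delta> / 2) ^ (2 ^ ?r) \<le> avg ?L (\<lambda>ks'. avg ?L (\<lambda>hs. avg ?L (\<lambda>ks. avg (Fp p \<times> (UNIV :: bool set)) (\<lambda>z. cmod (Lam p D (\<lambda>_. 1) w (dml us hs ks f0)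
        ((\<lambda>i. dml us hs ks (f i))(j := \<lambda>x. dl (\<lambda>l. ch l ks' (x + - (if snd z then 0 else sm (fst z) ?w))) hs ks)))))))" .
  let ?T = "?L \<times> ?L \<times> ?L \<times> (Fp p \<times> (UNIV :: bool set))"
  define X where "X ks' hs ks x = dl (\<lambda>l. ch l ks' x) hs ks" for ks' hs ks x
  define A where "A t = (case t of (ks', hs, ks, z) \<Rightarrow> cmod (Lam p D (\<lambda>_. 1) w (dml us hs ks f0)
        ((\<lambda>i. dml us hs ks (f i))(j := \<lambda>x. X ks' hs ks (x + - (if snd z then 0 else sm (fst z) ?w))))))"
    for t :: "int list \<times> int list \<times> int list \<times> int \<times> bool"
  have T: "finite ?T" "?T \<noteq> {}" using LS_nonempty[OF p] Fp_nonempty[OF p] by auto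
  have 2: "(?\<delta> / 2) ^ (2 ^ ?r) \<le> avg ?T A" using 1 unfolding A_def X_def by (simp add: avg_Times)
  \<comment> \<open>The alternating sum of the dominant frequencies over the cube. A cube product of
    eigenfunctions is an eigenfunction, here with frequency minus this sum.\<close>
  define D' where "D' ks' hs ks x = dls (\<lambda>l. \<phi> l ks' x) hs ks" for ks' hs ks x
  have Xsh: "X ks' hs ks (x + sm m ?w) = X ks' hs ks x * e_p p (- D' ks' hs ks x * m)" for ks' hs ks x m
  proof -
    have "X ks' hs ks (x + sm m ?w) = X ks' hs ks x * dl (\<lambda>l. e_p p (- \<phi> l ks' x * m)) hs ks"
      unfolding X_def chsh dl_mult ..
    also have "dl (\<lambda>l. e_p p (- \<phi> l ks' x * m)) hs ks = dl (\<lambda>l. e_p p (\<phi> l ks' x * (- m))) hs ks" by simp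
    also have "\<dots> = e_p p (D' ks' hs ks x * (- m))" unfolding D'_def by (rule dl_e_p)
    finally show ?thesis by (simp only: mult_minus_left mult_minus_right)
  qed
  have BX: "B1 p D (X ks' hs ks)" for ks' hs ks unfolding X_def by (rule B1_dl) (rule Bch)
  have EX: "Eig p ?w (X ks' hs ks)" for ks' hs ks unfolding Eig_def using Xsh by blast
  \<comment> \<open>The line mean of the eigenfunction \<open>X\<close> is \<open>X\<close> or zero
    according to whether \<open>p\<close> divides its frequency. So \<open>Zb\<close> measures how
    often the frequencies cancel over a cube.\<close>
  define Zt where "Zt ks' hs ks = EV p D (\<lambda>x. cmod (X ks' hs ks x) * (if int p dvd D' ks' hs ks x then 1 else 0))" for ks' hs ks
  have Zmean: "EV p D (\<lambda>x. cmod (EY p (\<lambda>n. X ks' hs ks (x + v + sm n ?w)))) = Zt ks' hs ks" for ks' hs ks v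
  proof -
    have pe: "per p D (\<lambda>x. cmod (EY p (\<lambda>n. X ks' hs ks (x + sm n ?w))))"
      using B1_per[OF B1_line_mean[OF p BX]] unfolding per_def by metis
    have "EV p D (\<lambda>x. cmod (EY p (\<lambda>n. X ks' hs ks (x + v + sm n ?w)))) = EV p D (\<lambda>x. cmod (EY p (\<lambda>n. X ks' hs ks (x + sm n ?w))))"
      by (rule EV_shift[OF p pe])
    also have "\<dots> = Zt ks' hs ks"
      unfolding Zt_def
    proof (rule avg_cong)
      fix x
      have "EY p (\<lambda>n. X ks' hs ks (x + sm n ?w)) = X ks' hs ks x * (if int p dvd - D' ks' hs ks x then 1 else 0)"
        unfolding Xsh avg_cmult EY_e_p[OF p] ..
      then show "cmod (EY p (\<lambda>n. X ks' hs ks (x + sm n ?w))) = cmod (X ks' hs ks x) * (if int p dvd D' ks' hs ks x then 1 else 0)"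
        by (simp add: norm_mult)
    qed
    finally show ?thesis .
  qed
  define Zb where "Zb = avg ?L (\<lambda>ks'. avg ?L (\<lambda>hs. avg ?L (\<lambda>ks. Zt ks' hs ks)))"
  have Z0: "0 \<le> Zb" unfolding Zb_def Zt_def by (intro avg_nonneg) simp
  have 3: "((?\<delta> / 2) ^ (2 ^ ?r)) ^ K' \<le> real K' * (\<beta> + Zb)"
  proof -
    have "((?\<delta> / 2) ^ (2 ^ ?r)) ^ K' \<le> (avg ?T A) ^ K'" by (rule power_mono[OF 2]) (use \<delta> in simp)
    also have "\<dots> \<le> avg ?T (\<lambda>t. A t ^ K')" by (rule avg_power_le[OF T]) (auto simp: A_def)
    also have "\<dots> \<le> avg ?T (\<lambda>t. real K' * (\<beta> + (case t of (ks', hs, ks, z) \<Rightarrow> Zt ks' hs ks)))"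
    proof (rule avg_mono)
      fix t :: "int list \<times> int list \<times> int list \<times> int \<times> bool"
      obtain ks' hs ks z where t: "t = (ks', hs, ks, z)" by (cases t)
      let ?v = "- (if snd z then 0 else sm (fst z) ?w)"
      let ?g = "(\<lambda>i. dml us hs ks (f i))(j := \<lambda>x. X ks' hs ks (x + ?v))"
      have "fam p D (insert j E) w (dml us hs ks f0) ?g"
        unfolding fam_def
      proof (intro conjI ballI)
        show "B1 p D (dml us hs ks f0)" by (rule B1_dml[OF B(1)])
        show "B1 p D (?g i)" if "i \<in> I" for i
          using B1_dml[OF B(2)[OF that]] B1_shift[OF BX, of ks' hs ks ?v] by (cases "i = j") (simp_all only: fun_upd_same fun_upd_other not_False_eq_True)
        show "Eig p (w i) (?g i)" if "i \<in> insert j E" for i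
        proof (cases "i = j")
          case True
          then show ?thesis using Eig_shift[OF EX, of ks' hs ks ?v] by (simp only: fun_upd_same)
        next
          case False
          then have "Eig p (w i) (f i)" using that fam unfolding fam_def by blast
          from Eig_dml[OF this] False show ?thesis by simp
        qed
      qed
      from Xat_control[OF X p K b _ this j(1)]
      have "A t ^ K' \<le> real K' * (\<beta> + EV p D (\<lambda>x. cmod (EY p (\<lambda>n. X ks' hs ks (x + sm n ?w + ?v)))))"
        unfolding t A_def K'_def prod.case fun_upd_same by simp
      moreover have "(\<lambda>x. cmod (EY p (\<lambda>n. X ks' hs ks (x + sm n ?w + ?v)))) = (\<lambda>x. cmod (EY p (\<lambda>n. X ks' hs ks (x + ?v + sm n ?w))))"
        by (simp only: ac_simps)
      ultimately show "A t ^ K' \<le> real K' * (\<beta> + (case t of (ks', hs, ks, z) \<Rightarrow> Zt ks' hs ks))"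
        by (simp only: t prod.case Zmean)
    qed
    also have "\<dots> = real K' * (\<beta> + avg ?T (\<lambda>t. case t of (ks', hs, ks, z) \<Rightarrow> Zt ks' hs ks))"
      by (simp only: avg_cmult avg_add avg_const[OF T])
    also have "avg ?T (\<lambda>t. case t of (ks', hs, ks, z) \<Rightarrow> Zt ks' hs ks) = Zb"
      unfolding Zb_def avg_Times prod.case by (simp only: avg_const[OF finite_Fp Fp_nonempty[OF p]] avg_const[OF finite UNIV_not_empty])
    finally show ?thesis .
  qed
  define N where "N = 2 ^ ?r * K'"
  define C where "C = 2 ^ N * K'"
  have C: "1 \<le> C" using K' by (simp add: C_def)
  have 4: "?\<delta> ^ N \<le> real C * (\<beta> + Zb)"
  proof -
    have "?\<delta> ^ N = 2 ^ N * ((?\<delta> / 2) ^ (2 ^ ?r)) ^ K'" by (simp add: N_def power_mult[symmetric] power_divide)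
    also have "\<dots> \<le> 2 ^ N * (real K' * (\<beta> + Zb))" using 3 by (rule mult_left_mono) simp
    finally show ?thesis by (simp add: C_def mult.assoc)
  qed
  \<comment> \<open>When the alternating sum vanishes modulo \<open>p\<close>, the phase at the
    vertex \<open>hs\<close> is the conjugate of the product of the phases at the other vertices,
    each of which ignores a coordinate of \<open>hs\<close>.\<close>
  define \<epsilon> where "\<epsilon> ks' x n l = e_p p (\<phi> l ks' x * (- n))" for ks' x n l
  define S where "S = avg ?L (\<lambda>ks'. avg ?L (\<lambda>hs. avg ?L (\<lambda>ks. EV p D (\<lambda>x.
      (cmod (EY p (\<lambda>n. g hs ks' (x + sm n ?w) * cnj (lowp (\<epsilon> ks' x n) ks hs))))\<^sup>2))))"
  have S0: "0 \<le> S" unfolding S_def by (intro avg_nonneg) simp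
  have 5: "?\<delta> * Zb \<le> 2 * S"
  proof -
    have "?\<delta> * Zb = avg ?L (\<lambda>ks'. avg ?L (\<lambda>hs. avg ?L (\<lambda>ks. EV p D (\<lambda>x. ?\<delta> * (cmod (X ks' hs ks x) * (if int p dvd D' ks' hs ks x then 1 else 0))))))"
      unfolding Zb_def Zt_def by (simp only: avg_cmult)
    also have "\<dots> \<le> avg ?L (\<lambda>ks'. avg ?L (\<lambda>hs. avg ?L (\<lambda>ks. EV p D (\<lambda>x.
      2 * (cmod (EY p (\<lambda>n. g hs ks' (x + sm n ?w) * cnj (lowp (\<epsilon> ks' x n) ks hs))))\<^sup>2))))"
    proof (intro avg_mono)
      fix ks' hs ks x
      show "?\<delta> * (cmod (X ks' hs ks x) * (if int p dvd D' ks' hs ks x then 1 else 0))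
        \<le> 2 * (cmod (EY p (\<lambda>n. g hs ks' (x + sm n ?w) * cnj (lowp (\<epsilon> ks' x n) ks hs))))\<^sup>2"
      proof (cases "int p dvd D' ks' hs ks x")
        case True
        have eps: "cnj (lowp (\<epsilon> ks' x n) ks hs) = \<epsilon> ks' x n hs" for n
        proof -
          have "\<epsilon> ks' x n hs * lowp (\<epsilon> ks' x n) ks hs = dl (\<epsilon> ks' x n) hs ks" by (rule dl_eq_lowp[symmetric])
          also have "\<dots> = e_p p (D' ks' hs ks x * (- n))" unfolding \<epsilon>_def D'_def by (rule dl_e_p)
          also have "\<dots> = 1" using True by (intro e_p_dvd[OF p]) simp
          finally show ?thesis by (intro norm_one_cnj[symmetric]) (simp_all add: \<epsilon>_def)
        qed
        have "EY p (\<lambda>n. g hs ks' (x + sm n ?w) * cnj (lowp (\<epsilon> ks' x n) ks hs)) = H hs ks' x"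
          unfolding eps \<epsilon>_def H_def fh_def by simp
        moreover have "?\<delta> * cmod (X ks' hs ks x) \<le> 2 * (cmod (H hs ks' x))\<^sup>2"
        proof -
          \<comment> \<open>One vertex of the cube suffices: the others are bounded by 1, and
            \<open>ch\<close> is nonzero only where the cutoff guarantees a large
            coefficient.\<close>
          have "cmod (X ks' hs ks x) \<le> cmod (ch hs ks' x)"
            unfolding X_def by (rule norm_dl_le_hd) (use B1_norm[OF Bch] in auto)
          also have "\<dots> \<le> \<iota> hs ks' x" by (rule ch1)
          finally have "?\<delta> * cmod (X ks' hs ks x) \<le> ?\<delta> * \<iota> hs ks' x" using \<delta>(1) by (rule mult_left_mono)
          also have "\<dots> \<le> 2 * (cmod (H hs ks' x))\<^sup>2" by (simp add: \<iota>_def)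
          finally show ?thesis .
        qed
        ultimately show ?thesis using True by simp
      qed simp
    qed
    also have "\<dots> = 2 * S" unfolding S_def by (simp only: avg_cmult)
    finally show ?thesis .
  qed
  have 6: "S ^ (2 ^ ?r) \<le> bx p D (?w # us) ?G"
  proof -
    let ?Y = "?L \<times> ?L \<times> Fp_vec p D \<times> (Fp p \<times> Fp p)"
    have Y: "finite ?Y" "?Y \<noteq> {}" using LS_nonempty[OF p] Fp_nonempty[OF p] Fp_vec_nonempty[OF p] by auto
    \<comment> \<open>Expanding the square doubles the variable of the line. The remaining vertices
      of the derivative and all phases \<open>\<epsilon>\<close> are of lower order in
      \<open>hs\<close>, so \<open>box_CS\<close> leaves only derivatives of the function in the
      directions \<open>w j\<close> and \<open>us\<close>.\<close>
    define Q where "Q z = (case z of (ks', ks, x, n, m) \<Rightarrow> avg ?L (\<lambda>hs. dm ?w n m ?G (x + dot hs us) *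
       ((lowp (\<lambda>l. ?G (x + sm n ?w + dot l us)) ks' hs * cnj (lowp (\<lambda>l. ?G (x + sm m ?w + dot l us)) ks' hs)) *
        (cnj (lowp (\<epsilon> ks' x n) ks hs) * lowp (\<epsilon> ks' x m) ks hs))))"
      for z :: "int list \<times> int list \<times> vec \<times> int \<times> int"
    have "complex_of_real S = avg ?L (\<lambda>ks'. avg ?L (\<lambda>hs. avg ?L (\<lambda>ks. EV p D (\<lambda>x. EY p (\<lambda>n. EY p (\<lambda>m.
      (g hs ks' (x + sm n ?w) * cnj (lowp (\<epsilon> ks' x n) ks hs)) * cnj (g hs ks' (x + sm m ?w) * cnj (lowp (\<epsilon> ks' x m) ks hs))))))))"
      unfolding S_def by (simp only: avg_of_real[symmetric] avg_square_expand)
    also have "\<dots> = avg ?L (\<lambda>ks'. avg ?L (\<lambda>hs. avg (?L \<times> Fp_vec p D \<times> (Fp p \<times> Fp p)) (\<lambda>(ks, x, n, m).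
      (g hs ks' (x + sm n ?w) * cnj (lowp (\<epsilon> ks' x n) ks hs)) * cnj (g hs ks' (x + sm m ?w) * cnj (lowp (\<epsilon> ks' x m) ks hs)))))"
      by (simp only: avg_Times prod.case)
    also have "\<dots> = avg ?L (\<lambda>ks'. avg (?L \<times> Fp_vec p D \<times> (Fp p \<times> Fp p)) (\<lambda>z. Q (ks', z)))"
    proof (rule avg_cong)
      fix ks'
      have "avg ?L (\<lambda>hs. case z of (ks, x, n, m) \<Rightarrow>
          (g hs ks' (x + sm n ?w) * cnj (lowp (\<epsilon> ks' x n) ks hs)) * cnj (g hs ks' (x + sm m ?w) * cnj (lowp (\<epsilon> ks' x m) ks hs))) = Q (ks', z)" for z
        unfolding Q_def g_def dml_def dl_eq_lowp dm_def
        by (simp add: split_beta ac_simps)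
      then show "avg ?L (\<lambda>hs. avg (?L \<times> Fp_vec p D \<times> (Fp p \<times> Fp p)) (\<lambda>(ks, x, n, m).
      (g hs ks' (x + sm n ?w) * cnj (lowp (\<epsilon> ks' x n) ks hs)) * cnj (g hs ks' (x + sm m ?w) * cnj (lowp (\<epsilon> ks' x m) ks hs))))
        = avg (?L \<times> Fp_vec p D \<times> (Fp p \<times> Fp p)) (\<lambda>z. Q (ks', z))"
        by (subst avg_swap) (simp only:)
    qed
    also have "\<dots> = avg ?Y Q" by (simp only: avg_Times)
    finally have e: "complex_of_real S = avg ?Y Q" .
    have "S = cmod (complex_of_real S)" using S0 by (simp only: norm_of_real abs_of_nonneg)
    also have "\<dots> = cmod (avg ?Y (\<lambda>z. 1 * Q z))" by (simp only: e mult_1)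
    finally have "S ^ (2 ^ ?r) = cmod (avg ?Y (\<lambda>z. 1 * Q z)) ^ (2 ^ ?r)" by (rule arg_cong)
    also have "\<dots> \<le> avg ?Y (\<lambda>z. cmod (Q z) ^ (2 ^ ?r))"
      by (rule norm_avg_power_le[OF Y]) simp
    also have "\<dots> \<le> avg ?Y (\<lambda>(ks', ks, x, n, m). Re (avg ?L (\<lambda>hs. avg ?L (\<lambda>l. dml us hs l (dm ?w n m ?G) x))))"
    proof (rule avg_mono)
      fix z :: "int list \<times> int list \<times> vec \<times> int \<times> int"
      obtain ks' ks x n m where z: "z = (ks', ks, x, n, m)" by (cases z)
      obtain r where r: "?r = Suc r" using us by (cases us) auto
      have eps1: "cmod (\<epsilon> ks' x n l) \<le> 1" for n l by (simp add: \<epsilon>_def)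
      have "low (Suc r) (\<lambda>hs. (lowp (\<lambda>l. ?G (x + sm n ?w + dot l us)) ks' hs * cnj (lowp (\<lambda>l. ?G (x + sm m ?w + dot l us)) ks' hs)) *
        (cnj (lowp (\<epsilon> ks' x n) ks hs) * lowp (\<epsilon> ks' x m) ks hs))"
        by (intro low_mult low_cnj low_lowp B1_norm[OF BG] eps1)
      from box_CS[OF p this, of "\<lambda>hs. dm ?w n m ?G (x + dot hs us)"]
      show "cmod (Q z) ^ (2 ^ ?r) \<le> (case z of (ks', ks, x, n, m) \<Rightarrow> Re (avg ?L (\<lambda>hs. avg ?L (\<lambda>l. dml us hs l (dm ?w n m ?G) x))))"
        unfolding z Q_def prod.case r dml_def .
    qed
    also have "\<dots> = EV p D (\<lambda>x. EY p (\<lambda>n. EY p (\<lambda>m. Re (avg ?L (\<lambda>hs. avg ?L (\<lambda>l. dml us hs l (dm ?w n m ?G) x))))))"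
      by (simp only: avg_Times prod.case avg_const[OF finite_LS LS_nonempty[OF p]])
    also have "\<dots> = EY p (\<lambda>n. EY p (\<lambda>m. Re (EV p D (\<lambda>x. avg ?L (\<lambda>hs. avg ?L (\<lambda>l. dml us hs l (dm ?w n m ?G) x))))))"
      by (subst avg_swap) (subst (2) avg_swap, simp only: avg_Re)
    also have "\<dots> = EY p (\<lambda>n. EY p (\<lambda>m. bx p D us (dm ?w n m ?G)))"
    proof -
      have "EV p D (\<lambda>x. avg ?L (\<lambda>hs. avg ?L (\<lambda>l. dml us hs l f x))) = avg ?L (\<lambda>hs. avg ?L (\<lambda>l. EV p D (dml us hs l f)))" for f
        by (subst avg_swap) (subst (2) avg_swap, rule refl)
      then show ?thesis by (simp only: bx_def avg_Re)
    qed
    also have "\<dots> = bx p D (?w # us) ?G" by (rule bx_Cons[symmetric])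
    finally show ?thesis .
  qed
  show ?thesis
    by (rule lower_loss[OF \<delta> b C _ Z0 S0 4 5 6 _ big]) (simp_all add: M N_def C_def K'_def)
qed

end

section \<open>From degree two control to one eigenfunction fewer\<close>

lemma EV_pair:
  assumes p: "p > 0" and A: "per p D A"
  shows "EV p D (\<lambda>z. EV p D (\<lambda>x. A x * cnj (A (x + z)))) = complex_of_real ((cmod (EV p D A))\<^sup>2)"
proof -
  have "EV p D (\<lambda>z. cnj (A (x + z))) = EV p D (\<lambda>z. cnj (A z))" for x
  proof -
    have "per p D (\<lambda>z. cnj (A z))" using A unfolding per_def by metis
    from EV_shift[OF p this, of x] show ?thesis by (simp only: add.commute[of x])
  qed
  then have "EV p D (\<lambda>x. EV p D (\<lambda>z. A x * cnj (A (x + z)))) = EV p D (\<lambda>x. EV p D (\<lambda>z. A x * cnj (A z)))"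
    by (simp only: avg_cmult)
  then show ?thesis by (simp only: avg_square_expand) (rule trans[OF avg_swap])
qed

lemma final_loss:
  fixes t a b \<beta> :: real
  assumes t: "0 \<le> t" "t \<le> 1" "t \<le> max a b" and K: "1 \<le> N" "1 \<le> L" and \<beta>: "0 \<le> \<beta>"
    and a: "0 \<le> a" "a ^ N \<le> real A * \<beta>" and b: "0 \<le> b" "b ^ L \<le> real B * \<beta>"
    and M: "N \<le> M" "L \<le> M" "A \<le> M" "B \<le> M"
  shows "t ^ M \<le> real M * \<beta>"
proof (cases "a \<le> b")
  case True
  have "t ^ M \<le> t ^ L" using t M by (intro power_antimono)
  also have "\<dots> \<le> b ^ L" using t True by (intro power_mono) auto
  also have "\<dots> \<le> real M * \<beta>" using b(2) mult_right_mono[of "real B" "real M" \<beta>] M \<beta> by simp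
  finally show ?thesis .
next
  case False
  have "t ^ M \<le> t ^ N" using t M by (intro power_antimono)
  also have "\<dots> \<le> a ^ N" using t False by (intro power_mono) auto
  also have "\<dots> \<le> real M * \<beta>" using a(2) mult_right_mono[of "real A" "real M" \<beta>] M \<beta> by simp
  finally show ?thesis .
qed

context polys
begin

text \<open>Iteration of \<open>degree_lowering\<close> from \<open>s + 2\<close> copies of
  \<open>w j\<close> down to two. It stops there because the list \<open>us\<close> of further
  directions has to be nonempty.\<close>

lemma lower_chain:
  assumes K: "1 \<le> K"
  shows "\<exists>M\<ge>1. \<forall>p D \<beta> j E w f0 f. p > 0 \<longrightarrow> 0 \<le> \<beta> \<longrightarrow> j \<in> I \<longrightarrow> j \<notin> E \<longrightarrow> fam p D E w f0 f \<longrightarrow>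
     Xat K (insert j E) p D \<beta> (\<lambda>_. 1) w \<longrightarrow>
     real M * \<beta> < bx p D (replicate (Suc (Suc s)) (w j)) (Gf p (\<lambda>_. 1) w j f0 f) ^ M \<longrightarrow>
     bx p D (replicate (Suc (Suc s)) (w j)) (Gf p (\<lambda>_. 1) w j f0 f) ^ M \<le> real M * bx p D [w j, w j] (Gf p (\<lambda>_. 1) w j f0 f)"
proof (induction s)
  case 0
  show ?case by (intro exI[of _ 1]) simp
next
  case (Suc s)
  then obtain M2 where M2: "1 \<le> M2" and E2: "\<And>p D \<beta> j E w f0 f. p > 0 \<Longrightarrow> 0 \<le> \<beta> \<Longrightarrow> j \<in> I \<Longrightarrow> j \<notin> E \<Longrightarrow> fam p D E w f0 f \<Longrightarrow>
     Xat K (insert j E) p D \<beta> (\<lambda>_. 1) w \<Longrightarrow>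
     real M2 * \<beta> < bx p D (replicate (Suc (Suc s)) (w j)) (Gf p (\<lambda>_. 1) w j f0 f) ^ M2 \<Longrightarrow>
     bx p D (replicate (Suc (Suc s)) (w j)) (Gf p (\<lambda>_. 1) w j f0 f) ^ M2 \<le> real M2 * bx p D [w j, w j] (Gf p (\<lambda>_. 1) w j f0 f)"
    by blast
  define M1 where "M1 = (2 ^ Suc s * (4 ^ K * K) + 1) * 2 ^ Suc s * (4 * (2 ^ (2 ^ Suc s * (4 ^ K * K)) * (4 ^ K * K))) ^ (2 ^ Suc s)"
  have "M1 \<noteq> 0" using K unfolding M1_def by simp
  then have M1: "1 \<le> M1" by simp
  define M where "M = cmp M1 M2"
  have M: "1 \<le> M" "M1 \<le> M" using cmp_ge[OF M1 M2] by (auto simp: M_def)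
  show ?case
  proof (intro exI[of _ M] conjI allI impI M(1))
    fix p D \<beta> j E w f0 f
    assume *: "p > 0" "0 \<le> \<beta>" "j \<in> I" "j \<notin> E" "fam p D E w f0 f" "Xat K (insert j E) p D \<beta> (\<lambda>_. 1) w"
     and big: "real M * \<beta> < bx p D (replicate (Suc (Suc (Suc s))) (w j)) (Gf p (\<lambda>_. 1) w j f0 f) ^ M"
    let ?G = "Gf p (\<lambda>_. 1) w j f0 f"
    let ?us = "replicate (Suc s) (w j)"
    let ?\<delta> = "bx p D (w j # w j # ?us) ?G"
    have B: "B1 p D f0" "\<And>i. i \<in> I \<Longrightarrow> B1 p D (f i)" using *(5) unfolding fam_def by auto
    have BG: "B1 p D ?G" by (rule B1_Gf[OF *(1)]) (use B in auto)
    have \<delta>: "0 \<le> ?\<delta>" "?\<delta> \<le> 1" using bx_nonneg[OF *(1) BG, of "w j # w j # ?us"] bx_le_1[OF *(1) BG] by auto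
    have big': "real M * \<beta> < ?\<delta> ^ M" using big by (simp only: replicate_Suc)
    have le: "?\<delta> ^ M1 \<le> real M1 * bx p D (w j # ?us) ?G"
    proof (rule degree_lowering[OF *(1,2) K *(3,4) _ *(5,6)])
      show "?us \<noteq> []" by simp
      show "real M1 * \<beta> < ?\<delta> ^ M1" by (rule loss_mono[OF \<delta> *(2) M(2) big'])
      show "M1 = (2 ^ length ?us * (4 ^ K * K) + 1) * 2 ^ length ?us * (4 * (2 ^ (2 ^ length ?us * (4 ^ K * K)) * (4 ^ K * K))) ^ (2 ^ length ?us)"
        by (simp only: M1_def length_replicate)
    qed
    note c = loss_chain[OF \<delta> *(2) M1 M2 _ big' le]
    have "real M2 * \<beta> < bx p D (w j # ?us) ?G ^ M2" by (rule c(1)) (simp add: M_def cmp_def)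
    then have "bx p D (w j # ?us) ?G ^ M2 \<le> real M2 * bx p D [w j, w j] ?G"
      using E2[OF *] by (simp only: replicate_Suc)
    then have "?\<delta> ^ M \<le> real M * bx p D [w j, w j] ?G" by (rule c(2)[rotated]) (simp add: M_def cmp_def)
    then show "bx p D (replicate (Suc (Suc (Suc s))) (w j)) ?G ^ M \<le> real M * bx p D [w j, w j] ?G"
      by (simp only: replicate_Suc)
  qed
qed

text \<open>The case \<open>insert j E\<close> is used twice. The line mean of \<open>f j\<close> is
  an eigenfunction and carries the main term. The rest of \<open>f j\<close> sees only the mean-zero
  part of the dual function; by \<open>H2\<close> its mean square is controlled by a degree two
  norm, which in turn is a correlation with an eigenfunction without main term.\<close>

lemma Xat_from_U2:
  assumes p: "p > 0" and b: "0 \<le> \<beta>" "\<beta> \<le> 1" and K1: "1 \<le> K1" and M2: "1 \<le> M2" and j: "j \<in> I" "j \<notin> E"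
    and th: "\<And>y. cmod (\<theta> y) \<le> 1" and X: "Xat K1 (insert j E) p D \<beta> \<theta> w"
    and H2: "\<And>f0 f. fam p D E w f0 f \<Longrightarrow>
      real M2 * \<beta> < cmod (Lam p D \<theta> w f0 (f(j := \<lambda>x. cnj (Gf p \<theta> w j f0 f x)))) ^ M2 \<Longrightarrow>
      cmod (Lam p D \<theta> w f0 (f(j := \<lambda>x. cnj (Gf p \<theta> w j f0 f x)))) ^ M2 \<le> real M2 * bx p D [w j, w j] (Gf p \<theta> w j f0 f)"
  shows "Xat (2 * M2 * K1 * (8 ^ (M2 * K1) * M2 ^ K1 * K1 + 2 ^ K1 * K1)) E p D \<beta> \<theta> w"
  unfolding Xat_def
proof (intro allI impI)
  fix f0 f assume fam: "fam p D E w f0 f"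
  have B: "B1 p D f0" "\<And>i. i \<in> I \<Longrightarrow> B1 p D (f i)" using fam unfolding fam_def by auto
  let ?F = "Fd p \<theta> w j f0 f" and ?G = "Gf p \<theta> w j f0 f" and ?w = "w j"
  have BF: "B1 p D ?F" by (rule B1_Fd[OF p B(1) _ th]) (use B in auto)
  have BG: "B1 p D ?G" by (rule B1_Gf[OF p B(1) _ th]) (use B in auto)
  have G0: "EY p (\<lambda>n. ?G (x + sm n ?w)) = 0" for x by (rule Gf_line_mean[OF p B(1) _ th]) (use B in auto)
  define M where "M x = EY p (\<lambda>n. ?F (x + sm n ?w))" for x
  have BM: "B1 p D M" unfolding M_def by (rule B1_line_mean[OF p BF])
  have Minv: "M (x + sm n ?w) = M x" for x n unfolding M_def by (rule line_mean_invariant[OF p B1_per[OF BF]])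
  have FG: "?F x = 2 * ?G x + M x" for x by (simp add: Gf_def M_def field_simps)
  have dual: "Lam p D \<theta> w f0 (f(j := g)) = EV p D (\<lambda>x. ?F x * g x)" if g: "B1 p D g" for g
  proof -
    have "B1 p D ((f(j := g)) i)" if "i \<in> I" for i using B(2)[OF that] g by simp
    from Lam_dual[where f = "f(j := g)" and \<theta> = \<theta> and w = w, OF p j(1) B(1) this] show ?thesis
      by (simp only: Fd_upd fun_upd_same)
  qed
  have orth: "EV p D (\<lambda>x. ?F x * g x) = 2 * EV p D (\<lambda>x. ?G x * g x)"
    if g: "per p D g" and g0: "\<And>x. EY p (\<lambda>n. g (x + sm n ?w)) = 0" for g
  proof -
    have "EV p D (\<lambda>x. g x * M x) = EV p D (\<lambda>x. EY p (\<lambda>n. g (x + sm n ?w)) * M x)"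
      by (rule EV_mult_line_mean[OF p g B1_per[OF BM] Minv])
    then have z: "EV p D (\<lambda>x. M x * g x) = 0" unfolding g0 by (simp add: mult.commute avg_def)
    have "EV p D (\<lambda>x. ?F x * g x) = EV p D (\<lambda>x. 2 * (?G x * g x) + M x * g x)"
      by (simp only: FG distrib_right mult.assoc)
    also have "\<dots> = 2 * EV p D (\<lambda>x. ?G x * g x)" by (simp only: avg_add avg_cmult z add_0_right)
    finally show ?thesis .
  qed
  \<comment> \<open>Invariant in direction \<open>w j\<close>, hence an eigenfunction of frequency
    zero. It has the same line means as \<open>f j\<close>, so the main term does not
    change.\<close>
  define m where "m x = EY p (\<lambda>n. f j (x + sm n ?w))" for x
  have Bm: "B1 p D m" unfolding m_def by (rule B1_line_mean[OF p B(2)[OF j(1)]])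
  have minv: "m (x + sm n ?w) = m x" for x n unfolding m_def by (rule line_mean_invariant[OF p B1_per[OF B(2)[OF j(1)]]])
  have EYm: "EY p (\<lambda>n. m (x + sm n ?w)) = m x" for x
    unfolding minv by (rule avg_const[OF finite_Fp Fp_nonempty[OF p]])
  have fam_m: "fam p D (insert j E) w f0 (f(j := m))"
    unfolding fam_def
  proof (intro conjI ballI)
    show "B1 p D ((f(j := m)) i)" if "i \<in> I" for i using B(2)[OF that] Bm by simp
    show "Eig p (w i) ((f(j := m)) i)" if "i \<in> insert j E" for i
      using that fam Eig_invariant[OF minv] j(2) by (auto simp: fam_def)
  qed (rule B(1))
  have Mn_eq: "Mn p D \<theta> w f0 f = Mn p D \<theta> w f0 (f(j := m))"
  proof -
    have "EY p (\<lambda>n. (f(j := m)) i (x + sm n (w i))) = EY p (\<lambda>n. f i (x + sm n (w i)))" for x i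
      by (cases "i = j") (simp_all only: fun_upd_same fun_upd_other EYm m_def[symmetric] not_False_eq_True)
    then show ?thesis unfolding Mn_def by (simp only:)
  qed
  define a where "a = cmod (EV p D (\<lambda>x. ?F x * (f j x - m x)))"
  define bb where "bb = cmod (Lam p D \<theta> w f0 (f(j := m)) - Mn p D \<theta> w f0 (f(j := m)))"
  have bb: "(bb / 2) ^ K1 \<le> real K1 * \<beta>" using X fam_m unfolding Xat_def bb_def by blast
  have Lf: "Lam p D \<theta> w f0 f = EV p D (\<lambda>x. ?F x * f j x)"
    using Lam_dual[where f = f and \<theta> = \<theta> and w = w, OF p j(1) B] .
  have "Lam p D \<theta> w f0 f - Mn p D \<theta> w f0 f
     = EV p D (\<lambda>x. ?F x * (f j x - m x)) + (Lam p D \<theta> w f0 (f(j := m)) - Mn p D \<theta> w f0 (f(j := m)))"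
    unfolding Mn_eq Lf dual[OF Bm] right_diff_distrib avg_diff by simp
  then have tri: "cmod (Lam p D \<theta> w f0 f - Mn p D \<theta> w f0 f) \<le> a + bb"
    unfolding a_def bb_def by (metis norm_triangle_ineq)
  have perd: "per p D (\<lambda>x. f j x - m x)"
    using B1_per[OF B(2)[OF j(1)]] B1_per[OF Bm] unfolding per_def by metis
  have meand: "EY p (\<lambda>n. f j (x + sm n ?w) - m (x + sm n ?w)) = 0" for x
    unfolding avg_diff EYm m_def[symmetric] by simp
  \<comment> \<open>\<open>M\<close> is constant on the lines on which \<open>f j - m\<close> has
    mean zero, so only \<open>?G\<close> contributes.\<close>
  have a_eq: "a = 2 * cmod (EV p D (\<lambda>x. ?G x * (f j x - m x)))"
    unfolding a_def orth[OF perd meand] by (simp add: norm_mult)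
  define g2 where "g2 = EV p D (\<lambda>x. (cmod (?G x))\<^sup>2)"
  have g2: "0 \<le> g2" unfolding g2_def by (rule avg_square_nonneg)
  have "(cmod (EV p D (\<lambda>x. ?G x * (f j x - m x))))\<^sup>2 \<le> g2 * EV p D (\<lambda>x. (cmod (f j x - m x))\<^sup>2)"
    unfolding g2_def by (rule avg_CS_complex)
  also have "\<dots> \<le> g2 * 4"
  proof (rule mult_left_mono[OF avg_le_const g2])
    fix x
    have "cmod (f j x - m x) \<le> 2"
      using norm_triangle_ineq4[of "f j x" "m x"] B1_norm[OF B(2)[OF j(1)], of x] B1_norm[OF Bm, of x] by linarith
    then have "(cmod (f j x - m x))\<^sup>2 \<le> 2\<^sup>2" by (rule power_mono) simp
    then show "(cmod (f j x - m x))\<^sup>2 \<le> 4" by simp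
  qed (use Fp_vec_nonempty[OF p] in auto)
  finally have a2: "a\<^sup>2 \<le> 16 * g2" unfolding a_eq by (simp add: power_mult_distrib)
  define lam where "lam = cmod (Lam p D \<theta> w f0 (f(j := \<lambda>x. cnj (?G x))))"
  have "Lam p D \<theta> w f0 (f(j := \<lambda>x. cnj (?G x))) = 2 * EV p D (\<lambda>x. ?G x * cnj (?G x))"
    unfolding dual[OF B1_cnj[OF BG]]
  proof (rule orth[OF B1_per[OF B1_cnj[OF BG]]])
    show "EY p (\<lambda>n. cnj (?G (x + sm n ?w))) = 0" for x unfolding avg_cnj[symmetric] G0 by simp
  qed
  also have "\<dots> = complex_of_real (2 * g2)"
    unfolding g2_def of_real_mult avg_of_real[symmetric] by (simp only: complex_norm_square of_real_numeral)
  finally have lam: "lam = 2 * g2" unfolding lam_def using g2 by (metis abs_of_nonneg mult_nonneg_nonneg norm_of_real zero_le_numeral)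
  then have a3: "a\<^sup>2 \<le> 8 * lam" using a2 by simp
  have lam0: "0 \<le> lam" unfolding lam_def by simp
  \<comment> \<open>The dominant Fourier coefficients of \<open>?G\<close> on its lines give an
    eigenfunction \<open>ch\<close> correlating with it. Its line means vanish, so the estimate for
    \<open>insert j E\<close> bounds the correlation itself.\<close>
  have mu: "bx p D [?w, ?w] ?G ^ K1 \<le> real K1 * \<beta>"
  proof -
    define H where "H x = fh p ?w ?G x (frq p ?w ?G x)" for x
    define ch where "ch x = cnj (H x)" for x
    have GP: "per p D ?G" using BG by (rule B1_per)
    have chsh: "ch (x + sm n ?w) = ch x * e_p p (- frq p ?w ?G x * n)" for x n
      unfolding ch_def H_def frq_shift[OF p GP] fh_shift[OF p GP] by (simp add: e_p_minus)
    have Bch: "B1 p D ch"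
      unfolding B1_def per_def ch_def H_def
    proof (intro conjI allI impI)
      fix x y assume c: "cg p D x y"
      show "cnj (fh p ?w ?G x (frq p ?w ?G x)) = cnj (fh p ?w ?G y (frq p ?w ?G y))"
        unfolding fh_cg[OF GP c] frq_cg[OF GP c] ..
    next
      fix x show "cmod (cnj (fh p ?w ?G x (frq p ?w ?G x))) \<le> 1" using norm_fh_le[OF p BG] by simp
    qed
    have mean0: "EY p (\<lambda>n. ch (x + sm n ?w)) = 0" for x
    proof (cases "int p dvd frq p ?w ?G x")
      case True
      \<comment> \<open>A dominant frequency divisible by \<open>p\<close> would make the
        coefficient a line mean of \<open>?G\<close>, and that is zero.\<close>
      have "H x = EY p (\<lambda>n. ?G (x + sm n ?w))"
        unfolding H_def fh_def using True by (intro avg_cong) (simp add: e_p_dvd[OF p])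
      then have "ch x = 0" unfolding ch_def G0 by simp
      then show ?thesis unfolding chsh by (simp add: avg_def)
    next
      case False
      then show ?thesis unfolding chsh avg_cmult EY_e_p[OF p] by simp
    qed
    have fam_c: "fam p D (insert j E) w f0 (f(j := ch))"
      unfolding fam_def
    proof (intro conjI ballI)
      show "B1 p D ((f(j := ch)) i)" if "i \<in> I" for i using B(2)[OF that] Bch by simp
      have "Eig p ?w ch" unfolding Eig_def using chsh by blast
      then show "Eig p (w i) ((f(j := ch)) i)" if "i \<in> insert j E" for i
        using that fam j(2) by (auto simp: fam_def)
    qed (rule B(1))
    have "Mn p D \<theta> w f0 (f(j := ch)) = 0"
    proof -
      have "(\<Prod>i\<in>I. EY p (\<lambda>n. (f(j := ch)) i (x + sm n (w i)))) = 0" for x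
        by (rule prod_zero[OF finI], rule bexI[OF _ j(1)]) (simp only: fun_upd_same mean0)
      then show ?thesis unfolding Mn_def by (simp add: avg_def)
    qed
    then have c1: "(cmod (Lam p D \<theta> w f0 (f(j := ch))) / 2) ^ K1 \<le> real K1 * \<beta>"
      using X fam_c unfolding Xat_def by (metis diff_0_right)
    have "Lam p D \<theta> w f0 (f(j := ch)) = 2 * EV p D (\<lambda>x. ?G x * ch x)"
      unfolding dual[OF Bch] by (rule orth[OF B1_per[OF Bch] mean0])
    also have "EV p D (\<lambda>x. ?G x * ch x) = complex_of_real (EV p D (\<lambda>x. (cmod (H x))\<^sup>2))"
      using EV_fh[OF p BG, of "\<lambda>_. 1" ?w] unfolding ch_def H_def avg_of_real[symmetric] by (simp add: per_def)
    finally have e: "Lam p D \<theta> w f0 (f(j := ch)) = 2 * complex_of_real (EV p D (\<lambda>x. (cmod (H x))\<^sup>2))" .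
    have "cmod (Lam p D \<theta> w f0 (f(j := ch))) / 2 = EV p D (\<lambda>x. (cmod (H x))\<^sup>2)"
      unfolding e using avg_square_nonneg[of "Fp_vec p D" "\<lambda>x. cmod (H x)"] by (simp add: norm_mult)
    moreover have "bx p D [?w, ?w] ?G \<le> EV p D (\<lambda>x. (cmod (H x))\<^sup>2)" unfolding H_def by (rule bx2_le_fh[OF p BG])
    moreover have "0 \<le> bx p D [?w, ?w] ?G" by (rule bx_nonneg[OF p BG]) simp
    ultimately show ?thesis using c1 power_mono[of "bx p D [?w, ?w] ?G" _ K1] by fastforce
  qed
  have lamK: "lam ^ (M2 * K1) \<le> real (M2 ^ K1 * K1) * \<beta>"
  proof (cases "real M2 * \<beta> < lam ^ M2")
    case True
    then have "lam ^ M2 \<le> real M2 * bx p D [?w, ?w] ?G" unfolding lam_def by (rule H2[OF fam])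
    then have "(lam ^ M2) ^ K1 \<le> (real M2 * bx p D [?w, ?w] ?G) ^ K1" using lam0 by (intro power_mono) auto
    also have "\<dots> \<le> real M2 ^ K1 * (real K1 * \<beta>)" unfolding power_mult_distrib using mu by (intro mult_left_mono) auto
    finally show ?thesis by (simp add: power_mult mult.assoc)
  next
    case False
    then have "(lam ^ M2) ^ K1 \<le> (real M2 * \<beta>) ^ K1" using lam0 by (intro power_mono) auto
    also have "\<dots> \<le> real M2 ^ K1 * (real K1 * \<beta>)"
      unfolding power_mult_distrib
    proof (rule mult_left_mono)
      have "\<beta> ^ K1 \<le> \<beta> ^ 1" using K1 by (rule power_antimono[OF b])
      also have "\<dots> \<le> real K1 * \<beta>" using mult_right_mono[of 1 "real K1" \<beta>] K1 b by simp
      finally show "\<beta> ^ K1 \<le> real K1 * \<beta>" .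
    qed simp
    finally show ?thesis by (simp add: power_mult mult.assoc)
  qed
  let ?N = "2 * M2 * K1"
  let ?Q = "8 ^ (M2 * K1) * M2 ^ K1 * K1 + 2 ^ K1 * K1"
  have aN: "a ^ ?N \<le> real (8 ^ (M2 * K1) * M2 ^ K1 * K1) * \<beta>"
  proof -
    have "a ^ ?N = (a\<^sup>2) ^ (M2 * K1)" by (simp add: power_mult[symmetric] mult.assoc)
    also have "\<dots> \<le> (8 * lam) ^ (M2 * K1)" using a3 by (intro power_mono) auto
    also have "\<dots> \<le> 8 ^ (M2 * K1) * (real (M2 ^ K1 * K1) * \<beta>)"
      unfolding power_mult_distrib using lamK by (intro mult_left_mono) auto
    finally show ?thesis by (simp add: mult.assoc)
  qed
  have bK: "bb ^ K1 \<le> real (2 ^ K1 * K1) * \<beta>"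
  proof -
    have "bb ^ K1 = 2 ^ K1 * (bb / 2) ^ K1" by (simp add: power_divide)
    also have "\<dots> \<le> 2 ^ K1 * (real K1 * \<beta>)" using bb by (rule mult_left_mono) simp
    finally show ?thesis by (simp add: mult.assoc)
  qed
  let ?t = "cmod (Lam p D \<theta> w f0 f - Mn p D \<theta> w f0 f) / 2"
  have t1: "?t \<le> 1"
  proof -
    have "cmod (Mn p D \<theta> w f0 f) \<le> EV p D (\<lambda>x. cmod (EY p (\<lambda>n. f j (x + sm n (w j)))))"
      by (rule norm_Mn_le[where f = f, OF p th B j(1)])
    also have "\<dots> \<le> 1"
      by (intro avg_le_const finite_Fp_vec Fp_vec_nonempty p B1_norm[OF B1_line_mean[OF p B(2)[OF j(1)]]])
    finally show ?thesis
      using norm_triangle_ineq4[of "Lam p D \<theta> w f0 f" "Mn p D \<theta> w f0 f"] norm_Lam_le[where f = f and \<theta> = \<theta> and w = w, OF p th B] by simp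
  qed
  have Q1: "1 \<le> ?Q" using K1 mult_mono[of 1 "2 ^ K1" 1 K1] by (simp add: trans_le_add2)
  have N1: "1 \<le> ?N" using K1 M2 by simp
  show "?t ^ (?N * ?Q) \<le> real (?N * ?Q) * \<beta>"
  proof (rule final_loss[OF _ t1 _ N1 K1 b(1) _ aN _ bK])
    show "0 \<le> ?t" by simp
    show "?t \<le> max a bb" using tri by linarith
    show "0 \<le> a" "0 \<le> bb" by (simp_all add: a_def bb_def)
    show "?N \<le> ?N * ?Q" using mult_left_mono[OF Q1, of ?N] by simp
    have "K1 * 1 \<le> ?N * ?Q" using K1 M2 Q1 by (intro mult_mono) auto
    then show "K1 \<le> ?N * ?Q" by simp
    have "1 * ?Q \<le> ?N * ?Q" using N1 by (rule mult_right_mono) simp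
    then show "8 ^ (M2 * K1) * M2 ^ K1 * K1 \<le> ?N * ?Q" "2 ^ K1 * K1 \<le> ?N * ?Q"
      by (rule order_trans[rotated], simp)+
  qed
qed

end

section \<open>Removing the weight, and the passage between dimensions\<close>

context polys
begin

lemma fam_upd:
  assumes "fam p D E w f0 f" "B1 p D g" "j \<notin> E"
  shows "fam p D E w f0 (f(j := g))"
  using assms unfolding fam_def by auto

text \<open>Cauchy--Schwarz in \<open>y\<close> removes \<open>\<theta>\<close> and leaves squared
  means over \<open>x\<close>. Expanded over all translations \<open>z\<close>, these are unweighted
  averages of the derivatives of the family, to which the unweighted estimate applies.\<close>

lemma weighted_U2_control:
  assumes p: "p > 0" and b: "0 \<le> \<beta>" and K: "1 \<le> K" and j: "j \<in> I" and th: "\<And>y. cmod (\<theta> y) \<le> 1"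
    and fam: "fam p D E w f0 f" and X: "Xat K E p D \<beta> (\<lambda>_. 1) w"
    and M: "M = 4 * (4 ^ K * K)\<^sup>2" and big: "real M * \<beta> < cmod (Lam p D \<theta> w f0 f) ^ M"
  shows "cmod (Lam p D \<theta> w f0 f) ^ M \<le> real M * bx p D [w j, w j] (f j)"
proof -
  define K' where "K' = 4 ^ K * K"
  have K': "1 \<le> K'" using K by (simp add: K'_def)
  let ?\<delta> = "cmod (Lam p D \<theta> w f0 f)" and ?w = "w j"
  have B: "B1 p D f0" "\<And>i. i \<in> I \<Longrightarrow> B1 p D (f i)" using fam unfolding fam_def by auto
  have \<delta>: "0 \<le> ?\<delta>" "?\<delta> \<le> 1" using norm_Lam_le[where f = f, OF p th B] by auto
  define A where "A y x = f0 x * (\<Prod>i\<in>I. f i (x + sm (poly (P i) y) (w i)))" for y x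
  have BA: "B1 p D (A y)" for y unfolding A_def by (intro B1_mult B1_prod B1_shift B)
  \<comment> \<open>The shift \<open>z\<close> ranges over the whole space, not over a line;
    eigenfunctions stay eigenfunctions under this derivative.\<close>
  define \<Delta> where "\<Delta> z g x = g x * cnj (g (x + z))" for z and g :: "vec \<Rightarrow> complex" and x
  have B\<Delta>: "B1 p D (\<Delta> z g)" if "B1 p D g" for z g unfolding \<Delta>_def by (intro B1_mult B1_cnj B1_shift that)
  define La where "La z = cmod (Lam p D (\<lambda>_. 1) w (\<Delta> z f0) (\<lambda>i. \<Delta> z (f i)))" for z
  define U where "U z = EV p D (\<lambda>x. cmod (EY p (\<lambda>n. \<Delta> z (f j) (x + sm n ?w))))" for z
  have V: "finite (Fp_vec p D)" "Fp_vec p D \<noteq> {}" using Fp_vec_nonempty[OF p] by auto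
  have "Lam p D \<theta> w f0 f = EY p (\<lambda>y. \<theta> y * EV p D (A y))"
    unfolding Lam_def A_def by (subst avg_swap) (simp only: avg_cmult)
  then have "?\<delta>\<^sup>2 \<le> EY p (\<lambda>y. (cmod (EV p D (A y)))\<^sup>2)"
    by (simp only:) (intro avg_CS_bounded finite_Fp Fp_nonempty[OF p] th)
  also have "\<dots> = Re (EY p (\<lambda>y. complex_of_real ((cmod (EV p D (A y)))\<^sup>2)))" by (simp add: avg_of_real del: of_real_power)
  also have "\<dots> = Re (EY p (\<lambda>y. EV p D (\<lambda>z. EV p D (\<lambda>x. A y x * cnj (A y (x + z))))))"
    by (simp only: EV_pair[OF p B1_per[OF BA]])
  also have "EY p (\<lambda>y. EV p D (\<lambda>z. EV p D (\<lambda>x. A y x * cnj (A y (x + z)))))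
      = EV p D (\<lambda>z. EV p D (\<lambda>x. EY p (\<lambda>y. A y x * cnj (A y (x + z)))))"
    by (subst avg_swap) (subst (2) avg_swap, rule refl)
  also have "\<dots> = EV p D (\<lambda>z. Lam p D (\<lambda>_. 1) w (\<Delta> z f0) (\<lambda>i. \<Delta> z (f i)))"
    unfolding Lam_def
  proof (intro avg_cong)
    fix z x y
    show "A y x * cnj (A y (x + z)) = 1 * (\<Delta> z f0 x * (\<Prod>i\<in>I. \<Delta> z (f i) (x + sm (poly (P i) y) (w i))))"
      unfolding A_def \<Delta>_def prod.distrib by (simp add: ac_simps)
  qed
  also have "Re \<dots> \<le> EV p D La" unfolding La_def using complex_Re_le_cmod norm_avg_le order_trans by blast
  finally have 1: "?\<delta>\<^sup>2 \<le> EV p D La" .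
  have "?\<delta> ^ (2 * K') = (?\<delta>\<^sup>2) ^ K'" by (simp add: power_mult)
  also have "\<dots> \<le> (EV p D La) ^ K'" by (rule power_mono[OF 1]) simp
  also have "\<dots> \<le> EV p D (\<lambda>z. La z ^ K')" by (rule avg_power_le[OF V]) (simp add: La_def)
  also have "\<dots> \<le> EV p D (\<lambda>z. real K' * (\<beta> + U z))"
  proof (rule avg_mono)
    fix z
    have "fam p D E w (\<Delta> z f0) (\<lambda>i. \<Delta> z (f i))"
      unfolding fam_def
    proof (intro conjI ballI)
      show "Eig p (w i) (\<Delta> z (f i))" if "i \<in> E" for i
      proof -
        have "Eig p (w i) (f i)" using fam that unfolding fam_def by blast
        then show ?thesis unfolding \<Delta>_def by (intro Eig_mult Eig_cnj Eig_shift)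
      qed
    qed (use B\<Delta> B in auto)
    from Xat_control[OF X p K b _ this j] show "La z ^ K' \<le> real K' * (\<beta> + U z)"
      unfolding La_def U_def K'_def by simp
  qed
  also have "\<dots> = real K' * (\<beta> + EV p D U)" by (simp only: avg_cmult avg_add avg_const[OF V])
  finally have le: "?\<delta> ^ (2 * K') \<le> real K' * (\<beta> + EV p D U)" .
  have sq: "(EV p D U)\<^sup>2 \<le> bx p D [?w, ?w] (f j)"
  proof -
    have Bf: "B1 p D (f j)" by (rule B(2)[OF j])
    have "(EV p D U)\<^sup>2 \<le> EV p D (\<lambda>z. (U z)\<^sup>2)" by (rule avg_power_le[OF V]) (auto simp: U_def intro: avg_nonneg)
    also have "\<dots> \<le> EV p D (\<lambda>z. bx p D [?w] (\<Delta> z (f j)))"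
    proof (rule avg_mono)
      fix z
      show "(U z)\<^sup>2 \<le> bx p D [?w] (\<Delta> z (f j))"
        unfolding U_def bx_eq_avg_norm[OF p B1_per[OF B\<Delta>[OF Bf]]] by (rule avg_power_le[OF V]) simp
    qed
    \<comment> \<open>Averaging over all \<open>z\<close> collapses the derivative to the squared
      mean of \<open>dm\<close> applied to \<open>f j\<close>, which is at most a box norm along one
      more copy of \<open>w j\<close>.\<close>
    also have "\<dots> = EV p D (\<lambda>z. EY p (\<lambda>n. EY p (\<lambda>m. Re (EV p D (\<lambda>x. dm ?w n m (f j) x * cnj (dm ?w n m (f j) (x + z)))))))"
    proof -
      have "dm ?w n m (\<Delta> z (f j)) = (\<lambda>x. dm ?w n m (f j) x * cnj (dm ?w n m (f j) (x + z)))" for z n m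
        by (rule ext) (simp add: dm_def \<Delta>_def ac_simps)
      then show ?thesis by (simp only: bx_Cons bx_Nil)
    qed
    also have "\<dots> = EY p (\<lambda>n. EY p (\<lambda>m. Re (EV p D (\<lambda>z. EV p D (\<lambda>x. dm ?w n m (f j) x * cnj (dm ?w n m (f j) (x + z)))))))"
      by (subst avg_swap) (subst (2) avg_swap, simp only: avg_Re)
    also have "\<dots> = EY p (\<lambda>n. EY p (\<lambda>m. (cmod (EV p D (dm ?w n m (f j))))\<^sup>2))"
      by (simp only: EV_pair[OF p B1_per[OF B1_dm[OF Bf]]] Re_complex_of_real)
    also have "\<dots> \<le> EY p (\<lambda>n. EY p (\<lambda>m. bx p D [?w] (dm ?w n m (f j))))"
      by (intro avg_mono square_mean_le_bx1[OF p B1_dm[OF Bf]])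
    also have "\<dots> = bx p D [?w, ?w] (f j)" by (rule bx_Cons[symmetric])
    finally show ?thesis .
  qed
  have "K' * 1 \<le> K' * K'" using K' by (intro mult_left_mono) auto
  then have "4 * K' \<le> 4 * K'\<^sup>2" by (simp add: power2_eq_square)
  then show ?thesis
    by (intro sqrt_loss[OF \<delta> b K' _ sq le _ _ big]) (auto simp: M K'_def[symmetric] U_def intro!: avg_nonneg)
qed

text \<open>Box control at place \<open>j\<close> is applied with the conjugate of \<open>Gf\<close>
  there. It bounds the mean square of \<open>Gf\<close> by its own box norm,
  \<open>lower_chain\<close> reduces that norm to degree two, and \<open>Xat_from_U2\<close>
  concludes.\<close>

lemma Xat_from_box_control:
  assumes K1: "1 \<le> K1" and K2: "1 \<le> K2"
  shows "\<exists>K\<ge>1. \<forall>p D \<beta> j E w. p > 0 \<longrightarrow> 0 \<le> \<beta> \<longrightarrow> \<beta> \<le> 1 \<longrightarrow> j \<in> I \<longrightarrow> j \<notin> E \<longrightarrow>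
    Xat K1 (insert j E) p D \<beta> (\<lambda>_. 1) w \<longrightarrow>
    (\<forall>f0 f. fam p D E w f0 f \<longrightarrow> real K2 * \<beta> < cmod (Lam p D (\<lambda>_. 1) w f0 f) ^ K2 \<longrightarrow>
      cmod (Lam p D (\<lambda>_. 1) w f0 f) ^ K2 \<le> real K2 * bx p D (replicate (Suc (Suc s)) (w j)) (f j)) \<longrightarrow>
    Xat K E p D \<beta> (\<lambda>_. 1) w"
proof -
  obtain M3 where M3: "1 \<le> M3" and E3: "\<And>p D \<beta> j E w f0 f. p > 0 \<Longrightarrow> 0 \<le> \<beta> \<Longrightarrow> j \<in> I \<Longrightarrow> j \<notin> E \<Longrightarrow> fam p D E w f0 f \<Longrightarrow>
     Xat K1 (insert j E) p D \<beta> (\<lambda>_. 1) w \<Longrightarrow>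
     real M3 * \<beta> < bx p D (replicate (Suc (Suc s)) (w j)) (Gf p (\<lambda>_. 1) w j f0 f) ^ M3 \<Longrightarrow>
     bx p D (replicate (Suc (Suc s)) (w j)) (Gf p (\<lambda>_. 1) w j f0 f) ^ M3 \<le> real M3 * bx p D [w j, w j] (Gf p (\<lambda>_. 1) w j f0 f)"
    using lower_chain[OF K1, of s] by blast
  define M2 where "M2 = cmp K2 M3"
  have M2: "1 \<le> M2" "K2 \<le> M2" using cmp_ge[OF K2 M3] by (auto simp: M2_def)
  define K where "K = 2 * M2 * K1 * (8 ^ (M2 * K1) * M2 ^ K1 * K1 + 2 ^ K1 * K1)"
  have "K \<noteq> 0" using M2 K1 by (simp add: K_def)
  then have K: "1 \<le> K" by simp
  show ?thesis
  proof (intro exI[of _ K] conjI allI impI K)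
    fix p D \<beta> j E w
    assume *: "p > 0" "0 \<le> \<beta>" "\<beta> \<le> 1" "j \<in> I" "j \<notin> E" "Xat K1 (insert j E) p D \<beta> (\<lambda>_. 1) w"
      and UC: "\<forall>f0 f. fam p D E w f0 f \<longrightarrow> real K2 * \<beta> < cmod (Lam p D (\<lambda>_. 1) w f0 f) ^ K2 \<longrightarrow>
      cmod (Lam p D (\<lambda>_. 1) w f0 f) ^ K2 \<le> real K2 * bx p D (replicate (Suc (Suc s)) (w j)) (f j)"
    show "Xat K E p D \<beta> (\<lambda>_. 1) w"
      unfolding K_def
    proof (rule Xat_from_U2[OF *(1-3) K1 M2(1) *(4,5) _ *(6)])
      fix f0 f assume fam: "fam p D E w f0 f"
      let ?G = "Gf p (\<lambda>_. 1) w j f0 f"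
      let ?\<delta> = "cmod (Lam p D (\<lambda>_. 1) w f0 (f(j := \<lambda>x. cnj (?G x))))"
      assume big: "real M2 * \<beta> < ?\<delta> ^ M2"
      have B: "B1 p D f0" "\<And>i. i \<in> I \<Longrightarrow> B1 p D (f i)" using fam unfolding fam_def by auto
      have BG: "B1 p D ?G" by (rule B1_Gf[OF *(1)]) (use B in auto)
      have fam': "fam p D E w f0 (f(j := \<lambda>x. cnj (?G x)))" by (rule fam_upd[OF fam B1_cnj[OF BG] *(5)])
      have \<delta>: "0 \<le> ?\<delta>" "?\<delta> \<le> 1"
        using fam' by (auto simp: fam_def intro!: norm_Lam_le[OF *(1)])
      have "?\<delta> ^ K2 \<le> real K2 * bx p D (replicate (Suc (Suc s)) (w j)) ((f(j := \<lambda>x. cnj (?G x))) j)"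
        using UC fam' loss_mono[OF \<delta> *(2) M2(2) big] by blast
      then have le: "?\<delta> ^ K2 \<le> real K2 * bx p D (replicate (Suc (Suc s)) (w j)) ?G"
        by (simp only: fun_upd_same bx_cnj)
      note c = loss_chain[OF \<delta> *(2) K2 M3 _ big le]
      have "real M3 * \<beta> < bx p D (replicate (Suc (Suc s)) (w j)) ?G ^ M3" by (rule c(1)) (simp add: M2_def cmp_def)
      from E3[OF *(1,2,4,5) fam *(6) this] show "?\<delta> ^ M2 \<le> real M2 * bx p D [w j, w j] ?G"
        by (rule c(2)[rotated]) (simp add: M2_def cmp_def)
    qed simp
  qed
qed

text \<open>Degree two control of the weighted average follows from the unweighted estimate with the
  same \<open>E\<close>, so weights need no box argument of their own; only the eigenfunction case
  is needed with the weight.\<close>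

lemma Xat_weighted:
  assumes K1: "1 \<le> K1" and K2: "1 \<le> K2"
  shows "\<exists>K\<ge>1. \<forall>p D \<beta> \<theta> j E w. p > 0 \<longrightarrow> 0 \<le> \<beta> \<longrightarrow> \<beta> \<le> 1 \<longrightarrow> j \<in> I \<longrightarrow> j \<notin> E \<longrightarrow> (\<forall>y. cmod (\<theta> y) \<le> 1) \<longrightarrow>
    Xat K1 (insert j E) p D \<beta> \<theta> w \<longrightarrow> Xat K2 E p D \<beta> (\<lambda>_. 1) w \<longrightarrow> Xat K E p D \<beta> \<theta> w"
proof -
  define M2 where "M2 = 4 * (4 ^ K2 * K2)\<^sup>2"
  have "M2 \<noteq> 0" using K2 by (simp add: M2_def)
  then have M2: "1 \<le> M2" by simp
  define K where "K = 2 * M2 * K1 * (8 ^ (M2 * K1) * M2 ^ K1 * K1 + 2 ^ K1 * K1)"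
  have "K \<noteq> 0" using M2 K1 by (simp add: K_def)
  then have K: "1 \<le> K" by simp
  show ?thesis
  proof (intro exI[of _ K] conjI allI impI K)
    fix p D \<beta> \<theta> j E w
    assume *: "p > 0" "0 \<le> \<beta>" "\<beta> \<le> 1" "j \<in> I" "j \<notin> E" "\<forall>y. cmod (\<theta> y) \<le> 1" "Xat K1 (insert j E) p D \<beta> \<theta> w" "Xat K2 E p D \<beta> (\<lambda>_. 1) w"
    have th: "\<And>y. cmod (\<theta> y) \<le> 1" using *(6) by blast
    show "Xat K E p D \<beta> \<theta> w"
      unfolding K_def
    proof (rule Xat_from_U2[OF *(1-3) K1 M2 *(4,5) th *(7)])
      fix f0 f assume fam: "fam p D E w f0 f"
      let ?G = "Gf p \<theta> w j f0 f"
      let ?f = "f(j := \<lambda>x. cnj (?G x))"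
      assume big: "real M2 * \<beta> < cmod (Lam p D \<theta> w f0 ?f) ^ M2"
      have B: "B1 p D f0" "\<And>i. i \<in> I \<Longrightarrow> B1 p D (f i)" using fam unfolding fam_def by auto
      have BG: "B1 p D ?G" by (rule B1_Gf[OF *(1) B(1) _ th]) (use B in auto)
      have fam': "fam p D E w f0 ?f" by (rule fam_upd[OF fam B1_cnj[OF BG] *(5)])
      have "cmod (Lam p D \<theta> w f0 ?f) ^ M2 \<le> real M2 * bx p D [w j, w j] (?f j)"
        by (rule weighted_U2_control[OF *(1,2) K2 *(4) th fam' *(8) M2_def big])
      then show "cmod (Lam p D \<theta> w f0 ?f) ^ M2 \<le> real M2 * bx p D [w j, w j] ?G" by (simp only: fun_upd_same bx_cnj)
    qed
  qed
qed

text \<open>This makes the constants independent of dimension and directions: through each base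
  point the average is restricted to combinations of the \<open>w l\<close>, and the coefficients of
  the combination are the new variables, in which the directions are unit vectors.\<close>

lemma Xat_lift:
  fixes Dk :: nat
  defines "\<epsilon> \<equiv> (\<lambda>i l. if l = i then 1 else 0 :: int)"
  assumes p: "p > 0" and Dk: "I \<subseteq> {..<Dk}" and E: "E \<subseteq> I" and b: "0 \<le> \<beta>" and X: "Xat K E p Dk \<beta> \<theta> \<epsilon>"
  shows "Xat K E p D \<beta> \<theta> w"
  unfolding Xat_def
proof (intro allI impI)
  fix f0 f assume fam: "fam p D E w f0 f"
  have B: "B1 p D f0" "\<And>i. i \<in> I \<Longrightarrow> B1 p D (f i)" using fam unfolding fam_def by auto
  \<comment> \<open>The homomorphism sending the unit vectors to the given directions. It need not
    be injective; the mean over \<open>x\<close> compensates for that.\<close>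
  define sv where "sv n = (\<lambda>j. \<Sum>l\<in>I. n l * w l j)" for n :: vec
  have sv_cg: "cg p D (sv n) (sv n')" if "cg p Dk n n'" for n n'
    unfolding cg_def sv_def
  proof (intro allI impI cong_sum cong_mult)
    fix j l assume "l \<in> I"
    then show "[n l = n' l] (mod int p)" using that Dk unfolding cg_def by auto
  qed simp
  have sv_add: "sv (n + sm t (\<epsilon> i)) = sv n + sm t (w i)" if i: "i \<in> I" for n t i
  proof
    fix j
    have "sv (n + sm t (\<epsilon> i)) j = (\<Sum>l\<in>I. n l * w l j) + (\<Sum>l\<in>I. (if l = i then t * w i j else 0))"
      unfolding sv_def sum.distrib[symmetric] by (rule sum.cong) (auto simp: sm_def \<epsilon>_def algebra_simps)
    also have "(\<Sum>l\<in>I. (if l = i then t * w i j else 0)) = t * w i j" using i finI by simp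
    finally show "sv (n + sm t (\<epsilon> i)) j = (sv n + sm t (w i)) j" by (simp add: sv_def sm_def)
  qed
  have sv_shift: "x + sv n + sm t (w i) = x + sv (n + sm t (\<epsilon> i))" if "i \<in> I" for x n t i
    by (simp only: sv_add[OF that] add.assoc)
  define g where "g x i n = f i (x + sv n)" for x i n
  define g0 where "g0 x n = f0 (x + sv n)" for x n
  have per_sv: "B1 p Dk (\<lambda>n. h (x + sv n))" if "B1 p D h" for h x
    unfolding B1_def per_def using B1_norm[OF that] perD[OF B1_per[OF that] cg_add[OF cg_refl sv_cg]] by blast
  have fam': "fam p Dk E \<epsilon> (g0 x) (g x)" for x
    unfolding fam_def
  proof (intro conjI ballI)
    show "B1 p Dk (g0 x)" unfolding g0_def by (rule per_sv[OF B(1)])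
    show "B1 p Dk (g x i)" if "i \<in> I" for i unfolding g_def by (rule per_sv[OF B(2)[OF that]])
    show "Eig p (\<epsilon> i) (g x i)" if "i \<in> E" for i
      unfolding Eig_def
    proof
      fix n
      have "Eig p (w i) (f i)" using fam that unfolding fam_def by blast
      then obtain \<phi> where "\<forall>t. f i ((x + sv n) + sm t (w i)) = f i (x + sv n) * e_p p (\<phi> * t)"
        unfolding Eig_def by blast
      moreover have "g x i (n + sm t (\<epsilon> i)) = f i ((x + sv n) + sm t (w i))" for t
        unfolding g_def by (simp only: sv_shift[OF subsetD[OF E that]])
      ultimately have "\<forall>t. g x i (n + sm t (\<epsilon> i)) = g x i n * e_p p (\<phi> * t)" unfolding g_def by (simp only: simp_thms)
      then show "\<exists>\<phi>. \<forall>t. g x i (n + sm t (\<epsilon> i)) = g x i n * e_p p (\<phi> * t)" ..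
    qed
  qed
  have avg_lift: "EV p D h = EV p D (\<lambda>x. EV p Dk (\<lambda>n. h (x + sv n)))" if "per p D h" for h :: "vec \<Rightarrow> complex"
  proof -
    have "EV p Dk (\<lambda>n. EV p D (\<lambda>x. h (x + sv n))) = EV p Dk (\<lambda>n. EV p D h)" by (simp only: EV_shift[OF p that])
    also have "\<dots> = EV p D h" by (rule avg_const[OF finite_Fp_vec Fp_vec_nonempty[OF p]])
    finally show ?thesis by (simp only: avg_swap[of "Fp_vec p Dk"])
  qed
  have L: "Lam p D \<theta> w f0 f = EV p D (\<lambda>x. Lam p Dk \<theta> \<epsilon> (g0 x) (g x))"
  proof -
    let ?h = "\<lambda>x. EY p (\<lambda>y. \<theta> y * (f0 x * (\<Prod>i\<in>I. f i (x + sm (poly (P i) y) (w i)))))"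
    have A: "per p D (\<lambda>x. f0 x * (\<Prod>i\<in>I. f i (x + sm (poly (P i) y) (w i))))" for y
      by (rule B1_per) (intro B1_mult B1_prod B1_shift B)
    have "?h x = ?h x'" if "cg p D x x'" for x x'
      by (rule avg_cong) (rule arg_cong2[where f = "(*)", OF refl perD[OF A that]])
    then have "per p D ?h" unfolding per_def by blast
    from avg_lift[OF this]
    have eq: "EV p D ?h = EV p D (\<lambda>x. EV p Dk (\<lambda>n. ?h (x + sv n)))" .
    have "(\<Prod>i\<in>I. f i (x + sv n + sm (poly (P i) y) (w i))) = (\<Prod>i\<in>I. g x i (n + sm (poly (P i) y) (\<epsilon> i)))" for x n y
      by (rule prod.cong[OF refl]) (simp only: g_def sv_shift)
    then show ?thesis unfolding Lam_def g0_def eq by (simp only:)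
  qed
  have R: "Mn p D \<theta> w f0 f = EV p D (\<lambda>x. Mn p Dk \<theta> \<epsilon> (g0 x) (g x))"
  proof -
    let ?h = "\<lambda>x. f0 x * (\<Prod>i\<in>I. EY p (\<lambda>n. f i (x + sm n (w i))))"
    have "per p D ?h" by (rule B1_per) (intro B1_mult B1_prod B1_line_mean[OF p] B)
    from avg_lift[OF this]
    have eq: "EV p D ?h = EV p D (\<lambda>x. EV p Dk (\<lambda>n. ?h (x + sv n)))" .
    have "(\<Prod>i\<in>I. EY p (\<lambda>t. f i (x + sv n + sm t (w i)))) = (\<Prod>i\<in>I. EY p (\<lambda>t. g x i (n + sm t (\<epsilon> i))))" for x n
      by (rule prod.cong[OF refl]) (simp only: g_def sv_shift)
    then show ?thesis unfolding Mn_def g0_def avg_cmult eq by (simp only:)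
  qed
  let ?t = "\<lambda>x. cmod (Lam p Dk \<theta> \<epsilon> (g0 x) (g x) - Mn p Dk \<theta> \<epsilon> (g0 x) (g x)) / 2"
  have "cmod (Lam p D \<theta> w f0 f - Mn p D \<theta> w f0 f) \<le> EV p D (\<lambda>x. ?t x * 2)"
    unfolding L R avg_diff[symmetric] using norm_avg_le[of "Fp_vec p D"] by simp
  then have "cmod (Lam p D \<theta> w f0 f - Mn p D \<theta> w f0 f) / 2 \<le> EV p D ?t" unfolding avg_cmult_right by simp
  then have "(cmod (Lam p D \<theta> w f0 f - Mn p D \<theta> w f0 f) / 2) ^ K \<le> (EV p D ?t) ^ K" by (rule power_mono) simp
  also have "\<dots> \<le> EV p D (\<lambda>x. ?t x ^ K)" by (rule avg_power_le) (use Fp_vec_nonempty[OF p] in auto)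
  also have "\<dots> \<le> real K * \<beta>"
    by (rule avg_le_const) (use X fam' Fp_vec_nonempty[OF p] in \<open>auto simp: Xat_def\<close>)
  finally show "(cmod (Lam p D \<theta> w f0 f - Mn p D \<theta> w f0 f) / 2) ^ K \<le> real K * \<beta>" .
qed

end

subsection \<open>Box control of a family with some eigenfunctions\<close>

text \<open>The combination in which the leading terms cancel when the degrees agree. It is the
  relevant polynomial when two scaled directions coincide modulo \<open>p\<close>, and is nonzero
  unless \<open>P j\<close> and \<open>P l\<close> are dependent.\<close>

definition cross :: "('i \<Rightarrow> int poly) \<Rightarrow> 'i \<Rightarrow> 'i \<Rightarrow> int poly" where
  "cross P j l = smult (lead_coeff (P l)) (P j) - smult (lead_coeff (P j)) (P l)"

lemma prime_inverse_mod:
  assumes "prime p" "\<not> int p dvd b"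
  shows "\<exists>b'. [b * b' = 1] (mod int p) \<and> \<not> int p dvd b'"
proof -
  have "coprime (int p) b" using assms by (intro prime_imp_coprime) auto
  then obtain b' where b': "[b * b' = 1] (mod int p)" using cong_solve_coprime_int[of b "int p"] by (auto simp: coprime_commute)
  have "\<not> int p dvd b'"
  proof
    assume "int p dvd b'"
    then have "int p dvd 1" using b' by (metis cong_dvd_iff dvd_mult)
    then show False using assms(1) by auto
  qed
  with b' show ?thesis by blast
qed

lemma prod_list_distinct: "distinct L \<Longrightarrow> (\<Prod>l\<leftarrow>L. g l) = (\<Prod>l\<in>set L. g l)"
  by (rule prod.distinct_set_conv_list[symmetric])

lemma loss_comp:
  fixes \<delta> \<delta>' t \<beta> :: real
  assumes "0 \<le> \<delta>" "\<delta> \<le> 1" "0 \<le> \<beta>" "1 \<le> K" "1 \<le> L" and big: "real (cmp K L) * \<beta> < \<delta> ^ cmp K L"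
    and a: "real K * \<beta> < \<delta> ^ K \<Longrightarrow> \<delta> ^ K \<le> real K * \<delta>'" and b: "real L * \<beta> < \<delta>' ^ L \<Longrightarrow> \<delta>' ^ L \<le> real L * t"
  shows "\<delta> ^ cmp K L \<le> real (cmp K L) * t"
proof -
  have "K \<le> cmp K L" using cmp_ge[OF assms(4,5)] by simp
  then have "\<delta> ^ K \<le> real K * \<delta>'" using a loss_mono[OF assms(1-3) _ big] by blast
  note c = loss_chain[OF assms(1-5) _ big this]
  show ?thesis by (rule c(2)[OF _ b[OF c(1)]]) (simp_all add: cmp_def)
qed

context polys
begin

text \<open>Eigenfunctions contribute a factor depending on \<open>x\<close> only and a polynomial
  phase in \<open>y\<close>. The sum of the degrees is just a common bound for the degree of that
  phase.\<close>

lemma Lam_eq_PHS: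
  assumes p: "p > 0" and fam: "fam p D E w f0 f" and E: "E \<subseteq> I" and j: "j \<in> I" "j \<notin> E"
    and L: "distinct L" "set L = I - E - {j}"
  obtains c Q where "\<And>x. cmod (c x) \<le> 1" "\<And>x. degree (Q x) \<le> (\<Sum>i\<in>I. degree (P i))"
    "cmod (Lam p D (\<lambda>_. 1) w f0 f) = PHS p D c Q (map (\<lambda>l. (f l, \<lambda>y. sm (poly (P l) y) (w l))) (j # L))"
proof -
  have B: "B1 p D f0" "\<And>i. i \<in> I \<Longrightarrow> B1 p D (f i)" using fam unfolding fam_def by auto
  have "\<forall>i x. \<exists>\<phi>. i \<in> E \<longrightarrow> (\<forall>n. f i (x + sm n (w i)) = f i x * e_p p (\<phi> * n))"
    using fam unfolding fam_def Eig_def by metis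
  then obtain \<phi> where \<phi>: "\<And>i x n. i \<in> E \<Longrightarrow> f i (x + sm n (w i)) = f i x * e_p p (\<phi> i x * n)" by metis
  define c where "c x = f0 x * (\<Prod>i\<in>E. f i x)" for x
  define Q where "Q x = (\<Sum>i\<in>E. smult (\<phi> i x) (P i))" for x
  have "B1 p D c" unfolding c_def using E by (intro B1_mult B1_prod B) auto
  then have 1: "cmod (c x) \<le> 1" for x by (rule B1_norm)
  have 2: "degree (Q x) \<le> (\<Sum>i\<in>I. degree (P i))" for x
    unfolding Q_def
  proof (rule degree_sum_le)
    show "finite E" using E finI finite_subset by blast
    fix i assume "i \<in> E"
    then have "degree (P i) \<le> (\<Sum>i\<in>I. degree (P i))" using E finI by (intro member_le_sum) auto
    then show "degree (smult (\<phi> i x) (P i)) \<le> (\<Sum>i\<in>I. degree (P i))" using degree_smult_le order_trans by blast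
  qed
  have I: "I = E \<union> insert j (set L)" "E \<inter> insert j (set L) = {}" using L E j by auto
  have fE: "finite E" using E finI finite_subset by blast
  let ?q = "\<lambda>l y. sm (poly (P l) y) (w l)"
  have "1 * (f0 x * (\<Prod>i\<in>I. f i (x + ?q i y)))
      = c x * (e_p p (poly (Q x) y) * (\<Prod>z\<leftarrow>map (\<lambda>l. (f l, ?q l)) (j # L). fst z (x + snd z y)))" for x y
  proof -
    have "(\<Prod>i\<in>I. f i (x + ?q i y)) = (\<Prod>i\<in>E. f i (x + ?q i y)) * (\<Prod>i\<in>set (j # L). f i (x + ?q i y))"
      by (subst I(1), subst list.set(2), rule prod.union_disjoint[OF fE _ I(2)]) simp
    also have "(\<Prod>i\<in>set (j # L). f i (x + ?q i y)) = (\<Prod>l\<leftarrow>j # L. f l (x + ?q l y))"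
      using L by (intro prod_list_distinct[symmetric]) auto
    also have "(\<Prod>i\<in>E. f i (x + ?q i y)) = (\<Prod>i\<in>E. f i x * e_p p (\<phi> i x * poly (P i) y))"
      by (rule prod.cong) (simp_all only: \<phi>)
    also have "\<dots> = (\<Prod>i\<in>E. f i x) * e_p p (poly (Q x) y)"
      unfolding prod.distrib Q_def poly_sum poly_smult e_p_sum ..
    finally show ?thesis unfolding c_def by (simp only: map_map o_def fst_conv snd_conv) (simp only: mult.assoc mult_1)
  qed
  then have "cmod (Lam p D (\<lambda>_. 1) w f0 f) = PHS p D c Q (map (\<lambda>l. (f l, ?q l)) (j # L))"
    unfolding Lam_def PHS_def by (simp only:)
  with 1 2 show ?thesis by (rule that)
qed

text \<open>Since \<open>f j\<close> is bounded by 1, Cauchy--Schwarz replaces it by the conjugate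
  of its dual function at the cost of a square.\<close>

lemma dual_square:
  assumes p: "p > 0" and j: "j \<in> I" and B: "B1 p D f0" "\<And>i. i \<in> I \<Longrightarrow> B1 p D (f i)"
  shows "(cmod (Lam p D (\<lambda>_. 1) w f0 f))\<^sup>2 \<le> cmod (Lam p D (\<lambda>_. 1) w f0 (f(j := \<lambda>x. cnj (Fd p (\<lambda>_. 1) w j f0 f x))))"
proof -
  let ?F = "Fd p (\<lambda>_. 1) w j f0 f"
  have BF: "B1 p D ?F" by (rule B1_Fd[OF p B(1)]) (use B in auto)
  have eq: "Lam p D (\<lambda>_. 1) w f0 f = EV p D (\<lambda>x. ?F x * f j x)"
    by (rule Lam_dual[where f = f, OF p j B])
  have "(cmod (Lam p D (\<lambda>_. 1) w f0 f))\<^sup>2 \<le> EV p D (\<lambda>x. (cmod (?F x))\<^sup>2) * EV p D (\<lambda>x. (cmod (f j x))\<^sup>2)"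
    unfolding eq by (rule avg_CS_complex)
  also have "\<dots> \<le> EV p D (\<lambda>x. (cmod (?F x))\<^sup>2) * 1"
    by (intro mult_left_mono avg_le_const finite_Fp_vec Fp_vec_nonempty p avg_nonneg)
      (use B1_norm[OF B(2)[OF j]] in \<open>auto simp: power_le_one\<close>)
  also have "\<dots> \<le> cmod (EV p D (\<lambda>x. ?F x * cnj (?F x)))"
  proof -
    have "EV p D (\<lambda>x. ?F x * cnj (?F x)) = complex_of_real (EV p D (\<lambda>x. (cmod (?F x))\<^sup>2))"
      unfolding avg_of_real[symmetric] complex_norm_square[symmetric] ..
    then show ?thesis by simp
  qed
  also have "EV p D (\<lambda>x. ?F x * cnj (?F x)) = Lam p D (\<lambda>_. 1) w f0 (f(j := \<lambda>x. cnj (?F x)))"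
    using B BF by (subst Lam_dual[OF p j]) (auto simp: Fd_upd intro: B1_cnj)
  finally show ?thesis .
qed

text \<open>Intermediate stages of the exchange of directions: \<open>a\<close> directions in \<open>G\<close> are left,
  \<open>b + 1\<close> have become \<open>w j\<close>.\<close>

definition BQ :: "nat \<Rightarrow> nat \<Rightarrow> nat \<Rightarrow> nat \<Rightarrow> nat \<Rightarrow> real \<Rightarrow> vec set \<Rightarrow> nat set \<Rightarrow> (nat \<Rightarrow> vec) \<Rightarrow> nat \<Rightarrow> bool" where
  "BQ K a b p D \<beta> G E w j \<longleftrightarrow> (\<forall>f0 f. fam p D E w f0 f \<longrightarrow> real K * \<beta> < cmod (Lam p D (\<lambda>_. 1) w f0 f) ^ K \<longrightarrow>
     (\<exists>us. length us = a \<and> set us \<subseteq> G \<and>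
        cmod (Lam p D (\<lambda>_. 1) w f0 f) ^ K \<le> real K * bx p D (us @ replicate (Suc b) (w j)) (f j)))"

text \<open>What the change of \<open>w j\<close> by multiples of \<open>u\<close> yields: control by the means of \<open>g i\<close> along \<open>w i\<close>.\<close>

definition Mov :: "nat \<Rightarrow> nat \<Rightarrow> nat \<Rightarrow> real \<Rightarrow> vec set \<Rightarrow> nat set \<Rightarrow> (nat \<Rightarrow> vec) \<Rightarrow> nat \<Rightarrow> nat \<Rightarrow> bool" where
  "Mov K p D \<beta> G E w j i \<longleftrightarrow> (\<forall>u\<in>G. \<forall>g0 g. fam p D E w g0 g \<longrightarrow> (\<forall>x n. g j (x + sm n u) = g j x) \<longrightarrow>
     cmod (Lam p D (\<lambda>_. 1) w g0 g) ^ K \<le> real K * (\<beta> + EV p D (\<lambda>x. cmod (EY p (\<lambda>n. g i (x + sm n (w i)))))))"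

text \<open>With dual functions at both places, a direction \<open>u\<close> at \<open>j\<close> is
  traded for \<open>w i\<close> at place \<open>i\<close> by \<open>Mov\<close>, and
  \<open>w i\<close> for \<open>w j\<close> at place \<open>j\<close> by the estimate for
  \<open>insert i E\<close>. The order of the two replacements makes the last box norm that of the
  original \<open>f j\<close>.\<close>

lemma ping_pong_step:
  assumes p: "p > 0" and b: "0 \<le> \<beta>" and K: "1 \<le> K" "1 \<le> Km" "1 \<le> K2"
    and ij: "i \<in> I" "j \<in> I" "i \<noteq> j" "i \<notin> E" "j \<notin> E" and E: "E \<subseteq> I"
    and mov: "Mov Km p D \<beta> G E w j i" and X: "Xat K2 (insert i E) p D \<beta> (\<lambda>_. 1) w"
    and Q: "BQ K (Suc a) r p D \<beta> G E w j"
    and M: "M = cmp 4 (cmp K (cmp (4 * Km\<^sup>2 * 2 ^ (a + Suc r)) (4 * (4 ^ K2 * K2)\<^sup>2 * 2 ^ (a + Suc r))))"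
  shows "BQ M a (Suc r) p D \<beta> G E w j"
  unfolding BQ_def
proof (intro allI impI)
  fix f0 f assume fam: "fam p D E w f0 f" and big: "real M * \<beta> < cmod (Lam p D (\<lambda>_. 1) w f0 f) ^ M"
  let ?one = "\<lambda>_::int. 1 :: complex"
  define M1 M2 where "M1 = 4 * Km\<^sup>2 * 2 ^ (a + Suc r)" and "M2 = 4 * (4 ^ K2 * K2)\<^sup>2 * 2 ^ (a + Suc r)"
  have "M1 \<noteq> 0" "M2 \<noteq> 0" using K by (simp_all add: M1_def M2_def)
  then have M12: "1 \<le> M1" "1 \<le> M2" by simp_all
  define L2 L1 where "L2 = cmp M1 M2" and "L1 = cmp K L2"
  have L2: "1 \<le> L2" using cmp_ge[OF M12] by (simp add: L2_def)
  have L1: "1 \<le> L1" "K \<le> L1" using cmp_ge[OF K(1) L2] by (simp_all add: L1_def)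
  have M: "M = cmp 4 L1" by (simp only: M L1_def L2_def M1_def M2_def)
  have B: "B1 p D f0" "\<And>i. i \<in> I \<Longrightarrow> B1 p D (f i)" using fam unfolding fam_def by auto
  define Fi where "Fi = Fd p ?one w i f0 f"
  have BFi: "B1 p D Fi" unfolding Fi_def by (rule B1_Fd[OF p B(1)]) (use B in auto)
  define f1 where "f1 = f(i := \<lambda>x. cnj (Fi x))"
  have fam1: "fam p D E w f0 f1" unfolding f1_def by (rule fam_upd[OF fam B1_cnj[OF BFi] ij(4)])
  have B1': "\<And>i. i \<in> I \<Longrightarrow> B1 p D (f1 i)" using fam1 unfolding fam_def by auto
  define Fj where "Fj = Fd p ?one w j f0 f1"
  have BFj: "B1 p D Fj" unfolding Fj_def by (rule B1_Fd[OF p B(1)]) (use B1' in auto)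
  define f2 where "f2 = f1(j := \<lambda>x. cnj (Fj x))"
  have fam2: "fam p D E w f0 f2" unfolding f2_def by (rule fam_upd[OF fam1 B1_cnj[OF BFj] ij(5)])
  have B2': "\<And>i. i \<in> I \<Longrightarrow> B1 p D (f2 i)" using fam2 unfolding fam_def by auto
  define \<delta> \<delta>1 \<delta>2 where "\<delta> = cmod (Lam p D ?one w f0 f)" and "\<delta>1 = cmod (Lam p D ?one w f0 f1)" and "\<delta>2 = cmod (Lam p D ?one w f0 f2)"
  have n: "0 \<le> \<delta>" "\<delta> \<le> 1" "0 \<le> \<delta>1" "0 \<le> \<delta>2" "\<delta>2 \<le> 1"
    unfolding \<delta>_def \<delta>1_def \<delta>2_def using norm_Lam_le[where f = f and w = w and \<theta> = ?one, OF p _ B]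
      norm_Lam_le[where f = f2 and w = w and \<theta> = ?one, OF p _ B(1) B2'] by simp_all
  have "\<delta>\<^sup>2 \<le> \<delta>1" unfolding \<delta>_def \<delta>1_def f1_def Fi_def by (rule dual_square[OF p ij(1) B])
  moreover have "\<delta>1\<^sup>2 \<le> \<delta>2" unfolding \<delta>1_def \<delta>2_def f2_def Fj_def by (rule dual_square[OF p ij(2) B(1) B1'])
  ultimately have "(\<delta>\<^sup>2)\<^sup>2 \<le> \<delta>2" using power_mono[of "\<delta>\<^sup>2" \<delta>1 2] by fastforce
  \<comment> \<open>Two dual replacements, each costing a square, explain the exponent and the outer
    4 in \<open>M\<close>.\<close>
  then have \<delta>4: "\<delta> ^ 4 \<le> real 4 * \<delta>2" using n by (simp add: power_mult[symmetric])
  have big': "real M * \<beta> < \<delta> ^ M" using big by (simp add: \<delta>_def)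
  note c = loss_chain[OF n(1,2) b _ L1(1) _ big' \<delta>4]
  have big2: "real L1 * \<beta> < \<delta>2 ^ L1" by (rule c(1)) (simp_all add: M cmp_def)
  have "real K * \<beta> < \<delta>2 ^ K" by (rule loss_mono[OF n(4,5) b L1(2) big2])
  then obtain us where us: "length us = Suc a" "set us \<subseteq> G" "\<delta>2 ^ K \<le> real K * bx p D (us @ replicate (Suc r) (w j)) (f2 j)"
    using Q fam2 unfolding BQ_def \<delta>2_def by blast
  obtain u us' where us': "us = u # us'" using us(1) by (cases us) auto
  have u: "u \<in> G" "set us' \<subseteq> G" "length us' = a" using us us' by auto
  define vs where "vs = us' @ replicate (Suc r) (w j)"
  have vs: "vs \<noteq> []" "length vs = a + Suc r" using u by (simp_all add: vs_def)
  have bFj: "bx p D (us @ replicate (Suc r) (w j)) (f2 j) = bx p D (u # vs) Fj"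
    unfolding us' vs_def f2_def by (simp only: fun_upd_same bx_cnj append_Cons)
  have Fi1: "bx p D (w i # vs) (f1 i) = bx p D (w i # vs) Fi" unfolding f1_def by (simp only: fun_upd_same bx_cnj)
  define t where "t = bx p D (w j # vs) (f j)"
  have step1: "bx p D (u # vs) Fj ^ M1 \<le> real M1 * bx p D (w i # vs) Fi" if "real M1 * \<beta> < bx p D (u # vs) Fj ^ M1"
    unfolding Fi1[symmetric] Fj_def
  proof (rule box_transfer[OF p b K(2) ij(2,1) ij(3)[symmetric] E ij(5) vs(1) fam1])
    show "M1 = 4 * Km\<^sup>2 * 2 ^ length vs" by (simp only: M1_def vs)
    show "real M1 * \<beta> < bx p D (u # vs) (Fd p ?one w j f0 f1) ^ M1" using that by (simp only: Fj_def)
    show "cmod (Lam p D ?one w g0 g) ^ Km \<le> real Km * (\<beta> + EV p D (\<lambda>x. cmod (EY p (\<lambda>n. g i (x + sm n (w i))))))"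
      if "fam p D E w g0 g" "\<And>x n. g j (x + sm n u) = g j x" for g0 g
      using mov that u(1) unfolding Mov_def by blast
  qed
  have K2': "1 \<le> 4 ^ K2 * K2" using K(3) by simp
  have step2: "bx p D (w i # vs) Fi ^ M2 \<le> real M2 * t" if "real M2 * \<beta> < bx p D (w i # vs) Fi ^ M2"
    unfolding t_def Fi_def
  proof (rule box_transfer[OF p b K2' ij(1,2) ij(3) E ij(4) vs(1) fam])
    show "M2 = 4 * (4 ^ K2 * K2)\<^sup>2 * 2 ^ length vs" by (simp only: M2_def vs)
    show "real M2 * \<beta> < bx p D (w i # vs) (Fd p ?one w i f0 f) ^ M2" using that by (simp only: Fi_def)
    show "cmod (Lam p D ?one w g0 g) ^ (4 ^ K2 * K2) \<le> real (4 ^ K2 * K2) * (\<beta> + EV p D (\<lambda>x. cmod (EY p (\<lambda>n. g j (x + sm n (w j))))))"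
      if g: "fam p D E w g0 g" "\<And>x n. g i (x + sm n (w i)) = g i x" for g0 g
    proof (rule Xat_control[OF X p K(3) b _ _ ij(2)])
      \<comment> \<open>The test function at \<open>i\<close> is invariant in direction
        \<open>w i\<close>, so it counts as an eigenfunction of frequency zero.\<close>
      have "Eig p (w i) (g i)" by (rule Eig_invariant) (rule g(2))
      then show "fam p D (insert i E) w g0 g" using g(1) unfolding fam_def by blast
    qed simp
  qed
  have bb: "0 \<le> bx p D (u # vs) Fj" "bx p D (u # vs) Fj \<le> 1"
    using bx_nonneg[OF p BFj, of "u # vs"] bx_le_1[OF p BFj] by auto
  have "\<delta>2 ^ L1 \<le> real L1 * t"
    unfolding L1_def
  proof (rule loss_comp[OF n(4,5) b K(1) L2])
    show "real (cmp K L2) * \<beta> < \<delta>2 ^ cmp K L2" using big2 by (simp only: L1_def)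
    show "\<delta>2 ^ K \<le> real K * bx p D (u # vs) Fj" using us(3) by (simp only: bFj)
    show "bx p D (u # vs) Fj ^ L2 \<le> real L2 * t" if "real L2 * \<beta> < bx p D (u # vs) Fj ^ L2"
      unfolding L2_def by (rule loss_comp[OF bb b M12 _ step1 step2]) (use that in \<open>simp_all only: L2_def\<close>)
  qed
  then have "\<delta> ^ M \<le> real M * t" by (rule c(2)[rotated 2]) (simp_all add: M cmp_def)
  moreover have "t = bx p D (us' @ replicate (Suc (Suc r)) (w j)) (f j)"
    unfolding t_def vs_def by (simp only: replicate_Suc[of "Suc r"] bx_move[of p D us' "w j"])
  ultimately show "\<exists>us. length us = a \<and> set us \<subseteq> G \<and> cmod (Lam p D ?one w f0 f) ^ M
      \<le> real M * bx p D (us @ replicate (Suc (Suc r)) (w j)) (f j)"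
    using u unfolding \<delta>_def by blast
qed

lemma ping_pong:
  assumes K: "1 \<le> Km" "1 \<le> K2"
  shows "1 \<le> K \<Longrightarrow> \<exists>M\<ge>1. \<forall>p D \<beta> G E w i j. p > 0 \<longrightarrow> 0 \<le> \<beta> \<longrightarrow> i \<in> I \<longrightarrow> j \<in> I \<longrightarrow> i \<noteq> j \<longrightarrow> i \<notin> E \<longrightarrow> j \<notin> E \<longrightarrow> E \<subseteq> I \<longrightarrow>
    Mov Km p D \<beta> G E w j i \<longrightarrow> Xat K2 (insert i E) p D \<beta> (\<lambda>_. 1) w \<longrightarrow> BQ K a r p D \<beta> G E w j \<longrightarrow> BQ M 0 (a + r) p D \<beta> G E w j"
proof (induction a arbitrary: r K)
  case 0
  then show ?case by (intro exI[of _ K]) simp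
next
  case (Suc a)
  define M where "M = cmp 4 (cmp K (cmp (4 * Km\<^sup>2 * 2 ^ (a + Suc r)) (4 * (4 ^ K2 * K2)\<^sup>2 * 2 ^ (a + Suc r))))"
  have "1 \<le> 4 * Km\<^sup>2 * 2 ^ (a + Suc r)" "1 \<le> 4 * (4 ^ K2 * K2)\<^sup>2 * 2 ^ (a + Suc r)"
    using K by (simp_all add: Suc_le_eq)
  then have M: "1 \<le> M" unfolding M_def using cmp_ge Suc.prems by simp
  from Suc.IH[OF M, of "Suc r"] obtain M' where M': "1 \<le> M'" and H: "\<And>p D \<beta> G E w i j. p > 0 \<Longrightarrow> 0 \<le> \<beta> \<Longrightarrow> i \<in> I \<Longrightarrow> j \<in> I \<Longrightarrow> i \<noteq> j \<Longrightarrow> i \<notin> E \<Longrightarrow> j \<notin> E \<Longrightarrow> E \<subseteq> I \<Longrightarrow>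
    Mov Km p D \<beta> G E w j i \<Longrightarrow> Xat K2 (insert i E) p D \<beta> (\<lambda>_. 1) w \<Longrightarrow> BQ M a (Suc r) p D \<beta> G E w j \<Longrightarrow> BQ M' 0 (a + Suc r) p D \<beta> G E w j"
    by blast
  show ?case
  proof (intro exI[of _ M'] conjI allI impI M')
    fix p D \<beta> G E w i j
    assume *: "p > 0" "0 \<le> \<beta>" "i \<in> I" "j \<in> I" "i \<noteq> j" "i \<notin> E" "j \<notin> E" "E \<subseteq> I" "Mov Km p D \<beta> G E w j i" "Xat K2 (insert i E) p D \<beta> (\<lambda>_. 1) w" "BQ K (Suc a) r p D \<beta> G E w j"
    have "BQ M a (Suc r) p D \<beta> G E w j" by (rule ping_pong_step[OF *(1,2) Suc.prems K *(3-11) M_def])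
    from H[OF *(1-10) this] show "BQ M' 0 (Suc a + r) p D \<beta> G E w j" by simp
  qed
qed

end

section \<open>Separation of the curves and box control of a family\<close>

lemma card_linear_root_le:
  assumes p: "prime p" and m: "\<not> int p dvd m"
  shows "card {h \<in> Fp p. int p dvd a - h * m} \<le> 1"
proof -
  have "h = h'" if "h \<in> Fp p" "h' \<in> Fp p" "int p dvd a - h * m" "int p dvd a - h' * m" for h h'
  proof -
    have "int p dvd (a - h * m) - (a - h' * m)" by (rule dvd_diff[OF that(3,4)])
    then have "int p dvd (h' - h) * m" by (simp add: algebra_simps)
    then have "int p dvd h' - h" using p m prime_not_dvd_mult by blast
    then have "[h' = h] (mod int p)" by (simp add: cong_iff_dvd_diff)
    then show ?thesis using that unfolding Fp_def by (auto dest: cong_less_imp_eq_int)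
  qed
  then show ?thesis by (subst One_nat_def, subst card_le_Suc0_iff_eq) auto
qed

text \<open>The consequences of linear independence that differencing needs, namely pairwise ones.
  Full independence enters through \<open>wt\<close>.\<close>

locale good_polys = polys +
  assumes deg_pos: "\<And>i. i \<in> I \<Longrightarrow> 1 \<le> degree (P i)" and const0: "\<And>i. i \<in> I \<Longrightarrow> coeff (P i) 0 = 0"
    and cross_nz: "\<And>j l. j \<in> I \<Longrightarrow> l \<in> I \<Longrightarrow> j \<noteq> l \<Longrightarrow> cross P j l \<noteq> 0"
begin

text \<open>\<open>Dk\<close> is a dimension in which the directions can be taken to be distinct unit vectors.\<close>

definition Dk :: nat where "Dk = Suc (\<Sum>I)"

text \<open>Primes for which no relevant leading coefficient degenerates. The last condition leaves
  enough residues for \<open>exists_separating\<close>.\<close>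

definition gp :: "nat \<Rightarrow> bool" where
  "gp p \<longleftrightarrow> prime p \<and> (\<forall>i\<in>I. degree (P i) < p \<and> \<not> int p dvd lead_coeff (P i)) \<and>
     (\<forall>j\<in>I. \<forall>l\<in>I. j \<noteq> l \<longrightarrow> \<not> int p dvd lead_coeff (cross P j l)) \<and> ((card I)\<^sup>2 + 1) * Dk < p"

lemma I_less_Dk: "I \<subseteq> {..<Dk}"
  using member_le_sum[of _ I "\<lambda>x. x"] finI by (auto simp: Dk_def less_Suc_eq_le)

lemma cross_degree:
  assumes "j \<in> I" "l \<in> I" "j \<noteq> l" "degree (P l) \<le> d" "degree (P j) \<le> d"
  shows "1 \<le> degree (cross P j l)" "degree (cross P j l) \<le> d"
proof -
  show "1 \<le> degree (cross P j l)"
  proof (rule ccontr)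
    assume "\<not> 1 \<le> degree (cross P j l)"
    then have "cross P j l = [:coeff (cross P j l) 0:]" by (metis coeff_pCons_0 degree_eq_zeroE less_one not_le)
    moreover have "coeff (cross P j l) 0 = 0" unfolding cross_def using const0 assms by simp
    ultimately show False using cross_nz assms by simp
  qed
  show "degree (cross P j l) \<le> d"
    unfolding cross_def by (intro degree_diff_le order_trans[OF degree_smult_le] assms)
qed

abbreviation dir :: "(nat \<Rightarrow> vec) \<Rightarrow> nat \<Rightarrow> int \<Rightarrow> vec" where
  "dir w l \<equiv> \<lambda>y. sm (poly (P l) y) (w l)"

abbreviation lw :: "(nat \<Rightarrow> vec) \<Rightarrow> nat \<Rightarrow> vec" where
  "lw w l \<equiv> sm (lead_coeff (P l)) (w l)"

lemma LT_dir: "LT p D (degree (P l)) (lw w l) (dir w l)"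
  by (rule LT_I[where R = "\<lambda>k. smult (w l k) (P l)"]) (simp_all add: sm_def mult.commute degree_smult_le)

text \<open>At equal degree the leading vectors of the two curves either differ by an element of
  \<open>G\<close> or agree modulo \<open>p\<close>. In the latter case they cancel, and the
  distance is a lower degree multiple of the same vector, nonzero thanks to
  \<open>cross_nz\<close>.\<close>

lemma rc_dir:
  assumes gp: "gp p" and G: "gd p G" and jl: "j \<in> I" "l \<in> I" "j \<noteq> l" "degree (P l) \<le> degree (P j)"
    and wj: "lw w j \<in> G" and sep: "degree (P l) = degree (P j) \<Longrightarrow> cg p D (lw w j) (lw w l) \<or> lw w j - lw w l \<in> G"
  shows "rc p D (degree (P j)) G (dir w j) (g, dir w l)"
proof -
  let ?d = "degree (P j)" and ?bj = "lead_coeff (P j)" and ?bl = "lead_coeff (P l)"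
  have p: "prime p" using gp by (simp add: gp_def)
  have d1: "1 \<le> ?d" using deg_pos jl by simp
  consider "degree (P l) < ?d" | "degree (P l) = ?d" "lw w j - lw w l \<in> G" | "degree (P l) = ?d" "cg p D (lw w j) (lw w l)"
    using jl(4) sep by fastforce
  then show ?thesis
  proof cases
    case 1
    have "LT p D ?d (lw w j - 0) (\<lambda>y. dir w j y - dir w l y)"
      by (rule LT_diff[OF LT_dir LT_mono[OF LT_dir 1]])
    then show ?thesis unfolding rc_def using wj d1 by (auto simp del: minus_apply)
  next
    case 2
    have "LT p D ?d (lw w j - lw w l) (\<lambda>y. dir w j y - dir w l y)"
    proof (rule LT_diff[OF LT_dir])
      show "LT p D ?d (lw w l) (dir w l)" by (subst 2(1)[symmetric]) (rule LT_dir)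
    qed
    then show ?thesis unfolding rc_def snd_conv using 2(2) d1 by blast
  next
    case 3
    have nd: "\<not> int p dvd ?bj" "\<not> int p dvd ?bl" "\<not> int p dvd lead_coeff (cross P j l)"
      using gp jl unfolding gp_def by auto
    obtain bj' bl' where bj': "[?bj * bj' = 1] (mod int p)" "\<not> int p dvd bj'" and bl': "[?bl * bl' = 1] (mod int p)" "\<not> int p dvd bl'"
      using prime_inverse_mod[OF p nd(1)] prime_inverse_mod[OF p nd(2)] by blast
    let ?R = "cross P j l"
    \<comment> \<open>Modulo \<open>p\<close> the directions are \<open>bj'\<close> and
      \<open>bl'\<close> times the common vector \<open>lw w j\<close>, so the difference of the
      curves is that vector times \<open>bl' * bj'\<close> times the cross polynomial.\<close>
    have "LT p D (degree ?R) (sm (bl' * bj' * lead_coeff ?R) (lw w j)) (\<lambda>y. dir w j y - dir w l y)"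
    proof (rule LT_I[where R = "\<lambda>k. smult (bl' * bj' * (?bj * w j k)) ?R"])
      fix k y assume "k < D"
      then have c: "[?bj * w j k = ?bl * w l k] (mod int p)" using 3(2) by (simp add: cg_def sm_def)
      let ?a = "poly (P j) y" and ?c = "poly (P l) y"
      have "bl' * bj' * (?bj * w j k) * poly ?R y = (?bj * bj') * (?bl * bl') * (?a * w j k) - (?bj * bj') * (bl' * ?c) * (?bj * w j k)"
        unfolding cross_def by (simp add: algebra_simps)
      also have "[\<dots> = 1 * 1 * (?a * w j k) - 1 * (bl' * ?c) * (?bl * w l k)] (mod int p)"
        by (intro cong_diff cong_mult bj' bl' c cong_refl)
      also have "1 * 1 * (?a * w j k) - 1 * (bl' * ?c) * (?bl * w l k) = ?a * w j k - (?bl * bl') * (?c * w l k)"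
        by (simp add: algebra_simps)
      also have "[\<dots> = ?a * w j k - 1 * (?c * w l k)] (mod int p)"
        by (intro cong_diff cong_mult bl' cong_refl)
      finally show "[(dir w j y - dir w l y) k = poly (smult (bl' * bj' * (?bj * w j k)) ?R) y] (mod int p)"
        by (simp add: sm_def cong_sym_eq)
    qed (simp_all add: sm_def degree_smult_le mult_ac)
    moreover have "sm (bl' * bj' * lead_coeff ?R) (lw w j) \<in> G"
      using G wj prime_not_dvd_mult[OF p prime_not_dvd_mult[OF p bl'(2) bj'(2)] nd(3)] unfolding gd_def by blast
    ultimately show ?thesis
      unfolding rc_def snd_conv using cross_degree[OF jl(1-4) order_refl] by blast
  qed
qed

text \<open>The eigenfunctions become phases and are removed first; the other curves are then
  handled by \<open>polynomial_box_control\<close> with the curve of top degree tracked. Polynomials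
  of eigenfunctions may have larger degree, as they only enter the phase.\<close>

lemma family_box_control:
  assumes E: "E \<subseteq> I" and j: "j \<in> I" "j \<notin> E" and top: "\<forall>l\<in>I - E. degree (P l) \<le> degree (P j)"
  shows "\<exists>K N. 1 \<le> K \<and> (\<forall>p D \<beta> G w. gp p \<longrightarrow> gd p G \<longrightarrow> 1 / real p \<le> \<beta> \<longrightarrow> lw w j \<in> G \<longrightarrow>
    (\<forall>l\<in>I - E - {j}. degree (P l) = degree (P j) \<longrightarrow> cg p D (lw w j) (lw w l) \<or> lw w j - lw w l \<in> G) \<longrightarrow>
    (\<forall>f0 f. fam p D E w f0 f \<longrightarrow> real K * \<beta> < cmod (Lam p D (\<lambda>_. 1) w f0 f) ^ K \<longrightarrow>
     (\<exists>us. length us = Suc N \<and> set us \<subseteq> G \<and> cmod (Lam p D (\<lambda>_. 1) w f0 f) ^ K \<le> real K * bx p D us (f j))))"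
proof -
  let ?d = "degree (P j)" and ?Nd = "\<Sum>i\<in>I. degree (P i)"
  obtain L where L: "set L = I - E - {j}" "distinct L" using finite_distinct_list finI by (meson finite_Diff)
  have d1: "1 \<le> ?d" using deg_pos j by simp
  show ?thesis
  proof (cases "?d = 1")
    case True
    \<comment> \<open>Linear polynomials without constant term are proportional, so at top degree
      one no second function can be left. This case is separate because the elimination needs degree
      at least two.\<close>
    have "I - E - {j} = {}"
    proof (rule ccontr)
      assume "I - E - {j} \<noteq> {}"
      then obtain l where l: "l \<in> I" "l \<notin> E" "l \<noteq> j" by blast
      then have dl: "degree (P l) = 1" using bspec[OF top, of l] deg_pos[of l] True by simp
      have "coeff (cross P j l) n = 0" for n
      proof (cases "n \<le> 1")
        case True': True
        then consider "n = 0" | "n = 1" by linarith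
        then show ?thesis by cases (use const0 j l dl True in \<open>simp_all add: cross_def\<close>)
      next
        case False
        then show ?thesis using cross_degree(2)[OF j(1) l(1) l(3)[symmetric], of 1] dl True by (simp add: coeff_eq_0)
      qed
      then have "cross P j l = 0" by (simp add: poly_eq_iff)
      then show False using cross_nz[OF j(1) l(1)] l(3) by blast
    qed
    then have L0: "L = []" using L(1) by (metis set_empty)
    have Pj: "poly (P j) y = y * lead_coeff (P j)" for y
    proof -
      have "P j = [:coeff (P j) 0, coeff (P j) 1:]"
      proof (rule poly_eqI)
        fix n
        show "coeff (P j) n = coeff [:coeff (P j) 0, coeff (P j) 1:] n"
          using True by (cases "n \<le> 1") (auto simp: coeff_eq_0 coeff_pCons le_Suc_eq split: nat.splits)
      qed
      then have "poly (P j) y = poly [:coeff (P j) 0, coeff (P j) 1:] y" by simp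
      then show ?thesis using const0[OF j(1)] True by simp
    qed
    show ?thesis
    proof (rule exI[of _ "2 ^ Suc ?Nd"], rule exI[of _ ?Nd], intro conjI allI impI)
      fix p D \<beta> G w f0 f
      assume gp: "gp p" and w: "lw w j \<in> G" and fam: "fam p D E w f0 f"
      have p: "prime p" "p > 0" using gp prime_gt_0_nat by (auto simp: gp_def)
      obtain c Q where cQ: "\<And>x. cmod (c x) \<le> 1" "\<And>x. degree (Q x) \<le> ?Nd"
        "cmod (Lam p D (\<lambda>_. 1) w f0 f) = PHS p D c Q (map (\<lambda>l. (f l, dir w l)) (j # L))"
        using Lam_eq_PHS[OF p(2) fam E j L(2,1)] by blast
      have "dir w j = (\<lambda>y. sm y (lw w j))" unfolding Pj sm_sm ..
      then have eq: "cmod (Lam p D (\<lambda>_. 1) w f0 f) = PHS p D c Q [(f j, \<lambda>y. sm y (lw w j))]"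
        unfolding cQ(3) L0 by (simp only: list.map)
      have Bf: "B1 p D (f j)" using fam j unfolding fam_def by blast
      have le: "cmod (Lam p D (\<lambda>_. 1) w f0 f) ^ (2 ^ Suc ?Nd) \<le> bx p D (replicate (Suc ?Nd) (lw w j)) (f j)"
        unfolding eq by (rule PHS_linear_box[OF p(1) cQ(1,2) Bf])
      moreover have "bx p D (replicate (Suc ?Nd) (lw w j)) (f j) \<le> real (2 ^ Suc ?Nd) * bx p D (replicate (Suc ?Nd) (lw w j)) (f j)"
      proof -
        have "1 \<le> real (2 ^ Suc ?Nd)" unfolding of_nat_power of_nat_numeral by (rule one_le_power) simp
        moreover have "0 \<le> bx p D (replicate (Suc ?Nd) (lw w j)) (f j)" by (rule bx_nonneg[OF p(2) Bf]) simp
        ultimately show ?thesis by (metis mult_1 mult_right_mono)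
      qed
      ultimately have "cmod (Lam p D (\<lambda>_. 1) w f0 f) ^ (2 ^ Suc ?Nd) \<le> real (2 ^ Suc ?Nd) * bx p D (replicate (Suc ?Nd) (lw w j)) (f j)"
        by (rule order_trans)
      moreover have "length (replicate (Suc ?Nd) (lw w j)) = Suc ?Nd" "set (replicate (Suc ?Nd) (lw w j)) \<subseteq> G" using w by auto
      ultimately show "\<exists>us. length us = Suc ?Nd \<and> set us \<subseteq> G \<and>
         cmod (Lam p D (\<lambda>_. 1) w f0 f) ^ (2 ^ Suc ?Nd) \<le> real (2 ^ Suc ?Nd) * bx p D us (f j)" by blast
    qed simp
  next
    case False
    then have d2: "2 \<le> ?d" using d1 by simp
    obtain K1 n' where K1: "1 \<le> K1" and PE: "\<And>p D \<beta> G g0 q0 L c Q \<nu>. cx p ?d G \<beta> \<Longrightarrow> adm p D (g0, q0) \<Longrightarrow>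
       (\<forall>z\<in>set L. adm p D z \<and> rc p D ?d G q0 z) \<Longrightarrow> length L \<le> card I \<Longrightarrow> \<nu> \<in> G \<Longrightarrow> LT p D ?d \<nu> q0 \<Longrightarrow>
       (\<forall>x. cmod (c x) \<le> 1) \<Longrightarrow> (\<forall>x. degree (Q x) \<le> ?Nd) \<Longrightarrow>
       real K1 * \<beta> < PHS p D c Q ((g0, q0) # L) ^ K1 \<Longrightarrow>
       (\<exists>L'. (\<forall>z\<in>set L'. adm p D z \<and> rc p D ?d G q0 z) \<and> length L' \<le> n' \<and>
        PHS p D c Q ((g0, q0) # L) ^ K1 \<le> real K1 * cmod (LamL p D ((g0, q0) # L')))"
      using phase_elimination[of ?d "card I" ?Nd] by blast
    obtain K2 N where K2: "1 \<le> K2" and PB: "\<And>p D \<beta> G g0 q0 L u0. prime p \<Longrightarrow> ?d < p \<Longrightarrow> gd p G \<Longrightarrow> 1 / real p \<le> \<beta> \<Longrightarrow>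
     u0 \<in> G \<Longrightarrow> adm p D (g0, q0) \<Longrightarrow> (\<forall>z\<in>set L. adm p D z \<and> rc p D ?d G q0 z) \<Longrightarrow> length L \<le> n' \<Longrightarrow>
     real K2 * \<beta> < cmod (LamL p D ((g0, q0) # L)) ^ K2 \<Longrightarrow>
     (\<exists>us. length us = Suc N \<and> set us \<subseteq> G \<and> cmod (LamL p D ((g0, q0) # L)) ^ K2 \<le> real K2 * bx p D us g0)"
      using polynomial_box_control[OF d1, of n'] by blast
    show ?thesis
    proof (rule exI[of _ "cmp K1 K2"], rule exI[of _ N], intro conjI allI impI)
      show "1 \<le> cmp K1 K2" using cmp_ge[OF K1 K2] by simp
      fix p D \<beta> G w f0 f
      assume gp: "gp p" and G: "gd p G" and b: "1 / real p \<le> \<beta>" and w: "lw w j \<in> G"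
        and sep: "\<forall>l\<in>I - E - {j}. degree (P l) = ?d \<longrightarrow> cg p D (lw w j) (lw w l) \<or> lw w j - lw w l \<in> G"
        and fam: "fam p D E w f0 f" and big: "real (cmp K1 K2) * \<beta> < cmod (Lam p D (\<lambda>_. 1) w f0 f) ^ cmp K1 K2"
      have p: "prime p" "p > 0" "?d < p" using gp prime_gt_0_nat j by (auto simp: gp_def)
      have b0: "0 \<le> \<beta>" using b order_trans[of 0 "1 / real p" \<beta>] by simp
      have B: "B1 p D f0" "\<And>i. i \<in> I \<Longrightarrow> B1 p D (f i)" using fam unfolding fam_def by auto
      have cx: "cx p ?d G \<beta>" unfolding cx_def using p d2 G b by simp
      obtain c Q where cQ: "\<And>x. cmod (c x) \<le> 1" "\<And>x. degree (Q x) \<le> ?Nd"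
        "cmod (Lam p D (\<lambda>_. 1) w f0 f) = PHS p D c Q (map (\<lambda>l. (f l, dir w l)) (j # L))"
        using Lam_eq_PHS[OF p(2) fam E j L(2,1)] by blast
      let ?L = "map (\<lambda>l. (f l, dir w l)) L"
      define \<delta> where "\<delta> = PHS p D c Q ((f j, dir w j) # ?L)"
      have \<delta>eq: "cmod (Lam p D (\<lambda>_. 1) w f0 f) = \<delta>" unfolding \<delta>_def cQ(3) by (simp only: list.map)
      have adm: "adm p D (f l, dir w l)" if "l \<in> I" for l
        unfolding adm_def fst_conv snd_conv using B(2)[OF that] LT_qp[OF LT_dir] by blast
      have rcL: "\<forall>z\<in>set ?L. adm p D z \<and> rc p D ?d G (dir w j) z"
      proof
        fix z assume "z \<in> set ?L"
        then obtain l where z: "z = (f l, dir w l)" and l: "l \<in> I - E - {j}" using L(1) by auto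
        have "rc p D ?d G (dir w j) (f l, dir w l)"
        proof (rule rc_dir[where w = w, OF gp G j(1) _ _ _ w])
          show "l \<in> I" "j \<noteq> l" "degree (P l) \<le> ?d" using l top by auto
          show "cg p D (lw w j) (lw w l) \<or> lw w j - lw w l \<in> G" if "degree (P l) = ?d" using sep l that by blast
        qed
        then show "adm p D z \<and> rc p D ?d G (dir w j) z" unfolding z using adm l by blast
      qed
      have "length L = card (I - E - {j})" using L distinct_card by fastforce
      also have "\<dots> \<le> card I" by (rule card_mono[OF finI]) blast
      finally have len: "length ?L \<le> card I" by simp
      have \<delta>1: "0 \<le> \<delta>" "\<delta> \<le> 1" unfolding \<delta>eq[symmetric] using norm_Lam_le[where f = f and w = w and \<theta> = "\<lambda>_. 1", OF p(2) _ B] by simp_all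
      have big': "real (cmp K1 K2) * \<beta> < \<delta> ^ cmp K1 K2" using big by (simp only: \<delta>eq)
      have "real K1 * \<beta> < \<delta> ^ K1" using cmp_ge[OF K1 K2] by (intro loss_mono[OF \<delta>1 b0 _ big']) simp
      moreover have "\<forall>x. cmod (c x) \<le> 1" "\<forall>x. degree (Q x) \<le> ?Nd" using cQ by blast+
      ultimately have "\<exists>L'. (\<forall>z\<in>set L'. adm p D z \<and> rc p D ?d G (dir w j) z) \<and> length L' \<le> n' \<and>
        \<delta> ^ K1 \<le> real K1 * cmod (LamL p D ((f j, dir w j) # L'))"
        unfolding \<delta>_def by (intro PE[where \<nu> = "lw w j", OF cx adm[OF j(1)] rcL len w LT_dir[of p D j w]])
      then      obtain L' where L': "\<forall>z\<in>set L'. adm p D z \<and> rc p D ?d G (dir w j) z" "length L' \<le> n'"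
        "\<delta> ^ K1 \<le> real K1 * cmod (LamL p D ((f j, dir w j) # L'))" by blast
      note ch = loss_chain[OF \<delta>1 b0 K1 K2 _ big' L'(3)]
      have "real K2 * \<beta> < cmod (LamL p D ((f j, dir w j) # L')) ^ K2" by (rule ch(1)) (simp add: cmp_def)
      from PB[OF p(1,3) G b w adm[OF j(1)] L'(1,2) this]
      obtain us where us: "length us = Suc N" "set us \<subseteq> G" "cmod (LamL p D ((f j, dir w j) # L')) ^ K2 \<le> real K2 * bx p D us (f j)"
        by blast
      have "\<delta> ^ cmp K1 K2 \<le> real (cmp K1 K2) * bx p D us (f j)" by (rule ch(2)[OF _ us(3)]) (simp add: cmp_def)
      then show "\<exists>us. length us = Suc N \<and> set us \<subseteq> G \<and> cmod (Lam p D (\<lambda>_. 1) w f0 f) ^ cmp K1 K2 \<le> real (cmp K1 K2) * bx p D us (f j)"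
        unfolding \<delta>eq using us by blast
    qed
  qed
qed

text \<open>The format of \<open>BQ\<close> counts \<open>b + 1\<close> copies of
  \<open>w j\<close>. The first copy is obtained here by padding, which squares the
  estimate.\<close>

lemma family_BQ:
  assumes E: "E \<subseteq> I" and j: "j \<in> I" "j \<notin> E" and top: "\<forall>l\<in>I - E. degree (P l) \<le> degree (P j)"
  shows "\<exists>K N. 1 \<le> K \<and> (\<forall>p D \<beta> G w. gp p \<longrightarrow> gd p G \<longrightarrow> 1 / real p \<le> \<beta> \<longrightarrow> lw w j \<in> G \<longrightarrow>
    (\<forall>l\<in>I - E - {j}. degree (P l) = degree (P j) \<longrightarrow> cg p D (lw w j) (lw w l) \<or> lw w j - lw w l \<in> G) \<longrightarrow>
    BQ K (Suc N) 0 p D \<beta> G E w j)"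
proof -
  from family_box_control[OF assms]
  obtain K N where K: "1 \<le> K" and H: "\<forall>p D \<beta> G w. gp p \<longrightarrow> gd p G \<longrightarrow> 1 / real p \<le> \<beta> \<longrightarrow> lw w j \<in> G \<longrightarrow>
    (\<forall>l\<in>I - E - {j}. degree (P l) = degree (P j) \<longrightarrow> cg p D (lw w j) (lw w l) \<or> lw w j - lw w l \<in> G) \<longrightarrow>
    (\<forall>f0 f. fam p D E w f0 f \<longrightarrow> real K * \<beta> < cmod (Lam p D (\<lambda>_. 1) w f0 f) ^ K \<longrightarrow>
     (\<exists>us. length us = Suc N \<and> set us \<subseteq> G \<and> cmod (Lam p D (\<lambda>_. 1) w f0 f) ^ K \<le> real K * bx p D us (f j)))"
    by (elim exE conjE)
  have two: "(1::nat) \<le> 2" by simp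
  show ?thesis
    unfolding BQ_def
  proof (rule exI[of _ "cmp K 2"], rule exI[of _ N], intro conjI allI impI)
    show "1 \<le> cmp K 2" using cmp_ge[OF K two] by simp
    fix p D \<beta> G w f0 f
    assume *: "gp p" "gd p G" "1 / real p \<le> \<beta>" "lw w j \<in> G"
      "\<forall>l\<in>I - E - {j}. degree (P l) = degree (P j) \<longrightarrow> cg p D (lw w j) (lw w l) \<or> lw w j - lw w l \<in> G"
      "fam p D E w f0 f" and big: "real (cmp K 2) * \<beta> < cmod (Lam p D (\<lambda>_. 1) w f0 f) ^ cmp K 2"
    define \<delta> where "\<delta> = cmod (Lam p D (\<lambda>_. 1) w f0 f)"
    have p: "p > 0" using *(1) prime_gt_0_nat by (auto simp: gp_def)
    have b0: "0 \<le> \<beta>" using *(3) order_trans[of 0 "1 / real p" \<beta>] by simp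
    have B: "B1 p D f0" "\<And>i. i \<in> I \<Longrightarrow> B1 p D (f i)" using *(6) unfolding fam_def by auto
    have \<delta>1: "0 \<le> \<delta>" "\<delta> \<le> 1" unfolding \<delta>_def using norm_Lam_le[where f = f and w = w and \<theta> = "\<lambda>_. 1", OF p _ B] by simp_all
    have big': "real (cmp K 2) * \<beta> < \<delta> ^ cmp K 2" using big by (simp only: \<delta>_def)
    have "real K * \<beta> < \<delta> ^ K" using cmp_ge[OF K two] by (intro loss_mono[OF \<delta>1 b0 _ big']) simp
    from H[THEN spec, THEN spec, THEN spec, THEN spec, THEN spec, THEN mp, THEN mp, THEN mp, THEN mp, THEN mp,
        THEN spec, THEN spec, THEN mp, THEN mp, OF *(1-6) this[unfolded \<delta>_def]]
    obtain us where us: "length us = Suc N" "set us \<subseteq> G" "\<delta> ^ K \<le> real K * bx p D us (f j)" unfolding \<delta>_def by blast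
    have "us \<noteq> []" using us(1) by auto
    then have nn: "0 \<le> bx p D (us @ [w j]) (f j)" by (intro bx_nonneg[OF p B(2)[OF j(1)]]) simp
    have "(bx p D us (f j))\<^sup>2 \<le> bx p D (w j # us) (f j)" by (rule bx_pad[OF p B(2)[OF j(1)]])
    also have "\<dots> = bx p D (us @ [w j]) (f j)" using bx_move[of p D us "w j" "[]"] by (simp only: append_Nil2)
    also have "\<dots> \<le> real 2 * bx p D (us @ [w j]) (f j)" using nn by simp
    finally have "\<delta> ^ cmp K 2 \<le> real (cmp K 2) * bx p D (us @ [w j]) (f j)"
      using us(3) by (intro loss_comp[OF \<delta>1 b0 K two big'])
    then show "\<exists>us. length us = Suc N \<and> set us \<subseteq> G \<and>
       cmod (Lam p D (\<lambda>_. 1) w f0 f) ^ cmp K 2 \<le> real (cmp K 2) * bx p D (us @ replicate (Suc 0) (w j)) (f j)"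
      unfolding \<delta>_def replicate_Suc replicate_0 using us by blast
  qed
qed

end

subsection \<open>Induction on the set of eigenfunctions\<close>

text \<open>Which index is used depends on the prime and the directions, so the constant has to be
  made uniform over the finitely many indices.\<close>

lemma finite_uniform_bound:
  assumes "finite T" "\<And>j. j \<in> T \<Longrightarrow> \<exists>K\<ge>(1::nat). Q j K"
    and mono: "\<And>j K K'. j \<in> T \<Longrightarrow> 1 \<le> K \<Longrightarrow> Q j K \<Longrightarrow> K \<le> K' \<Longrightarrow> Q j K'"
  shows "\<exists>K\<ge>1. \<forall>j\<in>T. Q j K"
proof -
  obtain k where k: "\<And>j. j \<in> T \<Longrightarrow> 1 \<le> k j \<and> Q j (k j)" using assms(2) by metis
  have "Q j (Suc (\<Sum>j\<in>T. k j))" if "j \<in> T" for j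
  proof -
    have "k j \<le> (\<Sum>j\<in>T. k j)" by (rule member_le_sum) (use that assms(1) in auto)
    then show ?thesis using mono[OF that, of "k j"] k[OF that] by simp
  qed
  then show ?thesis by (intro exI[of _ "Suc (\<Sum>j\<in>T. k j)"]) simp
qed

text \<open>The root count over a field, for integer polynomials modulo \<open>p\<close>: synthetic
  division splits off a root, and the quotient keeps a coefficient prime to
  \<open>p\<close>.\<close>

lemma card_poly_roots_mod:
  assumes p: "prime p"
  shows "degree (U :: int poly) < n \<Longrightarrow> \<not> int p dvd coeff U i \<Longrightarrow> card {s \<in> Fp p. int p dvd poly U s} < n"
proof (induction n arbitrary: U i)
  case 0
  then show ?case by simp
next
  case (Suc n)
  let ?Z = "\<lambda>U. {s \<in> Fp p. int p dvd poly U s}"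
  show ?case
  proof (cases "?Z U = {}")
    case False
    then obtain s where s: "s \<in> Fp p" "int p dvd poly U s" by blast
    define W where "W = synthetic_div U s"
    have UW: "U = [:- s, 1:] * W + [:poly U s:]" unfolding W_def by (rule synthetic_div_correct'[symmetric])
    have "\<exists>i. \<not> int p dvd coeff W i"
    proof (rule ccontr)
      assume "\<nexists>i. \<not> int p dvd coeff W i"
      then have "int p dvd coeff ([:- s, 1:] * W + [:poly U s:]) i"
        using s(2) by (auto simp: coeff_pCons split: nat.split)
      then show False using Suc.prems(2) by (simp only: UW[symmetric])
    qed
    then obtain i' where i': "\<not> int p dvd coeff W i'" by blast
    have "degree W = degree U - 1" unfolding W_def by (rule degree_synthetic_div)
    moreover have "degree U \<noteq> 0"
    proof
      assume "degree U = 0"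
      then have "W = 0" unfolding W_def by (metis degree_eq_zeroE synthetic_div_0 synthetic_div_pCons pCons_0_0 poly_0)
      then show False using i' by simp
    qed
    ultimately have "card (?Z W) < n" using Suc.prems(1) by (intro Suc.IH[OF _ i']) simp
    moreover have "?Z U \<subseteq> insert s (?Z W)"
    proof
      fix t assume t: "t \<in> ?Z U"
      have "poly U t = (t - s) * poly W t + poly U s" by (subst UW) (simp add: algebra_simps)
      then have "int p dvd (t - s) * poly W t" using t s(2) by (simp add: dvd_add_left_iff)
      then consider "int p dvd t - s" | "int p dvd poly W t" using p prime_not_dvd_mult by blast
      then show "t \<in> insert s (?Z W)"
      proof cases
        case 1
        then have "[t = s] (mod int p)" by (simp add: cong_iff_dvd_diff)
        then show ?thesis using t s(1) unfolding Fp_def by (auto dest: cong_less_imp_eq_int)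
      qed (use t in simp)
    qed
    moreover have fin: "finite (?Z W)" by simp
    ultimately have "card (?Z U) \<le> Suc (card (?Z W))"
      using card_mono[of "insert s (?Z W)" "?Z U"] card_insert_le_m1[of "Suc (card (?Z W))" "?Z W" s] by simp
    then show ?thesis using \<open>card (?Z W) < n\<close> by simp
  qed (simp only: card.empty zero_less_Suc)
qed

context polys
begin

lemma Xat_mono:
  assumes p: "p > 0" and th: "\<And>y. cmod (\<theta> y) \<le> 1" and K: "1 \<le> K" "K \<le> K'" and i: "i \<in> I" and X: "Xat K E p D \<beta> \<theta> w"
  shows "Xat K' E p D \<beta> \<theta> w"
  unfolding Xat_def
proof (intro allI impI)
  fix f0 f assume fam: "fam p D E w f0 f"
  have B: "B1 p D f0" "\<And>i. i \<in> I \<Longrightarrow> B1 p D (f i)" using fam unfolding fam_def by auto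
  let ?t = "cmod (Lam p D \<theta> w f0 f - Mn p D \<theta> w f0 f) / 2"
  have "cmod (Mn p D \<theta> w f0 f) \<le> EV p D (\<lambda>x. cmod (EY p (\<lambda>n. f i (x + sm n (w i)))))"
    by (rule norm_Mn_le[where f = f, OF p th B i])
  also have "\<dots> \<le> 1"
    by (intro avg_le_const finite_Fp_vec Fp_vec_nonempty p B1_norm[OF B1_line_mean[OF p B(2)[OF i]]])
  finally have "?t \<le> 1"
    using norm_triangle_ineq4[of "Lam p D \<theta> w f0 f" "Mn p D \<theta> w f0 f"] norm_Lam_le[where f = f and \<theta> = \<theta> and w = w, OF p th B] by simp
  then show "?t ^ K' \<le> real K' * \<beta>" using X fam unfolding Xat_def by (intro gain_mono[OF _ _ K]) auto
qed

text \<open>A direction that vanishes modulo \<open>p\<close> makes \<open>f j\<close> invariant, so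
  \<open>f j\<close> is already an eigenfunction.\<close>

lemma Xat_null:
  assumes X: "Xat K (insert j E) p D \<beta> \<theta> w" and j: "j \<in> I" and w: "cg p D (w j) 0"
  shows "Xat K E p D \<beta> \<theta> w"
  unfolding Xat_def
proof (intro allI impI)
  fix f0 f assume fam: "fam p D E w f0 f"
  have "Eig p (w j) (f j)"
  proof (rule Eig_invariant)
    fix x n
    have "cg p D (x + sm n (w j)) (x + sm n 0)" by (intro cg_add cg_refl cg_sm w cong_refl)
    moreover have "x + sm n 0 = x" by (rule ext) (simp add: sm_def)
    ultimately have "cg p D (x + sm n (w j)) x" by (simp only:)
    moreover have "per p D (f j)" using fam j unfolding fam_def B1_def by blast
    ultimately show "f j (x + sm n (w j)) = f j x" by (rule perD[rotated])
  qed
  then have "fam p D (insert j E) w f0 f" using fam unfolding fam_def by blast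
  then show "(cmod (Lam p D \<theta> w f0 f - Mn p D \<theta> w f0 f) / 2) ^ K \<le> real K * \<beta>" using X unfolding Xat_def by blast
qed

end

section \<open>Kernels of Vandermonde forms\<close>

context good_polys
begin

text \<open>The polynomial with coefficients \<open>u\<close> evaluated at \<open>s\<close>, read as
  a linear form in \<open>u\<close>. A vector nonzero modulo \<open>p\<close> lies in the kernel for
  fewer than \<open>Dk\<close> residues \<open>s\<close>.\<close>

definition psi :: "int \<Rightarrow> vec \<Rightarrow> int" where "psi s u = (\<Sum>i<Dk. s ^ i * u i)"

lemma psi_sm: "psi s (sm c u) = c * psi s u"
  unfolding psi_def sm_def sum_distrib_left by (simp add: mult_ac)

lemma psi_diff: "psi s (u - v) = psi s u - psi s v"
  unfolding psi_def by (simp add: right_diff_distrib sum_subtractf)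

lemma card_psi_roots:
  assumes p: "prime p" and u: "\<not> cg p Dk u 0"
  shows "card {s \<in> Fp p. int p dvd psi s u} < Dk"
proof -
  define U where "U = (\<Sum>i<Dk. monom (u i) i)"
  have cU: "coeff U i = (if i < Dk then u i else 0)" for i unfolding U_def coeff_sum coeff_monom by simp
  have "poly U s = psi s u" for s unfolding U_def psi_def poly_sum poly_monom by (simp add: mult.commute)
  moreover obtain i where "i < Dk" "\<not> int p dvd u i" using u unfolding cg_def by (auto simp: cong_0_iff)
  moreover have "degree U < Dk"
    using degree_le[of "Dk - 1" U] cU by (auto simp: Dk_def less_Suc_eq_le)
  ultimately show ?thesis using card_poly_roots_mod[OF p, of U Dk i] cU by simp
qed

definition VS :: "nat \<Rightarrow> int set \<Rightarrow> vec \<Rightarrow> bool" where "VS p S u \<longleftrightarrow> (\<forall>s\<in>S. int p dvd psi s u)"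

lemma VS_full:
  assumes p: "prime p" and S: "S \<subseteq> Fp p" "Dk \<le> card S" "VS p S u"
  shows "cg p Dk u 0"
proof (rule ccontr)
  assume "\<not> cg p Dk u 0"
  then have "card {s \<in> Fp p. int p dvd psi s u} < Dk" by (rule card_psi_roots[OF p])
  moreover have "card S \<le> card {s \<in> Fp p. int p dvd psi s u}"
    using S unfolding VS_def by (intro card_mono) auto
  ultimately show False using S(2) by simp
qed

text \<open>Each vector of \<open>U\<close> excludes fewer than \<open>Dk\<close> residues and
  \<open>S\<close> has fewer than \<open>Dk\<close> elements, so fewer than
  \<open>((card I)\<^sup>2 + 1) * Dk\<close> residues are lost in all, and \<open>gp\<close> makes
  \<open>p\<close> larger than that.\<close>

lemma exists_separating:
  assumes gp: "gp p" and S: "S \<subseteq> Fp p" "card S < Dk" and U: "finite U" "card U \<le> (card I)\<^sup>2" "\<And>u. u \<in> U \<Longrightarrow> \<not> cg p Dk u 0"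
  shows "\<exists>s\<in>Fp p - S. \<forall>u\<in>U. \<not> int p dvd psi s u"
proof -
  let ?Z = "\<lambda>u. {s \<in> Fp p. int p dvd psi s u}"
  have p: "prime p" "((card I)\<^sup>2 + 1) * Dk < p" using gp by (auto simp: gp_def)
  have "card (\<Union>u\<in>U. ?Z u) \<le> (\<Sum>u\<in>U. card (?Z u))" by (rule card_UN_le[OF U(1)])
  also have "\<dots> \<le> (\<Sum>u\<in>U. Dk)" using card_psi_roots[OF p(1) U(3)] by (intro sum_mono less_imp_le)
  also have "\<dots> \<le> (card I)\<^sup>2 * Dk" using U(2) by simp
  finally have "card (S \<union> (\<Union>u\<in>U. ?Z u)) < p"
    using card_Un_le[of S "\<Union>u\<in>U. ?Z u"] S(2) p(2) by (simp add: algebra_simps)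
  then have "\<not> Fp p \<subseteq> S \<union> (\<Union>u\<in>U. ?Z u)"
    using card_mono[of "S \<union> (\<Union>u\<in>U. ?Z u)" "Fp p"] S(1) U(1) finite_subset[OF S(1)] by (auto simp: card_Fp)
  then show ?thesis by blast
qed

lemma gd_multiples: "prime p \<Longrightarrow> gd p {u. \<exists>c. \<not> int p dvd c \<and> u = sm c v}"
  unfolding gd_def
proof (intro conjI ballI allI impI)
  assume p: "prime p"
  let ?G = "{u. \<exists>c. \<not> int p dvd c \<and> u = sm c v}"
  show "sm c \<nu> \<in> ?G" if "\<nu> \<in> ?G" "\<not> int p dvd c" for \<nu> c
  proof -
    obtain a where "\<nu> = sm a v" "\<not> int p dvd a" using \<open>\<nu> \<in> ?G\<close> by blast
    then have "sm c \<nu> = sm (c * a) v" "\<not> int p dvd c * a" using prime_not_dvd_mult[OF p that(2)] by (simp_all add: sm_sm)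
    then show ?thesis by blast
  qed
  show "card {h \<in> Fp p. \<nu> - sm (h * c) \<mu> \<notin> ?G} \<le> 1" if "\<nu> \<in> ?G" "\<mu> \<in> ?G" "\<not> int p dvd c" for \<nu> \<mu> c
  proof -
    obtain a b where ab: "\<nu> = sm a v" "\<mu> = sm b v" "\<not> int p dvd b" using \<open>\<nu> \<in> ?G\<close> \<open>\<mu> \<in> ?G\<close> by blast
    have "\<nu> - sm (h * c) \<mu> = sm (a - h * (c * b)) v" for h unfolding ab sm_sm sm_diff_left by (simp only: mult.assoc)
    then have "{h \<in> Fp p. \<nu> - sm (h * c) \<mu> \<notin> ?G} \<subseteq> {h \<in> Fp p. int p dvd a - h * (c * b)}" by blast
    then have "card {h \<in> Fp p. \<nu> - sm (h * c) \<mu> \<notin> ?G} \<le> card {h \<in> Fp p. int p dvd a - h * (c * b)}"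
      by (rule card_mono[rotated]) simp
    also have "\<dots> \<le> 1" by (rule card_linear_root_le[OF p prime_not_dvd_mult[OF p that(3) ab(3)]])
    finally show ?thesis .
  qed
qed

text \<open>Inside a common kernel, the complement of one more kernel has the required closedness:
  \<open>\<nu> - h c \<mu>\<close> falls into the hyperplane for at most one residue
  \<open>h\<close>, as the form does not vanish on \<open>\<mu>\<close>.\<close>

lemma gd_VS: "prime p \<Longrightarrow> gd p {u. VS p S u \<and> \<not> int p dvd psi s0 u}"
  unfolding gd_def
proof (intro conjI ballI allI impI)
  assume p: "prime p"
  let ?G = "{u. VS p S u \<and> \<not> int p dvd psi s0 u}"
  show "sm c \<nu> \<in> ?G" if "\<nu> \<in> ?G" "\<not> int p dvd c" for \<nu> c
    using that prime_not_dvd_mult[OF p] by (auto simp: VS_def psi_sm)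
  show "card {h \<in> Fp p. \<nu> - sm (h * c) \<mu> \<notin> ?G} \<le> 1" if "\<nu> \<in> ?G" "\<mu> \<in> ?G" "\<not> int p dvd c" for \<nu> \<mu> c
  proof -
    have "{h \<in> Fp p. \<nu> - sm (h * c) \<mu> \<notin> ?G} \<subseteq> {h \<in> Fp p. int p dvd psi s0 \<nu> - h * (c * psi s0 \<mu>)}"
      using that by (auto simp: VS_def psi_sm psi_diff mult.assoc)
    then have "card {h \<in> Fp p. \<nu> - sm (h * c) \<mu> \<notin> ?G} \<le> card {h \<in> Fp p. int p dvd psi s0 \<nu> - h * (c * psi s0 \<mu>)}"
      by (rule card_mono[rotated]) simp
    also have "\<dots> \<le> 1" using that by (intro card_linear_root_le[OF p prime_not_dvd_mult[OF p]]) auto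
    finally show ?thesis .
  qed
qed

lemma bx_multiples:
  assumes p: "prime p" and f: "B1 p D f"
  shows "set us \<subseteq> {u. \<exists>c. \<not> int p dvd c \<and> u = sm c v} \<Longrightarrow> bx p D (us @ vs) f = bx p D (replicate (length us) v @ vs) f"
proof (induction us arbitrary: vs)
  case (Cons u us)
  then obtain c where c: "\<not> int p dvd c" "u = sm c v" by auto
  have "bx p D ((u # us) @ vs) f = bx p D (v # us @ vs) f" unfolding c append_Cons by (rule bx_scale[OF p c(1) f])
  also have "\<dots> = bx p D (us @ v # vs) f" by (rule bx_move[symmetric])
  also have "\<dots> = bx p D (replicate (length us) v @ v # vs) f" using Cons by simp
  also have "\<dots> = bx p D (v # replicate (length us) v @ vs) f" by (rule bx_move)
  finally show ?case by simp
qed simp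

definition cnd :: "nat \<Rightarrow> real \<Rightarrow> bool" where
  "cnd p \<beta> \<longleftrightarrow> gp p \<and> 1 / real p \<le> \<beta> \<and> \<beta> \<le> 1 \<and> wt p \<beta> (\<lambda>_. 1)"

lemma cndD: "cnd p \<beta> \<Longrightarrow> prime p \<and> p > 0 \<and> 0 \<le> \<beta> \<and> \<beta> \<le> 1 \<and> gp p \<and> 1 / real p \<le> \<beta>"
  unfolding cnd_def gp_def using prime_gt_0_nat[of p] order_trans[of 0 "1 / real p" \<beta>] by auto

lemma single_alive:
  assumes E: "E \<subseteq> I" "I - E = {j}" and K1: "1 \<le> K1" and X: "\<forall>p D \<beta> w. cnd p \<beta> \<longrightarrow> Xat K1 (insert j E) p D \<beta> (\<lambda>_. 1) w"
  shows "\<exists>K\<ge>1. \<forall>p D \<beta> w. cnd p \<beta> \<longrightarrow> Xat K E p D \<beta> (\<lambda>_. 1) w"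
proof -
  have j: "j \<in> I" "j \<notin> E" using E(2) by auto
  have top: "\<forall>l\<in>I - E. degree (P l) \<le> degree (P j)" unfolding E(2) by simp
  have emp: "I - E - {j} = {}" unfolding E(2) by simp
  from family_BQ[OF E(1) j top]
  obtain K2 N where K2: "1 \<le> K2" and BQ: "\<forall>p D \<beta> G w. gp p \<longrightarrow> gd p G \<longrightarrow> 1 / real p \<le> \<beta> \<longrightarrow> lw w j \<in> G \<longrightarrow>
    (\<forall>l\<in>I - E - {j}. degree (P l) = degree (P j) \<longrightarrow> cg p D (lw w j) (lw w l) \<or> lw w j - lw w l \<in> G) \<longrightarrow>
    BQ K2 (Suc N) 0 p D \<beta> G E w j" by (elim exE conjE)
  from Xat_from_box_control[OF K1 K2, of N]
  obtain K where K: "1 \<le> K" and H: "\<And>p D \<beta> j E w. p > 0 \<Longrightarrow> 0 \<le> \<beta> \<Longrightarrow> \<beta> \<le> 1 \<Longrightarrow> j \<in> I \<Longrightarrow> j \<notin> E \<Longrightarrow>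
    Xat K1 (insert j E) p D \<beta> (\<lambda>_. 1) w \<Longrightarrow>
    (\<forall>f0 f. fam p D E w f0 f \<longrightarrow> real K2 * \<beta> < cmod (Lam p D (\<lambda>_. 1) w f0 f) ^ K2 \<longrightarrow>
      cmod (Lam p D (\<lambda>_. 1) w f0 f) ^ K2 \<le> real K2 * bx p D (replicate (Suc (Suc N)) (w j)) (f j)) \<Longrightarrow>
    Xat K E p D \<beta> (\<lambda>_. 1) w" by blast
  show ?thesis
  proof (intro exI[of _ K] conjI allI impI K)
    fix p D \<beta> w assume cnd: "cnd p \<beta>"
    have p: "prime p" "p > 0" "0 \<le> \<beta>" "\<beta> \<le> 1" "gp p" "1 / real p \<le> \<beta>" using cndD[OF cnd] by auto
    let ?G = "{u. \<exists>c. \<not> int p dvd c \<and> u = sm c (w j)}"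
    have "lw w j \<in> ?G" using p(5) j unfolding gp_def by blast
    from BQ[THEN spec[of _ p], THEN spec[of _ D], THEN spec[of _ \<beta>], THEN spec[of _ ?G], THEN spec[of _ w], THEN mp, THEN mp, THEN mp, THEN mp, THEN mp,
        OF p(5) gd_multiples[OF p(1)] p(6) this]
    have bq: "BQ K2 (Suc N) 0 p D \<beta> ?G E w j" unfolding emp by blast
    have Xj: "Xat K1 (insert j E) p D \<beta> (\<lambda>_. 1) w" using X cnd by blast
    show "Xat K E p D \<beta> (\<lambda>_. 1) w"
    proof (rule H[OF p(2-4) j Xj], intro allI impI)
      fix f0 f assume fam: "fam p D E w f0 f" and big: "real K2 * \<beta> < cmod (Lam p D (\<lambda>_. 1) w f0 f) ^ K2"
      from bq[unfolded BQ_def, THEN spec, THEN spec, THEN mp, THEN mp, OF fam big]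
      obtain us where us: "length us = Suc N" "set us \<subseteq> ?G"
        "cmod (Lam p D (\<lambda>_. 1) w f0 f) ^ K2 \<le> real K2 * bx p D (us @ replicate (Suc 0) (w j)) (f j)" by blast
      have "B1 p D (f j)" using fam j unfolding fam_def by blast
      then have "bx p D (us @ replicate (Suc 0) (w j)) (f j) = bx p D (replicate (Suc N) (w j) @ replicate (Suc 0) (w j)) (f j)"
        using bx_multiples[OF p(1) _ us(2)] us(1) by simp
      also have "replicate (Suc N) (w j) @ replicate (Suc 0) (w j) = replicate (Suc (Suc N)) (w j)"
        by (simp only: replicate_add[symmetric]) simp
      finally show "cmod (Lam p D (\<lambda>_. 1) w f0 f) ^ K2 \<le> real K2 * bx p D (replicate (Suc (Suc N)) (w j)) (f j)"
        using us(3) by simp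
    qed
  qed
qed

definition Tp :: "nat set \<Rightarrow> nat set" where
  "Tp E = {j \<in> I - E. \<forall>l\<in>I - E. degree (P l) \<le> degree (P j)}"

text \<open>The bound \<open>Mov\<close> needed for the exchange is the estimate for modified
  directions: at a place invariant under \<open>u\<close>, replacing \<open>w j\<close> by a vector
  in the kernel of the form changes nothing.\<close>

lemma move_step:
  assumes E: "E \<subseteq> I" and j: "j \<in> Tp E" and i: "i \<in> I" "i \<notin> E" "i \<noteq> j" and K1: "1 \<le> K1" and Kn: "1 \<le> Kn"
  shows "\<exists>K\<ge>1. \<forall>p \<beta> w S s0. cnd p \<beta> \<longrightarrow> Xat K1 (insert j E) p Dk \<beta> (\<lambda>_. 1) w \<longrightarrow> Xat K1 (insert i E) p Dk \<beta> (\<lambda>_. 1) w \<longrightarrow>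
    (\<forall>l\<in>Tp E. VS p S (w l)) \<longrightarrow> \<not> int p dvd psi s0 (w j) \<longrightarrow>
    (\<forall>l\<in>Tp E. j \<noteq> l \<longrightarrow> \<not> int p dvd psi s0 (w l) \<longrightarrow> cg p Dk (lw w j) (lw w l) \<or> \<not> int p dvd psi s0 (lw w j - lw w l)) \<longrightarrow>
    (\<forall>v. VS p S v \<longrightarrow> int p dvd psi s0 v \<longrightarrow> Xat Kn E p Dk \<beta> (\<lambda>_. 1) (w(j := v))) \<longrightarrow>
    Xat K E p Dk \<beta> (\<lambda>_. 1) w"
proof -
  have j': "j \<in> I" "j \<notin> E" "\<forall>l\<in>I - E. degree (P l) \<le> degree (P j)" using j by (auto simp: Tp_def)
  from family_BQ[OF E j']
  obtain K0 N where K0: "1 \<le> K0" and BQ: "\<forall>p D \<beta> G w. gp p \<longrightarrow> gd p G \<longrightarrow> 1 / real p \<le> \<beta> \<longrightarrow> lw w j \<in> G \<longrightarrow>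
    (\<forall>l\<in>I - E - {j}. degree (P l) = degree (P j) \<longrightarrow> cg p D (lw w j) (lw w l) \<or> lw w j - lw w l \<in> G) \<longrightarrow>
    BQ K0 (Suc N) 0 p D \<beta> G E w j" by (elim exE conjE)
  define Km where "Km = 4 ^ Kn * Kn"
  have Km: "1 \<le> Km" using Kn by (simp add: Km_def)
  from ping_pong[OF Km K1 K0, of "Suc N" 0]
  obtain K2 where K2: "1 \<le> K2" and PP: "\<And>p D \<beta> G E w i j. p > 0 \<Longrightarrow> 0 \<le> \<beta> \<Longrightarrow> i \<in> I \<Longrightarrow> j \<in> I \<Longrightarrow> i \<noteq> j \<Longrightarrow> i \<notin> E \<Longrightarrow> j \<notin> E \<Longrightarrow> E \<subseteq> I \<Longrightarrow>
    Mov Km p D \<beta> G E w j i \<Longrightarrow> Xat K1 (insert i E) p D \<beta> (\<lambda>_. 1) w \<Longrightarrow> BQ K0 (Suc N) 0 p D \<beta> G E w j \<Longrightarrow> BQ K2 0 (Suc N + 0) p D \<beta> G E w j"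
    by blast
  from Xat_from_box_control[OF K1 K2, of N]
  obtain K where K: "1 \<le> K" and H: "\<And>p D \<beta> j E w. p > 0 \<Longrightarrow> 0 \<le> \<beta> \<Longrightarrow> \<beta> \<le> 1 \<Longrightarrow> j \<in> I \<Longrightarrow> j \<notin> E \<Longrightarrow>
    Xat K1 (insert j E) p D \<beta> (\<lambda>_. 1) w \<Longrightarrow>
    (\<forall>f0 f. fam p D E w f0 f \<longrightarrow> real K2 * \<beta> < cmod (Lam p D (\<lambda>_. 1) w f0 f) ^ K2 \<longrightarrow>
      cmod (Lam p D (\<lambda>_. 1) w f0 f) ^ K2 \<le> real K2 * bx p D (replicate (Suc (Suc N)) (w j)) (f j)) \<Longrightarrow>
    Xat K E p D \<beta> (\<lambda>_. 1) w" by blast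
  show ?thesis
  proof (intro exI[of _ K] conjI allI impI K)
    fix p \<beta> w S s0
    assume cnd: "cnd p \<beta>" and Xj: "Xat K1 (insert j E) p Dk \<beta> (\<lambda>_. 1) w" and Xi: "Xat K1 (insert i E) p Dk \<beta> (\<lambda>_. 1) w"
      and V: "\<forall>l\<in>Tp E. VS p S (w l)" and out: "\<not> int p dvd psi s0 (w j)"
      and sep: "\<forall>l\<in>Tp E. j \<noteq> l \<longrightarrow> \<not> int p dvd psi s0 (w l) \<longrightarrow> cg p Dk (lw w j) (lw w l) \<or> \<not> int p dvd psi s0 (lw w j - lw w l)"
      and IH: "\<forall>v. VS p S v \<longrightarrow> int p dvd psi s0 v \<longrightarrow> Xat Kn E p Dk \<beta> (\<lambda>_. 1) (w(j := v))"
    have p: "prime p" "p > 0" "0 \<le> \<beta>" "\<beta> \<le> 1" "gp p" "1 / real p \<le> \<beta>" using cndD[OF cnd] by auto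
    \<comment> \<open>Every direction that differencing can produce lies outside the kernel of the
      form at \<open>s0\<close>, so it can be used to move \<open>w j\<close> into this
      kernel.\<close>
    let ?G = "{u. VS p S u \<and> \<not> int p dvd psi s0 u}"
    have bj: "\<not> int p dvd lead_coeff (P j)" using p(5) j'(1) unfolding gp_def by blast
    have lwG: "lw w j \<in> ?G"
      using V j out prime_not_dvd_mult[OF p(1) bj] unfolding VS_def mem_Collect_eq psi_sm by auto
    have sepG: "\<forall>l\<in>I - E - {j}. degree (P l) = degree (P j) \<longrightarrow> cg p Dk (lw w j) (lw w l) \<or> lw w j - lw w l \<in> ?G"
    proof (intro ballI impI)
      fix l assume l: "l \<in> I - E - {j}" "degree (P l) = degree (P j)"
      then have lT: "l \<in> Tp E" using j' by (auto simp: Tp_def)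
      have VS: "VS p S (lw w j - lw w l)" using V lT j unfolding VS_def psi_diff psi_sm by auto
      have "cg p Dk (lw w j) (lw w l) \<or> \<not> int p dvd psi s0 (lw w j - lw w l)"
      \<comment> \<open>If \<open>w l\<close> is already in the kernel, the form takes a nonzero
        value on the difference of the two vectors automatically; separation is required only
        otherwise.\<close>
      proof (cases "int p dvd psi s0 (w l)")
        case True
        have "\<not> int p dvd lead_coeff (P j) * psi s0 (w j)" by (rule prime_not_dvd_mult[OF p(1) bj out])
        moreover have "int p dvd lead_coeff (P l) * psi s0 (w l)" using True by simp
        ultimately have "\<not> int p dvd psi s0 (lw w j - lw w l)"
          unfolding psi_diff psi_sm using dvd_diff_left_iff by blast
        then show ?thesis ..
      next
        case False
        moreover have "j \<noteq> l" using l(1) by blast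
        ultimately show ?thesis using bspec[OF sep lT] by blast
      qed
      then show "cg p Dk (lw w j) (lw w l) \<or> lw w j - lw w l \<in> ?G" using VS by blast
    qed
    have bq0: "BQ K0 (Suc N) 0 p Dk \<beta> ?G E w j"
      by (rule BQ[THEN spec[of _ p], THEN spec[of _ Dk], THEN spec[of _ \<beta>], THEN spec[of _ ?G], THEN spec[of _ w],
         THEN mp, THEN mp, THEN mp, THEN mp, THEN mp, OF p(5) gd_VS[OF p(1)] p(6) lwG sepG])
    have mov: "Mov Km p Dk \<beta> ?G E w j i"
      unfolding Mov_def
    proof (intro ballI allI impI)
      fix u g0 g assume u: "u \<in> ?G" and fam: "fam p Dk E w g0 g" and inv: "\<forall>x n. g j (x + sm n u) = g j x"
      obtain c' where c': "[psi s0 u * c' = 1] (mod int p)" using prime_inverse_mod[OF p(1)] u by blast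
      \<comment> \<open>\<open>c\<close> solves the congruence that makes the form at
        \<open>s0\<close> vanish on \<open>v\<close>. Both \<open>w j\<close> and \<open>u\<close>
        lie in the kernels for \<open>S\<close>, so \<open>v\<close> stays there.\<close>
      define c v where "c = psi s0 (w j) * c'" and "v = w j - sm c u"
      have "psi s0 v = psi s0 (w j) * (1 - psi s0 u * c')" unfolding v_def c_def psi_diff psi_sm by (simp add: algebra_simps)
      moreover have "int p dvd 1 - psi s0 u * c'" using cong_sym[OF c'] by (simp add: cong_iff_dvd_diff)
      ultimately have "int p dvd psi s0 v" by simp
      moreover have "VS p S v" using V j u unfolding v_def VS_def psi_diff psi_sm by auto
      ultimately have X: "Xat Kn E p Dk \<beta> (\<lambda>_. 1) (w(j := v))" using IH by blast
      have fam': "fam p Dk E (w(j := v)) g0 g" using fam j'(2) unfolding fam_def by (metis fun_upd_other)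
      have "g j (x + sm t v) = g j (x + sm t (w j))" for x t
      proof -
        have "x + sm t (w j) = (x + sm t v) + sm (t * c) u" unfolding v_def sm_diff_right sm_sm by (simp only: diff_add_cancel add.assoc)
        then show ?thesis using inv by (simp only:)
      qed
      then have e: "g l (x + sm t ((w(j := v)) l)) = g l (x + sm t (w l))" for l x t by (cases "l = j") (simp_all only: fun_upd_apply if_True if_False simp_thms)
      have "Lam p Dk (\<lambda>_. 1) (w(j := v)) g0 g = Lam p Dk (\<lambda>_. 1) w g0 g" unfolding Lam_def e ..
      with Xat_control[OF X p(2) Kn p(3) _ fam' i(1)]
      show "cmod (Lam p Dk (\<lambda>_. 1) w g0 g) ^ Km \<le> real Km * (\<beta> + EV p Dk (\<lambda>x. cmod (EY p (\<lambda>n. g i (x + sm n (w i))))))"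
        unfolding Km_def e by simp
    qed
    have bq: "BQ K2 0 (Suc N + 0) p Dk \<beta> ?G E w j"
      by (rule PP[OF p(2,3) i(1) j'(1) i(3,2) j'(2) E mov Xi bq0])
    show "Xat K E p Dk \<beta> (\<lambda>_. 1) w"
    proof (rule H[OF p(2-4) j'(1,2) Xj], intro allI impI)
      fix f0 f assume fam: "fam p Dk E w f0 f" and big: "real K2 * \<beta> < cmod (Lam p Dk (\<lambda>_. 1) w f0 f) ^ K2"
      from bq[unfolded BQ_def, THEN spec, THEN spec, THEN mp, THEN mp, OF fam big]
      obtain us where us: "length us = 0" "cmod (Lam p Dk (\<lambda>_. 1) w f0 f) ^ K2 \<le> real K2 * bx p Dk (us @ replicate (Suc (Suc N + 0)) (w j)) (f j)"
        by blast
      then show "cmod (Lam p Dk (\<lambda>_. 1) w f0 f) ^ K2 \<le> real K2 * bx p Dk (replicate (Suc (Suc N)) (w j)) (f j)"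
        by (simp only: length_0_conv append_Nil add_0_right)
    qed
  qed
qed

end

section \<open>Moving the directions of top degree into smaller kernels\<close>

context good_polys
begin

text \<open>The estimate under \<open>m\<close> linear constraints on the directions of top degree.
  For \<open>m = Dk\<close> the constraints force these directions to vanish modulo
  \<open>p\<close>, for \<open>m = 0\<close> they are void.\<close>

definition St :: "nat set \<Rightarrow> nat \<Rightarrow> nat \<Rightarrow> bool" where
  "St E K m \<longleftrightarrow> (\<forall>p \<beta> w S. cnd p \<beta> \<longrightarrow> S \<subseteq> Fp p \<longrightarrow> card S = m \<longrightarrow> (\<forall>l\<in>Tp E. VS p S (w l)) \<longrightarrow> Xat K E p Dk \<beta> (\<lambda>_. 1) w)"

text \<open>Separation is needed only for the directions outside the kernel of \<open>psi s0\<close>, which have not been moved.\<close>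

definition spr :: "nat set \<Rightarrow> nat \<Rightarrow> int \<Rightarrow> (nat \<Rightarrow> vec) \<Rightarrow> bool" where
  "spr E p s0 w \<longleftrightarrow> (\<forall>j\<in>Tp E. \<forall>l\<in>Tp E. j \<noteq> l \<longrightarrow> \<not> int p dvd psi s0 (w j) \<longrightarrow> \<not> int p dvd psi s0 (w l) \<longrightarrow>
     cg p Dk (lw w j) (lw w l) \<or> \<not> int p dvd psi s0 (lw w j - lw w l))"

text \<open>Interpolates between \<open>St\<close> at \<open>m + 1\<close> and at \<open>m\<close>:
  \<open>n\<close> bounds the number of top directions still outside the kernel of the form at
  \<open>s0\<close>.\<close>

definition Cl :: "nat set \<Rightarrow> nat \<Rightarrow> nat \<Rightarrow> nat \<Rightarrow> bool" where
  "Cl E K m n \<longleftrightarrow> (\<forall>p \<beta> w S s0. cnd p \<beta> \<longrightarrow> S \<subseteq> Fp p \<longrightarrow> card S = m \<longrightarrow> s0 \<in> Fp p - S \<longrightarrow> (\<forall>l\<in>Tp E. VS p S (w l)) \<longrightarrow>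
     card {l \<in> Tp E. \<not> int p dvd psi s0 (w l)} \<le> n \<longrightarrow> spr E p s0 w \<longrightarrow> Xat K E p Dk \<beta> (\<lambda>_. 1) w)"

lemma Tp_subset: "Tp E \<subseteq> I - E" by (auto simp: Tp_def)

lemma finite_Tp: "finite (Tp E)" using Tp_subset finI by (meson finite_Diff finite_subset)

lemma Tp_nonempty:
  assumes "E \<subseteq> I" "E \<noteq> I"
  shows "Tp E \<noteq> {}"
proof -
  let ?D = "(\<lambda>i. degree (P i)) ` (I - E)"
  have D: "finite ?D" "?D \<noteq> {}" using finI assms by auto
  from Max_in[OF D] obtain j where j: "j \<in> I - E" "degree (P j) = Max ?D" by auto
  have "degree (P l) \<le> degree (P j)" if "l \<in> I - E" for l unfolding j(2) using that D by (intro Max_ge) auto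
  then have "j \<in> Tp E" using j by (auto simp: Tp_def)
  then show ?thesis by blast
qed

text \<open>With no direction outside the kernel, \<open>s0\<close> can be added to
  \<open>S\<close>.\<close>

lemma Cl_0:
  assumes "St E K (Suc m)"
  shows "Cl E K m 0"
  unfolding Cl_def
proof (intro allI impI)
  fix p \<beta> w S s0
  assume *: "cnd p \<beta>" "S \<subseteq> Fp p" "card S = m" "s0 \<in> Fp p - S" "\<forall>l\<in>Tp E. VS p S (w l)"
    "card {l \<in> Tp E. \<not> int p dvd psi s0 (w l)} \<le> 0"
  have "finite {l \<in> Tp E. \<not> int p dvd psi s0 (w l)}" using finite_Tp by simp
  then have "{l \<in> Tp E. \<not> int p dvd psi s0 (w l)} = {}" using *(6) by (meson card_0_eq le_zero_eq)
  then have "\<forall>l\<in>Tp E. VS p (insert s0 S) (w l)" using *(5) by (auto simp: VS_def)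
  moreover have "insert s0 S \<subseteq> Fp p" using * by blast
  moreover have "card (insert s0 S) = Suc m" using * finite_subset[OF *(2)] by simp
  ultimately show "Xat K E p Dk \<beta> (\<lambda>_. 1) w" using assms *(1) unfolding St_def by blast
qed

text \<open>Moving one outside direction into the kernel leaves one fewer. The index moved depends
  on the directions, so a constant is found for each and then made uniform.\<close>

lemma Cl_Suc:
  assumes E: "E \<subseteq> I" "E \<noteq> I" and two: "\<forall>j\<in>I - E. \<exists>i\<in>I - E. i \<noteq> j" and K1: "1 \<le> K1"
    and X: "\<forall>i\<in>I - E. \<forall>p D \<beta> w. cnd p \<beta> \<longrightarrow> Xat K1 (insert i E) p D \<beta> (\<lambda>_. 1) w"
    and Kn: "1 \<le> Kn" and cl: "Cl E Kn m n"
  shows "\<exists>K\<ge>1. Cl E K m (Suc n)"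
proof -
  let ?Q = "\<lambda>j K. \<forall>p \<beta> w S s0. cnd p \<beta> \<longrightarrow> S \<subseteq> Fp p \<longrightarrow> card S = m \<longrightarrow> s0 \<in> Fp p - S \<longrightarrow> (\<forall>l\<in>Tp E. VS p S (w l)) \<longrightarrow>
     card {l \<in> Tp E. \<not> int p dvd psi s0 (w l)} \<le> Suc n \<longrightarrow> spr E p s0 w \<longrightarrow> \<not> int p dvd psi s0 (w j) \<longrightarrow> Xat K E p Dk \<beta> (\<lambda>_. 1) w"
  have "\<exists>K\<ge>1. ?Q j K" if j: "j \<in> Tp E" for j
  proof -
    have jA: "j \<in> I - E" using j Tp_subset by blast
    obtain i where i: "i \<in> I" "i \<notin> E" "i \<noteq> j" using bspec[OF two jA] by blast
    from move_step[OF E(1) j i K1 Kn]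
    obtain K where K: "1 \<le> K" and H: "\<forall>p \<beta> w S s0. cnd p \<beta> \<longrightarrow> Xat K1 (insert j E) p Dk \<beta> (\<lambda>_. 1) w \<longrightarrow> Xat K1 (insert i E) p Dk \<beta> (\<lambda>_. 1) w \<longrightarrow>
    (\<forall>l\<in>Tp E. VS p S (w l)) \<longrightarrow> \<not> int p dvd psi s0 (w j) \<longrightarrow>
    (\<forall>l\<in>Tp E. j \<noteq> l \<longrightarrow> \<not> int p dvd psi s0 (w l) \<longrightarrow> cg p Dk (lw w j) (lw w l) \<or> \<not> int p dvd psi s0 (lw w j - lw w l)) \<longrightarrow>
    (\<forall>v. VS p S v \<longrightarrow> int p dvd psi s0 v \<longrightarrow> Xat Kn E p Dk \<beta> (\<lambda>_. 1) (w(j := v))) \<longrightarrow>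
    Xat K E p Dk \<beta> (\<lambda>_. 1) w" by (elim exE conjE)
    show ?thesis
    proof (intro exI[of _ K] conjI allI impI K)
      fix p \<beta> w S s0
      assume cnd: "cnd p \<beta>" and S: "S \<subseteq> Fp p" "card S = m" "s0 \<in> Fp p - S" and V: "\<forall>l\<in>Tp E. VS p S (w l)"
        and c: "card {l \<in> Tp E. \<not> int p dvd psi s0 (w l)} \<le> Suc n" and spr: "spr E p s0 w" and out: "\<not> int p dvd psi s0 (w j)"
      have Xj: "Xat K1 (insert j E) p Dk \<beta> (\<lambda>_. 1) w" using X cnd jA by blast
      have Xi: "Xat K1 (insert i E) p Dk \<beta> (\<lambda>_. 1) w" using X cnd i by blast
      have sep: "\<forall>l\<in>Tp E. j \<noteq> l \<longrightarrow> \<not> int p dvd psi s0 (w l) \<longrightarrow> cg p Dk (lw w j) (lw w l) \<or> \<not> int p dvd psi s0 (lw w j - lw w l)"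
      proof (intro ballI impI)
        fix l assume l: "l \<in> Tp E" "j \<noteq> l" "\<not> int p dvd psi s0 (w l)"
        show "cg p Dk (lw w j) (lw w l) \<or> \<not> int p dvd psi s0 (lw w j - lw w l)"
          by (rule spr[unfolded spr_def, THEN bspec, THEN bspec, THEN mp, THEN mp, THEN mp, OF j l(1,2) out l(3)])
      qed
      have mv: "Xat Kn E p Dk \<beta> (\<lambda>_. 1) (w(j := v))" if v: "VS p S v" "int p dvd psi s0 v" for v
      proof (rule cl[unfolded Cl_def, THEN spec, THEN spec, THEN spec, THEN spec, THEN spec, THEN mp, THEN mp, THEN mp, THEN mp, THEN mp, THEN mp, THEN mp, OF cnd S])
        show "\<forall>l\<in>Tp E. VS p S ((w(j := v)) l)" using V v(1) by simp
        \<comment> \<open>The moved direction is the only change, so precisely \<open>j\<close>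
          leaves the set that is counted.\<close>
        have "{l \<in> Tp E. \<not> int p dvd psi s0 ((w(j := v)) l)} = {l \<in> Tp E. \<not> int p dvd psi s0 (w l)} - {j}"
          using v(2) by (auto simp: fun_upd_def split: if_splits)
        then have "card {l \<in> Tp E. \<not> int p dvd psi s0 ((w(j := v)) l)} = card {l \<in> Tp E. \<not> int p dvd psi s0 (w l)} - 1"
          using j out finite_Tp by (simp add: card_Diff_singleton)
        then show "card {l \<in> Tp E. \<not> int p dvd psi s0 ((w(j := v)) l)} \<le> n" using c by linarith
        show "spr E p s0 (w(j := v))"
          unfolding spr_def
        proof (intro ballI impI)
          fix a b assume ab: "a \<in> Tp E" "b \<in> Tp E" "a \<noteq> b" "\<not> int p dvd psi s0 ((w(j := v)) a)" "\<not> int p dvd psi s0 ((w(j := v)) b)"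
          have "a \<noteq> j" "b \<noteq> j" using ab(4,5) v(2) by auto
          then have e: "(w(j := v)) a = w a" "(w(j := v)) b = w b" by simp_all
          show "cg p Dk (lw (w(j := v)) a) (lw (w(j := v)) b) \<or> \<not> int p dvd psi s0 (lw (w(j := v)) a - lw (w(j := v)) b)"
            unfolding e by (rule spr[unfolded spr_def, THEN bspec, THEN bspec, THEN mp, THEN mp, THEN mp, OF ab(1-3) ab(4,5)[unfolded e]])
        qed
      qed
      show "Xat K E p Dk \<beta> (\<lambda>_. 1) w"
        by (rule H[THEN spec, THEN spec, THEN spec, THEN spec, THEN spec, THEN mp, THEN mp, THEN mp, THEN mp, THEN mp, THEN mp, THEN mp, OF cnd Xj Xi V out sep])
          (intro allI impI mv)
    qed
  qed
  moreover have mono: "?Q j K'" if j: "j \<in> Tp E" "1 \<le> K" "?Q j K" "K \<le> K'" for j K K'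
  proof (intro allI impI)
    fix p \<beta> w S s0
    assume *: "cnd p \<beta>" "S \<subseteq> Fp p" "card S = m" "s0 \<in> Fp p - S" "\<forall>l\<in>Tp E. VS p S (w l)"
     "card {l \<in> Tp E. \<not> int p dvd psi s0 (w l)} \<le> Suc n" "spr E p s0 w" "\<not> int p dvd psi s0 (w j)"
    have "j \<in> I" "p > 0" using j(1) Tp_subset cndD[OF *(1)] by auto
    moreover have "Xat K E p Dk \<beta> (\<lambda>_. 1) w"
      by (rule j(3)[THEN spec, THEN spec, THEN spec, THEN spec, THEN spec, THEN mp, THEN mp, THEN mp, THEN mp, THEN mp, THEN mp, THEN mp, THEN mp, OF *])
    ultimately show "Xat K' E p Dk \<beta> (\<lambda>_. 1) w" by (intro Xat_mono[OF _ _ j(2,4)]) simp_all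
  qed
  ultimately have "\<exists>K\<ge>1. \<forall>j\<in>Tp E. ?Q j K" by (rule finite_uniform_bound[OF finite_Tp])
  then obtain K where K: "1 \<le> K" and Q: "\<forall>j\<in>Tp E. ?Q j K" by (elim exE conjE)
  show ?thesis
  proof (intro exI[of _ "K + Kn"] conjI)
    show "1 \<le> K + Kn" using K by simp
    show "Cl E (K + Kn) m (Suc n)"
      unfolding Cl_def
    proof (intro allI impI)
      fix p \<beta> w S s0
      assume *: "cnd p \<beta>" "S \<subseteq> Fp p" "card S = m" "s0 \<in> Fp p - S" "\<forall>l\<in>Tp E. VS p S (w l)"
       "card {l \<in> Tp E. \<not> int p dvd psi s0 (w l)} \<le> Suc n" "spr E p s0 w"
      have p: "p > 0" using cndD[OF *(1)] by simp
      show "Xat (K + Kn) E p Dk \<beta> (\<lambda>_. 1) w"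
      proof (cases "\<exists>j\<in>Tp E. \<not> int p dvd psi s0 (w j)")
        case True
        then obtain j where j: "j \<in> Tp E" "\<not> int p dvd psi s0 (w j)" by blast
        have "Xat K E p Dk \<beta> (\<lambda>_. 1) w"
          by (rule Q[THEN bspec, OF j(1), THEN spec, THEN spec, THEN spec, THEN spec, THEN spec, THEN mp, THEN mp, THEN mp, THEN mp, THEN mp, THEN mp, THEN mp, THEN mp, OF * j(2)])
        moreover have "j \<in> I" using j(1) Tp_subset by blast
        ultimately show ?thesis using Xat_mono[of p "\<lambda>_. 1" K "K + Kn"] p K by simp
      next
        case False
        obtain j where j: "j \<in> I" using E by blast
        have e: "{l \<in> Tp E. \<not> int p dvd psi s0 (w l)} = {}" using False by blast
        have "card {l \<in> Tp E. \<not> int p dvd psi s0 (w l)} \<le> n" unfolding e by simp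
        then have "Xat Kn E p Dk \<beta> (\<lambda>_. 1) w"
          by (rule cl[unfolded Cl_def, THEN spec, THEN spec, THEN spec, THEN spec, THEN spec, THEN mp, THEN mp, THEN mp, THEN mp, THEN mp, THEN mp, THEN mp, OF *(1-5) _ *(7)])
        then show ?thesis by (rule Xat_mono[OF p _ Kn _ j, rotated 2]) simp_all
      qed
    qed
  qed
qed

lemma St_of_Cl:
  assumes m: "m < Dk" and cl: "Cl E K m (card (Tp E))"
  shows "St E K m"
  unfolding St_def
proof (intro allI impI)
  fix p \<beta> w S
  assume *: "cnd p \<beta>" "S \<subseteq> Fp p" "card S = m" "\<forall>l\<in>Tp E. VS p S (w l)"
  have gp: "gp p" using cndD[OF *(1)] by simp
  let ?z = "\<lambda>(j, l). lw w j - lw w l"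
  \<comment> \<open>The differences of leading vectors that are nonzero modulo \<open>p\<close>, at
    most \<open>(card I)\<^sup>2\<close> of them. A form vanishing on none provides
    \<open>spr\<close>.\<close>
  define U where "U = ?z ` {z \<in> Tp E \<times> Tp E. \<not> cg p Dk (lw w (fst z)) (lw w (snd z))}"
  have fin: "finite (Tp E \<times> Tp E)" using finite_Tp by simp
  have U: "finite U" unfolding U_def by (intro finite_imageI finite_subset[OF _ fin]) blast
  have "card U \<le> card (Tp E \<times> Tp E)"
    unfolding U_def by (rule order_trans[OF card_image_le card_mono[OF fin]]) (auto intro: finite_subset[OF _ fin])
  also have "\<dots> = card (Tp E) * card (Tp E)" by (rule card_cartesian_product)
  also have "\<dots> \<le> (card I)\<^sup>2"
    unfolding power2_eq_square using Tp_subset finI by (intro mult_mono card_mono) auto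
  finally have cU: "card U \<le> (card I)\<^sup>2" .
  have nz: "\<not> cg p Dk u 0" if u: "u \<in> U" for u
  proof -
    obtain j l where jl: "u = lw w j - lw w l" "\<not> cg p Dk (lw w j) (lw w l)" using u unfolding U_def by auto
    show ?thesis
    proof
      assume "cg p Dk u 0"
      then have "cg p Dk (u + lw w l) (0 + lw w l)" by (intro cg_add cg_refl)
      then show False using jl by (simp only: diff_add_cancel add_0)
    qed
  qed
  obtain s0 where s0: "s0 \<in> Fp p - S" "\<And>u. u \<in> U \<Longrightarrow> \<not> int p dvd psi s0 u"
    using exists_separating[OF gp *(2) _ U cU nz] m *(3) by blast
  show "Xat K E p Dk \<beta> (\<lambda>_. 1) w"
  proof (rule cl[unfolded Cl_def, THEN spec, THEN spec, THEN spec, THEN spec, THEN spec, THEN mp, THEN mp, THEN mp, THEN mp, THEN mp, THEN mp, THEN mp, OF *(1-3) s0(1) *(4)])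
    show "card {l \<in> Tp E. \<not> int p dvd psi s0 (w l)} \<le> card (Tp E)" by (rule card_mono[OF finite_Tp]) blast
    show "spr E p s0 w"
      unfolding spr_def
    proof (intro ballI impI)
      fix j l assume jl: "j \<in> Tp E" "l \<in> Tp E"
      show "cg p Dk (lw w j) (lw w l) \<or> \<not> int p dvd psi s0 (lw w j - lw w l)"
      proof (cases "cg p Dk (lw w j) (lw w l)")
        case False
        then have "lw w j - lw w l \<in> U" unfolding U_def using jl by (intro image_eqI[of _ _ "(j, l)"]) auto
        then show ?thesis using s0(2) by blast
      qed blast
    qed
  qed
qed

text \<open>The number of constraints is lowered from \<open>Dk\<close> to zero in the fixed
  dimension \<open>Dk\<close>; the unit vectors then give every dimension and every choice of
  directions.\<close>

lemma several_alive:
  assumes E: "E \<subseteq> I" "E \<noteq> I" and two: "\<forall>j\<in>I - E. \<exists>i\<in>I - E. i \<noteq> j" and K1: "1 \<le> K1"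
    and X: "\<forall>i\<in>I - E. \<forall>p D \<beta> w. cnd p \<beta> \<longrightarrow> Xat K1 (insert i E) p D \<beta> (\<lambda>_. 1) w"
  shows "\<exists>K\<ge>1. \<forall>p D \<beta> w. cnd p \<beta> \<longrightarrow> Xat K E p D \<beta> (\<lambda>_. 1) w"
proof -
  have St: "\<exists>K\<ge>1. St E K m" if "m \<le> Dk" for m
    using that
  proof (induction rule: inc_induct)
    \<comment> \<open>A top direction killed by \<open>Dk\<close> forms is zero modulo
      \<open>p\<close>, and \<open>Xat_null\<close> reduces to the case with one more
      eigenfunction.\<close>
    case base
    have "St E K1 Dk"
      unfolding St_def
    proof (intro allI impI)
      fix p \<beta> w S
      assume *: "cnd p \<beta>" "S \<subseteq> Fp p" "card S = Dk" "\<forall>l\<in>Tp E. VS p S (w l)"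
      obtain j where j: "j \<in> Tp E" using Tp_nonempty[OF E] by blast
      then have jI: "j \<in> I - E" using Tp_subset by blast
      have "cg p Dk (w j) 0" using cndD[OF *(1)] bspec[OF *(4) j] *(2,3) by (intro VS_full[of p S]) simp_all
      moreover have "Xat K1 (insert j E) p Dk \<beta> (\<lambda>_. 1) w" using X jI *(1) by blast
      ultimately show "Xat K1 E p Dk \<beta> (\<lambda>_. 1) w" using jI Xat_null[of K1 j E p Dk \<beta>] by blast
    qed
    then show ?case using K1 by blast
  next
    case (step m)
    then obtain K where K: "1 \<le> K" "St E K (Suc m)" by blast
    have "\<exists>K\<ge>1. Cl E K m n" for n
    proof (induction n)
      case 0
      show ?case using Cl_0[OF K(2)] K(1) by blast
    next
      case (Suc n)
      then obtain Kn where "1 \<le> Kn" "Cl E Kn m n" by blast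
      then show ?case by (rule Cl_Suc[OF E two K1 X])
    qed
    then show ?case using St_of_Cl[OF step(2)] by blast
  qed
  then obtain K where K: "1 \<le> K" "St E K 0" by blast
  have "Xat K E p D \<beta> (\<lambda>_. 1) w" if c: "cnd p \<beta>" for p D \<beta> w
  proof (rule Xat_lift[OF _ I_less_Dk E(1)])
    show "p > 0" "0 \<le> \<beta>" using cndD[OF c] by auto
    show "Xat K E p Dk \<beta> (\<lambda>_. 1) (\<lambda>i l. if l = i then 1 else 0)"
      by (rule K(2)[unfolded St_def, THEN spec, THEN spec, THEN spec, THEN spec[of _ "{}"], THEN mp, THEN mp, THEN mp, THEN mp, OF c])
        (simp_all add: VS_def)
  qed
  with K(1) show ?thesis by blast
qed

lemma Xat_unweighted:
  assumes "E \<subseteq> I"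
  shows "\<exists>K\<ge>1. \<forall>p D \<beta> w. cnd p \<beta> \<longrightarrow> Xat K E p D \<beta> (\<lambda>_. 1) w"
  using assms
proof (induction "card (I - E)" arbitrary: E rule: less_induct)
  case less
  show ?case
  proof (cases "E = I")
    case True
    have "Xat 1 E p D \<beta> (\<lambda>_. 1) w" if "cnd p \<beta>" for p D \<beta> w
      unfolding True using cndD[OF that] that by (intro Xat_all_eigen) (auto simp: cnd_def)
    then show ?thesis by blast
  next
    case False
    have "\<exists>K\<ge>1. \<forall>i\<in>I - E. \<forall>p D \<beta> w. cnd p \<beta> \<longrightarrow> Xat K (insert i E) p D \<beta> (\<lambda>_. 1) w"
    proof (rule finite_uniform_bound)
      show "finite (I - E)" using finI by simp
      show "\<exists>K\<ge>1. \<forall>p D \<beta> w. cnd p \<beta> \<longrightarrow> Xat K (insert i E) p D \<beta> (\<lambda>_. 1) w" if i: "i \<in> I - E" for i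
      proof (rule less.hyps)
        show "insert i E \<subseteq> I" using i less.prems by blast
        have "I - insert i E \<subset> I - E" using i by blast
        then show "card (I - insert i E) < card (I - E)" using finI by (intro psubset_card_mono) auto
      qed
      show "\<forall>p D \<beta> w. cnd p \<beta> \<longrightarrow> Xat K' (insert i E) p D \<beta> (\<lambda>_. 1) w"
        if *: "i \<in> I - E" "1 \<le> K" "\<forall>p D \<beta> w. cnd p \<beta> \<longrightarrow> Xat K (insert i E) p D \<beta> (\<lambda>_. 1) w" "K \<le> K'" for i K K'
      proof (intro allI impI)
        fix p D \<beta> w assume c: "cnd p \<beta>"
        then have "Xat K (insert i E) p D \<beta> (\<lambda>_. 1) w" using *(3) by blast
        then show "Xat K' (insert i E) p D \<beta> (\<lambda>_. 1) w" using cndD[OF c] *(1) by (intro Xat_mono[where K = K and i = i, OF _ _ *(2,4)]) auto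
      qed
    qed
    then obtain K1 where K1: "1 \<le> K1" and X: "\<forall>i\<in>I - E. \<forall>p D \<beta> w. cnd p \<beta> \<longrightarrow> Xat K1 (insert i E) p D \<beta> (\<lambda>_. 1) w"
      by (elim exE conjE)
    show ?thesis
    \<comment> \<open>The exchange of directions passes through a second non-eigenfunction, so a
      single one is treated separately.\<close>
    proof (cases "\<exists>j. I - E = {j}")
      case True
      then obtain j where j: "I - E = {j}" by blast
      show ?thesis by (rule single_alive[OF less.prems j K1]) (use X j in blast)
    next
      case one: False
      have "\<exists>i\<in>I - E. i \<noteq> j" if "j \<in> I - E" for j
      proof (rule ccontr)
        assume "\<not> (\<exists>i\<in>I - E. i \<noteq> j)"
        then have "I - E = {j}" using that by blast
        with one show False by blast
      qed
      then have "\<forall>j\<in>I - E. \<exists>i\<in>I - E. i \<noteq> j" by blast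
      then show ?thesis by (rule several_alive[OF less.prems False _ K1 X])
    qed
  qed
qed

text \<open>A second induction on the same sets: each step of the weighted estimate uses the
  unweighted one for the same \<open>E\<close>, which is therefore proved completely
  beforehand.\<close>

lemma Xat_all:
  assumes "E \<subseteq> I"
  shows "\<exists>K\<ge>1. \<forall>p D \<beta> \<theta> w. cnd p \<beta> \<longrightarrow> wt p \<beta> \<theta> \<longrightarrow> Xat K E p D \<beta> \<theta> w"
  using assms
proof (induction "card (I - E)" arbitrary: E rule: less_induct)
  case less
  show ?case
  proof (cases "E = I")
    case True
    have "Xat 1 E p D \<beta> \<theta> w" if "cnd p \<beta>" "wt p \<beta> \<theta>" for p D \<beta> \<theta> w
      unfolding True using cndD[OF that(1)] that by (intro Xat_all_eigen) auto
    then show ?thesis by blast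
  next
    case False
    then obtain j where j: "j \<in> I" "j \<notin> E" using less.prems by blast
    have "I - insert j E \<subset> I - E" using j by blast
    then have "card (I - insert j E) < card (I - E)" using finI by (intro psubset_card_mono) auto
    moreover have "insert j E \<subseteq> I" using j less.prems by blast
    ultimately obtain K1 where K1: "1 \<le> K1" and X1: "\<And>p D \<beta> \<theta> w. cnd p \<beta> \<Longrightarrow> wt p \<beta> \<theta> \<Longrightarrow> Xat K1 (insert j E) p D \<beta> \<theta> w"
      using less.hyps[of "insert j E"] by blast
    obtain K2 where K2: "1 \<le> K2" and X2: "\<And>p D \<beta> w. cnd p \<beta> \<Longrightarrow> Xat K2 E p D \<beta> (\<lambda>_. 1) w"
      using Xat_unweighted[OF less.prems] by blast
    from Xat_weighted[OF K1 K2] obtain K where K: "1 \<le> K" and H: "\<And>p D \<beta> \<theta> j E w. p > 0 \<Longrightarrow> 0 \<le> \<beta> \<Longrightarrow> \<beta> \<le> 1 \<Longrightarrow> j \<in> I \<Longrightarrow> j \<notin> E \<Longrightarrow> (\<forall>y. cmod (\<theta> y) \<le> 1) \<Longrightarrow>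
      Xat K1 (insert j E) p D \<beta> \<theta> w \<Longrightarrow> Xat K2 E p D \<beta> (\<lambda>_. 1) w \<Longrightarrow> Xat K E p D \<beta> \<theta> w" by blast
    show ?thesis
    proof (intro exI[of _ K] conjI allI impI K)
      fix p D \<beta> \<theta> w assume c: "cnd p \<beta>" "wt p \<beta> \<theta>"
      show "Xat K E p D \<beta> \<theta> w"
        using cndD[OF c(1)] c(2) by (intro H[OF _ _ _ j _ X1[OF c] X2[OF c(1)]]) (auto simp: wt_def)
    qed
  qed
qed

end

subsection \<open>Weyl sums and independence modulo large primes\<close>

text \<open>Weyl differencing. The shift \<open>h = 0\<close> contributes \<open>1 / p\<close> and
  every other shift at most \<open>e / p\<close> by induction, which adds up to the numerator
  \<open>e + 1\<close>. For degree one the sum vanishes.\<close>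

lemma weyl_sum:
  assumes p: "prime p"
  shows "1 \<le> e \<Longrightarrow> degree R \<le> e \<Longrightarrow> e < p \<Longrightarrow> \<not> int p dvd coeff R e \<Longrightarrow>
    cmod (EY p (\<lambda>y. e_p p (poly R y))) ^ (2 ^ e) \<le> real e / real p"
proof (induction e arbitrary: R rule: nat_induct_at_least)
  case base
  have p0: "p > 0" using p prime_gt_0_nat by blast
  have "R = [:coeff R 0, coeff R 1:]"
  proof (rule poly_eqI)
    fix n
    show "coeff R n = coeff [:coeff R 0, coeff R 1:] n"
      using base(1) by (cases "n \<le> 1") (auto simp: coeff_eq_0 coeff_pCons le_Suc_eq split: nat.splits)
  qed
  then have "poly R y = coeff R 0 + coeff R 1 * y" for y by (metis poly_pCons poly_0 mult.commute mult_zero_right add_0_right)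
  then have "EY p (\<lambda>y. e_p p (poly R y)) = e_p p (coeff R 0) * EY p (\<lambda>y. e_p p (coeff R 1 * y))"
    by (simp only: e_p_add avg_cmult)
  also have "\<dots> = 0" using EY_e_p[OF p0, of "coeff R 1"] base(3) by simp
  finally show ?case by simp
next
  case (Suc e)
  have p0: "p > 0" using p prime_gt_0_nat by blast
  define F where "F y = e_p p (poly R y)" for y
  have yF: "yper p F" unfolding yper_def F_def using p0 by (blast intro: e_p_cong poly_cong)
  define S where "S = EY p F"
  have "EY p (\<lambda>h. EY p (\<lambda>y. F (y + h) * cnj (F y))) = EY p (\<lambda>y. EY p (\<lambda>h. F (h + y)) * cnj (F y))"
    by (subst avg_swap) (simp only: avg_cmult_right add.commute)
  also have "\<dots> = S * EY p (\<lambda>y. cnj (F y))" by (simp only: EY_shift[OF p0 yF] S_def avg_cmult)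
  also have "\<dots> = S * cnj S" by (simp add: S_def avg_def)
  also have "\<dots> = complex_of_real ((cmod S)\<^sup>2)" by (rule complex_norm_square[symmetric])
  finally have sq: "complex_of_real ((cmod S)\<^sup>2) = EY p (\<lambda>h. EY p (\<lambda>y. F (y + h) * cnj (F y)))" by (rule sym)
  have "(cmod S)\<^sup>2 = cmod (complex_of_real ((cmod S)\<^sup>2))" by (simp add: norm_power)
  also have "\<dots> \<le> EY p (\<lambda>h. cmod (EY p (\<lambda>y. F (y + h) * cnj (F y))))" unfolding sq by (rule norm_avg_le)
  finally have 1: "(cmod S)\<^sup>2 \<le> EY p (\<lambda>h. cmod (EY p (\<lambda>y. F (y + h) * cnj (F y))))" .
  have "cmod S ^ (2 ^ Suc e) = ((cmod S)\<^sup>2) ^ (2 ^ e)" by (simp add: power_mult[symmetric])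
  also have "\<dots> \<le> (EY p (\<lambda>h. cmod (EY p (\<lambda>y. F (y + h) * cnj (F y))))) ^ (2 ^ e)" by (rule power_mono[OF 1]) simp
  also have "\<dots> \<le> EY p (\<lambda>h. cmod (EY p (\<lambda>y. F (y + h) * cnj (F y))) ^ (2 ^ e))"
    by (rule avg_power_le) (use Fp_nonempty[OF p0] in auto)
  also have "\<dots> \<le> EY p (\<lambda>h. (if h = 0 then 1 else 0) + real e / real p)"
  proof (rule avg_mono)
    fix h assume h: "h \<in> Fp p"
    have b: "cmod (EY p (\<lambda>y. F (y + h) * cnj (F y))) \<le> 1"
      by (rule norm_avg_le_const) (use Fp_nonempty[OF p0] in \<open>auto simp: F_def norm_mult\<close>)
    show "cmod (EY p (\<lambda>y. F (y + h) * cnj (F y))) ^ (2 ^ e) \<le> (if h = 0 then 1 else 0) + real e / real p"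
    proof (cases "h = 0")
      case True
      have "cmod (EY p (\<lambda>y. F (y + h) * cnj (F y))) ^ (2 ^ e) \<le> 1" by (rule power_le_one[OF _ b]) simp
      then show ?thesis using True by (simp add: add_increasing2)
    next
      case False
      obtain R' where R': "\<And>y. poly R' y = poly R (y + h) - poly R y" "degree R' \<le> e" "coeff R' e = int (Suc e) * h * coeff R (Suc e)"
        using poly_shift_diff[OF Suc.prems(1)] by blast
      have "\<not> int p dvd coeff R' e"
        unfolding R'(3) using Suc.prems(2,3) Fp_nonzero_not_dvd[OF h False] prime_not_dvd_small[OF p, of "Suc e"]
        by (intro prime_not_dvd_mult[OF p]) auto
      then have "cmod (EY p (\<lambda>y. e_p p (poly R' y))) ^ (2 ^ e) \<le> real e / real p"
        using Suc.prems(2) R'(2) by (intro Suc.IH) auto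
      moreover have "e_p p (poly R' y) = F (y + h) * cnj (F y)" for y unfolding R'(1) F_def by (rule e_p_diff)
      ultimately show ?thesis using False by simp
    qed
  qed
  also have "\<dots> = EY p (\<lambda>h. if h = 0 then 1 else 0 :: real) + real e / real p"
    by (simp only: avg_add avg_const[OF finite_Fp Fp_nonempty[OF p0]])
  also have "EY p (\<lambda>h. if h = 0 then 1 else 0 :: real) = 1 / real p"
    using p0 by (simp add: avg_def) (simp add: Fp_def)
  finally show ?case unfolding S_def F_def by (simp add: add_divide_distrib)
qed

text \<open>Top coefficients divisible by \<open>p\<close> do not change the phase and are dropped
  until a coefficient prime to \<open>p\<close> is on top.\<close>

lemma weyl_sum_general:
  assumes p: "prime p"
  shows "degree R \<le> d \<Longrightarrow> d < p \<Longrightarrow> 1 \<le> i \<Longrightarrow> \<not> int p dvd coeff R i \<Longrightarrow>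
    cmod (EY p (\<lambda>y. e_p p (poly R y))) ^ (2 ^ d) \<le> real d / real p"
proof (induction d arbitrary: R)
  case 0
  then show ?case by (simp add: coeff_eq_0)
next
  case (Suc d)
  have p0: "p > 0" using p prime_gt_0_nat by blast
  show ?case
  proof (cases "int p dvd coeff R (Suc d)")
    case False
    then show ?thesis using Suc.prems by (intro weyl_sum[OF p]) auto
  next
    case True
    define R' where "R' = R - monom (coeff R (Suc d)) (Suc d)"
    have c: "coeff R' n = (if n = Suc d then 0 else coeff R n)" for n unfolding R'_def by (simp add: coeff_monom)
    have "degree R' \<le> d"
    proof (rule degree_le, intro allI impI)
      fix n assume "d < n"
      then show "coeff R' n = 0" unfolding c using Suc.prems(1) by (cases "n = Suc d") (auto intro: coeff_eq_0)
    qed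
    moreover have "\<not> int p dvd coeff R' i" using Suc.prems(4) True c by (cases "i = Suc d") auto
    ultimately have IH: "cmod (EY p (\<lambda>y. e_p p (poly R' y))) ^ (2 ^ d) \<le> real d / real p"
      using Suc.prems by (intro Suc.IH) auto
    have "e_p p (poly R y) = e_p p (poly R' y)" for y
    proof (rule e_p_cong[OF p0])
      have "poly R y - poly R' y = coeff R (Suc d) * y ^ Suc d" unfolding R'_def by (simp add: poly_monom)
      then show "[poly R y = poly R' y] (mod int p)" using True by (simp add: cong_iff_dvd_diff)
    qed
    then have e: "EY p (\<lambda>y. e_p p (poly R y)) = EY p (\<lambda>y. e_p p (poly R' y))" by simp
    have "cmod (EY p (\<lambda>y. e_p p (poly R' y))) \<le> 1"
      by (rule norm_avg_le_const) (use Fp_nonempty[OF p0] in auto)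
    then have "cmod (EY p (\<lambda>y. e_p p (poly R' y))) ^ (2 ^ Suc d) \<le> cmod (EY p (\<lambda>y. e_p p (poly R' y))) ^ (2 ^ d)"
      by (intro power_antimono) auto
    also have "\<dots> \<le> real d / real p" by (rule IH)
    also have "\<dots> \<le> real (Suc d) / real p" by (intro divide_right_mono) auto
    finally show ?thesis unfolding e .
  qed
qed

text \<open>Gaussian elimination over the integers: \<open>N\<close> is the product of the pivots,
  and modulo a prime not dividing it the elimination can be repeated literally.\<close>

lemma independence_mod_p:
  fixes P :: "'i \<Rightarrow> int poly"
  assumes "finite I" "lin_indep_polys I P"
  shows "\<exists>N\<noteq>0. \<forall>p \<phi>. prime p \<longrightarrow> \<not> int p dvd N \<longrightarrow> (\<forall>n. int p dvd coeff (\<Sum>i\<in>I. smult (\<phi> i) (P i)) n) \<longrightarrow> (\<forall>i\<in>I. int p dvd \<phi> i)"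
  using assms
proof (induction I arbitrary: P rule: finite_induct)
  case empty
  then show ?case by (intro exI[of _ 1]) auto
next
  case (insert j I)
  have "P j \<noteq> 0"
  proof
    assume "P j = 0"
    then have "(\<Sum>i\<in>insert j I. smult (if i = j then 1 else 0) (P i)) = 0" by (intro sum.neutral) auto
    then show False
      using insert.prems[unfolded lin_indep_polys_def, THEN spec[of _ "\<lambda>i. if i = j then 1 else 0"]] by auto
  qed
  then obtain n where n: "coeff (P j) n \<noteq> 0" using leading_coeff_0_iff by blast
  define a where "a = coeff (P j) n"
  \<comment> \<open>Cross-multiplication instead of division keeps the coefficients integral and
    makes the coefficient at \<open>n\<close> vanish.\<close>
  define P' where "P' i = smult a (P i) - smult (coeff (P i) n) (P j)" for i
  have sumP': "(\<Sum>i\<in>I. smult (c i) (P' i)) = smult a (\<Sum>i\<in>I. smult (c i) (P i)) - smult (\<Sum>i\<in>I. c i * coeff (P i) n) (P j)" for c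
    using insert.hyps(1)
    by (induction I rule: finite_induct) (simp_all add: P'_def smult_add_right smult_add_left smult_diff_right mult.commute algebra_simps)
  have "lin_indep_polys I P'"
    unfolding lin_indep_polys_def
  proof (intro allI impI)
    fix c assume z: "(\<Sum>i\<in>I. smult (c i) (P' i)) = 0"
    define b where "b i = (if i = j then - (\<Sum>i\<in>I. c i * coeff (P i) n) else a * c i)" for i
    have "(\<Sum>i\<in>insert j I. smult (b i) (P i)) = smult (b j) (P j) + (\<Sum>i\<in>I. smult (b i) (P i))"
      using insert.hyps by simp
    also have "(\<Sum>i\<in>I. smult (b i) (P i)) = (\<Sum>i\<in>I. smult a (smult (c i) (P i)))"
      using insert.hyps by (intro sum.cong) (auto simp: b_def)
    also have "\<dots> = smult a (\<Sum>i\<in>I. smult (c i) (P i))" by (simp add: poly_eq_iff coeff_sum sum_distrib_left mult.assoc)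
    also have "smult (b j) (P j) + \<dots> = 0" using z unfolding sumP' by (simp add: b_def)
    finally have "\<forall>i\<in>insert j I. b i = 0" using insert.prems unfolding lin_indep_polys_def by blast
    then show "\<forall>i\<in>I. c i = 0" using insert.hyps n by (auto simp: b_def a_def split: if_splits)
  qed
  from insert.IH[OF this] obtain N' where N': "N' \<noteq> 0" and H: "\<And>p \<phi>. prime p \<Longrightarrow> \<not> int p dvd N' \<Longrightarrow>
    (\<forall>n. int p dvd coeff (\<Sum>i\<in>I. smult (\<phi> i) (P' i)) n) \<Longrightarrow> (\<forall>i\<in>I. int p dvd \<phi> i)" by blast
  show ?case
  proof (intro exI[of _ "a * N'"] conjI allI impI)
    show "a * N' \<noteq> 0" using n N' by (simp add: a_def)
    fix p \<phi> assume p: "prime p" and N: "\<not> int p dvd a * N'"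
      and dv: "\<forall>n. int p dvd coeff (\<Sum>i\<in>insert j I. smult (\<phi> i) (P i)) n"
    let ?Q = "\<Sum>i\<in>I. smult (\<phi> i) (P i)" and ?s = "\<Sum>i\<in>I. \<phi> i * coeff (P i) n"
    have aN: "\<not> int p dvd a" "\<not> int p dvd N'" using N by auto
    have Q: "(\<Sum>i\<in>insert j I. smult (\<phi> i) (P i)) = smult (\<phi> j) (P j) + ?Q" using insert.hyps by simp
    have dv': "int p dvd \<phi> j * coeff (P j) m + coeff ?Q m" for m using spec[OF dv, of m] unfolding Q by simp
    have sQ: "coeff ?Q n = ?s" by (simp add: coeff_sum)
    have "int p dvd coeff (\<Sum>i\<in>I. smult (\<phi> i) (P' i)) m" for m
    proof -
      have "coeff (\<Sum>i\<in>I. smult (\<phi> i) (P' i)) m = a * (\<phi> j * coeff (P j) m + coeff ?Q m) - (\<phi> j * a + ?s) * coeff (P j) m"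
        unfolding sumP' by (simp add: algebra_simps)
      moreover have "int p dvd \<phi> j * a + ?s" using dv'[of n] unfolding sQ a_def .
      ultimately show ?thesis using dv'[of m] by (simp add: dvd_diff)
    qed
    then have I: "\<forall>i\<in>I. int p dvd \<phi> i" using H[OF p aN(2)] by blast
    then have "int p dvd ?s" by (intro dvd_sum) auto
    then have "int p dvd \<phi> j * a" using dv'[of n] unfolding sQ a_def[symmetric] by (simp add: dvd_add_left_iff)
    then have "int p dvd \<phi> j" using prime_not_dvd_mult[OF p] aN(1) by blast
    then show "\<forall>i\<in>insert j I. int p dvd \<phi> i" using I by blast
  qed
qed

section \<open>From the estimate for families to the theorem\<close>

lemma prime_not_dvd_large: "x \<noteq> 0 \<Longrightarrow> nat \<bar>x\<bar> < p \<Longrightarrow> \<not> int p dvd x"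
  using zdvd_imp_le[of "int p" "\<bar>x\<bar>"] by auto

lemma root_bound:
  fixes x y A :: real
  assumes "0 \<le> x" "1 \<le> A" "0 < y" "1 \<le> M" "x ^ M \<le> A * y"
  shows "x \<le> A * y powr (1 / real M)"
proof (cases "x = 0")
  case False
  then have x: "x > 0" using assms by simp
  have "x = (x ^ M) powr (1 / real M)" using x assms(4) by (simp add: powr_realpow[symmetric] powr_powr)
  also have "\<dots> \<le> (A * y) powr (1 / real M)" using assms by (intro powr_mono2) auto
  also have "\<dots> = A powr (1 / real M) * y powr (1 / real M)" using assms by (simp add: powr_mult)
  also have "\<dots> \<le> A powr 1 * y powr (1 / real M)" using assms by (intro mult_right_mono powr_mono) auto
  finally show ?thesis using assms by simp
qed (use assms in simp)

text \<open>The supremum runs over infinitely many polynomials, so a bound on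
  \<open>\<theta>\<close> is required to make it an upper bound.\<close>

lemma u_norm_upper:
  assumes p: "p > 0" and th: "\<And>y. y \<in> Fp p \<Longrightarrow> cmod (\<theta> y) \<le> B" and R: "degree R \<le> s - 1"
  shows "cmod (EY p (\<lambda>y. \<theta> y * e_p p (- poly R y))) \<le> u_norm s p \<theta>"
  unfolding u_norm_def
proof (rule cSUP_upper)
  show "bdd_above ((\<lambda>P. cmod (EY p (\<lambda>y. \<theta> y * e_p p (- poly P y)))) ` {P. degree P \<le> s - 1})"
    by (rule bdd_aboveI2[of _ _ B], rule norm_avg_le_const) (use Fp_nonempty[OF p] th in \<open>auto simp: norm_mult\<close>)
qed (use R in simp)

context polys
begin

text \<open>The difference to be estimated is itself periodic and bounded by 2. Half its conjugate
  is an admissible \<open>f0\<close> and turns the linear estimate into a mean square; the 4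
  combines this half with the one in \<open>Xat\<close>.\<close>

lemma Xat_L2:
  fixes w :: "nat \<Rightarrow> vec" and F :: "nat \<Rightarrow> vec \<Rightarrow> complex"
  defines "df \<equiv> \<lambda>p \<theta> x. EY p (\<lambda>y. \<theta> y * (\<Prod>i\<in>I. F i (x + sm (poly (P i) y) (w i))))
      - EY p \<theta> * (\<Prod>i\<in>I. EY p (\<lambda>n. F i (x + sm n (w i))))"
  assumes p: "p > 0" and th: "\<And>y. cmod (\<theta> y) \<le> 1" and F: "\<And>i. i \<in> I \<Longrightarrow> B1 p D (F i)" and X: "Xat K {} p D \<beta> \<theta> w"
  shows "(EV p D (\<lambda>x. (cmod (df p \<theta> x))\<^sup>2) / 4) ^ K \<le> real K * \<beta>"
proof -
  define a b where "a x = EY p (\<lambda>y. \<theta> y * (\<Prod>i\<in>I. F i (x + sm (poly (P i) y) (w i))))"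
    and "b x = EY p \<theta> * (\<Prod>i\<in>I. EY p (\<lambda>n. F i (x + sm n (w i))))" for x
  have Ba: "B1 p D a"
    unfolding a_def by (intro B1_avg finite_Fp Fp_nonempty p B1_mult[OF B1_const[OF th]] B1_prod B1_shift F)
  have Bb: "B1 p D b"
    unfolding b_def
    by (intro B1_mult[OF B1_const] norm_avg_le_const finite_Fp Fp_nonempty p th B1_prod B1_line_mean F)
  define f0 where "f0 x = cnj (a x - b x) / 2" for x
  have B0: "B1 p D f0"
    unfolding B1_def per_def
  proof (intro conjI allI impI)
    show "f0 x = f0 y" if "cg p D x y" for x y
      unfolding f0_def using perD[OF B1_per[OF Ba] that] perD[OF B1_per[OF Bb] that] by simp
    show "cmod (f0 x) \<le> 1" for x
    proof -
      have "cmod (f0 x) = cmod (a x - b x) / 2" unfolding f0_def norm_divide complex_mod_cnj by simp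
      then show ?thesis using norm_triangle_ineq4[of "a x" "b x"] B1_norm[OF Ba, of x] B1_norm[OF Bb, of x] by simp
    qed
  qed
  have L: "Lam p D \<theta> w f0 F = EV p D (\<lambda>x. f0 x * a x)"
    unfolding Lam_def a_def avg_cmult[symmetric] by (simp only: mult.left_commute)
  have M: "Mn p D \<theta> w f0 F = EV p D (\<lambda>x. f0 x * b x)"
    unfolding Mn_def b_def avg_cmult[symmetric] by (simp only: mult.left_commute)
  have "f0 x * a x - f0 x * b x = complex_of_real ((cmod (a x - b x))\<^sup>2 / 2)" for x
    unfolding f0_def right_diff_distrib[symmetric] of_real_divide complex_norm_square by simp
  then have LM: "Lam p D \<theta> w f0 F - Mn p D \<theta> w f0 F = complex_of_real (EV p D (\<lambda>x. (cmod (a x - b x))\<^sup>2 / 2))"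
    unfolding L M avg_diff[symmetric] by (simp only: avg_of_real)
  have half: "EV p D (\<lambda>x. (cmod (a x - b x))\<^sup>2 / 2) = EV p D (\<lambda>x. (cmod (a x - b x))\<^sup>2) / 2"
    by (simp only: divide_inverse avg_cmult_right)
  have "0 \<le> EV p D (\<lambda>x. (cmod (a x - b x))\<^sup>2)" by (rule avg_nonneg) simp
  then have e: "cmod (Lam p D \<theta> w f0 F - Mn p D \<theta> w f0 F) / 2 = EV p D (\<lambda>x. (cmod (a x - b x))\<^sup>2) / 4"
    unfolding LM half norm_of_real by simp
  have "fam p D {} w f0 F" unfolding fam_def using B0 F by blast
  then have "(cmod (Lam p D \<theta> w f0 F - Mn p D \<theta> w f0 F) / 2) ^ K \<le> real K * \<beta>" using X unfolding Xat_def by blast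
  then show ?thesis unfolding e a_def b_def df_def .
qed

end

context good_polys
begin

lemma gp_large: "\<exists>B. \<forall>p. prime p \<longrightarrow> B < p \<longrightarrow> gp p"
proof -
  let ?B1 = "\<Sum>i\<in>I. degree (P i) + nat \<bar>lead_coeff (P i)\<bar>"
  let ?B2 = "\<Sum>j\<in>I. \<Sum>l\<in>I. nat \<bar>lead_coeff (cross P j l)\<bar>"
  show ?thesis
  proof (intro exI[of _ "?B1 + ?B2 + ((card I)\<^sup>2 + 1) * Dk"] allI impI)
    fix p assume p: "prime p" "?B1 + ?B2 + ((card I)\<^sup>2 + 1) * Dk < p"
    have 1: "degree (P i) < p \<and> \<not> int p dvd lead_coeff (P i)" if i: "i \<in> I" for i
    proof -
      have "degree (P i) + nat \<bar>lead_coeff (P i)\<bar> \<le> ?B1" by (rule member_le_sum[OF i]) (use finI in auto)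
      then have "degree (P i) < p" "nat \<bar>lead_coeff (P i)\<bar> < p" using p(2) by linarith+
      moreover have "lead_coeff (P i) \<noteq> 0" using deg_pos[OF i] by auto
      ultimately show ?thesis using prime_not_dvd_large by blast
    qed
    have 2: "\<not> int p dvd lead_coeff (cross P j l)" if jl: "j \<in> I" "l \<in> I" "j \<noteq> l" for j l
    proof -
      have "nat \<bar>lead_coeff (cross P j l)\<bar> \<le> (\<Sum>l\<in>I. nat \<bar>lead_coeff (cross P j l)\<bar>)"
        by (rule member_le_sum[OF jl(2)]) (use finI in auto)
      also have "\<dots> \<le> ?B2" by (rule member_le_sum[OF jl(1)]) (use finI in auto)
      finally have "nat \<bar>lead_coeff (cross P j l)\<bar> < p" using p(2) by linarith
      moreover have "lead_coeff (cross P j l) \<noteq> 0" using cross_nz[OF jl] by simp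
      ultimately show ?thesis by (rule prime_not_dvd_large[rotated])
    qed
    have "((card I)\<^sup>2 + 1) * Dk < p" using p(2) by linarith
    then show "gp p" unfolding gp_def using p(1) 1 2 by blast
  qed
qed

end

lemma good_polys_of_lin_indep:
  assumes fin: "finite I" and ind: "lin_indep_polys I P" and c0: "\<forall>i\<in>I. coeff (P i) 0 = 0"
  shows "good_polys I P"
proof unfold_locales
  note ind' = ind[unfolded lin_indep_polys_def, THEN spec, THEN mp]
  show "finite I" by (rule fin)
  fix j assume j: "j \<in> I"
  show "coeff (P j) 0 = 0" using c0 j by blast
  have "P j \<noteq> 0"
  proof
    assume "P j = 0"
    then have "(\<Sum>i\<in>I. smult (if i = j then 1 else 0) (P i)) = 0" by (intro sum.neutral) auto
    from ind'[OF this] j show False by auto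
  qed
  moreover have "P j = 0" if "degree (P j) = 0" using that c0 j by (metis degree_eq_zeroE coeff_pCons_0 pCons_0_0)
  ultimately show "1 \<le> degree (P j)" by (cases "degree (P j)") auto
  fix l assume l: "l \<in> I" "j \<noteq> l"
  show "cross P j l \<noteq> 0"
  proof
    assume "cross P j l = 0"
    let ?a = "\<lambda>i. if i = j then lead_coeff (P l) else if i = l then - lead_coeff (P j) else 0"
    have "(\<Sum>i\<in>I. smult (?a i) (P i)) = (\<Sum>i\<in>{j, l}. smult (?a i) (P i))"
      using j l fin by (intro sum.mono_neutral_right) auto
    also have "\<dots> = cross P j l" using l by (simp add: cross_def)
    finally have "(\<Sum>i\<in>I. smult (?a i) (P i)) = 0" using \<open>cross P j l = 0\<close> by simp
    from bspec[OF ind'[OF this] l(1)] l(2) have "lead_coeff (P j) = 0" by (simp split: if_splits)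
    then show False using \<open>P j \<noteq> 0\<close> by simp
  qed
qed

lemma powr_one_divide: "0 < x \<Longrightarrow> (1 / x) powr a = x powr (- a)" for x :: real
  by (simp add: powr_divide powr_minus_divide)

theorem theorem1p2:
  fixes k d :: nat
    and P :: "nat \<Rightarrow> int poly"
    and \<theta> :: "nat \<Rightarrow> int \<Rightarrow> complex"
  assumes "k \<ge> 1"
    and "lin_indep_polys {1..k} P"
    and "\<forall>i\<in>{1..k}. coeff (P i) 0 = 0"
    and "d = Max ((\<lambda>i. degree (P i)) ` {1..k})"
    and "\<forall>p. prime p \<longrightarrow> one_bounded_on (Fp p) (\<theta> p)"
    and "strongly_uniform (d + 1) \<theta>"
  shows "\<exists>c>0. \<exists>C>0. \<forall>D\<ge>1. \<forall>v :: nat \<Rightarrow> nat \<Rightarrow> int.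
    (\<forall>i\<in>{1..k}. \<exists>j<D. v i j \<noteq> 0) \<longrightarrow>
    (\<exists>p0 :: nat. \<forall>p. prime p \<and> p > p0 \<longrightarrow>
      (\<forall>f :: nat \<Rightarrow> (nat \<Rightarrow> int) \<Rightarrow> complex.
        (\<forall>i\<in>{0..k}. one_bounded_on (Fp_vec p D) (f i)) \<longrightarrow>
        avg (Fp_vec p D) (\<lambda>x.
          (cmod (avg (Fp p) (\<lambda>y. \<theta> p y *
                   (\<Prod>i=1..k. f i (red_vec p D (\<lambda>j. x j + poly (P i) y * v i j))))
               - avg (Fp p) (\<theta> p) *
                   (\<Prod>i=1..k. avg (Fp p) (\<lambda>n. f i (red_vec p D (\<lambda>j. x j + n * v i j))))))\<^sup>2)
          \<le> C * real p powr (- c)))"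
proof -
  let ?I = "{1..k}"
  interpret G: good_polys ?I P
    by (rule good_polys_of_lin_indep) (use assms in auto)
  have deg: "degree (P i) \<le> d" if "i \<in> ?I" for i unfolding assms(4) using that by (intro Max_ge) auto
  have "1 \<in> ?I" using assms(1) by simp
  then have d1: "1 \<le> d" using deg[of 1] G.deg_pos[of 1] by linarith
  obtain Cs cs where Cs: "Cs > 0" "cs > 0" and su: "\<And>p. prime p \<Longrightarrow>
      u_norm (d + 1) p (\<lambda>y. \<theta> p y - avg (Fp p) (\<theta> p)) \<le> Cs * real p powr (- cs)"
    using assms(6) unfolding strongly_uniform_def by blast
  obtain N where N: "N \<noteq> 0" and indN: "\<And>p \<phi>. prime p \<Longrightarrow> \<not> int p dvd N \<Longrightarrow>
      (\<forall>n. int p dvd coeff (\<Sum>i\<in>?I. smult (\<phi> i) (P i)) n) \<Longrightarrow> (\<forall>i\<in>?I. int p dvd \<phi> i)"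
    using independence_mod_p[OF _ assms(2)] by (meson finite_atLeastAtMost)
  obtain K where K: "1 \<le> K" and XK: "\<And>p D \<beta> \<theta> w. G.cnd p \<beta> \<Longrightarrow> G.wt p \<beta> \<theta> \<Longrightarrow> G.Xat K {} p D \<beta> \<theta> w"
    using G.Xat_all[OF empty_subsetI] by blast
  obtain B where B: "\<And>p. prime p \<Longrightarrow> B < p \<Longrightarrow> G.gp p" using G.gp_large by blast
  let ?M = "2 ^ d :: nat"
  \<comment> \<open>The slower of two decays: that of the uniformity of \<open>\<theta>\<close> and
    that of Weyl sums of degree at most \<open>d\<close>.\<close>
  define c' where "c' = min cs (1 / real ?M)"
  have c': "c' > 0" "c' \<le> cs" "c' \<le> 1 / real ?M" using Cs by (auto simp: c'_def)
  define A where "A = real K * (Cs + real d)"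
  have A: "1 \<le> A"
  proof -
    have "1 * 1 \<le> real K * (Cs + real d)" using K Cs d1 by (intro mult_mono) auto
    then show ?thesis by (simp add: A_def)
  qed
  have main: "avg (Fp_vec p D) (\<lambda>x.
          (cmod (avg (Fp p) (\<lambda>y. \<theta> p y *
                   (\<Prod>i=1..k. f i (red_vec p D (\<lambda>j. x j + poly (P i) y * v i j))))
               - avg (Fp p) (\<theta> p) *
                   (\<Prod>i=1..k. avg (Fp p) (\<lambda>n. f i (red_vec p D (\<lambda>j. x j + n * v i j))))))\<^sup>2)
          \<le> 4 * A * real p powr (- (c' / real K))"
    if p: "prime p" and pB: "B + d + nat \<bar>N\<bar> < p" and f: "\<forall>i\<in>{0..k}. one_bounded_on (Fp_vec p D) (f i)"
    for p D :: nat and v :: "nat \<Rightarrow> nat \<Rightarrow> int" and f :: "nat \<Rightarrow> (nat \<Rightarrow> int) \<Rightarrow> complex"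
  proof -
    have p0: "p > 0" and p1: "1 \<le> real p" using prime_gt_0_nat[OF p] by auto
    have gp: "G.gp p" and dp: "d < p" and pN: "\<not> int p dvd N"
      using B[OF p] pB prime_not_dvd_large[OF N] by auto
    \<comment> \<open>\<open>\<theta> p\<close> is known only on the carrier, whereas
      \<open>wt\<close> demands a bound at every integer.\<close>
    define \<Theta> where "\<Theta> y = \<theta> p (y mod int p)" for y
    have \<Theta>1: "cmod (\<Theta> y) \<le> 1" for y
      using assms(5) p p0 unfolding one_bounded_on_def \<Theta>_def by (auto simp: Fp_def)
    have \<Theta>: "\<Theta> y = \<theta> p y" if "y \<in> Fp p" for y using that by (simp add: \<Theta>_def Fp_def)
    have avg\<Theta>: "EY p \<Theta> = EY p (\<theta> p)" by (rule avg_cong) (rule \<Theta>)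
    have av1: "cmod (EY p \<Theta>) \<le> 1" by (intro norm_avg_le_const finite_Fp Fp_nonempty p0 \<Theta>1)
    let ?w = "real d * real p powr (- (1 / real ?M))"
    \<comment> \<open>The minimum with 1 meets the condition in \<open>cnd\<close>; correlations
      never exceed 1.\<close>
    define \<beta> where "\<beta> = min 1 (Cs * real p powr (- cs) + ?w)"
    have pos: "0 \<le> Cs * real p powr (- cs)" using Cs by simp
    have wle: "1 / real p \<le> ?w"
    proof -
      have "1 / real p = 1 * real p powr (- 1)" using p0 by (simp add: powr_minus_divide)
      also have "\<dots> \<le> ?w" using d1 p1 by (intro mult_mono powr_mono) auto
      finally show ?thesis .
    qed
    have weyl: "cmod (EY p (\<lambda>y. e_p p (\<Sum>i\<in>?I. \<phi> i * poly (P i) y))) \<le> ?w"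
      and theta: "cmod (EY p (\<lambda>y. \<Theta> y * e_p p (\<Sum>i\<in>?I. \<phi> i * poly (P i) y))) \<le> Cs * real p powr (- cs) + ?w"
      if \<phi>: "\<exists>i\<in>?I. \<not> int p dvd \<phi> i" for \<phi>
    proof -
      define R where "R = (\<Sum>i\<in>?I. smult (\<phi> i) (P i))"
      have pR: "poly R y = (\<Sum>i\<in>?I. \<phi> i * poly (P i) y)" for y unfolding R_def poly_sum by simp
      have dR: "degree R \<le> d" unfolding R_def
        by (rule degree_sum_le) (auto intro: order_trans[OF degree_smult_le] deg)
      have "\<not> (\<forall>n. int p dvd coeff R n)" using indN[OF p pN] \<phi> unfolding R_def by blast
      then obtain n where n: "\<not> int p dvd coeff R n" by blast
      have "coeff R 0 = 0" unfolding R_def coeff_sum using assms(3) by simp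
      then have "1 \<le> n" using n by (cases n) auto
      from weyl_sum_general[OF p dR dp this n]
      have "cmod (EY p (\<lambda>y. e_p p (poly R y))) ^ ?M \<le> real d * (1 / real p)" by simp
      then have "cmod (EY p (\<lambda>y. e_p p (poly R y))) \<le> real d * (1 / real p) powr (1 / real ?M)"
        using d1 p0 by (intro root_bound) auto
      then have W: "cmod (EY p (\<lambda>y. e_p p (poly R y))) \<le> ?w" using p0 by (simp only: powr_one_divide of_nat_0_less_iff)
      then show "cmod (EY p (\<lambda>y. e_p p (\<Sum>i\<in>?I. \<phi> i * poly (P i) y))) \<le> ?w" by (simp only: pR)
      \<comment> \<open>\<open>u_norm\<close> tests against negative phases, hence
        \<open>- R\<close>. Its degree is at most \<open>d\<close>, which is why uniformity of order
        \<open>d + 1\<close> is assumed.\<close>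
      have "cmod (EY p (\<lambda>y. (\<theta> p y - EY p (\<theta> p)) * e_p p (- poly (- R) y))) \<le> u_norm (d + 1) p (\<lambda>y. \<theta> p y - EY p (\<theta> p))"
      proof (rule u_norm_upper[OF p0, of _ 2])
        show "degree (- R) \<le> d + 1 - 1" using dR by simp
        show "cmod (\<theta> p y - EY p (\<theta> p)) \<le> 2" if "y \<in> Fp p" for y
          using norm_triangle_ineq4[of "\<theta> p y" "EY p (\<theta> p)"] \<Theta>1[of y] av1 \<Theta>[OF that] avg\<Theta> by simp
      qed
      also have "\<dots> \<le> Cs * real p powr (- cs)" by (rule su[OF p])
      finally have U: "cmod (EY p (\<lambda>y. (\<theta> p y - EY p (\<theta> p)) * e_p p (poly R y))) \<le> Cs * real p powr (- cs)"
        by (simp only: poly_minus minus_minus)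
      \<comment> \<open>Uniformity concerns \<open>\<theta>\<close> minus its mean; the mean
        contributes a pure Weyl sum.\<close>
      have "EY p (\<lambda>y. \<Theta> y * e_p p (poly R y)) = EY p (\<lambda>y. (\<theta> p y - EY p (\<theta> p)) * e_p p (poly R y) + EY p (\<theta> p) * e_p p (poly R y))"
        by (rule avg_cong) (simp add: \<Theta> algebra_simps)
      also have "\<dots> = EY p (\<lambda>y. (\<theta> p y - EY p (\<theta> p)) * e_p p (poly R y)) + EY p \<Theta> * EY p (\<lambda>y. e_p p (poly R y))"
        by (simp only: avg_add avg_cmult avg\<Theta>)
      finally have eq: "EY p (\<lambda>y. \<Theta> y * e_p p (poly R y))
          = EY p (\<lambda>y. (\<theta> p y - EY p (\<theta> p)) * e_p p (poly R y)) + EY p \<Theta> * EY p (\<lambda>y. e_p p (poly R y))" .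
      have "cmod (EY p (\<lambda>y. \<Theta> y * e_p p (poly R y)))
          \<le> cmod (EY p (\<lambda>y. (\<theta> p y - EY p (\<theta> p)) * e_p p (poly R y))) + cmod (EY p \<Theta>) * cmod (EY p (\<lambda>y. e_p p (poly R y)))"
        unfolding eq norm_mult[symmetric] by (rule norm_triangle_ineq)
      also have "\<dots> \<le> Cs * real p powr (- cs) + 1 * ?w" using U W av1 by (intro add_mono mult_mono) auto
      finally show "cmod (EY p (\<lambda>y. \<Theta> y * e_p p (\<Sum>i\<in>?I. \<phi> i * poly (P i) y))) \<le> Cs * real p powr (- cs) + ?w"
        by (simp only: pR mult_1)
    qed
    have le1: "cmod (EY p (\<lambda>y. t y * e_p p (g y))) \<le> 1" if "\<And>y. cmod (t y) \<le> 1" for t g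
      using that by (intro norm_avg_le_const finite_Fp Fp_nonempty p0) (simp add: norm_mult)
    have wt1: "G.wt p \<beta> (\<lambda>_. 1)"
      unfolding G.wt_def
    proof (intro conjI allI impI)
      fix \<phi> assume "\<exists>i\<in>?I. \<not> int p dvd \<phi> i"
      from weyl[OF this] pos le1[of "\<lambda>_. 1" "\<lambda>y. \<Sum>i\<in>?I. \<phi> i * poly (P i) y"]
      show "cmod (EY p (\<lambda>y. 1 * e_p p (\<Sum>i\<in>?I. \<phi> i * poly (P i) y))) \<le> \<beta>" unfolding \<beta>_def by simp
    qed simp
    have wt\<Theta>: "G.wt p \<beta> \<Theta>"
      unfolding G.wt_def
    proof (intro conjI allI impI)
      fix \<phi> assume "\<exists>i\<in>?I. \<not> int p dvd \<phi> i"
      from theta[OF this] le1[of \<Theta> "\<lambda>y. \<Sum>i\<in>?I. \<phi> i * poly (P i) y", OF \<Theta>1]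
      show "cmod (EY p (\<lambda>y. \<Theta> y * e_p p (\<Sum>i\<in>?I. \<phi> i * poly (P i) y))) \<le> \<beta>" unfolding \<beta>_def by simp
    qed (rule \<Theta>1)
    have "1 / real p \<le> \<beta>" unfolding \<beta>_def using wle pos p1 by auto
    then have cnd: "G.cnd p \<beta>" unfolding G.cnd_def using gp wt1 by (simp add: \<beta>_def)
    define F where "F i x = f i (red_vec p D x)" for i x
    have BF: "B1 p D (F i)" if "i \<in> ?I" for i
      unfolding B1_def per_def
    proof (intro conjI allI impI)
      show "F i x = F i y" if "cg p D x y" for x y
      proof -
        have "red_vec p D x = red_vec p D y" using that unfolding cg_def red_vec_def cong_def by (auto simp: restrict_def)
        then show ?thesis by (simp add: F_def)
      qed
      show "cmod (F i x) \<le> 1" for x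
        using f \<open>i \<in> ?I\<close> red_vec_in[OF p0, of D x] unfolding F_def one_bounded_on_def by auto
    qed
    have Fe: "f i (red_vec p D (\<lambda>j. x j + n * v i j)) = F i (x + sm n (v i))" for i n x
      unfolding F_def sm_def plus_fun_def ..
    have EY\<Theta>: "EY p (\<lambda>y. \<theta> p y * g y) = EY p (\<lambda>y. \<Theta> y * g y)" for g by (rule avg_cong) (simp add: \<Theta>)
    let ?T = "EV p D (\<lambda>x. (cmod (EY p (\<lambda>y. \<Theta> y * (\<Prod>i\<in>?I. F i (x + sm (poly (P i) y) (v i))))
      - EY p \<Theta> * (\<Prod>i\<in>?I. EY p (\<lambda>n. F i (x + sm n (v i))))))\<^sup>2)"
    define T where "T = ?T"
    have T0: "0 \<le> T" unfolding T_def by (rule avg_nonneg) simp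
    have "(T / 4) ^ K \<le> real K * \<beta>"
      unfolding T_def by (rule G.Xat_L2[OF p0 \<Theta>1 BF XK[OF cnd wt\<Theta>]])
    also have "\<dots> \<le> real K * ((Cs + real d) * real p powr (- c'))"
    proof (rule mult_left_mono)
      have "\<beta> \<le> Cs * real p powr (- cs) + ?w" by (simp add: \<beta>_def)
      also have "\<dots> \<le> Cs * real p powr (- c') + real d * real p powr (- c')"
        using c' Cs p1 by (intro add_mono mult_left_mono powr_mono) auto
      finally show "\<beta> \<le> (Cs + real d) * real p powr (- c')" by (simp add: algebra_simps)
    qed simp
    finally have "(T / 4) ^ K \<le> A * real p powr (- c')" by (simp add: A_def mult.assoc)
    \<comment> \<open>Taking the \<open>K\<close>-th root produces the final exponent
      \<open>c' / K\<close> and the constant \<open>4 * A\<close>.\<close>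
    then have "T / 4 \<le> A * (real p powr (- c')) powr (1 / real K)" using T0 A K p0 by (intro root_bound) auto
    also have "\<dots> = A * real p powr (- (c' / real K))" by (simp add: powr_powr)
    finally have "T \<le> 4 * A * real p powr (- (c' / real K))" by simp
    then show ?thesis unfolding T_def Fe EY\<Theta> avg\<Theta>[symmetric] .
  qed
  show ?thesis
  \<comment> \<open>Both constants are chosen before the dimension and the directions are
    introduced; \<open>main\<close> holds for all of these with one threshold.\<close>
  proof (rule exI[of _ "c' / real K"], intro conjI, use c' K in simp, rule exI[of _ "4 * A"], intro conjI, use A in simp,
      intro allI impI, rule exI[of _ "B + d + nat \<bar>N\<bar>"], intro allI impI)
    fix D p :: nat and v :: "nat \<Rightarrow> nat \<Rightarrow> int" and f :: "nat \<Rightarrow> (nat \<Rightarrow> int) \<Rightarrow> complex"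
    assume "prime p \<and> B + d + nat \<bar>N\<bar> < p" "\<forall>i\<in>{0..k}. one_bounded_on (Fp_vec p D) (f i)"
    then show "avg (Fp_vec p D) (\<lambda>x.
          (cmod (avg (Fp p) (\<lambda>y. \<theta> p y *
                   (\<Prod>i=1..k. f i (red_vec p D (\<lambda>j. x j + poly (P i) y * v i j))))
               - avg (Fp p) (\<theta> p) *
                   (\<Prod>i=1..k. avg (Fp p) (\<lambda>n. f i (red_vec p D (\<lambda>j. x j + n * v i j))))))\<^sup>2)
          \<le> 4 * A * real p powr (- (c' / real K))" by (intro main) auto
  qed
qed

end
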